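(* Consider the plant $\mathcal P$, the directed graph and problems (P1), (P2) described in the context, with $\tau=0$, and suppose the system assumptions hold. Choose a block-diagonal $F_d$ such that $A+B_2F_d$ is Hurwitz, and take $L_d=L$ in (P2). A realization of the $\mathcal Q_{\mathrm{opt}}$ that solves (P2) with $\tau=0$ is $$\mathcal Q_{\mathrm{opt}}=\left[\begin{array}{c|c}\bar A+\bar B\bar F&-\bar L\bar{\mathbf 1}_p\\ \hline \bar{\mathbf 1}_m^{\mathsf T}(\bar F-\bar F_d)&0\end{array}\right],$$ and a corresponding $\mathcal K_{\mathrm{opt}}$ that solves (P1) with $\tau=0$ is $$\mathcal K_{\mathrm{opt}}=\left[\begin{array}{c|c}\bar A+\bar B\bar F+\bar L\bar C\bar{\mathbf 1}_n\bar{\mathbf 1}_n^{\mathsf T}&-\bar L\bar{\mathbf 1}_p\\ \hline \bar{\mathbf 1}_m^{\mathsf T}\bar F&0\end{array}\right].$$ Here $\bar A=I_N\otimes A$, $\bar B=I_N\otimes B_2$, $\bar C=I_N\otimes C_2$, $\bar F_d=I_N\otimes F_d$, $\bar{\mathbf 1}_k=1_N\otimes I_k$ for $k\in\{n,m,p\}$ ($1_N$ is the $N\times1$ vector of ones), $\bar F=\mathrm{blkdiag}(\{E_{m_{\underline i}}F^iE_{n_{\underline i}}^{\mathsf T}\}_{i\in[N]})$ and $\bar L=\mathrm{blkdiag}(\{E_{n_i}L^iE_{p_i}^{\mathsf T}\}_{i\in[N]})$.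
   Context: Plant. There are $N$ agents, $[N]=\{1,\dots,N\}$. Agent $i$ has state, input and measurement dimensions $n_i,m_i,p_i$; $n=\sum n_i$, $m=\sum m_i$, $p=\sum p_i$. The aggregate dynamics are $\dot x=Ax+B_1w+B_2u$, $z=C_1x+D_{12}u$, $y=C_2x+D_{21}w$, where $x,w,u,y$ are partitioned into $N$ pieces and $A,B_1,B_2,C_2,D_{21}$ are block-diagonal with respect to this partition ($C_1,D_{12}$ may be dense). The transfer matrix $(w,u)\mapsto(z,y)$ is $$\mathcal P=\begin{bmatrix}\mathcal P_{11}&\mathcal P_{12}\\ \mathcal P_{21}&\mathcal P_{22}\end{bmatrix}=\left[\begin{array}{c|cc}A&B_1&B_2\\ \hline C_1&0&D_{12}\\ C_2&D_{21}&0\end{array}\right],\qquad \left[\begin{array}{c|c}A&B\\ \hline C&D\end{array}\right]:=D+C(sI-A)^{-1}B.$$ Information structure. A directed graph on $[N]$ is given; write $j\to i$ if $i\ne j$ and there is a directed path from $j$ to $i$. $\mathcal L_{\mathrm{prop}}$ is the set of proper transfer matrices, i.e. those $\mathcal G$ with $\sup_{\mathrm{Re}(s)>\alpha}\|\mathcal G(s)\|<\infty$ for some $\alpha>0$. For $\tau\ge0$, $\mathcal S_\tau$ is the set of block transfer matrices (block $(i,j)$ of size $m_i\times p_j$) whose $(i,i)$ block is $\mathcal K_{ii}$, whose $(i,j)$ block is $e^{-s\tau}\mathcal K_{ij}$ if $j\to i$, and $0$ otherwise, where all $\mathcal K_{ij}\in\mathcal L_{\mathrm{prop}}$. $u=\mathcal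 Ky$ stabilizes $\mathcal P$ if $\begin{bmatrix}I&-\mathcal P_{22}\\-\mathcal K&I\end{bmatrix}^{-1}\in\mathcal H_\infty$. $\mathcal F_l(\mathcal P,\mathcal K)=\mathcal P_{11}+\mathcal P_{12}\mathcal K(I-\mathcal P_{22}\mathcal K)^{-1}\mathcal P_{21}$. A matrix is Hurwitz if all its eigenvalues have negative real part. Index notation. $\underline i$ is the ordered list of descendants of $i$: $i$ first, then all $j\ne i$ with $i\to j$ in increasing order. For ordered lists $S,T$, $X_{ST}$ is the block submatrix with block rows $S$ and block columns $T$, and $X_{:S}$ keeps all rows and block columns $S$; $X_{\underline{ii}}:=X_{\underline i\,\underline i}$. $E_{n_S}:=(I_n)_{:S}$ (and similarly $E_{m_S},E_{p_S}$, from $I_m,I_p$ partitioned by the $m_i$, $p_i$). System assumptions. Matrices $(A,B,C,D)$ satisfy the Riccati assumptions if (R1) $D^{\mathsf T}D\succ0$; (R2) $(A,B)$ is stabilizable; (R3) $\begin{bmatrix}A-j\omega I&B\\C&D\end{bmatrix}$ has full column rank for all $\omega\in\mathbb R$. In that case $(X,F)=\mathrm{ric}(A,B,C,D)$ denotes the unique stabilizing solution: $X\succeq0$ satisfies $A^{\mathsf T}X+XA+C^{\mathsf T}C-(XB+C^{\mathsf T}D)(D^{\mathsf T}D)^{-1}(B^{\mathsf T}X+D^{\mathsf T}C)=0$, $F=-(D^{\mathsf T}D)^{-1}(B^{\mathsf T}X+D^{\mathsf T}C)$, and $A+BF$ is Hurwitz. The system assumptions are: the Riccati assumptions hold for $(A,B_2,C_1,D_{12})$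 and for $(A_{ii}^{\mathsf T},C_{2_{ii}}^{\mathsf T},B_{1_{ii}}^{\mathsf T},D_{21_{ii}}^{\mathsf T})$ for every $i\in[N]$. Gains. $(X^i,F^i)=\mathrm{ric}(A_{\underline{ii}},B_{2_{\underline{ii}}},C_{1_{:\underline i}},D_{12_{:\underline i}})$, $(Y^i,{L^i}^{\mathsf T})=\mathrm{ric}(A_{ii}^{\mathsf T},C_{2_{ii}}^{\mathsf T},B_{1_{ii}}^{\mathsf T},D_{21_{ii}}^{\mathsf T})$, and $L=\mathrm{blkdiag}(\{L^i\})$; these exist under the system assumptions. Problems. (P1): minimize $\|\mathcal F_l(\mathcal P,\mathcal K)\|_2^2$ (squared $\mathcal H_2$ norm) over $\mathcal K\in\mathcal S_\tau$ that stabilize $\mathcal P$. (P2): minimize $\|\mathcal T_{11}+\mathcal T_{12}\mathcal Q\mathcal T_{21}\|_2^2$ over $\mathcal Q\in\mathcal H_\infty\cap\mathcal S_\tau$, where $$\mathcal T=\begin{bmatrix}\mathcal T_{11}&\mathcal T_{12}\\ \mathcal T_{21}&0\end{bmatrix}=\left[\begin{array}{cc|cc}A+B_2F_d&-B_2F_d&B_1&B_2\\0&A+L_dC_2&B_1+L_dD_{21}&0\\ \hline C_1+D_{12}F_d&-D_{12}F_d&0&D_{12}\\0&C_2&D_{21}&0\end{array}\right].$$ The two are related by $\mathcal K=\mathcal F_l(\mathcal J,\mathcal Q)$ with $$\mathcal J=\left[\begin{array}{c|cc}A+B_2F_d+L_dC_2&-L_d&B_2\\ \hline F_d&0&I\\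 -C_2&I&0\end{array}\right].$$ *)

theory Defs
  imports
    "HOL-Analysis.Analysis"
    "Jordan_Normal_Form.Char_Poly"
    "Jordan_Normal_Form.Gauss_Jordan_Elimination"
    "Jordan_Normal_Form.DL_Rank"
begin

text \<open>The inverse is unspecified for singular matrices.\<close>

definition inv_mat :: "'a::field mat \<Rightarrow> 'a mat" where
  "inv_mat M = the (mat_inverse M)"

abbreviation cmat :: "real mat \<Rightarrow> complex mat" where
  "cmat \<equiv> map_mat complex_of_real"

definition append_cols :: "'a::zero mat \<Rightarrow> 'a mat \<Rightarrow> 'a mat" where
  "append_cols M M' = four_block_mat M M' (0\<^sub>m 0 (dim_col M)) (0\<^sub>m 0 (dim_col M'))"

definition kron :: "'a::times mat \<Rightarrow> 'a mat \<Rightarrow> 'a mat" where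
  "kron M M' = mat (dim_row M * dim_row M') (dim_col M * dim_col M')
     (\<lambda>(i, j). M $$ (i div dim_row M', j div dim_col M') * M' $$ (i mod dim_row M', j mod dim_col M'))"

definition ones_col :: "nat \<Rightarrow> real mat" where
  "ones_col k = mat k 1 (\<lambda>_. 1)"

definition frob_sq :: "complex mat \<Rightarrow> real" where
  "frob_sq M = (\<Sum>i<dim_row M. \<Sum>j<dim_col M. (cmod (M $$ (i, j)))\<^sup>2)"

definition pos_semidef :: "real mat \<Rightarrow> bool" where
  "pos_semidef M \<longleftrightarrow> square_mat M \<and> transpose_mat M = M \<and>
     (\<forall>v\<in>carrier_vec (dim_row M). scalar_prod v (M *\<^sub>v v) \<ge> 0)"

definition pos_def :: "real mat \<Rightarrow> bool" where
  "pos_def M \<longleftrightarrow> square_mat M \<and> transpose_mat M = M \<and>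
     (\<forall>v\<in>carrier_vec (dim_row M). v \<noteq> 0\<^sub>v (dim_row M) \<longrightarrow> scalar_prod v (M *\<^sub>v v) > 0)"

definition hurwitz :: "real mat \<Rightarrow> bool" where
  "hurwitz M \<longleftrightarrow> square_mat M \<and> (\<forall>ev. eigenvalue (cmat M) ev \<longrightarrow> Re ev < 0)"

text \<open>
  Agents are numbered \<open>0, \<dots>, N - 1\<close>. A family \<open>d\<close> of block sizes partitions the indices below
  \<open>\<Sum>k<N. d k\<close>; \<open>block_idx d S\<close> lists the scalar indices belonging to the blocks in the
  ordered list \<open>S\<close>.
\<close>

definition block_idx :: "(nat \<Rightarrow> nat) \<Rightarrow> nat list \<Rightarrow> nat list" where
  "block_idx d S = concat (map (\<lambda>i. [(\<Sum>k<i. d k) ..< (\<Sum>k<Suc i. d k)]) S)"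

definition select_mat :: "'a mat \<Rightarrow> nat list \<Rightarrow> nat list \<Rightarrow> 'a mat" where
  "select_mat M rs cs = mat (length rs) (length cs) (\<lambda>(a, b). M $$ (rs ! a, cs ! b))"

definition sub_block :: "(nat \<Rightarrow> nat) \<Rightarrow> (nat \<Rightarrow> nat) \<Rightarrow> 'a mat \<Rightarrow> nat list \<Rightarrow> nat list \<Rightarrow> 'a mat" where
  "sub_block dr dc M S T = select_mat M (block_idx dr S) (block_idx dc T)"

definition sub_cols :: "(nat \<Rightarrow> nat) \<Rightarrow> 'a mat \<Rightarrow> nat list \<Rightarrow> 'a mat" where
  "sub_cols dc M T = select_mat M [0..<dim_row M] (block_idx dc T)"

definition embed :: "nat \<Rightarrow> (nat \<Rightarrow> nat) \<Rightarrow> nat list \<Rightarrow> real mat" where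
  "embed N d S = sub_cols d (1\<^sub>m (\<Sum>k<N. d k)) S"

definition block_diagonal ::
  "nat \<Rightarrow> (nat \<Rightarrow> nat) \<Rightarrow> (nat \<Rightarrow> nat) \<Rightarrow> 'a::zero mat \<Rightarrow> bool" where
  "block_diagonal N dr dc M \<longleftrightarrow>
     M \<in> carrier_mat (\<Sum>k<N. dr k) (\<Sum>k<N. dc k) \<and>
     (\<forall>i<N. \<forall>j<N. i \<noteq> j \<longrightarrow> sub_block dr dc M [i] [j] = 0\<^sub>m (dr i) (dc j))"

definition reaches :: "(nat \<times> nat) set \<Rightarrow> nat \<Rightarrow> nat \<Rightarrow> bool" where
  "reaches E j i \<longleftrightarrow> i \<noteq> j \<and> (j, i) \<in> E\<^sup>+"

definition descendants :: "nat \<Rightarrow> (nat \<times> nat) set \<Rightarrow> nat \<Rightarrow> nat list" where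
  "descendants N E i = i # filter (\<lambda>j. reaches E i j) [0..<N]"

definition stabilizable :: "real mat \<Rightarrow> real mat \<Rightarrow> bool" where
  "stabilizable A B \<longleftrightarrow> (\<exists>F\<in>carrier_mat (dim_col B) (dim_row A). hurwitz (A + B * F))"

definition riccati_assumptions :: "real mat \<Rightarrow> real mat \<Rightarrow> real mat \<Rightarrow> real mat \<Rightarrow> bool" where
  "riccati_assumptions A B C D \<longleftrightarrow>
     pos_def (transpose_mat D * D) \<and>
     stabilizable A B \<and>
     (\<forall>\<omega>::real.
        let M = four_block_mat (cmat A - (\<i> * of_real \<omega>) \<cdot>\<^sub>m 1\<^sub>m (dim_row A)) (cmat B) (cmat C) (cmat D)
        in vec_space.rank (dim_row M) M = dim_col M)"

definition is_ric ::
  "real mat \<Rightarrow> real mat \<Rightarrow> real mat \<Rightarrow> real mat \<Rightarrow> real mat \<Rightarrow> real mat \<Rightarrow> bool" where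
  "is_ric A B C D X F \<longleftrightarrow>
     X \<in> carrier_mat (dim_row A) (dim_row A) \<and> pos_semidef X \<and>
     transpose_mat A * X + X * A + transpose_mat C * C
       - (X * B + transpose_mat C * D) * inv_mat (transpose_mat D * D)
           * (transpose_mat B * X + transpose_mat D * C)
       = 0\<^sub>m (dim_row A) (dim_row A) \<and>
     F = - (inv_mat (transpose_mat D * D) * (transpose_mat B * X + transpose_mat D * C)) \<and>
     hurwitz (A + B * F)"

text \<open>The stabilizing solution exists and is unique under \<open>riccati_assumptions\<close>.\<close>

definition ric :: "real mat \<Rightarrow> real mat \<Rightarrow> real mat \<Rightarrow> real mat \<Rightarrow> real mat \<times> real mat" where
  "ric A B C D = (THE (X, F). is_ric A B C D X F)"

definition system_assumptions ::
  "nat \<Rightarrow> (nat \<Rightarrow> nat) \<Rightarrow> (nat \<Rightarrow> nat) \<Rightarrow> (nat \<Rightarrow> nat) \<Rightarrow> (nat \<Rightarrow> nat) \<Rightarrow> 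
   real mat \<Rightarrow> real mat \<Rightarrow> real mat \<Rightarrow> real mat \<Rightarrow> real mat \<Rightarrow> real mat \<Rightarrow> real mat \<Rightarrow> bool" where
  "system_assumptions N nd md pd wd A B1 B2 C1 C2 D12 D21 \<longleftrightarrow>
     riccati_assumptions A B2 C1 D12 \<and>
     (\<forall>i<N. riccati_assumptions
        (transpose_mat (sub_block nd nd A [i] [i])) (transpose_mat (sub_block pd nd C2 [i] [i]))
        (transpose_mat (sub_block nd wd B1 [i] [i])) (transpose_mat (sub_block pd wd D21 [i] [i])))"

definition ctrl_gain ::
  "nat \<Rightarrow> (nat \<times> nat) set \<Rightarrow> (nat \<Rightarrow> nat) \<Rightarrow> (nat \<Rightarrow> nat) \<Rightarrow> 
   real mat \<Rightarrow> real mat \<Rightarrow> real mat \<Rightarrow> real mat \<Rightarrow> nat \<Rightarrow> real mat" where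
  "ctrl_gain N E nd md A B2 C1 D12 i =
     (let S = descendants N E i
      in snd (ric (sub_block nd nd A S S) (sub_block nd md B2 S S) (sub_cols nd C1 S) (sub_cols md D12 S)))"

definition est_gain ::
  "(nat \<Rightarrow> nat) \<Rightarrow> (nat \<Rightarrow> nat) \<Rightarrow> (nat \<Rightarrow> nat) \<Rightarrow> 
   real mat \<Rightarrow> real mat \<Rightarrow> real mat \<Rightarrow> real mat \<Rightarrow> nat \<Rightarrow> real mat" where
  "est_gain nd pd wd A B1 C2 D21 i =
     transpose_mat (snd (ric
        (transpose_mat (sub_block nd nd A [i] [i])) (transpose_mat (sub_block pd nd C2 [i] [i]))
        (transpose_mat (sub_block nd wd B1 [i] [i])) (transpose_mat (sub_block pd wd D21 [i] [i]))))"

text \<open>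
  A transfer matrix is represented by a function whose values matter only on some half-plane
  \<open>Re s > \<alpha>\<close>. Thus a realization may have an unstable (cancelling) \<open>A\<close>-matrix and
  still define a stable transfer matrix, and all relations between transfer matrices are
  understood near \<open>Re s = \<infinity>\<close>.
\<close>

type_synonym tmat = "complex \<Rightarrow> complex mat"

abbreviation at_rhp :: "complex filter" where
  "at_rhp \<equiv> filtercomap Re at_top"

definition realization :: "real mat \<Rightarrow> real mat \<Rightarrow> real mat \<Rightarrow> real mat \<Rightarrow> tmat" where
  "realization A B C D =
     (\<lambda>s. cmat D + cmat C * inv_mat (s \<cdot>\<^sub>m 1\<^sub>m (dim_row A) - cmat A) * cmat B)"

text \<open>
  Boundedness does not depend on the matrix norm, so we use the Frobenius norm. Analyticity is
  not required here: it follows for every controller that stabilizes the plant.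
\<close>

definition L_prop :: "nat \<Rightarrow> nat \<Rightarrow> tmat set" where
  "L_prop r c = {G. \<exists>\<alpha>>0. \<exists>b. \<forall>s. Re s > \<alpha> \<longrightarrow> G s \<in> carrier_mat r c \<and> sqrt (frob_sq (G s)) \<le> b}"

definition analytic_rhp :: "nat \<Rightarrow> nat \<Rightarrow> tmat \<Rightarrow> bool" where
  "analytic_rhp r c H \<longleftrightarrow>
     (\<forall>s. Re s > 0 \<longrightarrow> H s \<in> carrier_mat r c) \<and>
     (\<forall>i<r. \<forall>j<c. (\<lambda>s. H s $$ (i, j)) holomorphic_on {s. Re s > 0})"

definition H_inf :: "nat \<Rightarrow> nat \<Rightarrow> tmat set" where
  "H_inf r c = {G. \<exists>H. analytic_rhp r c H \<and> (\<exists>b. \<forall>s. Re s > 0 \<longrightarrow> sqrt (frob_sq (H s)) \<le> b) \<and>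
                     (\<forall>\<^sub>F s in at_rhp. G s = H s)}"

text \<open>
  The squared Hardy-space norm. The analytic continuation \<open>H\<close> of \<open>G\<close> to the open right
  half-plane is unique on that half-plane if it exists; if there is none, or if it is not in
  \<open>H\<^sub>2\<close>, the value is \<open>\<infinity>\<close>.
\<close>

definition H2_norm_sq :: "nat \<Rightarrow> nat \<Rightarrow> tmat \<Rightarrow> ennreal" where
  "H2_norm_sq r c G =
     (INF H\<in>{H. analytic_rhp r c H \<and> (\<forall>\<^sub>F s in at_rhp. G s = H s)}.
        SUP \<xi>\<in>{0::real<..}. (\<integral>\<^sup>+\<omega>. ennreal (frob_sq (H (Complex \<xi> \<omega>))) \<partial>lborel) / ennreal (2 * pi))"

definition info_set ::
  "nat \<Rightarrow> (nat \<times> nat) set \<Rightarrow> (nat \<Rightarrow> nat) \<Rightarrow> (nat \<Rightarrow> nat) \<Rightarrow> real \<Rightarrow> tmat set" where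
  "info_set N E md pd \<tau> =
     {K. \<exists>Kb. (\<forall>i<N. \<forall>j<N. Kb i j \<in> L_prop (md i) (pd j)) \<and>
        (\<forall>\<^sub>F s in at_rhp. K s \<in> carrier_mat (\<Sum>k<N. md k) (\<Sum>k<N. pd k) \<and>
          (\<forall>i<N. \<forall>j<N. sub_block md pd (K s) [i] [j] =
             (if i = j then Kb i i s
              else if reaches E j i then exp (- s * of_real \<tau>) \<cdot>\<^sub>m Kb i j s
              else 0\<^sub>m (md i) (pd j))))}"

text \<open>Parts of a transfer matrix whose \<open>(1,1)\<close> block is of size \<open>r \<times> c\<close>.\<close>

definition tf11 :: "nat \<Rightarrow> nat \<Rightarrow> tmat \<Rightarrow> tmat" where
  "tf11 r c G = (\<lambda>s. case split_block (G s) r c of (M11, M12, M21, M22) \<Rightarrow> M11)"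

definition tf12 :: "nat \<Rightarrow> nat \<Rightarrow> tmat \<Rightarrow> tmat" where
  "tf12 r c G = (\<lambda>s. case split_block (G s) r c of (M11, M12, M21, M22) \<Rightarrow> M12)"

definition tf21 :: "nat \<Rightarrow> nat \<Rightarrow> tmat \<Rightarrow> tmat" where
  "tf21 r c G = (\<lambda>s. case split_block (G s) r c of (M11, M12, M21, M22) \<Rightarrow> M21)"

definition tf22 :: "nat \<Rightarrow> nat \<Rightarrow> tmat \<Rightarrow> tmat" where
  "tf22 r c G = (\<lambda>s. case split_block (G s) r c of (M11, M12, M21, M22) \<Rightarrow> M22)"

definition lower_lft :: "nat \<Rightarrow> nat \<Rightarrow> tmat \<Rightarrow> tmat \<Rightarrow> tmat" where
  "lower_lft r c P K = (\<lambda>s. tf11 r c P s +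
     tf12 r c P s * K s * inv_mat (1\<^sub>m (dim_row (tf22 r c P s)) - tf22 r c P s * K s) * tf21 r c P s)"

definition stabilizes :: "nat \<Rightarrow> nat \<Rightarrow> tmat \<Rightarrow> tmat \<Rightarrow> bool" where
  "stabilizes m p K P22 \<longleftrightarrow>
     (let M = (\<lambda>s. four_block_mat (1\<^sub>m p) (- P22 s) (- K s) (1\<^sub>m m))
      in (\<forall>\<^sub>F s in at_rhp. invertible_mat (M s)) \<and> (\<lambda>s. inv_mat (M s)) \<in> H_inf (p + m) (p + m))"

definition plant_tf ::
  "real mat \<Rightarrow> real mat \<Rightarrow> real mat \<Rightarrow> real mat \<Rightarrow> real mat \<Rightarrow> real mat \<Rightarrow> real mat \<Rightarrow> tmat" where
  "plant_tf A B1 B2 C1 C2 D12 D21 =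
     realization A (append_cols B1 B2) (C1 @\<^sub>r C2)
       (four_block_mat (0\<^sub>m (dim_row C1) (dim_col B1)) D12 D21 (0\<^sub>m (dim_row C2) (dim_col B2)))"

definition T_tf ::
  "real mat \<Rightarrow> real mat \<Rightarrow> real mat \<Rightarrow> real mat \<Rightarrow> real mat \<Rightarrow> real mat \<Rightarrow> real mat \<Rightarrow> real mat \<Rightarrow> real mat \<Rightarrow> tmat" where
  "T_tf A B1 B2 C1 C2 D12 D21 Fd Ld =
     realization
       (four_block_mat (A + B2 * Fd) (- (B2 * Fd)) (0\<^sub>m (dim_row A) (dim_row A)) (A + Ld * C2))
       (four_block_mat B1 B2 (B1 + Ld * D21) (0\<^sub>m (dim_row A) (dim_col B2)))
       (four_block_mat (C1 + D12 * Fd) (- (D12 * Fd)) (0\<^sub>m (dim_row C2) (dim_row A)) C2)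
       (four_block_mat (0\<^sub>m (dim_row C1) (dim_col B1)) D12 D21 (0\<^sub>m (dim_row C2) (dim_col B2)))"

definition J_tf ::
  "real mat \<Rightarrow> real mat \<Rightarrow> real mat \<Rightarrow> real mat \<Rightarrow> real mat \<Rightarrow> tmat" where
  "J_tf A B2 C2 Fd Ld =
     realization (A + B2 * Fd + Ld * C2) (append_cols (- Ld) B2) (Fd @\<^sub>r (- C2))
       (four_block_mat (0\<^sub>m (dim_col B2) (dim_row C2)) (1\<^sub>m (dim_col B2))
                       (1\<^sub>m (dim_row C2)) (0\<^sub>m (dim_row C2) (dim_col B2)))"

text \<open>
  Here \<open>P\<close> maps an input \<open>(w, u)\<close> to an output \<open>(z, y)\<close>, with \<open>nw\<close> and \<open>nz\<close> the
  dimensions of \<open>w\<close> and \<open>z\<close>.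
\<close>

definition solves_P1 ::
  "nat \<Rightarrow> (nat \<times> nat) set \<Rightarrow> (nat \<Rightarrow> nat) \<Rightarrow> (nat \<Rightarrow> nat) \<Rightarrow> nat \<Rightarrow> nat \<Rightarrow> real \<Rightarrow> tmat \<Rightarrow> tmat \<Rightarrow> bool" where
  "solves_P1 N E md pd nz nw \<tau> P =
     is_arg_min
       (\<lambda>K. H2_norm_sq nz nw (lower_lft nz nw P K))
       (\<lambda>K. K \<in> info_set N E md pd \<tau> \<and> stabilizes (\<Sum>k<N. md k) (\<Sum>k<N. pd k) K (tf22 nz nw P))"

definition solves_P2 ::
  "nat \<Rightarrow> (nat \<times> nat) set \<Rightarrow> (nat \<Rightarrow> nat) \<Rightarrow> (nat \<Rightarrow> nat) \<Rightarrow> nat \<Rightarrow> nat \<Rightarrow> real \<Rightarrow> tmat \<Rightarrow> tmat \<Rightarrow> bool" where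
  "solves_P2 N E md pd nz nw \<tau> T =
     is_arg_min
       (\<lambda>Q. H2_norm_sq nz nw (\<lambda>s. tf11 nz nw T s + tf12 nz nw T s * Q s * tf21 nz nw T s))
       (\<lambda>Q. Q \<in> H_inf (\<Sum>k<N. md k) (\<Sum>k<N. pd k) \<inter> info_set N E md pd \<tau>)"

end

theory Submission
  imports
    Defs
    "HOL-Complex_Analysis.Complex_Analysis"
    "HOL-Probability.Sinc_Integral"
    "Jordan_Normal_Form.Jordan_Normal_Form_Existence"
    "Jordan_Normal_Form.Spectral_Radius"
begin

text \<open>
  The Youla parametrization reduces (P1) to (P2): a controller \<open>K\<close> and a parameter
  \<open>Q\<close> correspond by \<open>Q (M - N K) = V K + U\<close> with coprime factors that respect the information
  structure, so \<open>K\<close> stabilizes and has the sparsity pattern iff \<open>Q\<close> is stable and has it.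

  (P2) is a convex problem that splits by columns. Let \<open>G = T11 + T12 Qopt T21\<close>. The
  Riccati equations of the estimators and of the descendants of \<open>j\<close> make the \<open>(descendants of j, j)\<close> block of
  \<open>T12(s)\<^sup>T G(-s) T21(s)\<^sup>T\<close> analytic and \<open>O(1/s)\<close> on the right half-plane. Hence \<open>G\<close> is orthogonal to
  \<open>T12 D T21\<close> for every stable \<open>D\<close> with the sparsity pattern, which is optimality. A controller with one
  state copy per agent is related to \<open>Qopt\<close> because the copies add up to the observer state.
\<close>

section \<open>Finitely supported matrices\<close>

text \<open>Two obstacles shape the proof. A competitor in (P2) is known only on the open right
  half-plane, without boundary values. Orthogonality is therefore tested on lines
  \<open>Re s = x > 0\<close> against the mirror image of \<open>G\<close>, which is analytic across
  the axis; this is why stable data carry a margin \<open>Re s > - d\<close>. Controllers are known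
  only far to the right, so the Youla correspondence is an identity between matrices at one point
  \<open>s\<close>, and the identity theorem is applied to its stable side only. It is kept implicit
  so that neither direction starts from an inverse. The columns decouple because of the local
  estimators: \<open>T21 (- s) * tp (T21 s)\<close> is the constant block-diagonal
  \<open>D21 * tp D21\<close>, so column \<open>j\<close> sees only the gain of agent
  \<open>j\<close>. As that column of an admissible \<open>Q\<close> has its rows in the descendants
  of \<open>j\<close>, the Riccati equation of exactly these descendants removes the remaining
  unstable part. \<open>ric\<close> is a definite description, so the stabilizing Riccati solutions
  have to be constructed and shown unique.\<close>

text \<open>
  All matrices live in one algebra of infinite matrices with finite support, so that blocks of
  different sizes can be added and multiplied freely; \<open>car r c\<close> states that a matrix fits into size
  \<open>r \<times> c\<close>, \<open>ix n\<close> is the identity of size \<open>n\<close>, and \<open>sh a n\<close> places a block of \<open>n\<close> rows at offset \<open>a\<close>.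
\<close>

typedef fmat = "{f :: nat \<Rightarrow> nat \<Rightarrow> complex. \<exists>N. \<forall>i j. N \<le> i \<or> N \<le> j \<longrightarrow> f i j = 0}"
  morphisms ent Fmat
  by (rule exI[of _ "\<lambda>_ _. 0"]) auto

definition car :: "nat \<Rightarrow> nat \<Rightarrow> fmat \<Rightarrow> bool" where
  "car r c M \<longleftrightarrow> (\<forall>i j. r \<le> i \<or> c \<le> j \<longrightarrow> ent M i j = 0)"

lemma car_ex: "\<exists>N. car N N M"
  using ent[of M] by (auto simp: car_def)

lemma car_mono: "car r c M \<Longrightarrow> r \<le> r' \<Longrightarrow> c \<le> c' \<Longrightarrow> car r' c' M"
  unfolding car_def using order_trans by blast

lemma car_ex2: "\<exists>N. car N N M \<and> car N N M'"
  using car_ex[of M] car_ex[of M'] by (metis car_mono nle_le)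

lemma car_ex3: "\<exists>N. car N N M \<and> car N N M' \<and> car N N M''"
  using car_ex2[of M M'] car_ex[of M''] by (metis car_mono nle_le)

lemma fmat_eqI: "(\<And>i j. ent M i j = ent M' i j) \<Longrightarrow> M = M'"
  using ent_inject by blast

lemma ent_Fmat: "(\<And>i j. N \<le> i \<or> N \<le> j \<Longrightarrow> f i j = 0) \<Longrightarrow> ent (Fmat f) = f"
  by (rule Fmat_inverse) auto

lemma carD: "car r c M \<Longrightarrow> \<not> (i < r \<and> j < c) \<Longrightarrow> ent M i j = 0"
  unfolding car_def by (meson not_le)

text \<open>Some bound on the support, not the least one. It only makes products, traces and norms
  finite sums; \<open>ent_mult_aux\<close>, \<open>tr_car\<close> and \<open>frs_car\<close> put any
  other bound in its place.\<close>

definition bd :: "fmat \<Rightarrow> nat" where "bd M = (SOME N. car N N M)"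

lemma car_bd: "car (bd M) (bd M) M"
  unfolding bd_def using car_ex by (rule someI_ex)

definition csc :: "complex \<Rightarrow> fmat \<Rightarrow> fmat" (infixr "*c" 75) where
  "csc a M = Fmat (\<lambda>i j. a * ent M i j)"

definition tp :: "fmat \<Rightarrow> fmat" where "tp M = Fmat (\<lambda>i j. ent M j i)"

definition cj :: "fmat \<Rightarrow> fmat" where "cj M = Fmat (\<lambda>i j. cnj (ent M i j))"

text \<open>The coordinate projection onto the indices in \<open>T\<close>. For infinite
  \<open>T\<close> the value is 0, since the result must have finite support.\<close>

definition dg :: "nat set \<Rightarrow> fmat" where
  "dg T = Fmat (\<lambda>i j. if finite T \<and> i = j \<and> i \<in> T then 1 else 0)"

definition sh :: "nat \<Rightarrow> nat \<Rightarrow> fmat" where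
  "sh a n = Fmat (\<lambda>i j. if i = a + j \<and> j < n then 1 else 0)"

abbreviation ix :: "nat \<Rightarrow> fmat" where "ix n \<equiv> dg {..<n}"

definition tr :: "fmat \<Rightarrow> complex" where "tr M = (\<Sum>i<bd M. ent M i i)"

lemma ent_csc [simp]: "ent (a *c M) i j = a * ent M i j"
  unfolding csc_def using car_bd[of M] by (subst ent_Fmat[where N = "bd M"]) (auto simp: car_def)

lemma ent_tp [simp]: "ent (tp M) i j = ent M j i"
  unfolding tp_def using car_bd[of M] by (subst ent_Fmat[where N = "bd M"]) (auto simp: car_def)

lemma ent_cj [simp]: "ent (cj M) i j = cnj (ent M i j)"
  unfolding cj_def using car_bd[of M] by (subst ent_Fmat[where N = "bd M"]) (auto simp: car_def)

lemma ent_dg [simp]: "finite T \<Longrightarrow> ent (dg T) i j = (if i = j \<and> i \<in> T then 1 else 0)"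
  unfolding dg_def
  by (subst ent_Fmat[where N = "Suc (Max (insert 0 T))"]) (auto simp: Suc_le_eq dest!: leD)

lemma ent_sh [simp]: "ent (sh a n) i j = (if i = a + j \<and> j < n then 1 else 0)"
  unfolding sh_def by (subst ent_Fmat[where N = "a + n"]) (auto split: if_splits)

lemma tr_car: "car N N M \<Longrightarrow> tr M = (\<Sum>i<N. ent M i i)"
proof -
  have *: "(\<Sum>i<N. ent M i i) = (\<Sum>i<K. ent M i i)" if "car N N M" "car K K M" "N \<le> K" for N K
    using that by (intro sum.mono_neutral_left) (auto simp: car_def)
  assume "car N N M"
  then show ?thesis unfolding tr_def using car_bd[of M] *[of N "bd M"] *[of "bd M" N]
    by (metis nle_le)
qed

text \<open>There is no unit, as the identity would have infinite support. Its role falls to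
  \<open>ix n\<close>, and carriers tell when \<open>ix n\<close> acts trivially
  (\<open>car_iff\<close>).\<close>

instantiation fmat :: ring
begin

definition "0 = Fmat (\<lambda>_ _. 0)"
definition "M + M' = Fmat (\<lambda>i j. ent M i j + ent M' i j)"
definition "M - M' = Fmat (\<lambda>i j. ent M i j - ent M' i j)"
definition "- M = Fmat (\<lambda>i j. - ent M i j)"
definition "M * M' = Fmat (\<lambda>i j. \<Sum>k<max (bd M) (bd M'). ent M i k * ent M' k j)"

lemma ent_0 [simp]: "ent 0 i j = 0"
  unfolding zero_fmat_def by (subst ent_Fmat[where N = 0]) auto

lemma ent_add [simp]: "ent (M + M') i j = ent M i j + ent M' i j"
proof -
  obtain N where "car N N M" "car N N M'" using car_ex2 by blast
  then show ?thesis unfolding plus_fmat_def by (subst ent_Fmat[where N = N]) (auto simp: car_def)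
qed

lemma ent_diff [simp]: "ent (M - M') i j = ent M i j - ent M' i j"
proof -
  obtain N where "car N N M" "car N N M'" using car_ex2 by blast
  then show ?thesis unfolding minus_fmat_def by (subst ent_Fmat[where N = N]) (auto simp: car_def)
qed

lemma ent_minus [simp]: "ent (- M) i j = - ent M i j"
  unfolding uminus_fmat_def using car_bd[of M] by (subst ent_Fmat[where N = "bd M"]) (auto simp: car_def)

lemma ent_mult0: "ent (M * M') i j = (\<Sum>k<max (bd M) (bd M'). ent M i k * ent M' k j)"
proof -
  have "car (bd M) (bd M) M" "car (bd M') (bd M') M'" by (rule car_bd)+
  then show ?thesis unfolding times_fmat_def
    by (subst ent_Fmat[where N = "max (bd M) (bd M')"]) (auto simp: car_def)
qed

text \<open>Terms beyond \<open>N\<close> vanish, and so do those beyond the bounds in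
  \<open>ent_mult0\<close>; both sums equal the one up to the maximum. A size for one factor is then
  enough to evaluate a product.\<close>

lemma ent_mult_aux:
  assumes "\<And>k. k \<ge> N \<Longrightarrow> ent M i k * ent M' k j = 0"
  shows "ent (M * M') i j = (\<Sum>k<N. ent M i k * ent M' k j)"
proof -
  let ?K = "max N (max (bd M) (bd M'))"
  have "ent (M * M') i j = (\<Sum>k<?K. ent M i k * ent M' k j)"
    unfolding ent_mult0 using car_bd[of M] by (intro sum.mono_neutral_left) (auto simp: car_def)
  also have "\<dots> = (\<Sum>k<N. ent M i k * ent M' k j)"
    using assms by (intro sum.mono_neutral_right) (auto simp: not_less)
  finally show ?thesis .
qed

lemma ent_mult_left: "car r N M \<Longrightarrow> ent (M * M') i j = (\<Sum>k<N. ent M i k * ent M' k j)"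
  by (rule ent_mult_aux) (auto simp: car_def not_less)

lemma ent_mult_right: "car N c M' \<Longrightarrow> ent (M * M') i j = (\<Sum>k<N. ent M i k * ent M' k j)"
  by (rule ent_mult_aux) (auto simp: car_def not_less)

instance
proof
  fix a b c :: fmat
  show "a * b * c = a * (b * c)"
  proof (rule fmat_eqI)
    fix i j
    obtain N where N: "car N N a" "car N N b" "car N N c" using car_ex3 by blast
    have "ent (a * b * c) i j = (\<Sum>k<N. \<Sum>l<N. ent a i l * ent b l k * ent c k j)"
      by (simp add: ent_mult_right[OF N(3)] ent_mult_left[OF N(1)] sum_distrib_right)
    also have "\<dots> = (\<Sum>l<N. \<Sum>k<N. ent a i l * ent b l k * ent c k j)" by (rule sum.swap)
    also have "\<dots> = ent (a * (b * c)) i j"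
      by (simp add: ent_mult_right[OF N(3)] ent_mult_left[OF N(1)] sum_distrib_left mult.assoc)
    finally show "ent (a * b * c) i j = ent (a * (b * c)) i j" .
  qed
  show "(a + b) * c = a * c + b * c"
  proof (rule fmat_eqI)
    fix i j
    obtain N where N: "car N N c" using car_ex by blast
    show "ent ((a + b) * c) i j = ent (a * c + b * c) i j"
      by (simp add: ent_mult_right[OF N] algebra_simps sum.distrib)
  qed
  show "a * (b + c) = a * b + a * c"
  proof (rule fmat_eqI)
    fix i j
    obtain N where N: "car N N a" using car_ex by blast
    show "ent (a * (b + c)) i j = ent (a * b + a * c) i j"
      by (simp add: ent_mult_left[OF N] algebra_simps sum.distrib)
  qed
qed (auto intro!: fmat_eqI)

end

definition frs :: "fmat \<Rightarrow> real" where
  "frs M = (\<Sum>(i,j)\<in>{..<bd M} \<times> {..<bd M}. (cmod (ent M i j))\<^sup>2)"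

lemma frs_car: "car r c M \<Longrightarrow> frs M = (\<Sum>(i,j)\<in>{..<r} \<times> {..<c}. (cmod (ent M i j))\<^sup>2)"
proof -
  assume a: "car r c M"
  have "(\<Sum>(i,j)\<in>{..<r} \<times> {..<c}. (cmod (ent M i j))\<^sup>2) =
        (\<Sum>(i,j)\<in>{..<max r (bd M)} \<times> {..<max c (bd M)}. (cmod (ent M i j))\<^sup>2)"
    using a by (intro sum.mono_neutral_left) (auto simp: car_def, (metis not_le)+)
  also have "\<dots> = frs M" unfolding frs_def
    using car_bd[of M] by (intro sum.mono_neutral_right) (auto simp: car_def, (metis not_le)+)
  finally show ?thesis by simp
qed

instantiation fmat :: real_vector
begin

definition "scaleR a M = complex_of_real a *c M"

lemma ent_scaleR [simp]: "ent (scaleR a M) i j = of_real a * ent M i j"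
  by (simp add: scaleR_fmat_def)

instance
  by standard (rule fmat_eqI; simp add: algebra_simps)+

end

text \<open>The norm is the Frobenius norm. The instance provides limits and the continuity of the
  ring operations.\<close>

instantiation fmat :: real_normed_algebra
begin

definition "norm_fmat M = sqrt (frs M)"
definition "sgn_fmat M = scaleR (inverse (norm M)) (M::fmat)"
definition "dist_fmat M M' = norm (M - M' :: fmat)"
definition [code del]: "(uniformity :: (fmat \<times> fmat) filter) = (INF e\<in>{0 <..}. principal {(x, y). dist x y < e})"
definition [code del]: "open_fmat U \<longleftrightarrow> (\<forall>x\<in>U. eventually (\<lambda>(x', y). x' = x \<longrightarrow> y \<in> U) (uniformity :: (fmat \<times> fmat) filter))"

lemma norm_car: "car r c M \<Longrightarrow> norm M = L2_set (\<lambda>(i,j). cmod (ent M i j)) ({..<r} \<times> {..<c})"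
  unfolding norm_fmat_def L2_set_def by (simp add: frs_car case_prod_unfold)

instance
proof
  fix a b :: real and x y z :: fmat
  show "dist x y = norm (x - y)" by (rule dist_fmat_def)

  show "sgn x = x /\<^sub>R norm x" by (simp add: sgn_fmat_def)
  show "norm (x + y) \<le> norm x + norm y"
  proof -
    obtain N where N: "car N N x" "car N N y" using car_ex2 by blast
    then have xy: "car N N (x + y)" by (auto simp: car_def)
    have "norm (x + y) \<le> L2_set (\<lambda>ij. cmod (case ij of (i,j) \<Rightarrow> ent x i j) + cmod (case ij of (i,j) \<Rightarrow> ent y i j)) ({..<N} \<times> {..<N})"
      unfolding norm_car[OF xy] by (intro L2_set_mono) (auto intro: norm_triangle_ineq)
    also have "\<dots> \<le> norm x + norm y"
      unfolding norm_car[OF N(1)] norm_car[OF N(2)] case_prod_unfold by (rule L2_set_triangle_ineq)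
    finally show ?thesis .
  qed
  show "norm (a *\<^sub>R x) = \<bar>a\<bar> * norm x"
  proof -
    obtain N where N: "car N N x" using car_ex by blast
    then have ax: "car N N (a *\<^sub>R x)" by (auto simp: car_def)
    show ?thesis
      unfolding norm_car[OF N] norm_car[OF ax] by (simp add: L2_set_right_distrib case_prod_unfold norm_mult)
  qed
  show "norm x = 0 \<longleftrightarrow> x = 0"
  proof -
    obtain N where N: "car N N x" using car_ex by blast
    have "norm x = 0 \<longleftrightarrow> (\<forall>i<N. \<forall>j<N. ent x i j = 0)"
      unfolding norm_car[OF N] by (auto simp: L2_set_eq_0_iff)
    also have "\<dots> \<longleftrightarrow> x = 0"
      using N by (auto intro!: fmat_eqI simp: car_def) (metis not_le)
    finally show ?thesis .
  qed
  show "a *\<^sub>R x * y = a *\<^sub>R (x * y)" "x * a *\<^sub>R y = a *\<^sub>R (x * y)"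
  proof -
    obtain N where N: "car N N x" "car N N y" using car_ex2 by blast
    show "a *\<^sub>R x * y = a *\<^sub>R (x * y)" "x * a *\<^sub>R y = a *\<^sub>R (x * y)"
      by (rule fmat_eqI; simp add: ent_mult_right[OF N(2)] ent_mult_left[OF N(1)] sum_distrib_left algebra_simps)+
  qed
  show "norm (x * y) \<le> norm x * norm y"
  proof -
    obtain N where N: "car N N x" "car N N y" using car_ex2 by blast
    have c: "car N N (x * y)"
      using N unfolding car_def[of _ _ "x * y"] by (auto simp: ent_mult_left[OF N(1)] car_def)
    \<comment> \<open>Cauchy-Schwarz for a row of \<open>x\<close> and a column of \<open>y\<close>;
      summed over all entries it makes the Frobenius norm submultiplicative.\<close>
    have e: "(cmod (ent (x * y) i j))\<^sup>2 \<le> (\<Sum>k<N. (cmod (ent x i k))\<^sup>2) * (\<Sum>k<N. (cmod (ent y k j))\<^sup>2)" for i j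
    proof -
      have "cmod (ent (x * y) i j) \<le> (\<Sum>k<N. \<bar>cmod (ent x i k)\<bar> * \<bar>cmod (ent y k j)\<bar>)"
        unfolding ent_mult_left[OF N(1)] by (rule order_trans[OF norm_sum]) (simp add: norm_mult)
      also have "\<dots> \<le> L2_set (\<lambda>k. cmod (ent x i k)) {..<N} * L2_set (\<lambda>k. cmod (ent y k j)) {..<N}"
        by (rule L2_set_mult_ineq)
      finally have "(cmod (ent (x * y) i j))\<^sup>2 \<le> (L2_set (\<lambda>k. cmod (ent x i k)) {..<N} * L2_set (\<lambda>k. cmod (ent y k j)) {..<N})\<^sup>2"
        by (rule power_mono) simp
      then show ?thesis by (simp add: power_mult_distrib L2_set_def sum_nonneg)
    qed
    have "frs (x * y) = (\<Sum>i<N. \<Sum>j<N. (cmod (ent (x * y) i j))\<^sup>2)"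
      by (simp add: frs_car[OF c] sum.cartesian_product)
    also have "\<dots> \<le> (\<Sum>i<N. \<Sum>j<N. (\<Sum>k<N. (cmod (ent x i k))\<^sup>2) * (\<Sum>k<N. (cmod (ent y k j))\<^sup>2))"
      by (intro sum_mono e)
    also have "\<dots> = (\<Sum>i<N. \<Sum>k<N. (cmod (ent x i k))\<^sup>2) * (\<Sum>j<N. \<Sum>k<N. (cmod (ent y k j))\<^sup>2)"
      by (simp add: sum_product)
    also have "(\<Sum>j<N. \<Sum>k<N. (cmod (ent y k j))\<^sup>2) = (\<Sum>k<N. \<Sum>j<N. (cmod (ent y k j))\<^sup>2)"
      by (rule sum.swap)
    finally have "frs (x * y) \<le> frs x * frs y"
      by (simp add: frs_car[OF N(1)] frs_car[OF N(2)] sum.cartesian_product)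
    then show ?thesis unfolding norm_fmat_def by (simp add: real_sqrt_mult[symmetric])
  qed
qed (rule uniformity_fmat_def open_fmat_def)+

end

lemma ent_sum [simp]: "ent (sum f S) i j = (\<Sum>x\<in>S. ent (f x) i j)"
  by (induction S rule: infinite_finite_induct) auto

lemma norm_sq: "car r c M \<Longrightarrow> (norm M)\<^sup>2 = (\<Sum>i<r. \<Sum>j<c. (cmod (ent M i j))\<^sup>2)"
  by (simp add: norm_fmat_def frs_car sum.cartesian_product sum_nonneg case_prod_unfold)

lemma norm_ent_le: "cmod (ent M i j) \<le> norm M"
proof -
  obtain N where N: "car N N M" using car_ex by blast
  show ?thesis
  proof (cases "i < N \<and> j < N")
    case True
    then show ?thesis unfolding norm_car[OF N]
      using member_le_L2_set[of "{..<N} \<times> {..<N}" "(i,j)" "\<lambda>(i,j). cmod (ent M i j)"] by simp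
  qed (use carD[OF N] in force)
qed

lemma car_0 [simp]: "car r c 0"
  and car_add [intro]: "car r c M \<Longrightarrow> car r c M' \<Longrightarrow> car r c (M + M')"
  and car_diff [intro]: "car r c M \<Longrightarrow> car r c M' \<Longrightarrow> car r c (M - M')"
  and car_minus [intro]: "car r c M \<Longrightarrow> car r c (- M)"
  and car_csc [intro]: "car r c M \<Longrightarrow> car r c (z *c M)"
  and car_scaleR [intro]: "car r c M \<Longrightarrow> car r c (x *\<^sub>R M)"
  and car_tp [intro]: "car r c M \<Longrightarrow> car c r (tp M)"
  and car_cj [intro]: "car r c M \<Longrightarrow> car r c (cj M)"
  and car_ix [simp]: "car n n (ix n)"
  and car_sh [simp]: "car (a + n) n (sh a n)"
  by (auto simp: car_def)

lemma car_sum [intro]: "(\<And>x. x \<in> S \<Longrightarrow> car r c (f x)) \<Longrightarrow> car r c (sum f S)"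
  by (induction S rule: infinite_finite_induct) auto

lemma car_mult: "car r k M \<Longrightarrow> car k' c M' \<Longrightarrow> car r c (M * M')"
  unfolding car_def[of r c] by (auto simp: ent_mult_left car_def)

lemma ent_dg_left: "finite T \<Longrightarrow> ent (dg T * M) i j = (if i \<in> T then ent M i j else 0)"
proof -
  assume T: "finite T"
  obtain N where N: "car N N M" using car_ex by blast
  have "ent (dg T * M) i j = (\<Sum>k<N. if k = i then (if i \<in> T then ent M i j else 0) else 0)"
    unfolding ent_mult_right[OF N] using T by (intro sum.cong) auto
  then show ?thesis using carD[OF N] by auto
qed

lemma ent_dg_right: "finite T \<Longrightarrow> ent (M * dg T) i j = (if j \<in> T then ent M i j else 0)"
proof -
  assume T: "finite T"
  obtain N where N: "car N N M" using car_ex by blast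
  have "ent (M * dg T) i j = (\<Sum>k<N. if k = j then (if j \<in> T then ent M i j else 0) else 0)"
    unfolding ent_mult_left[OF N] using T by (intro sum.cong) auto
  then show ?thesis using carD[OF N] by auto
qed

text \<open>Sizes become equations, so that carrier facts can be proved and used by rewriting in the
  ring.\<close>

lemma car_iff: "car r c M \<longleftrightarrow> ix r * M = M \<and> M * ix c = M"
proof
  assume "car r c M"
  then show "ix r * M = M \<and> M * ix c = M"
    by (auto intro!: fmat_eqI simp: ent_dg_left ent_dg_right car_def not_less)
next
  assume a: "ix r * M = M \<and> M * ix c = M"
  show "car r c M" unfolding car_def
  proof (intro allI impI)
    fix i j assume "r \<le> i \<or> c \<le> j"
    then have "ent (ix r * M) i j = 0 \<or> ent (M * ix c) i j = 0" by (auto simp: ent_dg_left ent_dg_right)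
    then show "ent M i j = 0" using a by auto
  qed
qed

lemma ix_left: "car r c M \<Longrightarrow> ix r * M = M" and ix_right: "car r c M \<Longrightarrow> M * ix c = M"
  by (simp_all add: car_iff)

lemma ix_left': "car r c M \<Longrightarrow> ix r * (M * x) = M * x"
  by (simp add: ix_left mult.assoc[symmetric])

lemma ix_right': "car r c M \<Longrightarrow> M * (ix c * x) = M * x"
  by (simp add: ix_right mult.assoc[symmetric])

lemma dg_mult: "finite S \<Longrightarrow> finite T \<Longrightarrow> dg S * dg T = dg (S \<inter> T)"
  by (rule fmat_eqI) (auto simp: ent_dg_left)

lemma car_dg: "T \<subseteq> {..<n} \<Longrightarrow> car n n (dg T)"
  using finite_subset[of T "{..<n}"] by (auto simp: car_def)

lemma csc_left: "(a *c M) * M' = a *c (M * M')" and csc_right: "M * (a *c M') = a *c (M * M')"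
proof -
  obtain N where N: "car N N M" "car N N M'" using car_ex2 by blast
  show "(a *c M) * M' = a *c (M * M')" "M * (a *c M') = a *c (M * M')"
    by (rule fmat_eqI; simp add: ent_mult_right[OF N(2)] ent_mult_left[OF N(1)] sum_distrib_left algebra_simps)+
qed

lemma csc_add: "a *c (M + M') = a *c M + a *c M'"
  and csc_diff: "a *c (M - M') = a *c M - a *c M'"
  and csc_minus: "a *c (- M) = - (a *c M)" "(- a) *c M = - (a *c M)"
  and csc_plus: "(a + b) *c M = a *c M + b *c M"
  and csc_sub: "(a - b) *c M = a *c M - b *c M"
  and csc_csc: "a *c b *c M = (a * b) *c M"
  and csc_one [simp]: "1 *c M = M"
  and csc_zero [simp]: "0 *c M = 0" "a *c 0 = 0"
  by (rule fmat_eqI; simp add: algebra_simps)+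

lemma norm_csc: "norm (a *c M) = cmod a * norm M"
proof -
  obtain N where N: "car N N M" using car_ex by blast
  then have aM: "car N N (a *c M)" by auto
  show ?thesis
    unfolding norm_car[OF N] norm_car[OF aM] by (simp add: L2_set_right_distrib case_prod_unfold norm_mult)
qed

lemma tp_mult: "tp (M * M') = tp M' * tp M"
proof -
  obtain N where N: "car N N M" "car N N M'" using car_ex2 by blast
  then have N': "car N N (tp M')" by auto
  show ?thesis
    by (rule fmat_eqI) (simp add: ent_mult_left[OF N(1)] ent_mult_left[OF N'] mult.commute)
qed

lemma cj_mult: "cj (M * M') = cj M * cj M'"
proof -
  obtain N where N: "car N N M" "car N N M'" using car_ex2 by blast
  then have N': "car N N (cj M)" by auto
  show ?thesis
    by (rule fmat_eqI) (simp add: ent_mult_left[OF N(1)] ent_mult_left[OF N'])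
qed

lemma tp_simps [simp]:
  "tp (M + M') = tp M + tp M'" "tp (M - M') = tp M - tp M'" "tp (- M) = - tp M"
  "tp (a *c M) = a *c tp M" "tp (x *\<^sub>R M) = x *\<^sub>R tp M" "tp 0 = 0" "tp (tp M) = M"
  by (rule fmat_eqI; simp)+

lemma dg_infinite: "infinite T \<Longrightarrow> dg T = 0"
  by (simp add: dg_def zero_fmat_def)

lemma tp_dg [simp]: "tp (dg T) = dg T"
  by (cases "finite T"; rule fmat_eqI) (auto simp: dg_infinite)

lemma cj_simps [simp]:
  "cj (M + M') = cj M + cj M'" "cj (M - M') = cj M - cj M'" "cj (- M) = - cj M"
  "cj (a *c M) = cnj a *c cj M" "cj (x *\<^sub>R M) = x *\<^sub>R cj M" "cj 0 = 0" "cj (cj M) = M" "cj (tp M) = tp (cj M)"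
  by (rule fmat_eqI; simp)+

lemma cj_dg [simp]: "cj (dg T) = dg T"
  by (cases "finite T"; rule fmat_eqI) (auto simp: dg_infinite)

lemma cj_sh [simp]: "cj (sh a n) = sh a n"
  by (rule fmat_eqI) simp

lemma tp_sum: "tp (sum f S) = (\<Sum>x\<in>S. tp (f x))" and cj_sum: "cj (sum f S) = (\<Sum>x\<in>S. cj (f x))"
  by (rule fmat_eqI; simp)+

abbreviation adj :: "fmat \<Rightarrow> fmat" where "adj M \<equiv> tp (cj M)"

lemma norm_tp [simp]: "norm (tp M) = norm M"
proof -
  obtain N where N: "car N N M" using car_ex by blast
  then have N': "car N N (tp M)" by auto
  have "(norm (tp M))\<^sup>2 = (norm M)\<^sup>2"
    unfolding norm_sq[OF N] norm_sq[OF N'] by (subst sum.swap) simp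
  then show ?thesis by simp
qed

lemma norm_cj [simp]: "norm (cj M) = norm M"
proof -
  obtain N where N: "car N N M" using car_ex by blast
  then have N': "car N N (cj M)" by auto
  have "(norm (cj M))\<^sup>2 = (norm M)\<^sup>2"
    unfolding norm_sq[OF N] norm_sq[OF N'] by simp
  then show ?thesis by simp
qed

lemma tr_simps [simp]: "tr (M + M') = tr M + tr M'" "tr (M - M') = tr M - tr M'" "tr (- M) = - tr M"
  "tr (a *c M) = a * tr M" "tr (x *\<^sub>R M) = of_real x * tr M" "tr (tp M) = tr M" "tr (cj M) = cnj (tr M)"
proof -
  obtain N where N: "car N N M" "car N N M'" using car_ex2 by blast
  then have N': "car N N (M + M')" "car N N (M - M')" "car N N (- M)" "car N N (a *c M)"
    "car N N (x *\<^sub>R M)" "car N N (tp M)" "car N N (cj M)" by auto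
  show "tr (M + M') = tr M + tr M'" "tr (M - M') = tr M - tr M'" "tr (- M) = - tr M"
    "tr (a *c M) = a * tr M" "tr (x *\<^sub>R M) = of_real x * tr M" "tr (tp M) = tr M" "tr (cj M) = cnj (tr M)"
    unfolding N'[THEN tr_car] N[THEN tr_car]
    by (simp_all add: sum.distrib sum_subtractf sum_negf sum_distrib_left)
qed

lemma tr_0 [simp]: "tr 0 = 0" using tr_car[of 0 0] by simp

lemma tr_sum: "tr (sum f S) = (\<Sum>x\<in>S. tr (f x))"
  by (induction S rule: infinite_finite_induct) auto

lemma tr_commute: "tr (M * M') = tr (M' * M)"
proof -
  obtain N where N: "car N N M" "car N N M'" using car_ex2 by blast
  show ?thesis
    unfolding tr_car[OF car_mult[OF N]] tr_car[OF car_mult[OF N(2,1)]] ent_mult_left[OF N(1)] ent_mult_left[OF N(2)]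
    by (subst sum.swap) (simp add: mult.commute)
qed

lemma tr_norm: "tr (adj M * M) = complex_of_real ((norm M)\<^sup>2)"
proof -
  obtain N where N: "car N N M" using car_ex by blast
  have sq: "cnj z * z = complex_of_real ((cmod z)\<^sup>2)" for z by (metis complex_norm_square mult.commute)
  have "tr (adj M * M) = (\<Sum>i<N. \<Sum>k<N. cnj (ent M k i) * ent M k i)"
    using N by (subst tr_car[of N]) (auto intro!: car_mult car_tp car_cj simp: ent_mult_right[OF N])
  also have "\<dots> = (\<Sum>k<N. \<Sum>i<N. cnj (ent M k i) * ent M k i)" by (rule sum.swap)
  also have "\<dots> = complex_of_real ((norm M)\<^sup>2)"
    unfolding norm_sq[OF N] by (simp only: sq of_real_sum)
  finally show ?thesis .
qed

lemma tr_ent: "car r c M \<Longrightarrow> car r c M' \<Longrightarrow> tr (adj M * M') = (\<Sum>i<r. \<Sum>j<c. cnj (ent M i j) * ent M' i j)"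
proof -
  assume a: "car r c M" "car r c M'"
  then have "tr (adj M * M') = (\<Sum>j<c. \<Sum>i<r. cnj (ent M i j) * ent M' i j)"
    by (subst tr_car[of c]) (auto intro!: car_mult car_tp car_cj simp: ent_mult_right[OF a(2)])
  then show ?thesis by (subst sum.swap) simp
qed

text \<open>Cauchy-Schwarz for the inner product \<open>tr (adj M * M')\<close>, whose norm is the
  Frobenius norm by \<open>tr_norm\<close>.\<close>

lemma norm_tr_le: "cmod (tr (adj M * M')) \<le> norm M * norm M'"
proof -
  obtain N where N: "car N N M" "car N N M'" using car_ex2 by blast
  have "cmod (tr (adj M * M')) = cmod (\<Sum>x\<in>{..<N}\<times>{..<N}. cnj (ent M (fst x) (snd x)) * ent M' (fst x) (snd x))"
    by (simp add: tr_ent[OF N] sum.cartesian_product case_prod_unfold)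
  also have "\<dots> \<le> (\<Sum>x\<in>{..<N}\<times>{..<N}. \<bar>cmod (ent M (fst x) (snd x))\<bar> * \<bar>cmod (ent M' (fst x) (snd x))\<bar>)"
    by (rule order_trans[OF norm_sum]) (simp add: norm_mult)
  also have "\<dots> \<le> norm M * norm M'"
    unfolding norm_car[OF N(1)] norm_car[OF N(2)] case_prod_unfold by (rule L2_set_mult_ineq)
  finally show ?thesis .
qed

lemma ent_sh_left: "ent (sh a n * M) i j = (if a \<le> i \<and> i < a + n then ent M (i - a) j else 0)"
proof -
  have "ent (sh a n * M) i j = (\<Sum>k<n. if k = i - a then (if a \<le> i then ent M (i - a) j else 0) else 0)"
    unfolding ent_mult_left[OF car_sh[of a n]] by (intro sum.cong) auto
  then show ?thesis by auto
qed

lemma ent_sh_right: "ent (M * tp (sh a n)) i j = (if a \<le> j \<and> j < a + n then ent M i (j - a) else 0)"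
proof -
  have "M * tp (sh a n) = tp (sh a n * tp M)" by (simp add: tp_mult)
  then show ?thesis by (simp add: ent_sh_left)
qed

lemma ent_tpsh_left: "ent (tp (sh a n) * M) i j = (if i < n then ent M (a + i) j else 0)"
proof -
  have c: "car n (a + n) (tp (sh a n))" by auto
  have "ent (tp (sh a n) * M) i j = (\<Sum>k<a+n. if k = a + i then (if i < n then ent M (a + i) j else 0) else 0)"
    unfolding ent_mult_left[OF c] by (intro sum.cong) auto
  then show ?thesis by auto
qed

lemma ent_sh_right': "ent (M * sh a n) i j = (if j < n then ent M i (a + j) else 0)"
proof -
  have "M * sh a n = tp (tp (sh a n) * tp M)" by (simp add: tp_mult)
  then show ?thesis by (simp add: ent_tpsh_left)
qed

text \<open>Entrywise convergence suffices only because all terms fit into one fixed size: the norm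
  is then a fixed finite expression in the entries.\<close>

lemma fmat_tendsto:
  fixes f :: "'a \<Rightarrow> fmat"
  assumes "\<forall>\<^sub>F x in F. car r c (f x)" and "car r c l" and "\<And>i j. i < r \<Longrightarrow> j < c \<Longrightarrow> ((\<lambda>x. ent (f x) i j) \<longlongrightarrow> ent l i j) F"
  shows "(f \<longlongrightarrow> l) F"
proof (rule Lim_null[THEN iffD2])
  have "((\<lambda>x. sqrt (\<Sum>i<r. \<Sum>j<c. (cmod (ent (f x) i j - ent l i j))\<^sup>2)) \<longlongrightarrow> sqrt (\<Sum>i<r. \<Sum>j<c. (cmod (ent l i j - ent l i j))\<^sup>2)) F"
    by (intro tendsto_intros assms(3)) auto
  then have "((\<lambda>x. sqrt (\<Sum>i<r. \<Sum>j<c. (cmod (ent (f x) i j - ent l i j))\<^sup>2)) \<longlongrightarrow> 0) F"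
    by simp
  then have "((\<lambda>x. norm (f x - l)) \<longlongrightarrow> 0) F"
  proof (rule Lim_transform_eventually)
    show "\<forall>\<^sub>F x in F. sqrt (\<Sum>i<r. \<Sum>j<c. (cmod (ent (f x) i j - ent l i j))\<^sup>2) = norm (f x - l)"
      using assms(1)
    proof eventually_elim
      case (elim x)
      then have "car r c (f x - l)" using assms(2) by auto
      from norm_sq[OF this] show ?case by simp (metis norm_ge_zero real_sqrt_abs abs_of_nonneg)
    qed
  qed
  then show "((\<lambda>x. f x - l) \<longlongrightarrow> 0) F" by (rule tendsto_norm_zero_cancel)
qed

lemma tendsto_ent [tendsto_intros]: "(f \<longlongrightarrow> l) F \<Longrightarrow> ((\<lambda>x. ent (f x) i j) \<longlongrightarrow> ent l i j) F"
proof -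
  assume "(f \<longlongrightarrow> l) F"
  then have "((\<lambda>x. norm (f x - l)) \<longlongrightarrow> 0) F" by (simp add: tendsto_norm_zero_iff Lim_null[symmetric])
  then have "((\<lambda>x. ent (f x) i j - ent l i j) \<longlongrightarrow> 0) F"
    by (rule Lim_null_comparison[rotated]) (auto intro!: always_eventually simp: norm_ent_le[of "_ - _", simplified])
  then show ?thesis by (simp add: Lim_null[symmetric])
qed

lemma tendsto_tp [tendsto_intros]: "(f \<longlongrightarrow> l) F \<Longrightarrow> ((\<lambda>x. tp (f x)) \<longlongrightarrow> tp l) F"
proof -
  assume "(f \<longlongrightarrow> l) F"
  then have "((\<lambda>x. norm (tp (f x - l))) \<longlongrightarrow> 0) F" by (simp only: norm_tp) (simp add: tendsto_norm_zero_iff Lim_null[symmetric])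
  then have "((\<lambda>x. tp (f x) - tp l) \<longlongrightarrow> 0) F" by (simp add: tendsto_norm_zero_iff)
  then show ?thesis by (simp add: Lim_null[symmetric])
qed

text \<open>\<open>tr\<close> sums up to a bound that varies with its argument. A left factor of
  fixed size turns it into a sum over a fixed range, and that passes to the limit.\<close>

lemma tendsto_tr [tendsto_intros]:
  fixes f :: "'a \<Rightarrow> fmat"
  assumes "(f \<longlongrightarrow> l) F" and "car n n M"
  shows "((\<lambda>x. tr (M * f x * M')) \<longlongrightarrow> tr (M * l * M')) F"
proof -
  have *: "tr (M * x * M') = (\<Sum>i<n. ent ((M * x * M') * ix n) i i)" for x
  proof -
    have "tr (M * x * M') = tr (ix n * (M * x * M') )" by (simp add: mult.assoc ix_left'[OF assms(2)])
    also have "\<dots> = tr (ix n * (ix n * (M * x * M')))"  by (simp add: mult.assoc ix_left'[OF assms(2)])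
    also have "\<dots> = tr (ix n * (M * x * M') * ix n)" by (subst tr_commute) simp
    also have "\<dots> = (\<Sum>i<n. ent (ix n * (M * x * M') * ix n) i i)"
      by (rule tr_car) (simp add: car_iff dg_mult mult.assoc[symmetric], simp add: dg_mult mult.assoc)
    finally show ?thesis by (simp add: mult.assoc ix_left'[OF assms(2)])
  qed
  show ?thesis unfolding * by (intro tendsto_intros assms)
qed

section \<open>Transfer from matrices with carriers\<close>

definition fm :: "complex mat \<Rightarrow> fmat" where
  "fm M = Fmat (\<lambda>i j. if i < dim_row M \<and> j < dim_col M then M $$ (i, j) else 0)"

abbreviation rm :: "real mat \<Rightarrow> fmat" where "rm M \<equiv> fm (cmat M)"

lemma ent_fm [simp]: "ent (fm M) i j = (if i < dim_row M \<and> j < dim_col M then M $$ (i, j) else 0)"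
  unfolding fm_def by (subst ent_Fmat[where N = "max (dim_row M) (dim_col M)"]) auto

lemma car_fm: "M \<in> carrier_mat r c \<Longrightarrow> car r c (fm M)"
  by (auto simp: car_def)

lemma car_rm: "M \<in> carrier_mat r c \<Longrightarrow> car r c (rm M)"
  by (auto simp: car_def)

lemma cj_rm [simp]: "cj (rm M) = rm M"
  by (rule fmat_eqI) auto

lemma fm_add: "M \<in> carrier_mat r c \<Longrightarrow> M' \<in> carrier_mat r c \<Longrightarrow> fm (M + M') = fm M + fm M'"
  and fm_diff: "M \<in> carrier_mat r c \<Longrightarrow> M' \<in> carrier_mat r c \<Longrightarrow> fm (M - M') = fm M - fm M'"
  and fm_uminus: "fm (- M) = - fm M"
  and fm_smult: "fm (z \<cdot>\<^sub>m M) = z *c fm M"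
  and fm_one: "fm (1\<^sub>m n) = ix n"
  and fm_zero: "fm (0\<^sub>m r c) = 0"
  and fm_transpose: "fm (transpose_mat M) = tp (fm M)"
  by (rule fmat_eqI; auto)+

lemma fm_mult: "dim_col M = dim_row M' \<Longrightarrow> fm (M * M') = fm M * fm M'"
proof (rule fmat_eqI)
  fix i j assume d: "dim_col M = dim_row M'"
  have c: "car (dim_row M) (dim_col M) (fm M)" by (rule car_fm) auto
  show "ent (fm (M * M')) i j = ent (fm M * fm M') i j"
    using d by (auto simp: ent_mult_left[OF c] scalar_prod_def atLeast0LessThan intro!: sum.cong)
qed

lemma fm_inject: "M \<in> carrier_mat r c \<Longrightarrow> M' \<in> carrier_mat r c \<Longrightarrow> fm M = fm M' \<longleftrightarrow> M = M'"
proof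
  assume M: "M \<in> carrier_mat r c" "M' \<in> carrier_mat r c" and eq: "fm M = fm M'"
  show "M = M'"
  proof (rule eq_matI)
    fix i j assume "i < dim_row M'" "j < dim_col M'"
    then show "M $$ (i, j) = M' $$ (i, j)"
      using arg_cong[OF eq, of "\<lambda>x. ent x i j"] M by auto
  qed (use M in auto)
qed simp

lemma rm_add: "M \<in> carrier_mat r c \<Longrightarrow> M' \<in> carrier_mat r c \<Longrightarrow> rm (M + M') = rm M + rm M'"
  and rm_diff: "M \<in> carrier_mat r c \<Longrightarrow> M' \<in> carrier_mat r c \<Longrightarrow> rm (M - M') = rm M - rm M'"
  and rm_uminus: "rm (- M) = - rm M"
  and rm_one: "rm (1\<^sub>m n) = ix n"
  and rm_zero: "rm (0\<^sub>m r c) = 0"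
  and rm_transpose: "rm (transpose_mat M) = tp (rm M)"
  by (rule fmat_eqI; auto)+

lemma rm_mult: "dim_col M = dim_row M' \<Longrightarrow> rm (M * M') = rm M * rm M'"
  using of_real_hom.mat_hom_mult[of M _ "dim_row M'" M' "dim_col M'"] fm_mult[of "cmat M" "cmat M'"]
  by (metis carrier_matI index_map_mat(2) index_map_mat(3))

lemma rm_inject: "M \<in> carrier_mat r c \<Longrightarrow> M' \<in> carrier_mat r c \<Longrightarrow> rm M = rm M' \<longleftrightarrow> M = M'"
proof
  assume M: "M \<in> carrier_mat r c" "M' \<in> carrier_mat r c" and eq: "rm M = rm M'"
  show "M = M'"
  proof (rule eq_matI)
    fix i j assume "i < dim_row M'" "j < dim_col M'"
    then show "M $$ (i, j) = M' $$ (i, j)"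
      using arg_cong[OF eq, of "\<lambda>x. ent x i j"] M by auto
  qed (use M in auto)
qed simp

definition mtx :: "nat \<Rightarrow> nat \<Rightarrow> fmat \<Rightarrow> complex mat" where
  "mtx r c M = mat r c (\<lambda>(i, j). ent M i j)"

definition rmtx :: "nat \<Rightarrow> nat \<Rightarrow> fmat \<Rightarrow> real mat" where
  "rmtx r c M = mat r c (\<lambda>(i, j). Re (ent M i j))"

lemma mtx_carrier [simp]: "mtx r c M \<in> carrier_mat r c" and rmtx_carrier [simp]: "rmtx r c M \<in> carrier_mat r c"
  by (simp_all add: mtx_def rmtx_def)

lemma fm_mtx: "car r c M \<Longrightarrow> fm (mtx r c M) = M"
  by (rule fmat_eqI) (auto simp: mtx_def car_def)

lemma rm_rmtx: "car r c M \<Longrightarrow> cj M = M \<Longrightarrow> rm (rmtx r c M) = M"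
proof (rule fmat_eqI)
  fix i j assume a: "car r c M" "cj M = M"
  then have "ent M i j \<in> \<real>" by (metis ent_cj Reals_cnj_iff)
  then show "ent (rm (rmtx r c M)) i j = ent M i j" using a(1) by (auto simp: rmtx_def car_def)
qed

lemma frob_sq_fm: "frob_sq M = (norm (fm M))\<^sup>2"
proof -
  have c: "car (dim_row M) (dim_col M) (fm M)" by (rule car_fm) auto
  show ?thesis unfolding frob_sq_def norm_sq[OF c] by (intro sum.cong) auto
qed

definition colv :: "nat \<Rightarrow> fmat \<Rightarrow> nat \<Rightarrow> complex vec" where
  "colv n x j = vec n (\<lambda>i. ent x i j)"

definition vfm :: "complex vec \<Rightarrow> fmat" where
  "vfm v = fm (mat (dim_vec v) 1 (\<lambda>(i, j). v $ i))"

lemma ent_vfm [simp]: "ent (vfm v) i j = (if i < dim_vec v \<and> j = 0 then v $ i else 0)"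
  by (auto simp: vfm_def)

lemma car_vfm: "v \<in> carrier_vec n \<Longrightarrow> car n 1 (vfm v)"
  by (auto simp: car_def)

lemma colv_carrier [simp]: "colv n x j \<in> carrier_vec n" by (simp add: colv_def)

lemma colv_mult: "M \<in> carrier_mat r c \<Longrightarrow> M *\<^sub>v colv c x j = colv r (fm M * x) j"
proof (rule eq_vecI)
  assume M: "M \<in> carrier_mat r c"
  fix i assume "i < dim_vec (colv r (fm M * x) j)"
  then show "(M *\<^sub>v colv c x j) $ i = colv r (fm M * x) j $ i"
    using M by (auto simp: colv_def ent_mult_left[OF car_fm[OF M]] scalar_prod_def atLeast0LessThan)
qed (auto simp: colv_def)

lemma vfm_mult: "M \<in> carrier_mat r c \<Longrightarrow> v \<in> carrier_vec c \<Longrightarrow> fm M * vfm v = vfm (M *\<^sub>v v)"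
proof (rule fmat_eqI)
  fix i j assume M: "M \<in> carrier_mat r c" "v \<in> carrier_vec c"
  then show "ent (fm M * vfm v) i j = ent (vfm (M *\<^sub>v v)) i j"
    by (auto simp: ent_mult_left[OF car_fm[OF M(1)]] scalar_prod_def atLeast0LessThan)
qed

lemma colv_zero_iff: "ix n * x = x \<Longrightarrow> (\<forall>j. colv n x j = 0\<^sub>v n) \<longleftrightarrow> x = 0"
proof safe
  assume a: "ix n * x = x" and b: "\<forall>j. colv n x j = 0\<^sub>v n"
  show "x = 0"
  proof (rule fmat_eqI)
    fix i j
    show "ent x i j = ent 0 i j"
    proof (cases "i < n")
      case True
      with b have "colv n x j $ i = 0" by simp
      with True show ?thesis by (simp add: colv_def)
    next
      case False
      then have "ent (ix n * x) i j = 0" by (simp add: ent_dg_left)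
      then show ?thesis using a by simp
    qed
  qed
qed (auto simp: colv_def)

text \<open>Trivial kernel, tested on matrices with any number of columns. Each column is a kernel
  vector, so this is injectivity on vectors, and the arguments stay inside the algebra.\<close>

definition inj_mul :: "nat \<Rightarrow> fmat \<Rightarrow> bool" where
  "inj_mul n M \<longleftrightarrow> (\<forall>x. ix n * x = x \<longrightarrow> M * x = 0 \<longrightarrow> x = 0)"

lemma inverse_exists:
  assumes M: "car n n M" and inj: "inj_mul n M"
  shows "\<exists>W. car n n W \<and> W * M = ix n \<and> M * W = ix n"
proof -
  let ?M = "mtx n n M"
  have MM: "?M \<in> carrier_mat n n" by simp
  have "det ?M \<noteq> 0"
  proof
    assume "det ?M = 0"
    then obtain v where v: "v \<in> carrier_vec n" "v \<noteq> 0\<^sub>v n" "?M *\<^sub>v v = 0\<^sub>v n"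
      using det_0_iff_vec_prod_zero_field[OF MM] by auto
    have "fm ?M * vfm v = 0"
      unfolding vfm_mult[OF MM v(1)] v(3) by (rule fmat_eqI) auto
    then have "M * vfm v = 0" by (simp add: fm_mtx[OF M])
    then have "vfm v = 0" using inj ix_left[OF car_vfm[OF v(1)]] by (auto simp: inj_mul_def)
    then have "ent (vfm v) i 0 = 0" for i by simp
    then have "v $ i = 0" if "i < n" for i
      using that v(1) by (metis carrier_vecD ent_vfm)
    then show False using v(1,2) by auto
  qed
  then obtain W where W: "W \<in> carrier_mat n n" "W * ?M = 1\<^sub>m n" "?M * W = 1\<^sub>m n"
    using det_non_zero_imp_unit[OF MM, of n] unfolding Units_def ring_mat_def by auto
  have "fm W * fm ?M = ix n" "fm ?M * fm W = ix n"
    using W fm_mult[of W ?M] fm_mult[of ?M W] carrier_matD[OF W(1)] carrier_matD[OF MM] by (simp_all add: fm_one)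
  then show ?thesis using W(1) car_fm by (auto simp: fm_mtx[OF M])
qed

lemma left_inverse_imp_right:
  assumes "car n n M" "car n n W" "W * M = ix n"
  shows "M * W = ix n"
proof -
  have "inj_mul n M" unfolding inj_mul_def using assms by (metis mult.assoc mult_zero_right)
  with inverse_exists[OF assms(1)] obtain W' where "car n n W'" "M * W' = ix n" by blast
  moreover from this have "W = W'" using assms by (metis ix_left ix_right mult.assoc)
  ultimately show ?thesis by simp
qed

text \<open>\<open>inv_mat\<close> is unspecified at singular matrices, so each use of it goes
  through an explicit left inverse \<open>W\<close>. Only for the identification with
  \<open>W\<close> does the size of \<open>W\<close> matter.\<close>

lemma fm_inv_mat:
  assumes M: "M \<in> carrier_mat n n" and W: "W * fm M = ix n"
  shows "inv_mat M \<in> carrier_mat n n" "fm (inv_mat M) * fm M = ix n" "fm M * fm (inv_mat M) = ix n"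
    "car n n W \<Longrightarrow> fm (inv_mat M) = W"
proof -
  have "inj_mul n (fm M)" unfolding inj_mul_def using W by (metis mult.assoc mult_zero_right)
  with inverse_exists[OF car_fm[OF M]] obtain V where V: "car n n V" "V * fm M = ix n" "fm M * V = ix n" by blast
  let ?V = "mtx n n V"
  have VV: "?V \<in> carrier_mat n n" by simp
  have "fm (?V * M) = fm (1\<^sub>m n)" "fm (M * ?V) = fm (1\<^sub>m n)"
    using V M by (simp_all add: fm_mult fm_mtx fm_one mtx_def[THEN arg_cong[of _ _ dim_row]] mtx_def[THEN arg_cong[of _ _ dim_col]])
  then have "?V * M = 1\<^sub>m n" "M * ?V = 1\<^sub>m n"
    using fm_inject[of "?V * M" n n "1\<^sub>m n"] fm_inject[of "M * ?V" n n "1\<^sub>m n"] M VV by auto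
  then have "M \<in> Units (ring_mat TYPE(complex) n ())"
    using M VV unfolding Units_def ring_mat_def by auto
  with mat_inverse(1)[OF M, of "()"] obtain B where "mat_inverse M = Some B" by (cases "mat_inverse M") auto
  with mat_inverse(2)[OF M this] have B: "inv_mat M = B" "B \<in> carrier_mat n n" "M * B = 1\<^sub>m n" "B * M = 1\<^sub>m n"
    by (auto simp: inv_mat_def)
  show 1: "inv_mat M \<in> carrier_mat n n" using B by simp
  show 2: "fm (inv_mat M) * fm M = ix n" "fm M * fm (inv_mat M) = ix n"
    using B M by (auto simp: fm_mult[symmetric] fm_one)
  show "fm (inv_mat M) = W" if "car n n W"
    using 2(2) W that car_fm[OF 1] by (metis ix_left ix_right mult.assoc)
qed

lemma rm_inv_mat:
  fixes M :: "real mat"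
  assumes M: "M \<in> carrier_mat n n" and W: "W * rm M = ix n"
  shows "inv_mat M \<in> carrier_mat n n" "rm (inv_mat M) * rm M = ix n" "rm M * rm (inv_mat M) = ix n"
proof -
  have "inj_mul n (rm M)" unfolding inj_mul_def using W by (metis mult.assoc mult_zero_right)
  with inverse_exists[OF car_rm[OF M]] obtain V where V: "car n n V" "V * rm M = ix n" "rm M * V = ix n" by blast
  \<comment> \<open>\<open>rm M\<close> is real, so the conjugate of its inverse is an inverse as
    well; uniqueness makes the inverse real.\<close>
  have "cj V * rm M = cj (V * rm M)" by (simp add: cj_mult)
  then have "cj V * rm M = ix n" using V by simp
  then have cj: "cj V = V" using V by (metis car_cj ix_left ix_right mult.assoc)
  let ?V = "rmtx n n V"
  have VV: "?V \<in> carrier_mat n n" by simp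
  have "rm (?V * M) = rm (1\<^sub>m n)" "rm (M * ?V) = rm (1\<^sub>m n)"
    using V M cj by (simp_all add: rm_mult rm_rmtx rm_one rmtx_def[THEN arg_cong[of _ _ dim_row]] rmtx_def[THEN arg_cong[of _ _ dim_col]])
  then have "?V * M = 1\<^sub>m n" "M * ?V = 1\<^sub>m n"
    using rm_inject[of "?V * M" n n "1\<^sub>m n"] rm_inject[of "M * ?V" n n "1\<^sub>m n"] M VV by auto
  then have "M \<in> Units (ring_mat TYPE(real) n ())"
    using M VV unfolding Units_def ring_mat_def by auto
  with mat_inverse(1)[OF M, of "()"] obtain B where "mat_inverse M = Some B" by (cases "mat_inverse M") auto
  with mat_inverse(2)[OF M this] have B: "inv_mat M = B" "B \<in> carrier_mat n n" "M * B = 1\<^sub>m n" "B * M = 1\<^sub>m n"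
    by (auto simp: inv_mat_def)
  show 1: "inv_mat M \<in> carrier_mat n n" using B by simp
  show 2: "rm (inv_mat M) * rm M = ix n" "rm M * rm (inv_mat M) = ix n"
    using B M by (auto simp: rm_mult[symmetric] rm_one)
qed

section \<open>Hurwitz matrices and Lyapunov equations\<close>

definition hurw :: "nat \<Rightarrow> fmat \<Rightarrow> bool" where
  "hurw n A \<longleftrightarrow> car n n A \<and> (\<forall>z x. ix n * x = x \<longrightarrow> x \<noteq> 0 \<longrightarrow> A * x = z *c x \<longrightarrow> Re z < 0)"

lemma eigenvalue_fm:
  assumes M: "M \<in> carrier_mat n n"
  shows "eigenvalue M z \<longleftrightarrow> (\<exists>x. ix n * x = x \<and> x \<noteq> 0 \<and> fm M * x = z *c x)"
proof
  assume "eigenvalue M z"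
  then obtain v where v: "v \<in> carrier_vec n" "v \<noteq> 0\<^sub>v n" "M *\<^sub>v v = z \<cdot>\<^sub>v v"
    using M unfolding eigenvalue_def eigenvector_def by auto
  have "fm M * vfm v = z *c vfm v"
    unfolding vfm_mult[OF M v(1)] v(3) by (rule fmat_eqI) auto
  moreover have "vfm v \<noteq> 0"
  proof
    assume "vfm v = 0"
    then have "ent (vfm v) i 0 = 0" for i by simp
    then have "v $ i = 0" if "i < n" for i
      using that v(1) by (metis carrier_vecD ent_vfm)
    then show False using v(1,2) by auto
  qed
  ultimately show "\<exists>x. ix n * x = x \<and> x \<noteq> 0 \<and> fm M * x = z *c x"
    using ix_left[OF car_vfm[OF v(1)]] by blast
next
  assume "\<exists>x. ix n * x = x \<and> x \<noteq> 0 \<and> fm M * x = z *c x"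
  then obtain x where x: "ix n * x = x" "x \<noteq> 0" "fm M * x = z *c x" by blast
  then obtain j where j: "colv n x j \<noteq> 0\<^sub>v n" using colv_zero_iff by blast
  have "M *\<^sub>v colv n x j = colv n (z *c x) j" unfolding colv_mult[OF M] x(3) ..
  also have "\<dots> = z \<cdot>\<^sub>v colv n x j" by (rule eq_vecI) (auto simp: colv_def)
  finally show "eigenvalue M z"
    unfolding eigenvalue_def eigenvector_def using j M by (intro exI[of _ "colv n x j"]) auto
qed

lemma hurwitz_iff: "M \<in> carrier_mat n n \<Longrightarrow> hurwitz M \<longleftrightarrow> hurw n (rm M)"
  unfolding hurwitz_def hurw_def using eigenvalue_fm[of "cmat M" n] car_rm[of M n n] by auto

text \<open>Powers in a ring without unit: the iteration starts at \<open>ix n\<close>.\<close>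

definition pw :: "nat \<Rightarrow> fmat \<Rightarrow> nat \<Rightarrow> fmat" where
  "pw n Z k = ((*) Z ^^ k) (ix n)"

lemma pw_0 [simp]: "pw n Z 0 = ix n" and pw_Suc [simp]: "pw n Z (Suc k) = Z * pw n Z k"
  by (simp_all add: pw_def)

lemma car_pw: "car n n Z \<Longrightarrow> car n n (pw n Z k)"
  by (induction k) (auto intro: car_mult)

lemma pw_Suc2: "car n n Z \<Longrightarrow> pw n Z (Suc k) = pw n Z k * Z"
  by (induction k) (simp_all add: ix_left ix_right, metis mult.assoc)

text \<open>Dividing \<open>Z\<close> by some \<open>r\<close> between its spectral radius and 1
  keeps all eigenvalues in the open unit disc. The Jordan normal form bounds the powers of the
  quotient uniformly, and multiplying back gives the factor \<open>r ^ k\<close>.\<close>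

lemma pw_geometric:
  assumes Z: "car n n Z" and ev: "\<And>z x. ix n * x = x \<Longrightarrow> x \<noteq> 0 \<Longrightarrow> Z * x = z *c x \<Longrightarrow> cmod z < 1"
  shows "\<exists>c r. 0 \<le> c \<and> 0 \<le> r \<and> r < 1 \<and> (\<forall>k. norm (pw n Z k) \<le> c * r ^ k)"
proof -
  let ?Z = "mtx n n Z"
  have ZZ: "?Z \<in> carrier_mat n n" by simp
  \<comment> \<open>The element 0 keeps the maximum defined when \<open>n = 0\<close> and the
    spectrum is empty.\<close>
  define S where "S = insert 0 (cmod ` spectrum ?Z)"
  have S: "finite S" "S \<noteq> {}" using card_finite_spectrum(1)[OF ZZ] by (auto simp: S_def)
  have "Max S < 1"
    unfolding Max_less_iff[OF S]
    using ev eigenvalue_fm[OF ZZ] by (auto simp: S_def spectrum_def fm_mtx[OF Z])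
  moreover have "0 \<le> Max S" using S by (intro Max_ge) (auto simp: S_def)
  moreover define r where "r = (1 + Max S) / 2"
  ultimately have r: "0 < r" "r < 1" "\<And>z. eigenvalue ?Z z \<Longrightarrow> cmod z < r"
  proof -
    show "0 < r" "r < 1" using \<open>Max S < 1\<close> \<open>0 \<le> Max S\<close> by (auto simp: r_def)
    fix z assume "eigenvalue ?Z z"
    then have "cmod z \<le> Max S" using S by (intro Max_ge) (auto simp: S_def spectrum_def)
    then show "cmod z < r" using \<open>Max S < 1\<close> by (simp add: r_def)
  qed
  define Y where "Y = (complex_of_real (1 / r)) \<cdot>\<^sub>m ?Z"
  have Y: "Y \<in> carrier_mat n n" by (simp add: Y_def)
  have fY: "fm Y = complex_of_real (1 / r) *c Z" by (simp add: Y_def fm_smult fm_mtx[OF Z])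
  have evY: "cmod z < 1" if z: "eigenvalue Y z" for z
  proof -
    obtain x where x: "ix n * x = x" "x \<noteq> 0" "fm Y * x = z *c x" using z eigenvalue_fm[OF Y] by blast
    have "Z * x = complex_of_real r *c (fm Y * x)" using r by (simp add: fY csc_left csc_csc)
    also have "\<dots> = (of_real r * z) *c x" by (simp add: x csc_csc)
    finally have "eigenvalue ?Z (of_real r * z)" using x eigenvalue_fm[OF ZZ] by (auto simp: fm_mtx[OF Z])
    then have "r * cmod z < r" using r(3)[of "of_real r * z"] r(1) by (simp add: norm_mult)
    then show ?thesis using r by simp
  qed
  from char_poly_factorized[OF Y] obtain as where as: "char_poly Y = (\<Prod>a\<leftarrow>as. [:- a, 1:])" by auto
  have as1: "cmod a < 1" if "a \<in> set as" for a
    using linear_poly_root[OF that] evY[of a] eigenvalue_root_char_poly[OF Y] as by simp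
  have "\<exists>n_as. jordan_nf Y n_as" by (rule jordan_nf_exists[OF Y]) (rule as)
  \<comment> \<open>The numerical parameter bounds the multiplicity of eigenvalues on the unit
    circle. There are none, so 0 is admissible and the bound does not grow with
    \<open>k\<close>.\<close>
  from factored_char_poly_norm_bound[OF Y as this, of 0]
  obtain c where c: "\<And>k. norm_bound (Y ^\<^sub>m k) c"
    using as1 by (force dest: less_imp_le)
  have pY: "fm (Y ^\<^sub>m k) = complex_of_real ((1 / r) ^ k) *c pw n Z k" for k
  proof (induction k)
    case 0
    then show ?case using Y by (simp add: fm_one)
  next
    case (Suc k)
    have "fm (Y ^\<^sub>m Suc k) = fm (Y ^\<^sub>m k) * fm Y" using Y pow_carrier_mat[OF Y, of k] by (auto simp: fm_mult)
    also have "\<dots> = complex_of_real ((1 / r) ^ Suc k) *c (pw n Z k * Z)"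
      unfolding Suc fY by (simp add: csc_left csc_right csc_csc mult.commute)
    finally show ?case unfolding pw_Suc2[OF Z] .
  qed
  have "norm (pw n Z k) \<le> (real n * \<bar>c\<bar>) * r ^ k" for k
  proof -
    have carY: "Y ^\<^sub>m k \<in> carrier_mat n n" using Y by (rule pow_carrier_mat)
    have "(norm (fm (Y ^\<^sub>m k)))\<^sup>2 \<le> (\<Sum>i<n. \<Sum>j<n. \<bar>c\<bar>\<^sup>2)"
      unfolding norm_sq[OF car_fm[OF carY]]
      using c[of k] carY unfolding norm_bound_def
      by (intro sum_mono power_mono) (simp_all add: carrier_matD[OF carY] order_trans[OF _ abs_ge_self])
    also have "\<dots> = (real n * \<bar>c\<bar>)\<^sup>2" by (simp add: power2_eq_square)
    finally have "norm (fm (Y ^\<^sub>m k)) \<le> real n * \<bar>c\<bar>" by (rule power2_le_imp_le) simp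
    moreover have "norm (fm (Y ^\<^sub>m k)) = (1 / r) ^ k * norm (pw n Z k)"
      using r by (simp add: pY norm_csc norm_power norm_divide)
    ultimately show ?thesis using r by (simp add: field_simps power_one_over)
  qed
  then show ?thesis using r by (intro exI[of _ "real n * \<bar>c\<bar>"] exI[of _ r]) auto
qed

text \<open>The Cayley transform turns Lyapunov equations into geometric series.\<close>

lemma cayley_exists:
  assumes A: "hurw n A"
  shows "\<exists>Z W. car n n Z \<and> car n n W \<and> W * (ix n - A) = ix n \<and> (ix n - A) * W = ix n \<and> Z = (ix n + A) * W \<and> Z = W * (ix n + A) \<and>
    (\<exists>c r. 0 \<le> c \<and> 0 \<le> r \<and> r < 1 \<and> (\<forall>k. norm (pw n Z k) \<le> c * r ^ k))"
proof -
  have cA: "car n n A" and ev: "\<And>z x. ix n * x = x \<Longrightarrow> x \<noteq> 0 \<Longrightarrow> A * x = z *c x \<Longrightarrow> Re z < 0"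
    using A by (auto simp: hurw_def)
  have "inj_mul n (ix n - A)"
    unfolding inj_mul_def
  proof (intro allI impI)
    fix x assume x: "ix n * x = x" "(ix n - A) * x = 0"
    then have "A * x = 1 *c x" by (simp add: left_diff_distrib)
    then show "x = 0" using ev[OF x(1), of 1] by force
  qed
  then obtain W where W: "car n n W" "W * (ix n - A) = ix n" "(ix n - A) * W = ix n"
    using inverse_exists[OF car_diff[OF car_ix cA]] by auto
  define Z where "Z = (ix n + A) * W"
  have cZ: "car n n Z" unfolding Z_def by (rule car_mult[OF car_add[OF car_ix cA] W(1)])
  have WA: "W * A = W - ix n" and AW: "A * W = W - ix n"
    using W(2,3) by (simp_all add: algebra_simps ix_left[OF W(1)] ix_right[OF W(1)])
  have Z: "Z = W * (ix n + A)"
    unfolding Z_def by (simp add: algebra_simps WA AW ix_left[OF W(1)] ix_right[OF W(1)])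
  have "cmod z < 1" if x: "ix n * x = x" "x \<noteq> 0" "Z * x = z *c x" for z x
  proof -
    \<comment> \<open>Undoing the Cayley map: \<open>y\<close> is an eigenvector of \<open>A\<close>
      for \<open>(z - 1) / (1 + z)\<close>, and this number has negative real part exactly when
      \<open>z\<close> lies in the open unit disc.\<close>
    define y where "y = W * x"
    have y: "ix n * y = y" by (simp add: y_def ix_left'[OF W(1)])
    have xy: "x = y - A * y" using W(3) x(1) by (metis y_def left_diff_distrib mult.assoc y)
    then have y0: "y \<noteq> 0" using x(2) by auto
    have "y + A * y = Z * x" by (simp add: Z_def y_def distrib_right mult.assoc ix_left'[OF W(1)])
    then have "y + A * y = z *c y - z *c (A * y)" by (simp add: x(3)) (simp add: xy csc_diff)
    then have e: "(1 + z) *c (A * y) = (z - 1) *c y"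
      by (simp add: csc_plus csc_sub algebra_simps)
    have "1 + z \<noteq> 0"
    proof
      assume "1 + z = 0"
      then have "z - 1 = -2" "1 + z = 0" by (auto simp: algebra_simps eq_neg_iff_add_eq_0)
      with e have "(-2) *c y = 0" by simp
      then have "(-1/2) *c (-2) *c y = 0" by simp
      then show False using y0 by (simp add: csc_csc)
    qed
    then have "A * y = ((z - 1) / (1 + z)) *c y"
    proof -
      have "A * y = (1 / (1 + z)) *c (1 + z) *c (A * y)" using \<open>1 + z \<noteq> 0\<close> by (simp add: csc_csc)
      also have "\<dots> = ((z - 1) / (1 + z)) *c y" unfolding e by (simp add: csc_csc)
      finally show ?thesis .
    qed
    from ev[OF y y0 this] have "Re ((z - 1) / (1 + z)) < 0" .
    moreover have "(z - 1) / (1 + z) = ((z - 1) * cnj (1 + z)) / of_real ((cmod (1 + z))\<^sup>2)"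
      by (subst complex_div_cnj) simp
    ultimately have "Re ((z - 1) * cnj (1 + z)) / (cmod (1 + z))\<^sup>2 < 0" by (simp only: Re_divide_of_real)
    then have "Re ((z - 1) * cnj (1 + z)) < 0"
      using \<open>1 + z \<noteq> 0\<close> by (simp add: divide_less_0_iff)
    moreover have "Re ((z - 1) * cnj (1 + z)) = (Re z)\<^sup>2 + (Im z)\<^sup>2 - 1"
      by (simp add: algebra_simps power2_eq_square)
    ultimately have "(cmod z)\<^sup>2 < 1" by (simp add: cmod_power2)
    then show ?thesis using abs_square_less_1[of "cmod z"] by simp
  qed
  note geo = pw_geometric[OF cZ this]
  show ?thesis
    by (rule exI[of _ Z], rule exI[of _ W], intro conjI) (rule cZ W Z_def Z geo)+
qed

text \<open>In terms of the two Cayley transforms the equation reads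
  \<open>adj Z * X * Z' = X\<close>. Iterating it puts ever higher powers around \<open>X\<close>,
  and these decay geometrically.\<close>

lemma sylvester_unique:
  assumes A: "hurw n A" and B: "hurw n B" and X: "car n n X" and eq: "adj A * X + X * B = 0"
  shows "X = 0"
proof -
  obtain Z W c r where Z: "car n n Z" "car n n W" "W * (ix n - A) = ix n" "(ix n - A) * W = ix n" "Z = (ix n + A) * W"
    "0 \<le> c" "0 \<le> r" "r < 1" "\<And>k. norm (pw n Z k) \<le> c * r ^ k"
    using cayley_exists[OF A] by auto
  obtain Z' W' c' r' where Z': "car n n Z'" "car n n W'" "W' * (ix n - B) = ix n" "(ix n - B) * W' = ix n" "Z' = (ix n + B) * W'"
    "0 \<le> c'" "0 \<le> r'" "r' < 1" "\<And>k. norm (pw n Z' k) \<le> c' * r' ^ k"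
    using cayley_exists[OF B] by auto
  have XB: "X * B = - (adj A * X)" using eq by (simp add: eq_neg_iff_add_eq_0 add.commute)
  have "adj (ix n + A) * X * (ix n + B) = adj (ix n - A) * X * (ix n - B)"
    by (simp add: algebra_simps ix_left[OF X] ix_right[OF X] ix_left'[OF X] XB)
  then have "adj W * (adj (ix n + A) * X * (ix n + B)) * W' = adj W * (adj (ix n - A) * X * (ix n - B)) * W'" by simp
  also have "\<dots> = (adj W * adj (ix n - A)) * X * ((ix n - B) * W')" by (simp only: mult.assoc)
  also have "adj W * adj (ix n - A) = adj ((ix n - A) * W)" by (simp add: tp_mult cj_mult)
  also have "\<dots> = ix n" using Z by simp
  finally have step: "adj Z * X * Z' = X"
    by (simp add: Z(5) Z'(4,5) tp_mult cj_mult mult.assoc ix_left[OF X] ix_right[OF X])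
  have it: "adj (pw n Z k) * X * pw n Z' k = X" for k
  proof (induction k)
    case 0
    then show ?case by (simp add: ix_left[OF X] ix_right[OF X])
  next
    case (Suc k)
    have "adj (pw n Z (Suc k)) * X * pw n Z' (Suc k) = adj (pw n Z k) * (adj Z * X * Z') * pw n Z' k"
      by (simp add: tp_mult cj_mult mult.assoc)
    then show ?case using Suc step by simp
  qed
  have "norm X \<le> (c * norm X * c') * (r * r') ^ k" for k
  proof -
    have "norm X = norm (adj (pw n Z k) * X * pw n Z' k)" by (simp only: it)
    also have "\<dots> \<le> norm (adj (pw n Z k)) * norm X * norm (pw n Z' k)"
      by (intro order_trans[OF norm_mult_ineq] mult_right_mono norm_mult_ineq) auto
    also have "\<dots> \<le> (c * r ^ k) * norm X * (c' * r' ^ k)"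
      using Z Z' by (intro mult_mono) auto
    finally show ?thesis by (simp add: power_mult_distrib algebra_simps)
  qed
  moreover have "(\<lambda>k. (c * norm X * c') * (r * r') ^ k) \<longlonglongrightarrow> (c * norm X * c') * 0"
    using Z Z' mult_left_le[of r' r] by (intro tendsto_mult LIMSEQ_realpow_zero tendsto_const) auto
  ultimately have "norm X \<le> 0" by (intro tendsto_lowerbound[of _ 0 sequentially "norm X"]) auto
  then show ?thesis by simp
qed

definition psd :: "fmat \<Rightarrow> bool" where
  "psd X \<longleftrightarrow> adj X = X \<and> (\<forall>x. 0 \<le> Re (tr (adj x * X * x)))"

lemma psd_gram: "psd (adj M * M)"
  unfolding psd_def
proof safe
  fix x
  have "adj x * (adj M * M) * x = adj (M * x) * (M * x)" by (simp add: tp_mult cj_mult mult.assoc)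
  then show "0 \<le> Re (tr (adj x * (adj M * M) * x))" by (simp only: tr_norm) simp
qed (simp add: tp_mult cj_mult)

text \<open>The Cayley transform turns the equation into the fixed point equation
  \<open>X = adj Z * X * Z + W'\<close>. It is solved by a geometric series, whose terms inherit
  semidefiniteness from \<open>W\<close>.\<close>

lemma lyapunov_exists:
  assumes A: "hurw n A" and W: "car n n W"
  shows "\<exists>X. car n n X \<and> adj A * X + X * A + W = 0 \<and> (psd W \<longrightarrow> psd X)"
proof -
  obtain Z V c r where Z: "car n n Z" "car n n V" "V * (ix n - A) = ix n" "(ix n - A) * V = ix n" "Z = (ix n + A) * V" "Z = V * (ix n + A)"
    and r: "0 \<le> c" "0 \<le> r" "r < 1" "\<And>k. norm (pw n Z k) \<le> c * r ^ k"
    using cayley_exists[OF A] by blast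
  have cA: "car n n A" using A by (auto simp: hurw_def)
  \<comment> \<open>The factor 2 matches the difference of
    \<open>adj (ix n - A) * X * (ix n - A)\<close> and
    \<open>adj (ix n + A) * X * (ix n + A)\<close>, which is \<open>-2\<close> times
    \<open>adj A * X + X * A\<close>.\<close>
  define W' where "W' = (2::real) *\<^sub>R (adj V * W * V)"
  define T where "T k = adj (pw n Z k) * W' * pw n Z k" for k
  define S where "S N = (\<Sum>k<N. T k)" for N
  have cW': "car n n W'" unfolding W'_def by (rule W Z(2) car_scaleR car_mult car_tp car_cj)+
  have cT: "car n n (T k)" for k unfolding T_def by (rule cW' car_pw[OF Z(1)] car_mult car_tp car_cj)+
  have cS: "car n n (S N)" for N unfolding S_def by (intro car_sum cT)
  have nT: "norm (T k) \<le> (c * norm W' * c) * (r * r) ^ k" for k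
  proof -
    have "norm (T k) \<le> norm (adj (pw n Z k)) * norm W' * norm (pw n Z k)"
      unfolding T_def by (intro order_trans[OF norm_mult_ineq] mult_right_mono norm_mult_ineq) auto
    also have "\<dots> \<le> (c * r ^ k) * norm W' * (c * r ^ k)"
      using r by (intro mult_mono) auto
    finally show ?thesis by (simp add: power_mult_distrib algebra_simps)
  qed
  have rr: "r * r < 1" using r mult_left_le[of r r] by auto
  have sm: "summable (\<lambda>k. ent (T k) i j)" for i j
  proof (rule summable_comparison_test)
    show "\<exists>N. \<forall>k\<ge>N. norm (ent (T k) i j) \<le> (c * norm W' * c) * (r * r) ^ k"
      using nT norm_ent_le order_trans by blast
    show "summable (\<lambda>k. (c * norm W' * c) * (r * r) ^ k)"
      using r rr by (intro summable_mult summable_geometric) auto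
  qed
  define X where "X = Fmat (\<lambda>i j. if i < n \<and> j < n then (\<Sum>k. ent (T k) i j) else 0)"
  have eX: "ent X i j = (if i < n \<and> j < n then (\<Sum>k. ent (T k) i j) else 0)" for i j
    unfolding X_def by (subst ent_Fmat[where N = n]) auto
  have cX: "car n n X" by (auto simp: car_def eX)
  have lim: "S \<longlonglongrightarrow> X"
  proof (rule fmat_tendsto)
    show "\<forall>\<^sub>F x in sequentially. car n n (S x)" using cS by simp
    fix i j assume "i < n" "j < n"
    then show "(\<lambda>x. ent (S x) i j) \<longlonglongrightarrow> ent X i j"
      using summable_LIMSEQ[OF sm[of i j]] by (simp add: eX S_def)
  qed (rule cX)
  have S1: "S (Suc k) = S k + T k" for k by (simp add: S_def)
  have SSuc: "S (Suc N) = adj Z * S N * Z + W'" for N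
  proof (induction N)
    case 0
    then show ?case by (simp add: S_def T_def ix_left[OF cW'] ix_right[OF cW'])
  next
    case (Suc N)
    have "T (Suc N) = adj Z * T N * Z"
      unfolding T_def pw_Suc2[OF Z(1)] by (simp add: cj_mult tp_mult mult.assoc)
    then have "S (Suc (Suc N)) = adj Z * S N * Z + W' + adj Z * T N * Z"
      by (simp only: S1[of "Suc N"] Suc)
    also have "\<dots> = adj Z * S (Suc N) * Z + W'" by (simp add: S1 algebra_simps)
    finally show ?case .
  qed
  have "(\<lambda>N. S (Suc N)) \<longlonglongrightarrow> adj Z * X * Z + W'"
    unfolding SSuc by (intro tendsto_intros lim)
  then have fixp: "X = adj Z * X * Z + W'"
    using LIMSEQ_unique LIMSEQ_Suc[OF lim] by blast
  have a: "V * (ix n - A) = ix n" "Z * (ix n - A) = ix n + A"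
  proof -
    show "V * (ix n - A) = ix n" by (rule Z)
    have "Z * (ix n - A) = (ix n + A) * (V * (ix n - A))" by (simp add: Z(5) mult.assoc)
    also have "\<dots> = ix n + A" using Z(3) cA by (simp add: distrib_right dg_mult ix_right)
    finally show "Z * (ix n - A) = ix n + A" .
  qed
  have "adj (ix n - A) * X * (ix n - A) = adj (Z * (ix n - A)) * X * (Z * (ix n - A)) + 2 *\<^sub>R (adj (V * (ix n - A)) * W * (V * (ix n - A)))"
    by (subst fixp) (simp only: W'_def distrib_left distrib_right cj_mult tp_mult mult.assoc mult_scaleR_left mult_scaleR_right)
  then have "adj (ix n - A) * X * (ix n - A) = adj (ix n + A) * X * (ix n + A) + 2 *\<^sub>R W"
    unfolding a by (simp add: ix_left[OF W] ix_right[OF W])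
  then have "2 *\<^sub>R (adj A * X + X * A + W) = 0"
    by (simp add: algebra_simps ix_left[OF cX] ix_right[OF cX] ix_left'[OF cX] scaleR_2)
  then have eq: "adj A * X + X * A + W = 0" by simp
  have "psd X" if "psd W"
  proof -
    have h: "adj (T k) = T k" for k
      using that by (simp add: T_def W'_def psd_def cj_mult tp_mult mult.assoc)
    have "adj (S N) = S N" for N by (simp add: S_def cj_sum tp_sum h)
    then have "adj X = X"
    proof -
      have "ent X j i = cnj (ent X i j)" for i j
      proof -
        have "(\<lambda>N. cnj (ent (S N) i j)) \<longlonglongrightarrow> cnj (ent X i j)" by (intro tendsto_intros lim)
        moreover have "cnj (ent (S N) i j) = ent (S N) j i" for N
          using arg_cong[OF \<open>\<And>N. adj (S N) = S N\<close>[of N], of "\<lambda>M. ent M j i"] by simp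
        ultimately have "(\<lambda>N. ent (S N) j i) \<longlonglongrightarrow> cnj (ent X i j)" by simp
        moreover have "(\<lambda>N. ent (S N) j i) \<longlonglongrightarrow> ent X j i" by (intro tendsto_intros lim)
        ultimately show ?thesis by (rule LIMSEQ_unique[rotated])
      qed
      note sym = this
      show ?thesis by (rule fmat_eqI) (simp only: ent_tp ent_cj sym[symmetric])
    qed
    moreover have "0 \<le> Re (tr (adj x * X * x))" for x
    proof -
      obtain K where K: "car K K (adj x)" using car_ex by blast
      have p: "0 \<le> Re (tr (adj x * T k * x))" for k
      proof -
        have "adj x * T k * x = 2 *\<^sub>R (adj (V * pw n Z k * x) * W * (V * pw n Z k * x))"
          by (simp add: T_def W'_def cj_mult tp_mult mult.assoc)
        then show ?thesis using that by (simp add: psd_def)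
      qed
      have "0 \<le> Re (tr (adj x * S N * x))" for N
        unfolding S_def by (simp add: sum_distrib_left sum_distrib_right tr_sum sum_nonneg p)
      moreover have "(\<lambda>N. Re (tr (adj x * S N * x))) \<longlonglongrightarrow> Re (tr (adj x * X * x))"
        by (intro tendsto_Re tendsto_tr[OF lim K])
      ultimately show ?thesis by (intro tendsto_lowerbound[of _ _ sequentially]) auto
    qed
    ultimately show ?thesis by (simp add: psd_def)
  qed
  then show ?thesis using eq cX by blast
qed

text \<open>A Lyapunov matrix \<open>P\<close> gives the margin. For
  \<open>y = s *c x - A * x\<close>, the real part of the inner product of \<open>P * x\<close> and
  \<open>y\<close> is \<open>Re s\<close> times the \<open>P\<close>-energy of \<open>x\<close> plus
  half the squared norm of \<open>x\<close>. Hence \<open>norm x\<close> is controlled by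
  \<open>norm y\<close> even slightly to the left of the imaginary axis.\<close>

lemma hurw_resolvent_bound:
  assumes A: "hurw n A"
  shows "\<exists>\<delta>>0. \<exists>c. \<forall>s. Re s > - \<delta> \<longrightarrow> (\<exists>W. car n n W \<and> W * (s *c ix n - A) = ix n \<and> (s *c ix n - A) * W = ix n \<and> norm W \<le> c)"
proof -
  have cA: "car n n A" using A by (auto simp: hurw_def)
  obtain P where P: "car n n P" "adj A * P + P * A + ix n = 0" "psd P"
    using lyapunov_exists[OF A car_ix] psd_gram[of "ix n"] by (auto simp: dg_mult)
  \<comment> \<open>Chosen so that a negative \<open>Re s\<close> costs at most half of the squared
    norm of \<open>x\<close>. The added 1 avoids a division by zero.\<close>
  define \<delta> where "\<delta> = 1 / (4 * (norm P + 1))"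
  have d: "0 < \<delta>" by (simp add: \<delta>_def add_nonneg_pos)
  have hP: "adj P = P" using P by (simp add: psd_def)
  have key: "norm x \<le> 4 * norm P * norm (s *c x - A * x)" if x: "ix n * x = x" and s: "Re s > - \<delta>" for x s
  proof -
    define y where "y = s *c x - A * x"
    have "adj (P * x) * y + adj y * (P * x) = (s + cnj s) *c (adj x * P * x) - adj x * (adj A * P + P * A) * x"
      by (simp add: y_def tp_mult cj_mult hP algebra_simps csc_left csc_right csc_plus csc_diff)
    also have "adj A * P + P * A = - ix n" using P(2) by (simp add: eq_neg_iff_add_eq_0)
    finally have "adj (P * x) * y + adj y * (P * x) = (s + cnj s) *c (adj x * P * x) + adj x * x"
      by (simp add: mult.assoc x)
    then have "Re (tr (adj (P * x) * y)) + Re (tr (adj y * (P * x))) = Re ((s + cnj s) * tr (adj x * P * x)) + (norm x)\<^sup>2"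
      by (metis plus_complex.sel(1) tr_simps(1,4) tr_norm Re_complex_of_real)
    moreover have "Re ((s + cnj s) * tr (adj x * P * x)) = 2 * Re s * Re (tr (adj x * P * x))"
      by (simp add: complex_add_cnj)
    moreover have "Re (tr (adj (P * x) * y)) \<le> norm P * norm x * norm y" "Re (tr (adj y * (P * x))) \<le> norm P * norm x * norm y"
      using order_trans[OF complex_Re_le_cmod order_trans[OF norm_tr_le mult_right_mono[OF norm_mult_ineq norm_ge_zero]], of "P" x y]
        order_trans[OF complex_Re_le_cmod order_trans[OF norm_tr_le mult_left_mono[OF norm_mult_ineq norm_ge_zero]], of y P x]
      by (auto simp: mult.commute mult.left_commute)
    moreover have "- (norm x)\<^sup>2 / 2 \<le> 2 * Re s * Re (tr (adj x * P * x))"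
    proof -
      have t: "0 \<le> Re (tr (adj x * P * x))" using P by (simp add: psd_def)
      have "Re (tr (adj x * P * x)) \<le> norm P * (norm x)\<^sup>2"
        using order_trans[OF complex_Re_le_cmod order_trans[OF norm_tr_le mult_left_mono[OF norm_mult_ineq norm_ge_zero]], of x P x]
        by (simp add: mult.assoc power2_eq_square mult.commute mult.left_commute)
      then have "\<delta> * Re (tr (adj x * P * x)) \<le> \<delta> * (norm P * (norm x)\<^sup>2)" using d by simp
      also have "\<dots> \<le> (norm x)\<^sup>2 / 4"
      proof -
        have "\<delta> * norm P \<le> 1 / 4" by (simp add: \<delta>_def divide_simps add_nonneg_pos)
        then have "(\<delta> * norm P) * (norm x)\<^sup>2 \<le> 1 / 4 * (norm x)\<^sup>2" by (rule mult_right_mono) simp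
        then show ?thesis by (simp add: mult.assoc)
      qed
      finally have "\<delta> * Re (tr (adj x * P * x)) \<le> (norm x)\<^sup>2 / 4" .
      moreover have "- \<delta> * Re (tr (adj x * P * x)) \<le> Re s * Re (tr (adj x * P * x))"
        using s t by (intro mult_right_mono) auto
      ultimately show ?thesis by simp
    qed
    ultimately have "(norm x)\<^sup>2 / 2 \<le> 2 * (norm P * norm x * norm y)" by linarith
    then have "norm x * norm x \<le> norm x * (4 * norm P * norm y)" by (simp add: power2_eq_square algebra_simps)
    then show ?thesis by (cases "norm x = 0") (auto simp: y_def[symmetric] mult_le_cancel_left)
  qed
  have "\<exists>W. car n n W \<and> W * (s *c ix n - A) = ix n \<and> (s *c ix n - A) * W = ix n \<and> norm W \<le> 4 * norm P * norm (ix n)"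
    if s: "Re s > - \<delta>" for s
  proof -
    have c: "car n n (s *c ix n - A)" by (intro car_diff car_csc car_ix cA)
    have e: "(s *c ix n - A) * x = s *c x - A * x" if "ix n * x = x" for x
      by (simp add: left_diff_distrib csc_left that)
    have "inj_mul n (s *c ix n - A)"
      unfolding inj_mul_def using key[OF _ s] e by fastforce
    from inverse_exists[OF c this] obtain W where W: "car n n W" "W * (s *c ix n - A) = ix n" "(s *c ix n - A) * W = ix n" by blast
    have "norm W \<le> 4 * norm P * norm (ix n)" using key[OF ix_left[OF W(1)] s] e[OF ix_left[OF W(1)]] W(3) by simp
    then show ?thesis using W by blast
  qed
  then show ?thesis using d by blast
qed

section \<open>Algebraic Riccati equations\<close>

text \<open>The Riccati assumptions inside the algebra: R1 as injectivity of \<open>D\<close>, R2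
  through a real gain, R3 as a kernel condition. The latter claims only \<open>x = 0\<close>,
  because \<open>D * u = 0\<close> then forces \<open>u = 0\<close>.\<close>

definition ric_hyp :: "nat \<Rightarrow> nat \<Rightarrow> nat \<Rightarrow> fmat \<Rightarrow> fmat \<Rightarrow> fmat \<Rightarrow> fmat \<Rightarrow> bool" where
  "ric_hyp n m z A B C D \<longleftrightarrow> car n n A \<and> car n m B \<and> car z n C \<and> car z m D \<and>
     cj A = A \<and> cj B = B \<and> cj C = C \<and> cj D = D \<and> inj_mul m D \<and>
     (\<exists>F. car m n F \<and> cj F = F \<and> hurw n (A + B * F)) \<and>
     (\<forall>w::real. \<forall>x u. ix n * x = x \<longrightarrow> ix m * u = u \<longrightarrow> A * x + B * u = (\<i> * of_real w) *c x \<longrightarrow>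
        C * x + D * u = 0 \<longrightarrow> x = 0)"

text \<open>The Riccati equation without inverses: the stationarity condition for the gain
  \<open>F\<close>, and the Lyapunov equation of the closed loop \<open>A + B * F\<close>.
  Substituting the first into the second gives the usual form.\<close>

definition ric_sol :: "nat \<Rightarrow> nat \<Rightarrow> fmat \<Rightarrow> fmat \<Rightarrow> fmat \<Rightarrow> fmat \<Rightarrow> fmat \<Rightarrow> fmat \<Rightarrow> bool" where
  "ric_sol n m A B C D X F \<longleftrightarrow> car n n X \<and> car m n F \<and> cj X = X \<and> cj F = F \<and> tp X = X \<and>
     tp D * (C + D * F) + tp B * X = 0 \<and>
     tp (A + B * F) * X + X * (A + B * F) + tp (C + D * F) * (C + D * F) = 0 \<and> hurw n (A + B * F)"

text \<open>The difference \<open>X1 - X2\<close> solves a homogeneous Sylvester equation with the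
  two closed loops as coefficients, one on each side. Both are Hurwitz, so it vanishes; the gains
  then agree because \<open>tp D * D\<close> is injective.\<close>

lemma ric_sol_unique:
  assumes A: "car n n A" "car n m B" "cj A = A" "cj B = B" and inj: "inj_mul m (tp D * D)"
    and 1: "ric_sol n m A B C D X1 F1" and 2: "ric_sol n m A B C D X2 F2"
  shows "X1 = X2 \<and> F1 = F2"
proof -
  have f1: "car n n X1" "cj F1 = F1" "tp X1 = X1" "hurw n (A + B * F1)" "car m n F1"
    and g1: "tp D * (C + D * F1) + tp B * X1 = 0"
    and h1: "tp (A + B * F1) * X1 + X1 * (A + B * F1) + tp (C + D * F1) * (C + D * F1) = 0"
    using 1 unfolding ric_sol_def by blast+
  have f2: "car n n X2" "cj F2 = F2" "tp X2 = X2" "hurw n (A + B * F2)" "car m n F2"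
    and g2: "tp D * (C + D * F2) + tp B * X2 = 0"
    and h2: "tp (A + B * F2) * X2 + X2 * (A + B * F2) + tp (C + D * F2) * (C + D * F2) = 0"
    using 2 unfolding ric_sol_def by blast+
  have r: "y = - x - z" if "x + y + z = 0" for x y z :: fmat
  proof -
    have "y = (x + y + z) - x - z" by (simp add: algebra_simps)
    then show ?thesis using that by simp
  qed
  have r1: "tp D * (D * F1) = - (tp D * C) - tp B * X1" by (rule r) (use g1 in \<open>simp only: distrib_left\<close>)
  have r2: "tp D * (D * F2) = - (tp D * C) - tp B * X2" by (rule r) (use g2 in \<open>simp only: distrib_left\<close>)
  have t1: "tp F1 * (tp D * D) = - (tp C * D) - X1 * B"
    using arg_cong[OF r1, of tp] f1 by (simp add: tp_mult mult.assoc)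
  have l1: "tp A * X1 + X1 * A + tp C * C + X1 * (B * F1) + tp C * (D * F1) = 0"
  proof -
    have "tp (A + B * F1) * X1 + X1 * (A + B * F1) + tp (C + D * F1) * (C + D * F1) =
      tp A * X1 + X1 * A + tp C * C + X1 * (B * F1) + tp C * (D * F1) + tp F1 * (tp D * (C + D * F1) + tp B * X1)"
      by (simp add: algebra_simps tp_mult)
    then show ?thesis unfolding g1 h1 by simp
  qed
  have l2: "tp A * X2 + X2 * A + tp C * C + X2 * (B * F2) + tp C * (D * F2) = 0"
  proof -
    have "tp (A + B * F2) * X2 + X2 * (A + B * F2) + tp (C + D * F2) * (C + D * F2) =
      tp A * X2 + X2 * A + tp C * C + X2 * (B * F2) + tp C * (D * F2) + tp F2 * (tp D * (C + D * F2) + tp B * X2)"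
      by (simp add: algebra_simps tp_mult)
    then show ?thesis unfolding g2 h2 by simp
  qed

  have e1: "tp F1 * (tp D * (D * F2)) = - (tp C * (D * F2)) - X1 * (B * F2)"
    using arg_cong[OF t1, of "\<lambda>y. y * F2"] by (simp add: algebra_simps)
  have e2: "tp F1 * (tp D * (D * F2)) = - (tp F1 * (tp D * C)) - tp F1 * (tp B * X2)"
    using arg_cong[OF r2, of "\<lambda>y. tp F1 * y"] by (simp add: algebra_simps)
  have e3: "tp F1 * (tp D * (D * F1)) = - (tp C * (D * F1)) - X1 * (B * F1)"
    using arg_cong[OF t1, of "\<lambda>y. y * F1"] by (simp add: algebra_simps)
  have e4: "tp F1 * (tp D * (D * F1)) = - (tp F1 * (tp D * C)) - tp F1 * (tp B * X1)"
    using arg_cong[OF r1, of "\<lambda>y. tp F1 * y"] by (simp add: algebra_simps)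
  have s: "tp F1 * (tp B * X1) - tp F1 * (tp B * X2) + X1 * (B * F2) - X1 * (B * F1)
     = tp C * (D * F1) - tp C * (D * F2)"
  proof -
    have c: "tp C * (D * F2) = - (tp F1 * (tp D * (D * F2))) - X1 * (B * F2)"
      "tp C * (D * F1) = - (tp F1 * (tp D * (D * F1))) - X1 * (B * F1)"
      using e1 e3 by simp_all
    show ?thesis by (simp only: c e2 e4) (simp add: algebra_simps)
  qed
  have "tp (A + B * F1) * (X1 - X2) + (X1 - X2) * (A + B * F2)
    = (tp A * X1 + X1 * A) - (tp A * X2 + X2 * A) + (tp F1 * (tp B * X1) - tp F1 * (tp B * X2) + X1 * (B * F2) - X1 * (B * F1)) + X1 * (B * F1) - X2 * (B * F2)"
    by (simp add: algebra_simps tp_mult)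
  also have "\<dots> = (tp A * X1 + X1 * A + tp C * C + X1 * (B * F1) + tp C * (D * F1)) - (tp A * X2 + X2 * A + tp C * C + X2 * (B * F2) + tp C * (D * F2))"
    unfolding s by (simp add: algebra_simps)
  also have "\<dots> = 0" unfolding l1 l2 by simp
  finally have e: "adj (A + B * F1) * (X1 - X2) + (X1 - X2) * (A + B * F2) = 0"
    using A(3,4) f1 by (simp add: cj_mult)
  have X: "X1 = X2"
    using sylvester_unique[OF f1(4) f2(4) car_diff[OF f1(1) f2(1)] e] by simp
  have "(tp D * D) * (F1 - F2) = 0" using r1 r2 by (simp add: right_diff_distrib mult.assoc X)
  moreover have "ix m * (F1 - F2) = F1 - F2" by (rule ix_left[OF car_diff[OF f1(5) f2(5)]])
  ultimately have "F1 = F2" using inj by (auto simp: inj_mul_def)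
  with X show ?thesis by simp
qed

section \<open>Existence of the stabilizing solution\<close>

lemma inverse_unique:
  assumes "car n n V" "car n n W" "V * M = ix n" "M * W = ix n"
  shows "V = W"
proof -
  have "V = V * (M * W)" unfolding assms(4) by (simp add: ix_right[OF assms(1)])
  also have "\<dots> = W" unfolding mult.assoc[symmetric] assms(3) by (simp add: ix_left[OF assms(2)])
  finally show ?thesis .
qed

text \<open>The residual of the Lyapunov equation whose solution is the cost matrix of the fixed
  gain \<open>F\<close>.\<close>

definition cl_lyap :: "fmat \<Rightarrow> fmat \<Rightarrow> fmat \<Rightarrow> fmat \<Rightarrow> fmat \<Rightarrow> fmat \<Rightarrow> fmat" where
  "cl_lyap A B C D X F = tp (A + B * F) * X + X * (A + B * F) + tp (C + D * F) * (C + D * F)"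

text \<open>Completing the square in the gain. At \<open>F'\<close> the linear term in
  \<open>F - F'\<close> disappears, so \<open>F'\<close> gives the least residual for the given
  \<open>X\<close> in the semidefinite order.\<close>

lemma cl_lyap_square:
  assumes X: "tp X = X" and F': "tp D * (D * F') = - (tp B * X + tp D * C)"
  shows "cl_lyap A B C D X F = tp A * X + X * A + tp C * C - tp F' * (tp D * (D * F')) + tp (F - F') * (tp D * (D * (F - F')))"
proof -
  have t: "tp F' * (tp D * D) = - (X * B + tp C * D)"
    using arg_cong[OF F', of tp] X by (simp add: tp_mult mult.assoc)
  have t': "tp F' * (tp D * (D * y)) = - (X * (B * y)) - tp C * (D * y)" for y
    using arg_cong[OF t, of "\<lambda>x. x * y"] by (simp add: algebra_simps)
  have f: "tp y * (tp D * (D * F')) = - (tp y * (tp B * X)) - tp y * (tp D * C)" for y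
    unfolding F' by (simp add: algebra_simps)
  show ?thesis
    unfolding cl_lyap_def by (simp add: algebra_simps tp_mult t') (simp add: f algebra_simps)
qed

lemma cl_lyap_compare:
  assumes X: "tp X = X" and F': "tp D * (D * F') = - (tp B * X + tp D * C)"
  shows "cl_lyap A B C D X F = cl_lyap A B C D X F' + tp (D * (F - F')) * (D * (F - F'))"
  unfolding cl_lyap_square[OF assms, of A F] cl_lyap_square[OF assms, of A F'] by (simp add: tp_mult mult.assoc)

lemma gram_zero:
  assumes "cj M = M" and "Re (tr (adj x * (tp M * M) * x)) = 0"
  shows "M * x = 0"
proof -
  have "adj x * (tp M * M) * x = adj (M * x) * (M * x)" using assms(1) by (simp add: tp_mult cj_mult mult.assoc)
  then have "Re (tr (adj (M * x) * (M * x))) = 0" using assms(2) by simp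
  then show ?thesis by (simp add: tr_norm)
qed

lemma gram_nonneg: "cj M = M \<Longrightarrow> 0 \<le> Re (tr (adj x * (tp M * M) * x))"
  using psd_gram[of M] by (simp add: psd_def)

lemma lyap_quadratic:
  assumes "cj A = A" and "A * x = z *c x"
  shows "Re (tr (adj x * (tp A * X + X * A) * x)) = 2 * Re z * Re (tr (adj x * X * x))"
proof -
  have "adj x * (tp A * X + X * A) * x = adj (A * x) * X * x + adj x * X * (A * x)"
    using assms(1) by (simp add: cj_mult tp_mult algebra_simps)
  also have "\<dots> = (cnj z + z) *c (adj x * X * x)"
    by (simp add: assms(2) csc_left csc_right csc_plus mult.assoc)
  finally show ?thesis by (simp add: complex_add_cnj[of z, simplified add.commute])
qed

text \<open>At a point \<open>z\<close> of the open right half-plane, each factor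
  \<open>z - a\<close> of the characteristic polynomial of a Hurwitz matrix has modulus at least
  \<open>Re z\<close>. The lower bound \<open>(Re z) ^ n\<close> survives the limit, since
  determinants are continuous in the entries, so \<open>z\<close> is no root of the limit
  polynomial.\<close>

lemma hurw_limit:
  assumes An: "\<And>k. hurw n (An k)" and lim: "An \<longlonglongrightarrow> A" and A: "car n n A"
    and x: "ix n * x = x" "x \<noteq> 0" "A * x = z *c x"
  shows "Re z \<le> 0"
proof (rule ccontr)
  assume "\<not> Re z \<le> 0"
  then have z: "0 < Re z" by simp
  let ?M = "\<lambda>k. mtx n n (An k)" and ?A = "mtx n n A"
  have cA: "car n n (An k)" for k using An by (auto simp: hurw_def)
  have M: "?M k \<in> carrier_mat n n" "?A \<in> carrier_mat n n" for k by auto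
  have lower: "(Re z) ^ n \<le> cmod (poly (char_poly (?M k)) z)" for k
  proof -
    obtain as where as: "char_poly (?M k) = (\<Prod>a\<leftarrow>as. [:- a, 1:])" "length as = n"
      using char_poly_factorized[OF M(1)] by auto
    have neg: "Re a < 0" if "a \<in> set as" for a
    proof -
      have "eigenvalue (?M k) a"
        using linear_poly_root[OF that] eigenvalue_root_char_poly[OF M(1)] as by simp
      then show ?thesis using An[of k] eigenvalue_fm[OF M(1)] unfolding hurw_def by (auto simp: fm_mtx[OF cA])
    qed
    have "(Re z) ^ length bs \<le> cmod (poly (\<Prod>a\<leftarrow>bs. [:- a, 1:]) z)" if "set bs \<subseteq> set as" for bs
      using that
    proof (induction bs)
      case (Cons b bs)
      have "Re z \<le> Re (z - b)" using neg[of b] Cons by auto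
      also have "\<dots> \<le> cmod (z - b)" by (rule complex_Re_le_cmod)
      finally have "Re z * Re z ^ length bs \<le> cmod (z - b) * cmod (poly (\<Prod>a\<leftarrow>bs. [:- a, 1:]) z)"
        using Cons z by (intro mult_mono) auto
      moreover have "poly (\<Prod>a\<leftarrow>b # bs. [:- a, 1:]) z = (z - b) * poly (\<Prod>a\<leftarrow>bs. [:- a, 1:]) z"
        by (simp add: algebra_simps)
      ultimately show ?case by (simp only: norm_mult length_Cons power_Suc)
    qed simp
    from this[of as] as show ?thesis by simp
  qed
  have pdet: "poly (char_poly Q) z = (\<Sum>p\<in>{p. p permutes {0..<n}}. signof p * (\<Prod>i=0..<n. (if i = p i then z else 0) - Q $$ (i, p i)))"
    if "Q \<in> carrier_mat n n" for Q
  proof -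
    have "- char_matrix Q z \<in> carrier_mat n n" using that by (simp add: char_matrix_def)
    then have "poly (char_poly Q) z = (\<Sum>p\<in>{p. p permutes {0..<n}}. signof p * (\<Prod>i=0..<n. (- char_matrix Q z) $$ (i, p i)))"
      unfolding char_poly_matrix[OF that] by (rule det_def')
    also have "\<dots> = (\<Sum>p\<in>{p. p permutes {0..<n}}. signof p * (\<Prod>i=0..<n. (if i = p i then z else 0) - Q $$ (i, p i)))"
    proof (intro sum.cong refl arg_cong2[where f = "(*)"] prod.cong)
      fix p i assume "p \<in> {p. p permutes {0..<n}}" "i \<in> {0..<n}"
      then have "i < n" "p i < n" using permutes_in_image[of p "{0..<n}" i] by auto
      then show "(- char_matrix Q z) $$ (i, p i) = (if i = p i then z else 0) - Q $$ (i, p i)"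
        using that by (auto simp: char_matrix_def)
    qed
    finally show ?thesis .
  qed
  have "(\<lambda>k. poly (char_poly (?M k)) z) \<longlonglongrightarrow> poly (char_poly ?A) z"
    unfolding pdet[OF M(1)] pdet[OF M(2)]
  proof (intro tendsto_sum tendsto_mult tendsto_const tendsto_prod tendsto_diff)
    fix p i assume "p \<in> {p. p permutes {0..<n}}" "i \<in> {0..<n}"
    then have "i < n" "p i < n" using permutes_in_image[of p "{0..<n}" i] by auto
    then show "(\<lambda>k. ?M k $$ (i, p i)) \<longlonglongrightarrow> ?A $$ (i, p i)"
      using tendsto_ent[OF lim] by (simp add: mtx_def)
  qed
  then have "(Re z) ^ n \<le> cmod (poly (char_poly ?A) z)"
    using lower by (intro tendsto_lowerbound[OF tendsto_norm[of _ "poly (char_poly ?A) z" sequentially]]) auto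
  moreover have "poly (char_poly ?A) z = 0"
    using x eigenvalue_fm[OF M(2)] eigenvalue_root_char_poly[OF M(2)] by (auto simp: fm_mtx[OF A])
  ultimately show False using zero_less_power[OF z, of n] by simp
qed

text \<open>Kleinman's iteration: the solutions of successive Lyapunov equations decrease to the stabilizing solution.\<close>

theorem ric_exists:
  assumes H: "ric_hyp n m z A B C D"
  shows "\<exists>X F. ric_sol n m A B C D X F \<and> psd X"
proof -
  note h = H[unfolded ric_hyp_def]
  have car: "car n n A" "car n m B" "car z n C" "car z m D" and re: "cj A = A" "cj B = B" "cj C = C" "cj D = D"
    and injD: "inj_mul m D" using h by auto
  obtain F0 where F0: "car m n F0" "cj F0 = F0" "hurw n (A + B * F0)" using h by blast
  have carR: "car m m (tp D * D)" by (rule car_mult[OF car_tp[OF car(4)] car(4)])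
  have injR: "inj_mul m (tp D * D)"
    unfolding inj_mul_def
  proof (intro allI impI)
    fix u assume u: "ix m * u = u" "tp D * D * u = 0"
    have "D * u = 0" by (rule gram_zero[OF re(4)]) (simp add: u mult.assoc[of "adj u"])
    then show "u = 0" using injD u by (auto simp: inj_mul_def)
  qed
  obtain Ri where Ri: "car m m Ri" "Ri * (tp D * D) = ix m" "tp D * D * Ri = ix m"
    using inverse_exists[OF carR injR] by blast
  have cjRi: "cj Ri = Ri"
  proof -
    have "cj Ri * (tp D * D) = cj (Ri * (tp D * D))" by (simp add: cj_mult re)
    then have e: "cj Ri * (tp D * D) = ix m" by (simp add: Ri)
    show ?thesis by (rule inverse_unique[OF car_cj[OF Ri(1)] Ri(1) e Ri(3)])
  qed
  \<comment> \<open>Policy improvement: the minimizing gain of \<open>cl_lyap_square\<close> for the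
    cost matrix \<open>X\<close>.\<close>
  define nx where "nx X = - (Ri * (tp B * X + tp D * C))" for X
  have nx: "tp D * (D * nx X) = - (tp B * X + tp D * C)" if "car n n X" for X
  proof -
    have c: "car m n (tp B * X + tp D * C)"
      by (rule car_add[OF car_mult[OF car_tp[OF car(2)] that] car_mult[OF car_tp[OF car(4)] car(3)]])
    have "tp D * (D * nx X) = - ((tp D * D * Ri) * (tp B * X + tp D * C))" by (simp add: nx_def mult.assoc)
    then show ?thesis unfolding Ri(3) by (simp add: ix_left[OF c])
  qed
  have nxc: "car m n (nx X)" if "car n n X" for X
    unfolding nx_def
    by (rule car_minus[OF car_mult[OF Ri(1) car_add[OF car_mult[OF car_tp[OF car(2)] that] car_mult[OF car_tp[OF car(4)] car(3)]]]])
  have nxr: "cj (nx X) = nx X" if "cj X = X" for X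
    by (simp add: nx_def cj_mult cjRi re that)
  define ok where "ok F \<longleftrightarrow> car m n F \<and> cj F = F \<and> hurw n (A + B * F)" for F
  define sl where "sl F X \<longleftrightarrow> car n n X \<and> cj X = X \<and> tp X = X \<and> psd X \<and> cl_lyap A B C D X F = 0" for F X
  have ex: "\<exists>X. sl F X" if F: "ok F" for F
  proof -
    have F': "car m n F" "cj F = F" "hurw n (A + B * F)" using F by (auto simp: ok_def)
    have "car z n (C + D * F)" by (rule car_add[OF car(3) car_mult[OF car(4) F'(1)]])
    then have cC: "car n n (tp (C + D * F) * (C + D * F))" using car_mult car_tp by blast
    have reCl: "cj (C + D * F) = C + D * F" "cj (A + B * F) = A + B * F" by (simp_all add: cj_mult re F')
    obtain X where X: "car n n X" "adj (A + B * F) * X + X * (A + B * F) + tp (C + D * F) * (C + D * F) = 0" "psd X"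
      using lyapunov_exists[OF F'(3) cC] psd_gram[of "C + D * F"] unfolding reCl by blast
    let ?W = "tp (C + D * F) * (C + D * F)"
    \<comment> \<open>The conjugate solves the same equation with real coefficients, so uniqueness
      makes \<open>X\<close> real.\<close>
    have X': "adj (A + B * F) * cj X + cj X * (A + B * F) + ?W = 0"
      using arg_cong[OF X(2), of cj] by (simp add: cj_mult re F')
    have "adj (A + B * F) * (X - cj X) + (X - cj X) * (A + B * F) =
      (adj (A + B * F) * X + X * (A + B * F) + ?W) - (adj (A + B * F) * cj X + cj X * (A + B * F) + ?W)"
      by (simp only: right_diff_distrib left_diff_distrib) (simp only: algebra_simps)
    also have "\<dots> = 0" unfolding X(2) X' by simp
    finally have e: "adj (A + B * F) * (X - cj X) + (X - cj X) * (A + B * F) = 0" .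
    have cjX: "cj X = X"
      using sylvester_unique[OF F'(3) F'(3) car_diff[OF X(1) car_cj[OF X(1)]] e] by simp
    then have tpX: "tp X = X" using X(3) by (simp add: psd_def)
    have ly: "cl_lyap A B C D X F = 0" using X(2) unfolding reCl cl_lyap_def .
    have "sl F X" unfolding sl_def by (intro conjI X(1,3) cjX tpX ly)
    then show ?thesis ..
  qed
  define Xs where "Xs F = (SOME X. sl F X)" for F
  have Xs: "sl F (Xs F)" if "ok F" for F unfolding Xs_def by (rule someI_ex[OF ex[OF that]])
  have ok_step: "ok (nx X)" if F: "ok F" and X: "sl F X" for F X
  proof -
    let ?G = "nx X"
    have X': "car n n X" "cj X = X" "tp X = X" "psd X" "cl_lyap A B C D X F = 0" using X by (auto simp: sl_def)
    have "hurw n (A + B * ?G)" unfolding hurw_def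
    proof (intro conjI allI impI)
      show "car n n (A + B * ?G)" by (intro car_add car car_mult[OF car(2) nxc[OF X'(1)]])
      fix l x assume x: "ix n * x = x" "x \<noteq> 0" "(A + B * ?G) * x = l *c x"
      have rc: "cj (A + B * ?G) = A + B * ?G" "cj (C + D * ?G) = C + D * ?G" "cj (D * (F - ?G)) = D * (F - ?G)"
        using F by (simp_all add: cj_mult re nxr[OF X'(2)] ok_def)
      show "Re l < 0"
      proof (rule ccontr)
        assume l: "\<not> Re l < 0"
        \<comment> \<open>On an eigenvector with \<open>Re l \<ge> 0\<close> this equation is a sum
          of three nonnegative terms, hence all vanish. The last one says that \<open>F\<close> and
          \<open>?G\<close> agree there, which would give an unstable eigenvector of the Hurwitz
          matrix \<open>A + B * F\<close>.\<close>
        have "cl_lyap A B C D X ?G + tp (D * (F - ?G)) * (D * (F - ?G)) = 0"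
          using cl_lyap_compare[OF X'(3) nx[OF X'(1)], of A F] X'(5) by simp
        then have "Re (tr (adj x * (cl_lyap A B C D X ?G + tp (D * (F - ?G)) * (D * (F - ?G))) * x)) = 0" by simp
        then have "2 * Re l * Re (tr (adj x * X * x)) + Re (tr (adj x * (tp (C + D * ?G) * (C + D * ?G)) * x))
            + Re (tr (adj x * (tp (D * (F - ?G)) * (D * (F - ?G))) * x)) = 0"
          unfolding cl_lyap_def lyap_quadratic[OF rc(1) x(3), symmetric]
          by (simp only: distrib_left distrib_right tr_simps plus_complex.sel)
        moreover have "0 \<le> 2 * Re l * Re (tr (adj x * X * x))" using l X'(4) by (simp add: psd_def)
        ultimately have "Re (tr (adj x * (tp (D * (F - ?G)) * (D * (F - ?G))) * x)) = 0"
          using gram_nonneg[OF rc(2), of x] gram_nonneg[OF rc(3), of x] by linarith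
        then have "D * ((F - ?G) * x) = 0" using gram_zero[OF rc(3)] by (simp add: mult.assoc)
        moreover have "car m n (F - ?G)" using F nxc[OF X'(1)] by (auto simp: ok_def)
        ultimately have "(F - ?G) * x = 0" using injD by (simp add: inj_mul_def ix_left')
        then have "(A + B * F) * x = l *c x" using x(3) by (simp add: algebra_simps)
        then show False using F x l by (auto simp: ok_def hurw_def)
      qed
    qed
    then show ?thesis using nxc[OF X'(1)] nxr[OF X'(2)] by (simp add: ok_def)
  qed
  define Fk where "Fk k = ((\<lambda>F. nx (Xs F)) ^^ k) F0" for k
  have F_Suc: "Fk (Suc k) = nx (Xs (Fk k))" for k by (simp add: Fk_def)
  have okF: "ok (Fk k)" for k
  proof (induction k)
    case 0
    then show ?case using F0 by (simp add: Fk_def ok_def)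
  next
    case (Suc k)
    show ?case unfolding F_Suc by (rule ok_step[OF Suc Xs[OF Suc]])
  qed
  define Xk where "Xk k = Xs (Fk k)" for k
  have Xk: "car n n (Xk k)" "cj (Xk k) = Xk k" "tp (Xk k) = Xk k" "psd (Xk k)" "cl_lyap A B C D (Xk k) (Fk k) = 0" for k
    using Xs[OF okF[of k]] by (auto simp: sl_def Xk_def)
  have FX: "Fk (Suc k) = nx (Xk k)" for k by (simp add: F_Suc Xk_def)
  \<comment> \<open>The Lyapunov equations of \<open>Xk k\<close> and \<open>Xk (Suc k)\<close>,
    both written with the new gain, differ by a Gram matrix. So the difference of the cost matrices
    is the semidefinite solution of a Lyapunov equation.\<close>
  have mono: "psd (Xk k - Xk (Suc k))" for k
  proof -
    let ?G = "Fk (Suc k)" and ?M = "D * (Fk k - Fk (Suc k))"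
    have hG: "hurw n (A + B * ?G)" and cG: "cj ?G = ?G" "car m n ?G" using okF[of "Suc k"] by (auto simp: ok_def)
    have cM: "car z n ?M" using okF[of k] cG by (intro car_mult[OF car(4)]) (auto simp: ok_def)
    have rM: "cj ?M = ?M" using okF[of k] cG by (simp add: ok_def cj_mult re)
    have rcl: "cj (A + B * ?G) = A + B * ?G" by (simp add: cj_mult re cG)
    have a: "cl_lyap A B C D (Xk k) ?G + tp ?M * ?M = 0"
      using cl_lyap_compare[OF Xk(3)[of k] nx[OF Xk(1)[of k]], of A "Fk k"] Xk(5)[of k] by (simp add: FX)
    have "cl_lyap A B C D (Xk k) ?G + tp ?M * ?M - cl_lyap A B C D (Xk (Suc k)) ?G = 0" using a Xk(5)[of "Suc k"] by simp
    then have e: "adj (A + B * ?G) * (Xk k - Xk (Suc k)) + (Xk k - Xk (Suc k)) * (A + B * ?G) + tp ?M * ?M = 0"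
      unfolding rcl cl_lyap_def by (simp add: algebra_simps)
    obtain Y where Y: "car n n Y" "adj (A + B * ?G) * Y + Y * (A + B * ?G) + tp ?M * ?M = 0" "psd Y"
      using lyapunov_exists[OF hG, of "tp ?M * ?M"] psd_gram[of ?M] car_mult[OF car_tp[OF cM] cM] unfolding rM by blast
    have "adj (A + B * ?G) * (Y - (Xk k - Xk (Suc k))) + (Y - (Xk k - Xk (Suc k))) * (A + B * ?G)
       = (adj (A + B * ?G) * Y + Y * (A + B * ?G) + tp ?M * ?M) -
         (adj (A + B * ?G) * (Xk k - Xk (Suc k)) + (Xk k - Xk (Suc k)) * (A + B * ?G) + tp ?M * ?M)"
      by (simp only: right_diff_distrib left_diff_distrib) (simp only: algebra_simps)
    also have "\<dots> = 0" unfolding e Y(2) by simp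
    finally have e': "adj (A + B * ?G) * (Y - (Xk k - Xk (Suc k))) + (Y - (Xk k - Xk (Suc k))) * (A + B * ?G) = 0" .
    have "Y = Xk k - Xk (Suc k)"
      using sylvester_unique[OF hG hG car_diff[OF Y(1) car_diff[OF Xk(1) Xk(1)]] e'] by simp
    then show ?thesis using Y(3) by simp
  qed
  define q where "q k x = Re (tr (adj x * Xk k * x))" for k x
  have "convergent (\<lambda>k. q k x)" for x
  proof (rule Bseq_monoseq_convergent)
    have "q (Suc k) x \<le> q k x" for k
    proof -
      have "adj x * (Xk k - Xk (Suc k)) * x = adj x * Xk k * x - adj x * Xk (Suc k) * x"
        by (simp only: left_diff_distrib right_diff_distrib)
      moreover have "0 \<le> Re (tr (adj x * (Xk k - Xk (Suc k)) * x))" using mono[of k] unfolding psd_def by blast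
      ultimately show ?thesis by (simp add: q_def)
    qed
    then have "decseq (\<lambda>k. q k x)" by (rule decseq_SucI)
    then show "monoseq (\<lambda>k. q k x)" by (rule decseq_imp_monoseq)
    have "0 \<le> q k x" for k using Xk(4)[of k] by (simp add: psd_def q_def)
    then show "Bseq (\<lambda>k. q k x)" using \<open>decseq (\<lambda>k. q k x)\<close> by (intro decseq_bounded) auto
  qed
  then have conv_q: "(\<lambda>k. q k x) \<longlonglongrightarrow> lim (\<lambda>k. q k x)" for x by (simp add: convergent_LIMSEQ_iff)
  \<comment> \<open>Decreasing nonnegative quadratic forms converge, and polarization at coordinate
    vectors transfers this to the entries. Since \<open>Xk k\<close> is real and symmetric, the sums
    of two coordinate vectors suffice.\<close>
  have polar: "ent (Xk k) i j = complex_of_real ((q k (sh i 1 + sh j 1) - q k (sh i 1) - q k (sh j 1)) / 2)" for k i j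
  proof -
    have t: "tr (tp (sh a 1) * Xk k * sh b 1) = ent (Xk k) a b" for a b
    proof -
      have "car 1 1 (tp (sh a 1) * Xk k * sh b 1)"
        by (rule car_mult[OF car_mult[OF car_tp[OF car_sh] Xk(1)[of k]] car_sh])
      then show ?thesis
        by (subst tr_car[of 1]) (simp_all add: ent_sh_right' ent_tpsh_left)
    qed
    have sym: "ent (Xk k) a b = ent (Xk k) b a" for a b using arg_cong[OF Xk(3)[of k], of "\<lambda>M. ent M b a"] by simp
    have real: "complex_of_real (Re (ent (Xk k) a b)) = ent (Xk k) a b" for a b
      using arg_cong[OF Xk(2)[of k], of "\<lambda>M. ent M a b"] by (simp add: Reals_cnj_iff[symmetric])
    show ?thesis
      unfolding q_def by (simp add: distrib_left distrib_right t) (simp add: sym[of j i] real t[unfolded One_nat_def])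
  qed
  define X where "X = Fmat (\<lambda>i j. if i < n \<and> j < n then lim (\<lambda>k. ent (Xk k) i j) else 0)"
  have eX: "ent X i j = (if i < n \<and> j < n then lim (\<lambda>k. ent (Xk k) i j) else 0)" for i j
    unfolding X_def by (subst ent_Fmat[where N = n]) auto
  have cX: "car n n X" by (auto simp: car_def eX)
  have limX: "Xk \<longlonglongrightarrow> X"
  proof (rule fmat_tendsto)
    show "\<forall>\<^sub>F k in sequentially. car n n (Xk k)" using Xk by simp
    fix i j assume ij: "i < n" "j < n"
    have "convergent (\<lambda>k. ent (Xk k) i j)"
      unfolding polar
      by (rule convergentI, rule tendsto_of_real, rule tendsto_divide[OF _ tendsto_const], rule tendsto_diff, rule tendsto_diff)
        (rule conv_q | simp)+
    then show "(\<lambda>k. ent (Xk k) i j) \<longlonglongrightarrow> ent X i j" using ij by (simp add: eX convergent_LIMSEQ_iff)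
  qed (rule cX)
  have tpX: "tp X = X"
    using LIMSEQ_unique[OF tendsto_tp[OF limX]] limX Xk(3) by simp
  have cjX: "cj X = X"
  proof (rule fmat_eqI)
    fix i j
    have "(\<lambda>k. cnj (ent (Xk k) i j)) \<longlonglongrightarrow> cnj (ent X i j)" by (intro tendsto_intros limX)
    moreover have "cnj (ent (Xk k) i j) = ent (Xk k) i j" for k
      using arg_cong[OF Xk(2)[of k], of "\<lambda>M. ent M i j"] by simp
    ultimately have "(\<lambda>k. ent (Xk k) i j) \<longlonglongrightarrow> cnj (ent X i j)" by simp
    then show "ent (cj X) i j = ent X i j"
      unfolding ent_cj by (rule LIMSEQ_unique[OF _ tendsto_ent[OF limX]])
  qed
  have psdX: "psd X" unfolding psd_def
  proof (intro conjI allI)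
    fix x
    obtain K where K: "car K K (adj x)" using car_ex by blast
    have "(\<lambda>k. Re (tr (adj x * Xk k * x))) \<longlonglongrightarrow> Re (tr (adj x * X * x))"
      by (intro tendsto_Re tendsto_tr[OF limX K])
    then show "0 \<le> Re (tr (adj x * X * x))"
      using Xk(4) by (intro tendsto_lowerbound[of _ _ sequentially]) (auto simp: psd_def)
  qed (simp add: cjX tpX)
  define F where "F = nx X"
  have limF: "(\<lambda>k. Fk (Suc k)) \<longlonglongrightarrow> F" unfolding FX F_def nx_def by (intro tendsto_intros limX)
  have limF': "Fk \<longlonglongrightarrow> F" using limF by (rule LIMSEQ_imp_Suc)
  have limA: "(\<lambda>k. A + B * Fk k) \<longlonglongrightarrow> A + B * F" by (intro tendsto_intros limF')
  have cF: "car m n F" and rF: "cj F = F" using nxc[OF cX] nxr[OF cjX] by (auto simp: F_def)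
  have ly: "cl_lyap A B C D X F = 0"
  proof -
    have "(\<lambda>k. cl_lyap A B C D (Xk k) (Fk k)) \<longlonglongrightarrow> cl_lyap A B C D X F"
      unfolding cl_lyap_def by (intro tendsto_intros limX limF' )
    then show ?thesis unfolding Xk(5) using LIMSEQ_unique tendsto_const by blast
  qed
  have fe: "tp D * (C + D * F) + tp B * X = 0" using nx[OF cX] by (simp add: F_def distrib_left)
  have "hurw n (A + B * F)" unfolding hurw_def
  proof (intro conjI allI impI)
    show cA: "car n n (A + B * F)" by (intro car_add car car_mult[OF car(2) cF])
    fix l x assume x: "ix n * x = x" "x \<noteq> 0" "(A + B * F) * x = l *c x"
    have rc: "cj (A + B * F) = A + B * F" "cj (C + D * F) = C + D * F" by (simp_all add: cj_mult re rF)
    have "Re l \<le> 0"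
      using hurw_limit[OF _ limA cA x] okF by (auto simp: ok_def)
    \<comment> \<open>The limit of Hurwitz matrices can lose stability only on the imaginary axis.
      There the Lyapunov equation forces \<open>C * x + D * (F * x) = 0\<close>, which R3
      excludes.\<close>
    moreover have "Re l \<noteq> 0"
    proof
      assume l: "Re l = 0"
      have "Re (tr (adj x * cl_lyap A B C D X F * x)) = 0" by (simp add: ly)
      then have "2 * Re l * Re (tr (adj x * X * x)) + Re (tr (adj x * (tp (C + D * F) * (C + D * F)) * x)) = 0"
        unfolding cl_lyap_def lyap_quadratic[OF rc(1) x(3), symmetric]
        by (simp only: distrib_left distrib_right tr_simps plus_complex.sel)
      then have "(C + D * F) * x = 0" using gram_zero[OF rc(2), of x] l by simp
      then have "C * x + D * (F * x) = 0" by (simp add: algebra_simps)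
      moreover have "A * x + B * (F * x) = (\<i> * of_real (Im l)) *c x"
      proof -
        have "l = \<i> * of_real (Im l)" using l by (simp add: complex_eq_iff)
        then show ?thesis using x(3) by (simp add: distrib_right mult.assoc)
      qed
      ultimately have "x = 0" using h x(1) ix_left'[OF cF, of x] by blast
      then show False using x(2) by simp
    qed
    ultimately show "Re l < 0" by simp
  qed
  then have "ric_sol n m A B C D X F"
    unfolding ric_sol_def using cX cF cjX rF tpX fe ly by (simp add: cl_lyap_def)
  then show ?thesis using psdX by blast
qed

section \<open>Riccati data of concrete real matrices\<close>

lemma fm_four_block:
  assumes "A \<in> carrier_mat r c" "B \<in> carrier_mat r c'" "C \<in> carrier_mat r' c" "D \<in> carrier_mat r' c'"
  shows "fm (four_block_mat A B C D) =
    fm A + fm B * tp (sh c c') + sh r r' * fm C + sh r r' * fm D * tp (sh c c')"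
  using assms by (intro fmat_eqI) (auto simp: ent_sh_left ent_sh_right)

lemma rm_four_block:
  assumes "A \<in> carrier_mat r c" "B \<in> carrier_mat r c'" "C \<in> carrier_mat r' c" "D \<in> carrier_mat r' c'"
  shows "rm (four_block_mat A B C D) =
    rm A + rm B * tp (sh c c') + sh r r' * rm C + sh r r' * rm D * tp (sh c c')"
  using assms by (intro fmat_eqI) (auto simp: ent_sh_left ent_sh_right)

lemma tpsh_sh: "tp (sh a n) * sh a n = ix n"
  by (rule fmat_eqI) (auto simp: ent_tpsh_left)

lemma tpsh_ix: "tp (sh a n) * ix a = 0" and ix_sh: "ix a * sh a n = 0"
  by (rule fmat_eqI, simp add: ent_dg_right ent_dg_left)+

text \<open>The rank is computed from the set of columns. Repeated columns would make it smaller
  than \<open>c\<close>, so they are excluded before linear independence can be applied.\<close>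

lemma full_rank_inj:
  fixes M :: "complex mat"
  assumes M: "M \<in> carrier_mat r c" and rank: "vec_space.rank r M = c"
    and v: "v \<in> carrier_vec c" "M *\<^sub>v v = 0\<^sub>v r"
  shows "v = 0\<^sub>v c"
proof (rule ccontr)
  interpret vec_space "TYPE(complex)" r .
  assume v0: "v \<noteq> 0\<^sub>v c"
  have dist: "distinct (cols M)"
  proof (rule ccontr)
    assume nd: "\<not> distinct (cols M)"
    obtain S where S: "maximal S (\<lambda>T. T \<subseteq> set (cols M) \<and> lin_indpt T)"
      using maximal_exists[of "(\<lambda>T. T \<subseteq> set (cols M) \<and> lin_indpt T)" "card (set (cols M))" "{}"]
      by (meson List.finite_set card_mono empty_iff empty_subsetI finite_lin_indpt2 rev_finite_subset)
    then have "card S \<le> card (set (cols M))" by (simp add: card_mono maximal_def)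
    moreover have "card (set (cols M)) < length (cols M)"
      using nd card_distinct card_length le_neq_implies_less by blast
    ultimately show False using rank_card_indpt[OF M S] rank M by simp
  qed
  have "lin_dep (set (cols M))" by (rule lin_depI[OF M v(1) v0 v(2) dist])
  then show False using full_rank_lin_indpt[OF M rank dist] by simp
qed

lemma riccati_assumptions_hyp:
  assumes carr: "A \<in> carrier_mat n n" "B \<in> carrier_mat n m" "C \<in> carrier_mat z n" "D \<in> carrier_mat z m"
    and ric: "riccati_assumptions A B C D"
  shows "ric_hyp n m z (rm A) (rm B) (rm C) (rm D)"
proof -
  have pd: "pos_def (transpose_mat D * D)" and st: "stabilizable A B"
    and rk: "\<And>\<omega>::real. let M = four_block_mat (cmat A - (\<i> * of_real \<omega>) \<cdot>\<^sub>m 1\<^sub>m (dim_row A)) (cmat B) (cmat C) (cmat D)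
        in vec_space.rank (dim_row M) M = dim_col M"
    using ric by (auto simp: riccati_assumptions_def)
  let ?R = "transpose_mat D * D"
  have R: "?R \<in> carrier_mat m m" using carr by simp
  have "det ?R \<noteq> 0"
  proof
    assume "det ?R = 0"
    then obtain v where v: "v \<in> carrier_vec m" "v \<noteq> 0\<^sub>v m" "?R *\<^sub>v v = 0\<^sub>v m"
      using det_0_iff_vec_prod_zero_field[OF R] by auto
    have "v \<in> carrier_vec (dim_row ?R)" "v \<noteq> 0\<^sub>v (dim_row ?R)" using v carr by auto
    then have "0 < scalar_prod v (?R *\<^sub>v v)" using pd unfolding pos_def_def by blast
    then show False using v by simp
  qed
  then obtain W where W: "W \<in> carrier_mat m m" "W * ?R = 1\<^sub>m m"
    using det_non_zero_imp_unit[OF R, of "()"] unfolding Units_def ring_mat_def by auto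
  have "rm W * (tp (rm D) * rm D) = rm (W * ?R)"
    using rm_mult[of W ?R] rm_mult[of "transpose_mat D" D] carrier_matD[OF W(1)] carrier_matD[OF R] by (simp add: rm_transpose)
  then have WR: "rm W * (tp (rm D) * rm D) = ix m" by (simp add: W(2) rm_one)
  have inj: "inj_mul m (rm D)"
    unfolding inj_mul_def
  proof (intro allI impI)
    fix u assume u: "ix m * u = u" "rm D * u = 0"
    have "u = rm W * (tp (rm D) * rm D) * u" by (simp only: WR u)
    then show "u = 0" by (simp add: mult.assoc u(2))
  qed
  obtain F where F: "F \<in> carrier_mat m n" "hurwitz (A + B * F)"
    using st carr unfolding stabilizable_def by auto
  have ABF: "A + B * F \<in> carrier_mat n n" using carr F by simp
  have "rm (A + B * F) = rm A + rm B * rm F"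
    using rm_add[OF carr(1), of "B * F"] rm_mult[of B F] carr F by simp
  then have hur: "hurw n (rm A + rm B * rm F)" using F(2) hurwitz_iff[OF ABF] by simp
  have "x = 0" if x: "ix n * x = x" "ix m * u = u" "rm A * x + rm B * u = (\<i> * of_real w) *c x" "rm C * x + rm D * u = 0"
    for w :: real and x u
  proof -
    let ?a = "\<i> * complex_of_real w"
    define M where "M = four_block_mat (cmat A - ?a \<cdot>\<^sub>m 1\<^sub>m (dim_row A)) (cmat B) (cmat C) (cmat D)"
    have M: "M \<in> carrier_mat (n + z) (n + m)" using carr unfolding M_def by (intro four_block_carrier_mat) auto
    have rank: "vec_space.rank (n + z) M = n + m" using rk[of w] carrier_matD[OF M] unfolding M_def[symmetric] Let_def by simp
    have "fm (cmat A - ?a \<cdot>\<^sub>m 1\<^sub>m (dim_row A)) = rm A - ?a *c ix n"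
      using carr by (subst fm_diff[of _ n n]) (auto simp: fm_smult fm_one)
    then have fM: "fm M = (rm A - ?a *c ix n) + rm B * tp (sh n m) + sh n z * rm C + sh n z * rm D * tp (sh n m)"
      unfolding M_def using carr by (subst fm_four_block[where r = n and c = n and r' = z and c' = m]) auto
    \<comment> \<open>\<open>x\<close> stacked on top of \<open>u\<close>, so that
      \<open>fm M * y\<close> collects the two equations of the kernel condition.\<close>
    define y where "y = x + sh n m * u"
    have s1: "rm A * sh n m = 0" "rm C * sh n m = 0" "tp (sh n m) * x = 0"
    proof -
      have "rm A * (ix n * sh n m) = 0" "rm C * (ix n * sh n m) = 0" "tp (sh n m) * ix n * x = 0"
        by (simp_all only: ix_sh tpsh_ix mult_zero_left mult_zero_right)
      then show "rm A * sh n m = 0" "rm C * sh n m = 0" "tp (sh n m) * x = 0"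
        using ix_right'[OF car_rm[OF carr(1)]] ix_right'[OF car_rm[OF carr(3)]] x(1) by (simp_all add: mult.assoc)
    qed
    have s2: "rm A * (sh n m * u) = 0" "rm C * (sh n m * u) = 0" "ix n * (sh n m * u) = 0" "tp (sh n m) * (sh n m * u) = u"
      using s1 x(2) by (simp_all add: mult.assoc[symmetric] ix_sh tpsh_sh)
    have "fm M * y = (rm A * x + rm B * u - ?a *c x) + sh n z * (rm C * x + rm D * u)"
      unfolding fM y_def by (simp add: algebra_simps csc_left s1 s2 x(1))
    then have My: "fm M * y = 0" unfolding x(3,4) by simp
    have "colv (n + m) y j = 0\<^sub>v (n + m)" for j
    proof (rule full_rank_inj[OF M rank])
      show "M *\<^sub>v colv (n + m) y j = 0\<^sub>v (n + z)"
        unfolding colv_mult[OF M] My by (auto simp: colv_def)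
    qed simp
    moreover have "ix (n + m) * y = y"
    proof -
      have "ix (n + m) * x = x"
        by (subst (1 2) x(1)[symmetric]) (simp add: mult.assoc[symmetric] dg_mult Int_absorb1 Int_absorb2)
      then show ?thesis by (simp add: y_def distrib_left ix_left'[OF car_sh])
    qed
    ultimately have "y = 0" using colv_zero_iff by blast
    then have "ix n * y = 0" by simp
    then show "x = 0" by (simp add: y_def distrib_left x s2)
  qed
  then show ?thesis
    unfolding ric_hyp_def using carr F(1) hur inj by (intro conjI exI[of _ "rm F"] allI impI) (auto intro: car_rm)
qed

lemma is_ric_sol:
  assumes carr: "A \<in> carrier_mat n n" "B \<in> carrier_mat n m" "C \<in> carrier_mat z n" "D \<in> carrier_mat z m"
    and W: "W * (tp (rm D) * rm D) = ix m"
    and ric: "is_ric A B C D X F"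
  shows "X \<in> carrier_mat n n" "F \<in> carrier_mat m n" "ric_sol n m (rm A) (rm B) (rm C) (rm D) (rm X) (rm F)"
proof -
  let ?R = "transpose_mat D * D"
  have R: "?R \<in> carrier_mat m m" using carr by simp
  have fR: "rm ?R = tp (rm D) * rm D" using rm_mult[of "transpose_mat D" D] by (simp add: rm_transpose)
  have X: "X \<in> carrier_mat n n" "pos_semidef X"
    and eq: "transpose_mat A * X + X * A + transpose_mat C * C
       - (X * B + transpose_mat C * D) * inv_mat ?R * (transpose_mat B * X + transpose_mat D * C) = 0\<^sub>m n n"
    and F: "F = - (inv_mat ?R * (transpose_mat B * X + transpose_mat D * C))" and hz: "hurwitz (A + B * F)"
    using ric carr unfolding is_ric_def by auto
  have iR: "inv_mat ?R \<in> carrier_mat m m" "rm ?R * rm (inv_mat ?R) = ix m"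
    using rm_inv_mat[OF R] W fR by auto
  define G where "G = transpose_mat B * X + transpose_mat D * C"
  define G' where "G' = X * B + transpose_mat C * D"
  have G: "G \<in> carrier_mat m n" "G' \<in> carrier_mat n m" using carr X by (auto simp: G_def G'_def)
  have fG: "rm G = tp (rm B) * rm X + tp (rm D) * rm C"
    unfolding G_def using carr X
    by (subst rm_add[of _ m n]) (auto simp: rm_mult rm_transpose)
  have fG': "rm G' = rm X * rm B + tp (rm C) * rm D"
    unfolding G'_def using carr X
    by (subst rm_add[of _ n m]) (auto simp: rm_mult rm_transpose)
  have Fc: "F \<in> carrier_mat m n" unfolding F G_def[symmetric] using iR(1) G(1) by simp
  have fF: "rm F = - (rm (inv_mat ?R) * rm G)"
    unfolding F G_def[symmetric] rm_uminus using rm_mult[of "inv_mat ?R" G] iR(1) G(1) by simp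
  have RF: "tp (rm D) * (rm D * rm F) = - (tp (rm B) * rm X) - tp (rm D) * rm C"
  proof -
    have "tp (rm D) * rm D * rm F = - (rm ?R * rm (inv_mat ?R) * rm G)" by (simp add: fF fR mult.assoc)
    also have "\<dots> = - rm G" unfolding iR(2) using ix_left[OF car_rm[OF G(1)]] by simp
    finally show ?thesis by (simp add: fG mult.assoc)
  qed
  have "transpose_mat X = X" using X by (simp add: pos_semidef_def)
  then have tpX: "tp (rm X) = rm X" by (metis rm_transpose)
  have "rm (transpose_mat A * X + X * A + transpose_mat C * C - G' * inv_mat ?R * G) =
     tp (rm A) * rm X + rm X * rm A + tp (rm C) * rm C - rm G' * rm (inv_mat ?R) * rm G"
  proof -
    have c: "transpose_mat A * X \<in> carrier_mat n n" "X * A \<in> carrier_mat n n" "transpose_mat C * C \<in> carrier_mat n n"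
      "G' * inv_mat ?R \<in> carrier_mat n m" "G' * inv_mat ?R * G \<in> carrier_mat n n"
      using carr X G iR by auto
    have "rm (G' * inv_mat ?R * G) = rm G' * rm (inv_mat ?R) * rm G"
      using rm_mult[of "G' * inv_mat ?R" G] rm_mult[of "G'" "inv_mat ?R"] carrier_matD[OF c(4)] carrier_matD[OF G(1)] carrier_matD[OF G(2)] carrier_matD[OF iR(1)] by simp
    moreover have "rm (transpose_mat A * X + X * A + transpose_mat C * C) = tp (rm A) * rm X + rm X * rm A + tp (rm C) * rm C"
      using rm_add[OF add_carrier_mat[OF c(2), of "transpose_mat A * X"] c(3)] rm_add[OF c(1,2)] carr X
        rm_mult[of "transpose_mat A" X] rm_mult[of X A] rm_mult[of "transpose_mat C" C] by (simp add: rm_transpose)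
    ultimately show ?thesis
      using rm_diff[OF add_carrier_mat[OF c(3), of "transpose_mat A * X + X * A"] c(5)] by simp
  qed
  then have eq': "tp (rm A) * rm X + rm X * rm A + tp (rm C) * rm C + rm G' * rm F = 0"
    using eq by (simp add: G_def[symmetric] G'_def[symmetric] rm_zero fF mult.assoc)
  have fcl: "rm (A + B * F) = rm A + rm B * rm F"
    using rm_add[OF carr(1), of "B * F"] rm_mult[of B F] carr Fc by simp
  have e1: "tp (rm D) * (rm C + rm D * rm F) + tp (rm B) * rm X = 0"
    by (simp add: distrib_left RF)
  have "tp (rm A + rm B * rm F) * rm X + rm X * (rm A + rm B * rm F) + tp (rm C + rm D * rm F) * (rm C + rm D * rm F)
     = (tp (rm A) * rm X + rm X * rm A + tp (rm C) * rm C + rm G' * rm F) + tp (rm F) * (tp (rm D) * (rm C + rm D * rm F) + tp (rm B) * rm X)"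
    by (simp add: algebra_simps tp_mult fG')
  also have "\<dots> = 0" unfolding e1 eq' by simp
  finally have e2: "tp (rm A + rm B * rm F) * rm X + rm X * (rm A + rm B * rm F) + tp (rm C + rm D * rm F) * (rm C + rm D * rm F) = 0" .
  have "A + B * F \<in> carrier_mat n n" using carr Fc by simp
  then have hw: "hurw n (rm A + rm B * rm F)" using hz hurwitz_iff fcl by metis
  show "X \<in> carrier_mat n n" by (rule X)
  show "F \<in> carrier_mat m n" by (rule Fc)
  show "ric_sol n m (rm A) (rm B) (rm C) (rm D) (rm X) (rm F)"
    unfolding ric_sol_def by (intro conjI car_rm X Fc cj_rm tpX e1 e2 hw)
qed

lemma psd_pos_semidef:
  assumes X: "X \<in> carrier_mat n n" and p: "psd (rm X)"
  shows "pos_semidef X"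
  unfolding pos_semidef_def
proof (intro conjI ballI)
  show "square_mat X" using X by simp
  have "rm (transpose_mat X) = rm X" using p by (simp add: psd_def rm_transpose)
  then show "transpose_mat X = X" using rm_inject[of "transpose_mat X" n n X] X by simp
  fix v :: "real vec" assume "v \<in> carrier_vec (dim_row X)"
  then have v: "v \<in> carrier_vec n" using X by simp
  let ?v = "map_vec complex_of_real v"
  have cv: "?v \<in> carrier_vec n" using v by simp
  have Xv: "X *\<^sub>v v \<in> carrier_vec n" using X v by simp
  have "cmat X *\<^sub>v ?v = map_vec complex_of_real (X *\<^sub>v v)"
    by (rule of_real_hom.mult_mat_vec_hom[OF X v, symmetric])
  then have e: "rm X * vfm ?v = vfm (map_vec complex_of_real (X *\<^sub>v v))"
    using vfm_mult[of "cmat X" n n ?v] X cv by simp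
  have "tr (adj (vfm ?v) * rm X * vfm ?v) = tr (adj (vfm ?v) * (rm X * vfm ?v))" by (simp add: mult.assoc)
  also have "\<dots> = (\<Sum>i<n. complex_of_real (v $ i) * complex_of_real ((X *\<^sub>v v) $ i))"
    unfolding e using v Xv X
    by (subst tr_ent[OF car_vfm[OF cv] car_vfm]) (auto intro!: sum.cong)
  also have "\<dots> = complex_of_real (scalar_prod v (X *\<^sub>v v))"
    unfolding scalar_prod_def[of v] carrier_vecD[OF Xv] by (simp only: of_real_sum of_real_mult atLeast0LessThan)
  finally show "0 \<le> scalar_prod v (X *\<^sub>v v)" using p unfolding psd_def by (metis Re_complex_of_real)
qed

text \<open>The value of a definite description is known only after existence and uniqueness.
  Existence is \<open>ric_exists\<close>, whose solution is real and hence comes from real matrices;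
  uniqueness goes through \<open>is_ric_sol\<close> to \<open>ric_sol_unique\<close>.\<close>

theorem ric_correct:
  assumes carr: "A \<in> carrier_mat n n" "B \<in> carrier_mat n m" "C \<in> carrier_mat z n" "D \<in> carrier_mat z m"
    and hyp: "ric_hyp n m z (rm A) (rm B) (rm C) (rm D)"
  shows "\<exists>X F. ric A B C D = (X, F) \<and> X \<in> carrier_mat n n \<and> F \<in> carrier_mat m n \<and>
    ric_sol n m (rm A) (rm B) (rm C) (rm D) (rm X) (rm F)"
proof -
  let ?R = "transpose_mat D * D"
  have R: "?R \<in> carrier_mat m m" using carr by simp
  have fR: "rm ?R = tp (rm D) * rm D" using rm_mult[of "transpose_mat D" D] by (simp add: rm_transpose)
  have carR: "car m m (tp (rm D) * rm D)" using car_rm[OF R] fR by simp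
  have injD: "inj_mul m (rm D)" using hyp by (simp add: ric_hyp_def)
  have injR: "inj_mul m (tp (rm D) * rm D)"
    unfolding inj_mul_def
  proof (intro allI impI)
    fix u assume u: "ix m * u = u" "tp (rm D) * rm D * u = 0"
    have "rm D * u = 0" by (rule gram_zero[OF cj_rm]) (simp add: u mult.assoc[of "adj u"])
    then show "u = 0" using injD u by (auto simp: inj_mul_def)
  qed
  obtain W where W: "W * (tp (rm D) * rm D) = ix m" using inverse_exists[OF carR injR] by blast
  have iR: "inv_mat ?R \<in> carrier_mat m m" "rm (inv_mat ?R) * rm ?R = ix m"
    using rm_inv_mat[OF R] W fR by auto
  obtain X' F' where sol: "ric_sol n m (rm A) (rm B) (rm C) (rm D) X' F'" and psd: "psd X'"
    using ric_exists[OF hyp] by blast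
  have X': "car n n X'" "cj X' = X'" and F': "car m n F'" "cj F' = F'"
    and g: "tp (rm D) * (rm C + rm D * F') + tp (rm B) * X' = 0"
    and l: "tp (rm A + rm B * F') * X' + X' * (rm A + rm B * F') + tp (rm C + rm D * F') * (rm C + rm D * F') = 0"
    and hw: "hurw n (rm A + rm B * F')"
    using sol unfolding ric_sol_def by blast+
  define X where "X = rmtx n n X'"
  define F where "F = rmtx m n F'"
  have X: "X \<in> carrier_mat n n" "rm X = X'" and F: "F \<in> carrier_mat m n" "rm F = F'"
    using rm_rmtx X' F' by (auto simp: X_def F_def)
  define G where "G = transpose_mat B * X + transpose_mat D * C"
  define G' where "G' = X * B + transpose_mat C * D"
  have G: "G \<in> carrier_mat m n" "G' \<in> carrier_mat n m" using carr X by (auto simp: G_def G'_def)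
  have fG: "rm G = tp (rm B) * rm X + tp (rm D) * rm C"
    unfolding G_def using carr X
    by (subst rm_add[of _ m n]) (auto simp: rm_mult rm_transpose)
  have fG': "rm G' = rm X * rm B + tp (rm C) * rm D"
    unfolding G'_def using carr X
    by (subst rm_add[of _ n m]) (auto simp: rm_mult rm_transpose)
  have RF: "rm ?R * rm F = - rm G"
  proof -
    have "rm ?R * rm F + rm G = tp (rm D) * (rm C + rm D * F') + tp (rm B) * X'"
      by (simp add: fR fG X F algebra_simps)
    then show ?thesis unfolding g by (simp add: eq_neg_iff_add_eq_0)
  qed
  have Fe: "rm F = - (rm (inv_mat ?R) * rm G)"
  proof -
    have "rm F = rm (inv_mat ?R) * rm ?R * rm F" unfolding iR(2) by (rule ix_left[OF car_rm[OF F(1)], symmetric])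
    also have "\<dots> = - (rm (inv_mat ?R) * rm G)" by (simp add: mult.assoc RF)
    finally show ?thesis .
  qed
  have FF: "F = - (inv_mat ?R * G)"
  proof -
    have "rm (- (inv_mat ?R * G)) = rm F"
      unfolding Fe rm_uminus using rm_mult[of "inv_mat ?R" G] iR(1) G(1) by simp
    moreover have "- (inv_mat ?R * G) \<in> carrier_mat m n" using iR(1) G by simp
    ultimately show ?thesis using rm_inject[OF F(1)] by metis
  qed
  have c: "transpose_mat A * X \<in> carrier_mat n n" "X * A \<in> carrier_mat n n" "transpose_mat C * C \<in> carrier_mat n n"
    "G' * inv_mat ?R \<in> carrier_mat n m" "G' * inv_mat ?R * G \<in> carrier_mat n n"
    using carr X G iR by auto
  have "rm (transpose_mat A * X + X * A + transpose_mat C * C - G' * inv_mat ?R * G) =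
     tp (rm A) * rm X + rm X * rm A + tp (rm C) * rm C - rm G' * rm (inv_mat ?R) * rm G"
  proof -
    have "rm (G' * inv_mat ?R * G) = rm G' * rm (inv_mat ?R) * rm G"
      using rm_mult[of "G' * inv_mat ?R" G] rm_mult[of "G'" "inv_mat ?R"] carrier_matD[OF c(4)] carrier_matD[OF G(1)] carrier_matD[OF G(2)] carrier_matD[OF iR(1)] by simp
    moreover have "rm (transpose_mat A * X + X * A + transpose_mat C * C) = tp (rm A) * rm X + rm X * rm A + tp (rm C) * rm C"
      using rm_add[OF add_carrier_mat[OF c(2), of "transpose_mat A * X"] c(3)] rm_add[OF c(1,2)] carr X
        rm_mult[of "transpose_mat A" X] rm_mult[of X A] rm_mult[of "transpose_mat C" C] by (simp add: rm_transpose)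
    ultimately show ?thesis
      using rm_diff[OF add_carrier_mat[OF c(3), of "transpose_mat A * X + X * A"] c(5)] by simp
  qed
  also have "\<dots> = tp (rm A) * rm X + rm X * rm A + tp (rm C) * rm C + rm G' * rm F"
    by (simp add: Fe mult.assoc)
  also have "\<dots> = (tp (rm A + rm B * F') * X' + X' * (rm A + rm B * F') + tp (rm C + rm D * F') * (rm C + rm D * F'))
     - tp F' * (tp (rm D) * (rm C + rm D * F') + tp (rm B) * X')"
    by (simp add: algebra_simps tp_mult fG' X F)
  also have "\<dots> = rm (0\<^sub>m n n)" unfolding g l by (simp add: rm_zero)
  finally have eq: "transpose_mat A * X + X * A + transpose_mat C * C - G' * inv_mat ?R * G = 0\<^sub>m n n"
    using rm_inject[of _ n n "0\<^sub>m n n"] c(5) by (metis minus_carrier_mat zero_carrier_mat)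
  have fcl: "rm (A + B * F) = rm A + rm B * F'"
    using rm_add[OF carr(1), of "B * F"] rm_mult[of B F] carr F by simp
  have "A + B * F \<in> carrier_mat n n" using carr F by simp
  then have hz: "hurwitz (A + B * F)" using hw hurwitz_iff fcl by metis
  have "pos_semidef X" using psd_pos_semidef[OF X(1)] psd X(2) by simp
  then have ir: "is_ric A B C D X F"
    unfolding is_ric_def carrier_matD[OF carr(1)] using X(1) eq[unfolded G_def G'_def] FF[unfolded G_def] hz by blast
  have uniq: "X2 = X \<and> F2 = F" if "is_ric A B C D X2 F2" for X2 F2
  proof -
    note s = is_ric_sol[OF carr W that]
    have "rm X2 = rm X \<and> rm F2 = rm F"
      by (rule ric_sol_unique[OF car_rm[OF carr(1)] car_rm[OF carr(2)] cj_rm cj_rm injR s(3)]) (simp add: X F sol)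
    then show ?thesis using rm_inject[OF s(1) X(1)] rm_inject[OF s(2) F(1)] by simp
  qed
  have "ric A B C D = (X, F)"
    unfolding ric_def
  proof (rule the_equality)
    show "case (X, F) of (X, F) \<Rightarrow> is_ric A B C D X F" by (simp only: prod.case ir)
    fix p assume "case p of (X, F) \<Rightarrow> is_ric A B C D X F"
    then show "p = (X, F)" using uniq by (cases p) (simp only: prod.case prod.inject)
  qed
  then show ?thesis using X F sol by auto
qed

section \<open>Integrals along vertical lines\<close>

lemma integrable_cauchy_kernel: "integrable lborel (\<lambda>x::real. c / (1 + x\<^sup>2))"
proof -
  have "integrable lborel (\<lambda>x::real. inverse (1 + x\<^sup>2))"
    using integrable_inverse_1_plus_square by (simp add: set_integrable_def)
  then have "integrable lborel (\<lambda>x::real. c * inverse (1 + x\<^sup>2))" by (rule integrable_mult_right)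
  then show ?thesis by (simp add: divide_inverse)
qed

lemma cauchy_kernel_tendsto: "(\<lambda>k. c / (1 + (real k)\<^sup>2)) \<longlonglongrightarrow> 0"
proof (rule tendsto_divide_0[OF tendsto_const], rule filterlim_at_top_imp_at_infinity)
  show "filterlim (\<lambda>k. 1 + (real k)\<^sup>2) at_top sequentially"
    by (intro filterlim_tendsto_add_at_top[OF tendsto_const] filterlim_pow_at_top filterlim_real_sequentially) simp
qed

lemma line_continuous:
  assumes "f holomorphic_on S" and "\<And>\<omega>. Complex a \<omega> \<in> S"
  shows "continuous_on UNIV (\<lambda>\<omega>. f (Complex a \<omega>))"
proof (rule continuous_on_compose2[OF holomorphic_on_imp_continuous_on[OF assms(1)]])
  show "continuous_on UNIV (Complex a)"
    unfolding Complex_eq by (intro continuous_intros)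
qed (use assms(2) in auto)

lemma line_measurable:
  assumes "f holomorphic_on S" and "\<And>\<omega>. Complex a \<omega> \<in> S"
  shows "(\<lambda>\<omega>. f (Complex a \<omega>)) \<in> borel_measurable lborel"
  using line_continuous[OF assms] by (simp add: borel_measurable_continuous_onI)

lemma line_integrable:
  assumes "f holomorphic_on S" and "\<And>\<omega>. Complex a \<omega> \<in> S" and "\<And>\<omega>. cmod (f (Complex a \<omega>)) \<le> C / (1 + \<omega>\<^sup>2)"
  shows "integrable lborel (\<lambda>\<omega>. f (Complex a \<omega>))"
proof (rule Bochner_Integration.integrable_bound[OF integrable_cauchy_kernel[of C]])
  show "AE x in lborel. norm (f (Complex a x)) \<le> norm (C / (1 + x\<^sup>2))"
    using order_trans[OF assms(3) abs_ge_self] by (intro always_eventually allI) (simp only: real_norm_def)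
qed (rule line_measurable[OF assms(1,2)])

text \<open>Shifting works with a primitive \<open>F\<close> on the convex strip: the truncated integrals are increments
  of \<open>F\<close>, and \<open>F\<close> varies little between the lines far up and down.\<close>

lemma line_shift:
  assumes hol: "f holomorphic_on {s. \<alpha> < Re s \<and> Re s < \<beta>}"
    and bnd: "\<And>s. \<alpha> < Re s \<Longrightarrow> Re s < \<beta> \<Longrightarrow> cmod (f s) \<le> C / (1 + (Im s)\<^sup>2)"
    and a: "\<alpha> < a" "a < \<beta>" and b: "\<alpha> < b" "b < \<beta>"
  shows "(LINT \<omega>|lborel. f (Complex a \<omega>)) = (LINT \<omega>|lborel. f (Complex b \<omega>))"
proof -
  let ?S = "{s. \<alpha> < Re s \<and> Re s < \<beta>}"
  have cvx: "convex ?S"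
    using convex_Int[OF convex_halfspace_Re_gt[of \<alpha>] convex_halfspace_Re_lt[of \<beta>]]
    by (simp add: Collect_conj_eq)
  have opn: "open ?S"
    using open_Int[OF open_halfspace_Re_gt[of \<alpha>] open_halfspace_Re_lt[of \<beta>]]
    by (simp add: Collect_conj_eq)
  obtain F where F: "\<And>s. s \<in> ?S \<Longrightarrow> (F has_field_derivative f s) (at s within ?S)"
    using holomorphic_convex_primitive'[OF cvx opn hol] by blast
  have F': "(F has_field_derivative f s) (at s)" if "s \<in> ?S" for s
    using F[OF that] at_within_open[OF that opn] by simp
  have int: "integrable lborel (\<lambda>\<omega>. f (Complex x \<omega>))" if "\<alpha> < x" "x < \<beta>" for x
    by (rule line_integrable[OF hol]) (use that bnd[of "Complex x _"] in auto)
  have lim: "(\<lambda>k. (F (Complex x (real k)) - F (Complex x (- real k))) / \<i>) \<longlonglongrightarrow> (LINT \<omega>|lborel. f (Complex x \<omega>))"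
    if x: "\<alpha> < x" "x < \<beta>" for x
  proof -
    have "(LINT \<omega>|lborel. indicator {- real k..real k} \<omega> *\<^sub>R (\<i> * f (Complex x \<omega>))) = F (Complex x (real k)) - F (Complex x (- real k))" for k
    proof (rule has_bochner_integral_integral_eq[OF has_bochner_integral_FTC_Icc])
      fix \<omega>
      have "((\<lambda>t. Complex x t) has_vector_derivative \<i>) (at \<omega> within {- real k..real k})"
        unfolding Complex_eq by (auto intro!: derivative_eq_intros)
      moreover have "(F has_field_derivative f (Complex x \<omega>)) (at (Complex x \<omega>) within Complex x ` {- real k..real k})"
        using F'[of "Complex x \<omega>"] x by (auto intro: DERIV_subset)
      ultimately have "((F \<circ> Complex x) has_vector_derivative \<i> * f (Complex x \<omega>)) (at \<omega> within {- real k..real k})"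
        by (rule field_vector_diff_chain_within)
      then show "((\<lambda>\<omega>. F (Complex x \<omega>)) has_vector_derivative \<i> * f (Complex x \<omega>)) (at \<omega> within {- real k..real k})"
        by (simp add: o_def)
    next
      show "continuous_on {- real k..real k} (\<lambda>\<omega>. \<i> * f (Complex x \<omega>))"
        using line_continuous[OF hol, of x] x by (intro continuous_intros) (auto intro: continuous_on_subset)
    qed simp
    moreover have "(\<lambda>k. LINT \<omega>|lborel. indicator {- real k..real k} \<omega> *\<^sub>R (\<i> * f (Complex x \<omega>))) \<longlonglongrightarrow> (LINT \<omega>|lborel. \<i> * f (Complex x \<omega>))"
    proof (rule integral_dominated_convergence)
      show "(\<lambda>\<omega>. \<i> * f (Complex x \<omega>)) \<in> borel_measurable lborel"
        using line_measurable[OF hol, of x] x by simp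
      then show "(\<lambda>\<omega>. indicator {- real k..real k} \<omega> *\<^sub>R (\<i> * f (Complex x \<omega>))) \<in> borel_measurable lborel" for k
        by simp
      show "integrable lborel (\<lambda>\<omega>. norm (f (Complex x \<omega>)))" using int[OF x] by (rule integrable_norm)
      show "AE \<omega> in lborel. (\<lambda>k. indicator {- real k..real k} \<omega> *\<^sub>R (\<i> * f (Complex x \<omega>))) \<longlonglongrightarrow> \<i> * f (Complex x \<omega>)"
      proof (intro always_eventually allI)
        fix \<omega> :: real
        obtain K where K: "\<bar>\<omega>\<bar> \<le> real K" using real_arch_simple by blast
        have "\<forall>\<^sub>F k in sequentially. indicator {- real k..real k} \<omega> *\<^sub>R (\<i> * f (Complex x \<omega>)) = \<i> * f (Complex x \<omega>)"
          using eventually_ge_at_top[of K]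
        proof eventually_elim
          case (elim k)
          then have "\<bar>\<omega>\<bar> \<le> real k" using K by linarith
          then show ?case by (simp add: indicator_def abs_le_iff)
        qed
        then show "(\<lambda>k. indicator {- real k..real k} \<omega> *\<^sub>R (\<i> * f (Complex x \<omega>))) \<longlonglongrightarrow> \<i> * f (Complex x \<omega>)"
          by (rule tendsto_eventually)
      qed
      show "AE \<omega> in lborel. norm (indicator {- real k..real k} \<omega> *\<^sub>R (\<i> * f (Complex x \<omega>))) \<le> norm (f (Complex x \<omega>))" for k
        by (intro always_eventually allI) (auto simp: indicator_def norm_mult)
    qed
    ultimately have "(\<lambda>k. F (Complex x (real k)) - F (Complex x (- real k))) \<longlonglongrightarrow> \<i> * (LINT \<omega>|lborel. f (Complex x \<omega>))"
      by simp
    from tendsto_divide[OF this tendsto_const[of \<i>]] show ?thesis by simp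
  qed
  have edge: "cmod (F (Complex b t) - F (Complex a t)) \<le> C / (1 + t\<^sup>2) * \<bar>b - a\<bar>" for t
  proof -
    let ?L = "{s. Im s = t} \<inter> ?S"
    have "cmod (F (Complex b t) - F (Complex a t)) \<le> C / (1 + t\<^sup>2) * cmod (Complex b t - Complex a t)"
    proof (rule field_differentiable_bound[of ?L])
      have "{s. Im s = t} = {s. Im s \<le> t} \<inter> {s. t \<le> Im s}" by auto
      then have "convex {s. Im s = t}"
        using convex_Int[OF convex_halfspace_Im_le convex_halfspace_Im_ge] by metis
      then show "convex ?L" by (rule convex_Int[OF _ cvx])
      show "(F has_field_derivative f s) (at s within ?L)" if "s \<in> ?L" for s
        using F'[of s] that by (auto intro: has_field_derivative_at_within)
      show "cmod (f s) \<le> C / (1 + t\<^sup>2)" if "s \<in> ?L" for s using bnd[of s] that by auto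
    qed (use a b in auto)
    also have "Complex b t - Complex a t = of_real (b - a)" by (simp add: complex_eq_iff)
    finally show ?thesis by (simp only: norm_of_real)
  qed
  have "(\<lambda>k. (F (Complex b (real k)) - F (Complex b (- real k))) / \<i> - (F (Complex a (real k)) - F (Complex a (- real k))) / \<i>) \<longlonglongrightarrow> 0"
  proof (rule Lim_null_comparison)
    show "(\<lambda>k. 2 * (C * \<bar>b - a\<bar>) / (1 + (real k)\<^sup>2)) \<longlonglongrightarrow> 0" by (rule cauchy_kernel_tendsto)
    show "\<forall>\<^sub>F k in sequentially. norm ((F (Complex b (real k)) - F (Complex b (- real k))) / \<i> - (F (Complex a (real k)) - F (Complex a (- real k))) / \<i>)
        \<le> 2 * (C * \<bar>b - a\<bar>) / (1 + (real k)\<^sup>2)"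
    proof (intro always_eventually allI)
      fix k
      have "norm ((F (Complex b (real k)) - F (Complex b (- real k))) / \<i> - (F (Complex a (real k)) - F (Complex a (- real k))) / \<i>)
        = norm ((F (Complex b (real k)) - F (Complex a (real k))) - (F (Complex b (- real k)) - F (Complex a (- real k))))"
        by (simp only: diff_divide_distrib[symmetric] norm_divide norm_ii div_by_1) (simp add: algebra_simps)
      also have "\<dots> \<le> C / (1 + (real k)\<^sup>2) * \<bar>b - a\<bar> + C / (1 + (real k)\<^sup>2) * \<bar>b - a\<bar>"
        by (rule order_trans[OF norm_triangle_ineq4 add_mono[OF edge[of "real k"] edge[of "- real k", unfolded power2_minus]]])
      finally show "norm ((F (Complex b (real k)) - F (Complex b (- real k))) / \<i> - (F (Complex a (real k)) - F (Complex a (- real k))) / \<i>)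
        \<le> 2 * (C * \<bar>b - a\<bar>) / (1 + (real k)\<^sup>2)" by simp
    qed
  qed
  moreover have "(\<lambda>k. (F (Complex b (real k)) - F (Complex b (- real k))) / \<i> - (F (Complex a (real k)) - F (Complex a (- real k))) / \<i>)
    \<longlonglongrightarrow> (LINT \<omega>|lborel. f (Complex b \<omega>)) - (LINT \<omega>|lborel. f (Complex a \<omega>))"
    by (intro tendsto_diff lim a b)
  ultimately show ?thesis using LIMSEQ_unique by fastforce
qed

text \<open>Pushing the line to the far right needs more decay than 1/s. The factor
  \<open>(k + 1) / (k + 1 + s)\<close> supplies it; it has modulus at most 1 on the half-plane and
  tends to 1, so dominated convergence removes it again. Integrability of \<open>f\<close> on the
  line is what makes this last step possible.\<close>

lemma line_zero:
  assumes hol: "f holomorphic_on {s. 0 < Re s}" and bnd: "\<And>s. 0 < Re s \<Longrightarrow> cmod (f s) * cmod s \<le> C"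
    and a: "0 < a" and int: "integrable lborel (\<lambda>\<omega>. f (Complex a \<omega>))"
  shows "(LINT \<omega>|lborel. f (Complex a \<omega>)) = 0"
proof -
  have C: "0 \<le> C" using bnd[of 1] by (smt (verit) mult_nonneg_nonneg norm_ge_zero one_complex.sel(1))
  define g where "g k s = f s * (of_nat (Suc k) / (of_nat (Suc k) + s))" for k :: nat and s
  have nz: "of_nat (Suc k) + s \<noteq> 0" if "0 < Re s" for k and s :: complex
    using that by (auto simp: complex_eq_iff)
  have ratio: "cmod (of_nat (Suc k) / (of_nat (Suc k) + s)) \<le> 1" "cmod s \<le> cmod (of_nat (Suc k) + s)" if "0 < Re s" for k s
  proof -
    show "cmod s \<le> cmod (of_nat (Suc k) + s)" using that
      unfolding cmod_def by (intro real_sqrt_le_mono add_mono) (auto intro!: power_mono)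
    have "real (Suc k) \<le> Re (of_nat (Suc k) + s)" using that by simp
    also have "\<dots> \<le> cmod (of_nat (Suc k) + s)" by (rule complex_Re_le_cmod)
    finally show "cmod (of_nat (Suc k) / (of_nat (Suc k) + s)) \<le> 1"
      using nz[OF that, of k] by (simp add: norm_divide divide_le_eq_1 del: of_nat_Suc)
  qed
  have holg: "g k holomorphic_on {s. 0 < Re s}" for k
    unfolding g_def using nz by (intro holomorphic_intros hol) auto
  have gb: "cmod (g k s) \<le> C * real (Suc k) / (cmod s)\<^sup>2" if "0 < Re s" for k s
  proof -
    have s0: "0 < cmod s" using that by auto
    have "cmod (g k s) = cmod (f s) * (real (Suc k) / cmod (of_nat (Suc k) + s))"
      by (simp add: g_def norm_mult norm_divide del: of_nat_Suc)
    also have "\<dots> \<le> (C / cmod s) * (real (Suc k) / cmod s)"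
      using bnd[OF that] ratio(2)[OF that, of k] s0 C less_le_trans[OF s0 ratio(2)[OF that, of k]]
      by (intro mult_mono divide_left_mono) (auto simp: pos_le_divide_eq simp del: of_nat_Suc intro!: mult_pos_pos)
    finally show ?thesis by (simp add: power2_eq_square)
  qed
  \<comment> \<open>For \<open>Re s \<ge> e\<close> the squared modulus of \<open>s\<close> is at
    least \<open>min 1 (e^2) * (1 + (Im s)^2)\<close>. This puts the quadratic decay into the form
    of the integrable kernel.\<close>
  have gb': "cmod (g k s) \<le> C * real (Suc k) / (min 1 (e\<^sup>2)) / (1 + (Im s)\<^sup>2)" if e: "0 < e" "e \<le> Re s" for k s e
  proof -
    have "min 1 (e\<^sup>2) * (1 + (Im s)\<^sup>2) \<le> e\<^sup>2 + (Im s)\<^sup>2"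
      using mult_right_mono[of "min 1 (e\<^sup>2)" 1 "(Im s)\<^sup>2"] by (simp add: distrib_left)
    also have "\<dots> \<le> (cmod s)\<^sup>2" using e by (simp add: cmod_power2)
    finally have "C * real (Suc k) / (cmod s)\<^sup>2 \<le> C * real (Suc k) / (min 1 (e\<^sup>2) * (1 + (Im s)\<^sup>2))"
      using e C by (intro divide_left_mono mult_pos_pos) (auto simp: add_pos_nonneg power2_eq_square[symmetric] intro!: mult_nonneg_nonneg zero_less_power)
    then show ?thesis using gb[of s k] e by simp
  qed
  have g0: "(LINT \<omega>|lborel. g k (Complex a \<omega>)) = 0" for k
  proof -
    have shift: "(LINT \<omega>|lborel. g k (Complex a \<omega>)) = (LINT \<omega>|lborel. g k (Complex (a + real j) \<omega>))" for j
    proof (rule line_shift[where \<alpha> = "a / 2" and \<beta> = "a + real j + 1"])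
      show "g k holomorphic_on {s. a / 2 < Re s \<and> Re s < a + real j + 1}"
        by (rule holomorphic_on_subset[OF holg]) (use a in auto)
      show "cmod (g k s) \<le> C * real (Suc k) / (min 1 ((a/2)\<^sup>2)) / (1 + (Im s)\<^sup>2)" if "a / 2 < Re s" "Re s < a + real j + 1" for s
        by (rule gb') (use that a in auto)
    qed (use a in auto)
    \<comment> \<open>By shifting, all these integrals are equal, while their integrands tend to 0
      under one integrable bound.\<close>
    have "(\<lambda>j. LINT \<omega>|lborel. g k (Complex (a + real j) \<omega>)) \<longlonglongrightarrow> (LINT (\<omega>::real)|lborel. 0)"
    proof (rule integral_dominated_convergence)
      show "(\<lambda>\<omega>. g k (Complex (a + real j) \<omega>)) \<in> borel_measurable lborel" for j
        using a by (intro line_measurable[OF holg]) auto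
      show "integrable lborel (\<lambda>\<omega>. C * real (Suc k) / (min 1 (a\<^sup>2)) / (1 + \<omega>\<^sup>2))" by (rule integrable_cauchy_kernel)
      show "AE \<omega> in lborel. norm (g k (Complex (a + real j) \<omega>)) \<le> C * real (Suc k) / (min 1 (a\<^sup>2)) / (1 + \<omega>\<^sup>2)" for j
        using gb'[of a "Complex (a + real j) _" k] a by (intro always_eventually allI) auto
      show "AE \<omega> in lborel. (\<lambda>j. g k (Complex (a + real j) \<omega>)) \<longlonglongrightarrow> 0"
      proof (intro always_eventually allI)
        fix \<omega> :: real
        show "(\<lambda>j. g k (Complex (a + real j) \<omega>)) \<longlonglongrightarrow> 0"
        proof (rule Lim_null_comparison)
          have "(\<lambda>j. (C * real (Suc k)) / (1 + (real j)\<^sup>2) * (1 / (min 1 (a\<^sup>2)))) \<longlonglongrightarrow> 0 * (1 / (min 1 (a\<^sup>2)))"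
            by (intro tendsto_mult tendsto_const cauchy_kernel_tendsto)
          then show "(\<lambda>j. (C * real (Suc k)) / (1 + (real j)\<^sup>2) * (1 / (min 1 (a\<^sup>2)))) \<longlonglongrightarrow> 0" by simp
          show "\<forall>\<^sub>F j in sequentially. norm (g k (Complex (a + real j) \<omega>)) \<le> (C * real (Suc k)) / (1 + (real j)\<^sup>2) * (1 / (min 1 (a\<^sup>2)))"
          proof (intro always_eventually allI)
            fix j
            have "min 1 (a\<^sup>2) * (1 + (real j)\<^sup>2) \<le> a\<^sup>2 + (real j)\<^sup>2"
              using mult_right_mono[of "min 1 (a\<^sup>2)" 1 "(real j)\<^sup>2"] by (simp add: distrib_left)
            also have "\<dots> \<le> (a + real j)\<^sup>2" using a by (simp add: power2_sum)
            also have "\<dots> \<le> (cmod (Complex (a + real j) \<omega>))\<^sup>2" by (simp add: cmod_power2)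
            finally have "C * real (Suc k) / (cmod (Complex (a + real j) \<omega>))\<^sup>2 \<le> C * real (Suc k) / (min 1 (a\<^sup>2) * (1 + (real j)\<^sup>2))"
              using a C by (intro divide_left_mono mult_pos_pos) (auto simp: add_pos_nonneg power2_eq_square[symmetric] cmod_power2 intro!: mult_nonneg_nonneg)
            then show "norm (g k (Complex (a + real j) \<omega>)) \<le> (C * real (Suc k)) / (1 + (real j)\<^sup>2) * (1 / (min 1 (a\<^sup>2)))"
              using gb[of "Complex (a + real j) \<omega>" k] a by (simp add: mult.commute)
          qed
        qed
      qed
    qed simp
    then show ?thesis unfolding shift[symmetric] using LIMSEQ_unique[OF _ tendsto_const] by fastforce
  qed
  have "(\<lambda>k. LINT \<omega>|lborel. g k (Complex a \<omega>)) \<longlonglongrightarrow> (LINT \<omega>|lborel. f (Complex a \<omega>))"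
  proof (rule integral_dominated_convergence)
    show "(\<lambda>\<omega>. f (Complex a \<omega>)) \<in> borel_measurable lborel" using a by (intro line_measurable[OF hol]) auto
    show "(\<lambda>\<omega>. g k (Complex a \<omega>)) \<in> borel_measurable lborel" for k using a by (intro line_measurable[OF holg]) auto
    show "integrable lborel (\<lambda>\<omega>. norm (f (Complex a \<omega>)))" using int by (rule integrable_norm)
    show "AE \<omega> in lborel. norm (g k (Complex a \<omega>)) \<le> norm (f (Complex a \<omega>))" for k
    proof (intro always_eventually allI)
      fix \<omega>
      show "norm (g k (Complex a \<omega>)) \<le> norm (f (Complex a \<omega>))"
        unfolding g_def norm_mult using ratio(1)[of "Complex a \<omega>" k] a by (intro mult_left_le) auto
    qed
    show "AE \<omega> in lborel. (\<lambda>k. g k (Complex a \<omega>)) \<longlonglongrightarrow> f (Complex a \<omega>)"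
    proof (intro always_eventually allI)
      fix \<omega>
      let ?s = "Complex a \<omega>"
      have "(\<lambda>k. f ?s * (1 / (1 + ?s * of_real (inverse (real (Suc k)))))) \<longlonglongrightarrow> f ?s * (1 / (1 + ?s * of_real 0))"
        by (intro tendsto_intros LIMSEQ_inverse_real_of_nat) simp
      moreover have "f ?s * (1 / (1 + ?s * of_real (inverse (real (Suc k))))) = g k ?s" for k
      proof -
        have "of_nat (Suc k) / (of_nat (Suc k) + ?s) = 1 / (1 + ?s * of_real (inverse (real (Suc k))))"
          using nz[of ?s k] a by (simp add: field_simps del: of_nat_Suc)
        then show ?thesis by (simp add: g_def)
      qed
      ultimately show "(\<lambda>k. g k ?s) \<longlonglongrightarrow> f ?s" by simp
    qed
  qed
  then show ?thesis unfolding g0 using LIMSEQ_unique[OF _ tendsto_const] by fastforce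
qed

lemma decay_square:
  assumes "cmod z * (1 + cmod s) \<le> C"
  shows "(cmod z)\<^sup>2 \<le> C\<^sup>2 / (1 + (Im s)\<^sup>2)"
proof -
  have "(cmod z * (1 + cmod s))\<^sup>2 \<le> C\<^sup>2" using assms by (intro power_mono) auto
  moreover have "1 + (Im s)\<^sup>2 \<le> (1 + cmod s)\<^sup>2"
    using abs_Im_le_cmod[of s] power_mono[OF abs_Im_le_cmod[of s], of 2] by (simp add: power2_sum)
  then have "(cmod z)\<^sup>2 * (1 + (Im s)\<^sup>2) \<le> (cmod z)\<^sup>2 * (1 + cmod s)\<^sup>2" by (rule mult_left_mono) simp
  ultimately show ?thesis by (simp add: pos_le_divide_eq add_pos_nonneg power_mult_distrib)
qed

lemma prod_le_squares: "cmod x * cmod y \<le> ((cmod x)\<^sup>2 + (cmod y)\<^sup>2) / 2"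
  using sum_squares_bound[of "cmod x" "cmod y"] by simp

text \<open>Shifting \<open>conj g(2a - conj s) g(s)\<close> from the line through \<open>a\<close> to the imaginary axis bounds the
  energy at \<open>a\<close> by the mean of the energies at \<open>0\<close> and \<open>2a\<close>; taking suprema gives monotonicity.\<close>

lemma line_energy_mono:
  assumes hol: "g holomorphic_on {s. - d < Re s}" and d: "0 < d"
    and bnd: "\<And>s. - d < Re s \<Longrightarrow> cmod (g s) * (1 + cmod s) \<le> C" and a: "0 \<le> a"
  shows "(LINT \<omega>|lborel. (cmod (g (Complex a \<omega>)))\<^sup>2) \<le> (LINT \<omega>|lborel. (cmod (g (Complex 0 \<omega>)))\<^sup>2)"
proof -
  define m where "m x = (LINT \<omega>|lborel. (cmod (g (Complex x \<omega>)))\<^sup>2)" for x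
  have sq: "(cmod (g s))\<^sup>2 \<le> C\<^sup>2 / (1 + (Im s)\<^sup>2)" if "- d < Re s" for s by (rule decay_square[OF bnd[OF that]])
  have int: "integrable lborel (\<lambda>\<omega>. (cmod (g (Complex x \<omega>)))\<^sup>2)" if "- d < x" for x
  proof (rule Bochner_Integration.integrable_bound[OF integrable_cauchy_kernel[of "C\<^sup>2"]])
    show "(\<lambda>\<omega>. (cmod (g (Complex x \<omega>)))\<^sup>2) \<in> borel_measurable lborel"
      using line_measurable[OF hol, of x] that by simp
    show "AE \<omega> in lborel. norm ((cmod (g (Complex x \<omega>)))\<^sup>2) \<le> norm (C\<^sup>2 / (1 + \<omega>\<^sup>2))"
      using sq[of "Complex x _"] that by (intro always_eventually allI) simp
  qed
  have half: "m x \<le> (m 0 + m (2 * x)) / 2" if x: "0 \<le> x" for x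
  proof -
    \<comment> \<open>The conjugated reflection keeps \<open>k\<close> holomorphic. On the line
      \<open>Re s = x\<close> the two arguments coincide, so \<open>k\<close> is the energy density
      there; on the imaginary axis they lie on the lines through \<open>2 * x\<close> and 0.\<close>
    define k where "k s = cnj (g (cnj (2 * of_real x - s))) * g s" for s
    have "(\<lambda>s. (cnj \<circ> g \<circ> cnj) (2 * of_real x - s) * g s) holomorphic_on {s. - d < Re s \<and> Re s < 2 * x + d}"
    proof (intro holomorphic_intros)
      have c1: "(cnj \<circ> g \<circ> cnj) holomorphic_on {s. - d < Re s}"
        unfolding holomorphic_on_def
      proof
        fix s assume "s \<in> {s. - d < Re s}"
        then have s: "cnj s \<in> {s. - d < Re s}" by simp
        have o: "open {s. - d < Re s}" by (rule open_halfspace_Re_gt)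
        have "g field_differentiable at (cnj s)" by (rule holomorphic_on_imp_differentiable_at[OF hol o s])
        then have "(cnj \<circ> g \<circ> cnj) field_differentiable at s"
          unfolding field_differentiable_def by (metis complex_cnj_cnj has_field_derivative_cnj_cnj)
        then show "(cnj \<circ> g \<circ> cnj) field_differentiable at s within {s. - d < Re s}"
          by (rule field_differentiable_at_within)
      qed
      have c2: "(\<lambda>s. 2 * of_real x - s) holomorphic_on {s. - d < Re s \<and> Re s < 2 * x + d}"
        by (intro holomorphic_intros)
      have c3: "(\<lambda>s. 2 * of_real x - s) ` {s. - d < Re s \<and> Re s < 2 * x + d} \<subseteq> {s. - d < Re s}" by auto
      from holomorphic_on_compose_gen[OF c2 c1 c3] show "(\<lambda>s. (cnj \<circ> g \<circ> cnj) (2 * of_real x - s)) holomorphic_on {s. - d < Re s \<and> Re s < 2 * x + d}"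
        by (simp add: o_def)
      show "g holomorphic_on {s. - d < Re s \<and> Re s < 2 * x + d}" by (rule holomorphic_on_subset[OF hol]) auto
    qed
    then have holk: "k holomorphic_on {s. - d < Re s \<and> Re s < 2 * x + d}" unfolding k_def by (simp add: o_def)
    have kb: "cmod (k s) \<le> C\<^sup>2 / (1 + (Im s)\<^sup>2)" if "- d < Re s" "Re s < 2 * x + d" for s
    proof -
      have "cmod (k s) \<le> ((cmod (g (cnj (2 * of_real x - s))))\<^sup>2 + (cmod (g s))\<^sup>2) / 2"
        unfolding k_def norm_mult complex_mod_cnj by (rule prod_le_squares)
      also have "\<dots> \<le> (C\<^sup>2 / (1 + (Im s)\<^sup>2) + C\<^sup>2 / (1 + (Im s)\<^sup>2)) / 2"
        using sq[of "cnj (2 * of_real x - s)"] sq[of s] that by (intro divide_right_mono add_mono) auto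
      finally show ?thesis by (simp only: field_sum_of_halves add_divide_distrib)
    qed
    have "complex_of_real (m x) = (LINT \<omega>|lborel. k (Complex x \<omega>))"
    proof -
      have "k (Complex x \<omega>) = complex_of_real ((cmod (g (Complex x \<omega>)))\<^sup>2)" for \<omega>
      proof -
        have "cnj (2 * of_real x - Complex x \<omega>) = Complex x \<omega>" by (simp add: complex_eq_iff)
        then show ?thesis unfolding k_def by (metis complex_norm_square mult.commute)
      qed
      note kx = this
      show ?thesis unfolding m_def kx by (rule integral_complex_of_real[symmetric])
    qed
    also have "\<dots> = (LINT \<omega>|lborel. k (Complex 0 \<omega>))"
      by (rule line_shift[OF holk kb]) (use x d in auto)
    finally have "m x = Re (LINT \<omega>|lborel. k (Complex 0 \<omega>))" by (metis Re_complex_of_real)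
    also have "\<dots> \<le> cmod (LINT \<omega>|lborel. k (Complex 0 \<omega>))" by (rule complex_Re_le_cmod)
    also have "\<dots> \<le> (LINT \<omega>|lborel. ((cmod (g (Complex (2 * x) \<omega>)))\<^sup>2 + (cmod (g (Complex 0 \<omega>)))\<^sup>2) / 2)"
    proof (rule Bochner_Integration.integral_norm_bound_integral)
      show "integrable lborel (\<lambda>\<omega>. k (Complex 0 \<omega>))"
        by (rule line_integrable[OF holk, of 0 "C\<^sup>2"]) (use kb[of "Complex 0 _"] x d in auto)
      show "integrable lborel (\<lambda>\<omega>. ((cmod (g (Complex (2 * x) \<omega>)))\<^sup>2 + (cmod (g (Complex 0 \<omega>)))\<^sup>2) / 2)"
        using int[of "2 * x"] int[of 0] x d by simp
      fix \<omega>
      have "cnj (2 * of_real x - Complex 0 \<omega>) = Complex (2 * x) \<omega>" by (simp add: complex_eq_iff)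
      then show "norm (k (Complex 0 \<omega>)) \<le> ((cmod (g (Complex (2 * x) \<omega>)))\<^sup>2 + (cmod (g (Complex 0 \<omega>)))\<^sup>2) / 2"
        unfolding k_def norm_mult complex_mod_cnj by (simp only: prod_le_squares)
    qed
    also have "\<dots> = (m 0 + m (2 * x)) / 2"
      unfolding m_def using int[of "2 * x"] int[of 0] x d by simp
    finally show ?thesis .
  qed
  define B where "B = (SUP x\<in>{0..}. m x)"
  have bdd: "bdd_above (m ` {0..})"
  proof (rule bdd_aboveI2)
    fix x :: real assume "x \<in> {0..}"
    then have x: "- d < x" using d by simp
    show "m x \<le> (LINT \<omega>|lborel. C\<^sup>2 / (1 + \<omega>\<^sup>2))"
      unfolding m_def using sq[of "Complex x _"] x
      by (intro Bochner_Integration.integral_mono int integrable_cauchy_kernel) auto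
  qed
  \<comment> \<open>The supremum is finite, so this inequality can be solved for \<open>B\<close>
    and gives \<open>B \<le> m 0\<close>.\<close>
  have "B \<le> (m 0 + B) / 2"
    unfolding B_def
  proof (rule cSUP_least)
    fix x :: real assume x: "x \<in> {0..}"
    have "m (2 * x) \<le> (SUP x\<in>{0..}. m x)" using x by (intro cSUP_upper bdd) auto
    then show "m x \<le> (m 0 + (SUP x\<in>{0..}. m x)) / 2" using half[of x] x by simp
  qed simp
  moreover have "m a \<le> B" unfolding B_def using a by (intro cSUP_upper bdd) auto
  ultimately show ?thesis unfolding m_def[symmetric] by simp
qed

section \<open>Orthogonality in the Hardy space\<close>

lemma integrable_square:
  assumes "h \<in> borel_measurable lborel" and "(\<integral>\<^sup>+\<omega>. ennreal ((cmod (h \<omega>))\<^sup>2) \<partial>lborel) < \<infinity>"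
  shows "integrable lborel (\<lambda>\<omega>::real. (cmod (h \<omega>))\<^sup>2)"
  using assms by (intro integrableI_bounded) auto

text \<open>On the line \<open>Re s = \<xi>\<close> compare \<open>H\<close> with \<open>V(s) = G(- conj s)\<close>: the hypothesis \<open>ortho\<close> makes
  \<open>H - G\<close> orthogonal to \<open>V\<close>, and \<open>V\<close> tends to \<open>G\<close> as \<open>\<xi> \<rightarrow> 0\<close>. No boundary values of \<open>H\<close> are needed.\<close>

lemma hardy_optimal:
  fixes G H :: "complex \<Rightarrow> fmat" and f :: "complex \<Rightarrow> complex"
  assumes d: "0 < d"
    and Gc: "\<And>s. - d < Re s \<Longrightarrow> car r c (G s)"
    and Gh: "\<And>i j. (\<lambda>s. ent (G s) i j) holomorphic_on {s. - d < Re s}"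
    and Gb: "\<And>s. - d < Re s \<Longrightarrow> norm (G s) * (1 + cmod s) \<le> C"
    and Gr: "\<And>s. - d < Re s \<Longrightarrow> cj (G s) = G (cnj s)"
    and Hc: "\<And>s. 0 < Re s \<Longrightarrow> car r c (H s)"
    and Hh: "\<And>i j. (\<lambda>s. ent (H s) i j) holomorphic_on {s. 0 < Re s}"
    and fh: "f holomorphic_on {s. 0 < Re s}" and fb: "\<And>s. 0 < Re s \<Longrightarrow> cmod (f s) * cmod s \<le> C'"
    and ortho: "\<And>s. 0 < Re s \<Longrightarrow> Re s < d \<Longrightarrow> tr (tp (G (- s)) * (H s - G s)) = f s"
    and a: "0 < a"
  shows "(\<integral>\<^sup>+\<omega>. ennreal ((norm (G (Complex a \<omega>)))\<^sup>2) \<partial>lborel)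
    \<le> (SUP \<xi>\<in>{0::real<..}. \<integral>\<^sup>+\<omega>. ennreal ((norm (H (Complex \<xi> \<omega>)))\<^sup>2) \<partial>lborel)"
proof -
  define I where "I = {..<r} \<times> {..<c}"
  have fI: "finite I" by (simp add: I_def)
  define K where "K = (SUP \<xi>\<in>{0::real<..}. \<integral>\<^sup>+\<omega>. ennreal ((norm (H (Complex \<xi> \<omega>)))\<^sup>2) \<partial>lborel)"
  define g where "g x \<omega> ij = ent (G (Complex x \<omega>)) (fst ij) (snd ij)" for x \<omega> and ij :: "nat \<times> nat"
  define z where "z x \<omega> ij = ent (H (Complex x \<omega>)) (fst ij) (snd ij)" for x \<omega> and ij :: "nat \<times> nat"
  have nsq: "(norm M)\<^sup>2 = (\<Sum>ij\<in>I. (cmod (ent M (fst ij) (snd ij)))\<^sup>2)" if "car r c M" for M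
    unfolding norm_sq[OF that] I_def by (simp add: sum.cartesian_product case_prod_unfold)
  have Gn: "(norm (G (Complex x \<omega>)))\<^sup>2 = (\<Sum>ij\<in>I. (cmod (g x \<omega> ij))\<^sup>2)" if "- d < x" for x \<omega>
    unfolding g_def using nsq[OF Gc] that by simp
  have Hn: "(norm (H (Complex x \<omega>)))\<^sup>2 = (\<Sum>ij\<in>I. (cmod (z x \<omega> ij))\<^sup>2)" if "0 < x" for x \<omega>
    unfolding z_def using nsq[OF Hc] that by simp
  have eb: "cmod (ent (G s) i j) * (1 + cmod s) \<le> C" if "- d < Re s" for s i j
    by (rule order_trans[OF mult_right_mono[OF norm_ent_le] Gb[OF that]]) simp
  have gsq: "(cmod (g x \<omega> ij))\<^sup>2 \<le> C\<^sup>2 / (1 + \<omega>\<^sup>2)" if "- d < x" for x \<omega> ij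
    using decay_square[OF eb[of "Complex x \<omega>" "fst ij" "snd ij"]] that by (simp add: g_def)
  have gm: "(\<lambda>\<omega>. g x \<omega> ij) \<in> borel_measurable lborel" if "- d < x" for x ij
    unfolding g_def by (rule line_measurable[OF Gh]) (use that in auto)
  have gcm: "(\<lambda>\<omega>. cnj (g x \<omega> ij)) \<in> borel_measurable lborel" if "- d < x" for x ij
  proof -
    have "continuous_on UNIV (\<lambda>\<omega>. cnj (g x \<omega> ij))"
      unfolding g_def by (intro continuous_on_cnj line_continuous[OF Gh]) (use that in auto)
    then show ?thesis by (simp add: borel_measurable_continuous_onI)
  qed
  have zm: "(\<lambda>\<omega>. z x \<omega> ij) \<in> borel_measurable lborel" if "0 < x" for x ij
    unfolding z_def by (rule line_measurable[OF Hh]) (use that in auto)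
  have gi: "integrable lborel (\<lambda>\<omega>. (cmod (g x \<omega> ij))\<^sup>2)" if "- d < x" for x ij
  proof (rule Bochner_Integration.integrable_bound[OF integrable_cauchy_kernel[of "C\<^sup>2"]])
    show "AE \<omega> in lborel. norm ((cmod (g x \<omega> ij))\<^sup>2) \<le> norm (C\<^sup>2 / (1 + \<omega>\<^sup>2))"
      using gsq[OF that] by (intro always_eventually allI) simp
  qed (use gm[OF that] in simp)
  define M0 where "M0 = (LINT \<omega>|lborel. (\<Sum>ij\<in>I. (cmod (g 0 \<omega> ij))\<^sup>2))"
  \<comment> \<open>With \<open>V\<close> the value of \<open>G\<close> at the mirrored point on the
    line \<open>Re s = - x\<close>, this is the density \<open>2 * Re <V, G> - |V|^2\<close>. At
    \<open>x = 0\<close> it is the energy density of \<open>G\<close>.\<close>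
  define h where "h x \<omega> = (\<Sum>ij\<in>I. 2 * Re (cnj (g (- x) \<omega> ij) * g x \<omega> ij) - (cmod (g (- x) \<omega> ij))\<^sup>2)" for x \<omega>
  have abs_gen: "\<bar>2 * R - v\<bar> \<le> 2 * v + w" if "\<bar>R\<bar> \<le> (v + w) / 2" "0 \<le> v" for R v w :: real
    using that by (auto simp: abs_le_iff field_simps)
  have hb: "\<bar>h x \<omega>\<bar> \<le> real (card I) * (3 * C\<^sup>2) / (1 + \<omega>\<^sup>2)" if x: "0 \<le> x" "x < d" for x \<omega>
  proof -
    have "\<bar>2 * Re (cnj (g (- x) \<omega> ij) * g x \<omega> ij) - (cmod (g (- x) \<omega> ij))\<^sup>2\<bar> \<le> 3 * C\<^sup>2 / (1 + \<omega>\<^sup>2)" for ij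
    proof -
      have "\<bar>Re (cnj (g (- x) \<omega> ij) * g x \<omega> ij)\<bar> \<le> cmod (g (- x) \<omega> ij) * cmod (g x \<omega> ij)"
        by (metis abs_Re_le_cmod complex_mod_cnj norm_mult)
      also have "\<dots> \<le> ((cmod (g (- x) \<omega> ij))\<^sup>2 + (cmod (g x \<omega> ij))\<^sup>2) / 2" by (rule prod_le_squares)
      finally have "\<bar>2 * Re (cnj (g (- x) \<omega> ij) * g x \<omega> ij) - (cmod (g (- x) \<omega> ij))\<^sup>2\<bar>
          \<le> 2 * (cmod (g (- x) \<omega> ij))\<^sup>2 + (cmod (g x \<omega> ij))\<^sup>2"
        by (rule abs_gen[OF _ zero_le_power2])
      moreover have "(cmod (g (- x) \<omega> ij))\<^sup>2 \<le> C\<^sup>2 / (1 + \<omega>\<^sup>2)" "(cmod (g x \<omega> ij))\<^sup>2 \<le> C\<^sup>2 / (1 + \<omega>\<^sup>2)"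
        by (rule gsq; use x d in simp)+
      ultimately show ?thesis by simp
    qed
    then have "\<bar>h x \<omega>\<bar> \<le> (\<Sum>ij\<in>I. 3 * C\<^sup>2 / (1 + \<omega>\<^sup>2))"
      unfolding h_def by (intro order_trans[OF sum_abs] sum_mono)
    then show ?thesis by simp
  qed
  have hm: "h x \<in> borel_measurable lborel" if x: "0 \<le> x" "x < d" for x
  proof -
    have [measurable]: "(\<lambda>\<omega>. cnj (g (- x) \<omega> ij)) \<in> borel_measurable lborel" "(\<lambda>\<omega>. g x \<omega> ij) \<in> borel_measurable lborel"
      "(\<lambda>\<omega>. g (- x) \<omega> ij) \<in> borel_measurable lborel" for ij
      using x d by (intro gm gcm; simp)+
    show ?thesis unfolding h_def by measurable
  qed
  have hi: "integrable lborel (h x)" if x: "0 \<le> x" "x < d" for x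
  proof (rule Bochner_Integration.integrable_bound[OF integrable_cauchy_kernel hm[OF x]])
    show "AE \<omega> in lborel. norm (h x \<omega>) \<le> norm (real (card I) * (3 * C\<^sup>2) / (1 + \<omega>\<^sup>2))"
      using order_trans[OF hb[OF x] abs_ge_self] by (intro always_eventually allI) (simp only: real_norm_def)
  qed
  \<comment> \<open>Based on \<open>|w|^2 \<ge> 2 * Re (cnj v * w) - |v|^2\<close> with
    \<open>w\<close> from \<open>H\<close> and \<open>v\<close> from the mirrored line. The right
    side is \<open>h x\<close> plus twice the real part of \<open>f\<close>, and \<open>f\<close>
    integrates to 0 by \<open>line_zero\<close>. The finite energy of \<open>H\<close> makes
    \<open>f\<close> integrable on the line; if \<open>K\<close> is infinite, there is nothing to
    prove.\<close>
  have lower: "ennreal (LINT \<omega>|lborel. h x \<omega>) \<le> K" if x: "0 < x" "x < d" for x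
  proof (cases "K = \<infinity>")
    case False
    have Kx: "(\<integral>\<^sup>+\<omega>. ennreal (\<Sum>ij\<in>I. (cmod (z x \<omega> ij))\<^sup>2) \<partial>lborel) \<le> K"
      unfolding K_def Hn[OF x(1), symmetric] by (rule SUP_upper) (use x in simp)
    have zi: "integrable lborel (\<lambda>\<omega>. (cmod (z x \<omega> ij))\<^sup>2)" if "ij \<in> I" for ij
    proof (rule integrable_square[OF zm[OF x(1)]])
      have "(\<integral>\<^sup>+\<omega>. ennreal ((cmod (z x \<omega> ij))\<^sup>2) \<partial>lborel) \<le> (\<integral>\<^sup>+\<omega>. ennreal (\<Sum>ij\<in>I. (cmod (z x \<omega> ij))\<^sup>2) \<partial>lborel)"
        using that fI by (intro nn_integral_mono ennreal_leI member_le_sum) auto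
      also have "\<dots> < \<infinity>" by (rule order_le_less_trans[OF Kx]) (use False in \<open>simp add: less_top[symmetric]\<close>)
      finally show "(\<integral>\<^sup>+\<omega>. ennreal ((cmod (z x \<omega> ij))\<^sup>2) \<partial>lborel) < \<infinity>" .
    qed
    have fe: "f (Complex x \<omega>) = (\<Sum>ij\<in>I. cnj (g (- x) \<omega> ij) * (z x \<omega> ij - g x \<omega> ij))" for \<omega>
    proof -
      let ?s = "Complex x \<omega>"
      have v: "- ?s = cnj (Complex (- x) \<omega>)" by (simp add: complex_eq_iff)
      have "tp (G (- ?s)) = adj (G (Complex (- x) \<omega>))" unfolding v using Gr[of "Complex (- x) \<omega>"] x by simp
      then have "f ?s = tr (adj (G (Complex (- x) \<omega>)) * (H ?s - G ?s))" using ortho[of ?s] x by simp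
      also have "\<dots> = (\<Sum>ij\<in>I. cnj (ent (G (Complex (- x) \<omega>)) (fst ij) (snd ij)) * ent (H ?s - G ?s) (fst ij) (snd ij))"
        unfolding I_def using x d
        by (subst tr_ent[of r c]) (auto intro!: Gc Hc simp: sum.cartesian_product case_prod_unfold)
      finally show ?thesis by (simp add: g_def z_def)
    qed
    have ci: "integrable lborel (\<lambda>\<omega>. cnj (g (- x) \<omega> ij) * z x \<omega> ij)" if "ij \<in> I" for ij
    proof (rule Bochner_Integration.integrable_bound)
      show "integrable lborel (\<lambda>\<omega>. ((cmod (g (- x) \<omega> ij))\<^sup>2 + (cmod (z x \<omega> ij))\<^sup>2) / 2)"
        using gi[of "- x" ij] zi[OF that] x d by simp
      show "(\<lambda>\<omega>. cnj (g (- x) \<omega> ij) * z x \<omega> ij) \<in> borel_measurable lborel"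
        using x d by (intro borel_measurable_times gcm zm) auto
      show "AE \<omega> in lborel. norm (cnj (g (- x) \<omega> ij) * z x \<omega> ij) \<le> norm (((cmod (g (- x) \<omega> ij))\<^sup>2 + (cmod (z x \<omega> ij))\<^sup>2) / 2)"
        using prod_le_squares by (intro always_eventually allI) (simp add: norm_mult)
    qed
    have ci': "integrable lborel (\<lambda>\<omega>. cnj (g (- x) \<omega> ij) * g x \<omega> ij)" for ij
    proof (rule Bochner_Integration.integrable_bound)
      show "integrable lborel (\<lambda>\<omega>. ((cmod (g (- x) \<omega> ij))\<^sup>2 + (cmod (g x \<omega> ij))\<^sup>2) / 2)"
        using gi[of "- x" ij] gi[of x ij] x d by simp
      show "(\<lambda>\<omega>. cnj (g (- x) \<omega> ij) * g x \<omega> ij) \<in> borel_measurable lborel"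
        using x d by (intro borel_measurable_times gcm gm) auto
      show "AE \<omega> in lborel. norm (cnj (g (- x) \<omega> ij) * g x \<omega> ij) \<le> norm (((cmod (g (- x) \<omega> ij))\<^sup>2 + (cmod (g x \<omega> ij))\<^sup>2) / 2)"
        using prod_le_squares by (intro always_eventually allI) (simp add: norm_mult)
    qed
    have fi: "integrable lborel (\<lambda>\<omega>. f (Complex x \<omega>))"
      unfolding fe right_diff_distrib by (intro Bochner_Integration.integrable_sum Bochner_Integration.integrable_diff ci ci')
    have f0: "(LINT \<omega>|lborel. f (Complex x \<omega>)) = 0" by (rule line_zero[OF fh fb x(1) fi])
    have pt: "2 * Re (f (Complex x \<omega>)) + h x \<omega> \<le> (\<Sum>ij\<in>I. (cmod (z x \<omega> ij))\<^sup>2)" for \<omega>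
    proof -
      have "2 * Re (cnj v * w) - (cmod v)\<^sup>2 \<le> (cmod w)\<^sup>2" for v w
      proof -
        have "0 \<le> (Re w - Re v)\<^sup>2 + (Im w - Im v)\<^sup>2" by simp
        then show ?thesis unfolding cmod_power2 by (simp add: power2_eq_square algebra_simps)
      qed
      then have "(\<Sum>ij\<in>I. 2 * Re (cnj (g (- x) \<omega> ij) * z x \<omega> ij) - (cmod (g (- x) \<omega> ij))\<^sup>2) \<le> (\<Sum>ij\<in>I. (cmod (z x \<omega> ij))\<^sup>2)"
        by (intro sum_mono)
      moreover have "2 * Re (f (Complex x \<omega>)) + h x \<omega> = (\<Sum>ij\<in>I. 2 * Re (cnj (g (- x) \<omega> ij) * z x \<omega> ij) - (cmod (g (- x) \<omega> ij))\<^sup>2)"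
        unfolding fe h_def by (simp add: right_diff_distrib sum_subtractf sum_distrib_left algebra_simps)
      ultimately show ?thesis by simp
    qed
    have "(LINT \<omega>|lborel. h x \<omega>) = (LINT \<omega>|lborel. 2 * Re (f (Complex x \<omega>)) + h x \<omega>)"
    proof -
      have "(LINT \<omega>|lborel. Re (f (Complex x \<omega>))) = 0" using integral_Re[OF fi] f0 by simp
      then show ?thesis using fi hi[of x] x by simp
    qed
    also have "\<dots> \<le> (LINT \<omega>|lborel. (\<Sum>ij\<in>I. (cmod (z x \<omega> ij))\<^sup>2))"
      using fi hi[of x] x zi by (intro Bochner_Integration.integral_mono pt) auto
    finally have "ennreal (LINT \<omega>|lborel. h x \<omega>) \<le> ennreal (LINT \<omega>|lborel. (\<Sum>ij\<in>I. (cmod (z x \<omega> ij))\<^sup>2))"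
      by (rule ennreal_leI)
    also have "\<dots> = (\<integral>\<^sup>+\<omega>. ennreal (\<Sum>ij\<in>I. (cmod (z x \<omega> ij))\<^sup>2) \<partial>lborel)"
      using zi by (intro nn_integral_eq_integral[symmetric] Bochner_Integration.integrable_sum) (auto intro!: sum_nonneg)
    finally show ?thesis using Kx by simp
  qed simp
  have lim: "(\<lambda>k. LINT \<omega>|lborel. h (d / real (k + 2)) \<omega>) \<longlonglongrightarrow> (LINT \<omega>|lborel. h 0 \<omega>)"
  proof (rule integral_dominated_convergence)
    \<comment> \<open>The offset 2 keeps even the first of these lines strictly inside the margin
      \<open>d\<close>.\<close>
    have xk: "0 \<le> d / real (k + 2)" "d / real (k + 2) < d" for k using d by (auto simp: divide_less_eq)
    show "h 0 \<in> borel_measurable lborel" by (rule hm) (use d in auto)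
    show "h (d / real (k + 2)) \<in> borel_measurable lborel" for k by (rule hm[OF xk])
    show "integrable lborel (\<lambda>\<omega>. real (card I) * (3 * C\<^sup>2) / (1 + \<omega>\<^sup>2))" by (rule integrable_cauchy_kernel)
    show "AE \<omega> in lborel. norm (h (d / real (k + 2)) \<omega>) \<le> real (card I) * (3 * C\<^sup>2) / (1 + \<omega>\<^sup>2)" for k
      using hb[OF xk] by (intro always_eventually allI) simp
    show "AE \<omega> in lborel. (\<lambda>k. h (d / real (k + 2)) \<omega>) \<longlonglongrightarrow> h 0 \<omega>"
    proof (intro always_eventually allI)
      fix \<omega>
      have xl: "(\<lambda>k. d / real (k + 2)) \<longlonglongrightarrow> 0"
        by (rule LIMSEQ_ignore_initial_segment[of "\<lambda>k. d / real k" 0 2]) (rule lim_const_over_n)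
      have gl: "((\<lambda>x. g x \<omega> ij) \<longlongrightarrow> g 0 \<omega> ij) (at 0)" for ij
      proof -
        have c: "isCont (\<lambda>s. ent (G s) (fst ij) (snd ij)) (Complex 0 \<omega>)"
          by (rule field_differentiable_imp_continuous_at[OF holomorphic_on_imp_differentiable_at[OF Gh open_halfspace_Re_gt]])
            (use d in simp)
        have "((\<lambda>x. Complex x \<omega>) \<longlongrightarrow> Complex 0 \<omega>) (at 0)"
          unfolding Complex_eq by (intro tendsto_intros)
        then show ?thesis unfolding g_def by (rule isCont_tendsto_compose[OF c])
      qed
      have gseq: "(\<lambda>k. g (y k) \<omega> ij) \<longlonglongrightarrow> g 0 \<omega> ij" if y: "y \<longlonglongrightarrow> 0" for y ij
      proof -
        have "isCont (\<lambda>x. g x \<omega> ij) 0" using gl[of ij] by (simp add: isCont_def)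
        then show ?thesis using y by (rule isCont_tendsto_compose)
      qed
      show "(\<lambda>k. h (d / real (k + 2)) \<omega>) \<longlonglongrightarrow> h 0 \<omega>"
        unfolding h_def using gseq[OF xl] gseq[OF tendsto_minus[OF xl, simplified]]
        by (intro tendsto_sum tendsto_diff tendsto_mult tendsto_const tendsto_Re tendsto_cnj tendsto_power tendsto_norm) auto
    qed
  qed
  have h0: "h 0 \<omega> = (\<Sum>ij\<in>I. (cmod (g 0 \<omega> ij))\<^sup>2)" for \<omega>
  proof -
    have "2 * Re (cnj v * v) - (cmod v)\<^sup>2 = (cmod v)\<^sup>2" for v
      unfolding cmod_power2 by (simp add: power2_eq_square)
    then show ?thesis by (simp only: h_def minus_zero)
  qed
  have "ennreal M0 \<le> K"
  proof -
    have "(\<lambda>k. ennreal (LINT \<omega>|lborel. h (d / real (k + 2)) \<omega>)) \<longlonglongrightarrow> ennreal M0"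
      using tendsto_ennrealI[OF lim] unfolding h0 M0_def .
    moreover have "ennreal (LINT \<omega>|lborel. h (d / real (k + 2)) \<omega>) \<le> K" for k
      by (rule lower) (use d in \<open>auto simp: divide_less_eq\<close>)
    ultimately show ?thesis by (intro tendsto_upperbound[of _ "ennreal M0" sequentially]) auto
  qed
  moreover have "(LINT \<omega>|lborel. (\<Sum>ij\<in>I. (cmod (g a \<omega> ij))\<^sup>2)) \<le> M0"
  proof -
    have "(LINT \<omega>|lborel. (cmod (g a \<omega> ij))\<^sup>2) \<le> (LINT \<omega>|lborel. (cmod (g 0 \<omega> ij))\<^sup>2)" for ij
      unfolding g_def by (rule line_energy_mono[OF Gh d eb]) (use a in auto)
    then show ?thesis
      unfolding M0_def using gi[of a] gi[of 0] a d by (simp add: sum_mono)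
  qed
  moreover have "(\<integral>\<^sup>+\<omega>. ennreal ((norm (G (Complex a \<omega>)))\<^sup>2) \<partial>lborel) = ennreal (LINT \<omega>|lborel. (\<Sum>ij\<in>I. (cmod (g a \<omega> ij))\<^sup>2))"
  proof -
    have "- d < a" using a d by simp
    then show ?thesis
      unfolding Gn[OF \<open>- d < a\<close>]
      by (intro nn_integral_eq_integral Bochner_Integration.integrable_sum gi) (auto intro!: sum_nonneg)
  qed
  ultimately show ?thesis unfolding K_def[symmetric] by (simp only: order_trans[OF ennreal_leI])
qed

section \<open>Bounded analytic matrix functions and resolvents\<close>

text \<open>Bounded analytic matrix functions on a half-plane. The common size \<open>N\<close> lets
  products and traces be sums over a fixed range; a stability margin appears as a negative
  \<open>a\<close>.\<close>

definition holb :: "real \<Rightarrow> (complex \<Rightarrow> fmat) \<Rightarrow> bool" where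
  "holb a f \<longleftrightarrow> (\<forall>i j. (\<lambda>s. ent (f s) i j) holomorphic_on {s. a < Re s}) \<and>
     (\<exists>N. \<forall>s. a < Re s \<longrightarrow> car N N (f s)) \<and> (\<exists>b. \<forall>s. a < Re s \<longrightarrow> norm (f s) \<le> b)"

text \<open>The elements of \<open>holb\<close> of order 1/s. They absorb multiplication by
  \<open>holb\<close> on both sides, so one strictly proper factor is enough. The weight
  \<open>1 + cmod s\<close> includes points near 0.\<close>

definition hold :: "real \<Rightarrow> (complex \<Rightarrow> fmat) \<Rightarrow> bool" where
  "hold a f \<longleftrightarrow> holb a f \<and> (\<exists>b. \<forall>s. a < Re s \<longrightarrow> norm (f s) * (1 + cmod s) \<le> b)"

lemma hold_holb: "hold a f \<Longrightarrow> holb a f" by (simp add: hold_def)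

lemma holb_mono: "holb a f \<Longrightarrow> a \<le> a' \<Longrightarrow> holb a' f"
proof -
  assume f: "holb a f" and a: "a \<le> a'"
  have "{s. a' < Re s} \<subseteq> {s. a < Re s}" using a by auto
  then have "(\<lambda>s. ent (f s) i j) holomorphic_on {s. a' < Re s}" for i j
    using f holomorphic_on_subset unfolding holb_def by blast
  moreover have "a < Re s" if "a' < Re s" for s using that a by simp
  ultimately show ?thesis using f unfolding holb_def by blast
qed

lemma hold_mono: "hold a f \<Longrightarrow> a \<le> a' \<Longrightarrow> hold a' f"
  unfolding hold_def using holb_mono by (meson order_le_less_trans)

lemma holb_const [intro]: "holb a (\<lambda>_. M)"
  unfolding holb_def using car_ex[of M] by auto

lemma holb_add [intro]:
  assumes "holb a f" "holb a g"
  shows "holb a (\<lambda>s. f s + g s)"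
proof -
  obtain N M b c where *: "\<And>s. a < Re s \<Longrightarrow> car N N (f s)" "\<And>s. a < Re s \<Longrightarrow> car M M (g s)"
    "\<And>s. a < Re s \<Longrightarrow> norm (f s) \<le> b" "\<And>s. a < Re s \<Longrightarrow> norm (g s) \<le> c"
    using assms unfolding holb_def by blast
  have "car (max N M) (max N M) (f s + g s)" if "a < Re s" for s
    by (intro car_add car_mono[OF *(1)[OF that]] car_mono[OF *(2)[OF that]]) auto
  moreover have "norm (f s + g s) \<le> b + c" if "a < Re s" for s
    by (rule order_trans[OF norm_triangle_ineq add_mono[OF *(3,4)[OF that]]])
  ultimately show ?thesis
    using assms unfolding holb_def by (auto intro!: holomorphic_on_add)
qed

lemma holb_csc [intro]:
  assumes "holb a f"
  shows "holb a (\<lambda>s. z *c f s)"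
proof -
  obtain N b where *: "\<And>s. a < Re s \<Longrightarrow> car N N (f s)" "\<And>s. a < Re s \<Longrightarrow> norm (f s) \<le> b"
    using assms unfolding holb_def by blast
  have "norm (z *c f s) \<le> cmod z * b" if "a < Re s" for s
    unfolding norm_csc by (rule mult_left_mono[OF *(2)[OF that]]) simp
  then show ?thesis
    using assms *(1) unfolding holb_def by (auto intro!: holomorphic_on_mult)
qed

lemma csc_neg1: "(-1) *c M = - M" by (rule fmat_eqI) simp

lemma holb_minus [intro]: "holb a f \<Longrightarrow> holb a (\<lambda>s. - f s)"
  using holb_csc[of a f "-1"] by (simp add: csc_neg1)

lemma holb_diff [intro]: "holb a f \<Longrightarrow> holb a g \<Longrightarrow> holb a (\<lambda>s. f s - g s)"
  using holb_add[of a f "\<lambda>s. - g s"] by auto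

lemma holb_tp [intro]: "holb a f \<Longrightarrow> holb a (\<lambda>s. tp (f s))"
  unfolding holb_def by (metis (no_types, lifting) car_tp ent_tp norm_tp holomorphic_cong)

lemma holb_mult [intro]:
  assumes "holb a f" "holb a g"
  shows "holb a (\<lambda>s. f s * g s)"
proof -
  obtain N M b c where *: "\<And>s. a < Re s \<Longrightarrow> car N N (f s)" "\<And>s. a < Re s \<Longrightarrow> car M M (g s)"
    "\<And>s. a < Re s \<Longrightarrow> norm (f s) \<le> b" "\<And>s. a < Re s \<Longrightarrow> norm (g s) \<le> c"
    using assms unfolding holb_def by blast
  have 1: "car (max N M) (max N M) (f s * g s)" if "a < Re s" for s
    by (rule car_mult; rule car_mono[OF *(1)[OF that]] car_mono[OF *(2)[OF that]]) auto
  have 2: "norm (f s * g s) \<le> \<bar>b\<bar> * \<bar>c\<bar>" if "a < Re s" for s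
    using *(3,4)[OF that] by (intro order_trans[OF norm_mult_ineq mult_mono]) auto
  have 3: "(\<lambda>s. ent (f s * g s) i j) holomorphic_on {s. a < Re s}" for i j
  proof (rule holomorphic_transform)
    show "(\<lambda>s. \<Sum>k<N. ent (f s) i k * ent (g s) k j) holomorphic_on {s. a < Re s}"
      using assms unfolding holb_def by (intro holomorphic_intros) auto
    show "(\<Sum>k<N. ent (f s) i k * ent (g s) k j) = ent (f s * g s) i j" if "s \<in> {s. a < Re s}" for s
      using ent_mult_left[OF *(1)] that by simp
  qed
  show ?thesis unfolding holb_def using 1 2 3 by blast
qed

lemma holb_sum [intro]: "(\<And>x. x \<in> S \<Longrightarrow> holb a (f x)) \<Longrightarrow> holb a (\<lambda>s. \<Sum>x\<in>S. f x s)"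
  by (induction S rule: infinite_finite_induct) auto

lemma hold_add [intro]:
  assumes "hold a f" "hold a g"
  shows "hold a (\<lambda>s. f s + g s)"
proof -
  obtain b c where *: "\<And>s. a < Re s \<Longrightarrow> norm (f s) * (1 + cmod s) \<le> b" "\<And>s. a < Re s \<Longrightarrow> norm (g s) * (1 + cmod s) \<le> c"
    using assms unfolding hold_def by blast
  have "norm (f s + g s) * (1 + cmod s) \<le> b + c" if "a < Re s" for s
  proof -
    have "norm (f s + g s) * (1 + cmod s) \<le> (norm (f s) + norm (g s)) * (1 + cmod s)"
      by (intro mult_right_mono norm_triangle_ineq) simp
    then show ?thesis using *[OF that] by (simp add: distrib_right)
  qed
  then show ?thesis using assms unfolding hold_def by blast
qed

lemma hold_mult_left [intro]:
  assumes "holb a f" "hold a g"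
  shows "hold a (\<lambda>s. f s * g s)"
proof -
  obtain b c where *: "\<And>s. a < Re s \<Longrightarrow> norm (f s) \<le> b" "\<And>s. a < Re s \<Longrightarrow> norm (g s) * (1 + cmod s) \<le> c"
    using assms unfolding hold_def holb_def by blast
  have "norm (f s * g s) * (1 + cmod s) \<le> \<bar>b\<bar> * \<bar>c\<bar>" if "a < Re s" for s
  proof -
    have "norm (f s * g s) * (1 + cmod s) \<le> (norm (f s) * norm (g s)) * (1 + cmod s)"
      by (intro mult_right_mono norm_mult_ineq) simp
    also have "\<dots> = norm (f s) * (norm (g s) * (1 + cmod s))" by simp
    also have "\<dots> \<le> \<bar>b\<bar> * \<bar>c\<bar>" using *[OF that] by (intro mult_mono) auto
    finally show ?thesis .
  qed
  then show ?thesis using assms unfolding hold_def by blast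
qed

lemma hold_tp [intro]: "hold a f \<Longrightarrow> hold a (\<lambda>s. tp (f s))"
  unfolding hold_def using holb_tp by auto

lemma hold_mult_right [intro]: "hold a f \<Longrightarrow> holb a g \<Longrightarrow> hold a (\<lambda>s. f s * g s)"
  using hold_tp[OF hold_mult_left[OF holb_tp hold_tp], of a g f] by (simp add: tp_mult)

lemma hold_minus [intro]: "hold a f \<Longrightarrow> hold a (\<lambda>s. - f s)"
  unfolding hold_def using holb_minus by auto

lemma hold_diff [intro]: "hold a f \<Longrightarrow> hold a g \<Longrightarrow> hold a (\<lambda>s. f s - g s)"
  using hold_add[of a f "\<lambda>s. - g s"] by auto

lemma hold_zero [intro]: "hold a (\<lambda>_. 0)" unfolding hold_def by auto

lemma hold_sum [intro]: "(\<And>x. x \<in> S \<Longrightarrow> hold a (f x)) \<Longrightarrow> hold a (\<lambda>s. \<Sum>x\<in>S. f x s)"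
  by (induction S rule: infinite_finite_induct) auto

lemma hold_trace:
  assumes "hold a f"
  shows "(\<lambda>s. tr (f s)) holomorphic_on {s. a < Re s}" "\<exists>C. \<forall>s. a < Re s \<longrightarrow> cmod (tr (f s)) * cmod s \<le> C"
proof -
  obtain N b where *: "\<And>s. a < Re s \<Longrightarrow> car N N (f s)" "\<And>s. a < Re s \<Longrightarrow> norm (f s) * (1 + cmod s) \<le> b"
    using assms unfolding hold_def holb_def by blast
  show "(\<lambda>s. tr (f s)) holomorphic_on {s. a < Re s}"
  proof (rule holomorphic_transform)
    show "(\<lambda>s. \<Sum>k<N. ent (f s) k k) holomorphic_on {s. a < Re s}"
      using assms unfolding hold_def holb_def by (intro holomorphic_intros) auto
    show "(\<Sum>k<N. ent (f s) k k) = tr (f s)" if "s \<in> {s. a < Re s}" for s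
      using tr_car[OF *(1)] that by simp
  qed
  have "cmod (tr (f s)) * cmod s \<le> real N * b" if s: "a < Re s" for s
  proof -
    have "cmod (tr (f s)) \<le> (\<Sum>k<N. norm (f s))"
      unfolding tr_car[OF *(1)[OF s]] by (intro order_trans[OF norm_sum] sum_mono norm_ent_le)
    then have "cmod (tr (f s)) * cmod s \<le> (real N * norm (f s)) * (1 + cmod s)"
      by (intro mult_mono) auto
    also have "\<dots> \<le> real N * b" using *(2)[OF s] by (simp add: mult.assoc mult_left_mono)
    finally show ?thesis .
  qed
  then show "\<exists>C. \<forall>s. a < Re s \<longrightarrow> cmod (tr (f s)) * cmod s \<le> C" by blast
qed

text \<open>The resolvent of \<open>A\<close> on the coordinate subspace spanned by \<open>T\<close>.\<close>

definition isrsv :: "nat set \<Rightarrow> fmat \<Rightarrow> complex \<Rightarrow> fmat \<Rightarrow> bool" where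
  "isrsv T A s W \<longleftrightarrow> dg T * W = W \<and> W * dg T = W \<and> W * (s *c dg T - A) = dg T \<and> (s *c dg T - A) * W = dg T"

definition rsv :: "nat set \<Rightarrow> fmat \<Rightarrow> complex \<Rightarrow> fmat" where
  "rsv T A s = (SOME W. isrsv T A s W)"

lemma isrsv_unique: "isrsv T A s W \<Longrightarrow> isrsv T A s V \<Longrightarrow> W = V"
  unfolding isrsv_def by (metis mult.assoc)

lemma rsv_eq: "isrsv T A s W \<Longrightarrow> rsv T A s = W"
  unfolding rsv_def using isrsv_unique by (metis someI)

text \<open>Stability through uniformly bounded resolvents, not eigenvalues. This form leads
  directly to analyticity and decay, and it is easy to move from a subsystem to its coordinates in
  the whole system.\<close>

definition stbl :: "nat set \<Rightarrow> fmat \<Rightarrow> bool" where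
  "stbl T A \<longleftrightarrow> finite T \<and> (\<exists>d>0. \<exists>c. \<forall>s. - d < Re s \<longrightarrow> (\<exists>W. isrsv T A s W \<and> norm W \<le> c))"

text \<open>The resolvent identity \<open>diff\<close> gives first continuity and then the
  derivative, minus the square of the resolvent. Decay of order 1/s follows from
  \<open>s *c ?R s = dg T + A * ?R s\<close>.\<close>

lemma stbl_resolvent:
  assumes "stbl T A"
  shows "\<exists>d>0. hold (- d) (rsv T A) \<and> (\<forall>s. - d < Re s \<longrightarrow> isrsv T A s (rsv T A s))"
proof -
  obtain d c where d: "0 < d" and W: "\<And>s. - d < Re s \<Longrightarrow> \<exists>W. isrsv T A s W \<and> norm W \<le> c" and T: "finite T"
    using assms unfolding stbl_def by blast
  let ?R = "rsv T A"
  have R: "isrsv T A s (?R s)" and Rc: "norm (?R s) \<le> c" if "- d < Re s" for s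
    using W[OF that] rsv_eq by blast+
  obtain N where N: "T \<subseteq> {..<N}" using T finite_nat_iff_bounded by blast
  have carR: "car N N (?R s)" if "- d < Re s" for s
  proof -
    have "ix N * dg T = dg T" "dg T * ix N = dg T" using N T by (simp_all add: dg_mult Int_absorb1 Int_absorb2)
    then have "ix N * ?R s = ?R s" "?R s * ix N = ?R s"
      using R[OF that] unfolding isrsv_def by (metis mult.assoc)+
    then show ?thesis by (simp add: car_iff)
  qed
  have diff: "?R s - ?R t = (t - s) *c (?R s * ?R t)" if "- d < Re s" "- d < Re t" for s t
  proof -
    note r = R[OF that(1), unfolded isrsv_def] R[OF that(2), unfolded isrsv_def]
    have "?R s - ?R t = ?R s * ((t *c dg T - A) * ?R t) - (?R s * (s *c dg T - A)) * ?R t"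
      using r by metis
    also have "\<dots> = (t - s) *c (?R s * (dg T * ?R t))"
      by (simp add: algebra_simps csc_left csc_right csc_sub)
    finally show ?thesis using r by simp
  qed
  have lim: "(?R \<longlongrightarrow> ?R s) (at s)" if s: "- d < Re s" for s
  proof -
    have ev: "\<forall>\<^sub>F t in at s. - d < Re t"
      using eventually_at_in_open'[OF open_halfspace_Re_gt[of "- d"]] s by simp
    have "((\<lambda>t. ?R t - ?R s) \<longlongrightarrow> 0) (at s)"
    proof (rule Lim_null_comparison)
      show "\<forall>\<^sub>F t in at s. norm (?R t - ?R s) \<le> cmod (s - t) * (c * c)"
        using ev
      proof eventually_elim
        case (elim t)
        have "norm (?R t * ?R s) \<le> c * c"
          using Rc[OF elim] Rc[OF s] by (intro order_trans[OF norm_mult_ineq mult_mono]) (auto intro: order_trans[OF norm_ge_zero])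
        then show ?case unfolding diff[OF elim s] norm_csc by (rule mult_left_mono) simp
      qed
      have "((\<lambda>t. cmod (s - t) * (c * c)) \<longlongrightarrow> cmod (s - s) * (c * c)) (at s)" by (intro tendsto_intros)
      then show "((\<lambda>t. cmod (s - t) * (c * c)) \<longlongrightarrow> 0) (at s)" by simp
    qed
    then show ?thesis by (simp add: Lim_null[symmetric])
  qed
  have deriv: "((\<lambda>s. ent (?R s) i j) has_field_derivative - ent (?R s * ?R s) i j) (at s)" if s: "- d < Re s" for s i j
    unfolding has_field_derivative_iff
  proof (rule Lim_transform_eventually)
    show "((\<lambda>t. - ent (?R t * ?R s) i j) \<longlongrightarrow> - ent (?R s * ?R s) i j) (at s)"
      by (intro tendsto_intros lim s)
    have ev: "\<forall>\<^sub>F t in at s. - d < Re t \<and> t \<noteq> s"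
      using eventually_conj[OF eventually_at_in_open'[OF open_halfspace_Re_gt[of "- d"]] eventually_neq_at_within[of s s]] s by simp
    then show "\<forall>\<^sub>F t in at s. - ent (?R t * ?R s) i j = (ent (?R t) i j - ent (?R s) i j) / (t - s)"
    proof eventually_elim
      case (elim t)
      then have "ent (?R t - ?R s) i j = (s - t) * ent (?R t * ?R s) i j" using diff[of t s] s by simp
      then show ?case using elim by (simp add: field_simps)
    qed
  qed
  have hol: "(\<lambda>s. ent (?R s) i j) holomorphic_on {s. - d < Re s}" for i j
    unfolding holomorphic_on_def field_differentiable_def
    using deriv has_field_derivative_at_within by blast
  have decay: "norm (?R s) * (1 + cmod s) \<le> c + (norm (dg T) + norm A * c)" if s: "- d < Re s" for s
  proof -
    have 1: "dg T * ?R s = ?R s" and 2: "(s *c dg T - A) * ?R s = dg T"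
      using R[OF s] by (auto simp: isrsv_def)
    from 2 have "s *c (dg T * ?R s) = dg T + A * ?R s" by (simp add: left_diff_distrib csc_left diff_eq_eq)
    then have "s *c ?R s = dg T + A * ?R s" by (simp only: 1)
    then have "cmod s * norm (?R s) = norm (dg T + A * ?R s)" by (metis norm_csc)
    also have "\<dots> \<le> norm (dg T) + norm A * c"
      using Rc[OF s] by (intro order_trans[OF norm_triangle_ineq] add_mono order_trans[OF norm_mult_ineq] mult_left_mono) auto
    moreover have "norm (?R s) * (1 + cmod s) = norm (?R s) + cmod s * norm (?R s)" by (simp add: algebra_simps)
    ultimately show ?thesis using Rc[OF s] by linarith
  qed
  have "hold (- d) ?R" unfolding hold_def holb_def using hol carR Rc decay by blast
  then show ?thesis using d R by blast
qed

lemma isrsv_cnj: "isrsv T A s W \<Longrightarrow> cj A = A \<Longrightarrow> isrsv T A (cnj s) (cj W)"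
  unfolding isrsv_def by (metis cj_mult cj_simps(2) cj_simps(4) cj_dg)

lemma isrsv_rules:
  assumes "isrsv T A s W"
  shows "dg T * W = W" "W * dg T = W" "W * A = s *c W - dg T" "A * W = s *c W - dg T"
    "dg T * (W * x) = W * x" "W * (dg T * x) = W * x" "A * (W * x) = s *c (W * x) - dg T * x"
    "W * (A * x) = s *c (W * x) - dg T * x"
proof -
  show 1: "dg T * W = W" "W * dg T = W" using assms by (auto simp: isrsv_def)
  show 2: "W * A = s *c W - dg T" "A * W = s *c W - dg T"
    using assms by (auto simp: isrsv_def right_diff_distrib left_diff_distrib csc_left csc_right algebra_simps)
  show "dg T * (W * x) = W * x" "W * (dg T * x) = W * x" by (simp_all add: 1 mult.assoc[symmetric])
  have "(A * W) * x = s *c (W * x) - dg T * x" "(W * A) * x = s *c (W * x) - dg T * x"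
    by (simp_all only: 2 left_diff_distrib csc_left)
  then show "A * (W * x) = s *c (W * x) - dg T * x" "W * (A * x) = s *c (W * x) - dg T * x"
    by (simp_all only: mult.assoc)
qed

text \<open>Stability is not assumed: the plant and the realizations of the controllers only have to
  make sense far to the right.\<close>

lemma isrsv_large:
  assumes A: "car n n A" and s: "norm A < Re s"
  shows "\<exists>W. isrsv {..<n} A s W \<and> norm W * (Re s - norm A) \<le> norm (ix n)"
proof -
  have c: "car n n (s *c ix n - A)" by (intro car_diff car_csc car_ix A)
  have key: "norm x * (Re s - norm A) \<le> norm ((s *c ix n - A) * x)" if x: "ix n * x = x" for x
  proof -
    have "cmod s * norm x = norm ((s *c ix n - A) * x + A * x)" by (simp add: left_diff_distrib csc_left x norm_csc)
    also have "\<dots> \<le> norm ((s *c ix n - A) * x) + norm A * norm x"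
      by (intro order_trans[OF norm_triangle_ineq] add_mono norm_mult_ineq order_refl)
    finally have "norm x * (cmod s - norm A) \<le> norm ((s *c ix n - A) * x)" by (simp add: algebra_simps)
    moreover have "norm x * (Re s - norm A) \<le> norm x * (cmod s - norm A)"
      by (intro mult_left_mono diff_right_mono complex_Re_le_cmod) simp
    ultimately show ?thesis by linarith
  qed
  have "inj_mul n (s *c ix n - A)" unfolding inj_mul_def
  proof (intro allI impI)
    fix x assume x: "ix n * x = x" "(s *c ix n - A) * x = 0"
    then have "norm x * (Re s - norm A) \<le> 0" using key[of x] by simp
    then show "x = 0" using s by (simp add: mult_le_0_iff)
  qed
  then obtain W where W: "car n n W" "W * (s *c ix n - A) = ix n" "(s *c ix n - A) * W = ix n"
    using inverse_exists[OF c] by blast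
  then have "isrsv {..<n} A s W" by (simp add: isrsv_def ix_left ix_right)
  moreover have "norm W * (Re s - norm A) \<le> norm (ix n)" using key[OF ix_left[OF W(1)]] W(3) by simp
  ultimately show ?thesis by blast
qed

lemma hurw_stbl:
  assumes "hurw n A"
  shows "stbl {..<n} A"
proof -
  obtain d c where d: "0 < d" and W: "\<And>s. - d < Re s \<Longrightarrow>
      \<exists>W. car n n W \<and> W * (s *c ix n - A) = ix n \<and> (s *c ix n - A) * W = ix n \<and> norm W \<le> c"
    using hurw_resolvent_bound[OF assms] by blast
  have "\<exists>W. isrsv {..<n} A s W \<and> norm W \<le> c" if s: "- d < Re s" for s
  proof -
    obtain W where "car n n W" "W * (s *c ix n - A) = ix n" "(s *c ix n - A) * W = ix n" "norm W \<le> c"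
      using W[OF s] by blast
    then show ?thesis by (intro exI[of _ W]) (simp add: isrsv_def ix_left ix_right)
  qed
  then show ?thesis using d unfolding stbl_def by blast
qed

text \<open>\<open>E\<close> is an isometry onto the coordinates in \<open>T\<close>, so the
  resolvent there is \<open>E * W * tp E\<close> for the resolvent \<open>W\<close> of the small
  matrix.\<close>

lemma stbl_lift:
  assumes "stbl {..<k} A" and E: "car r k E" "tp E * E = ix k" "E * tp E = dg T" "finite T"
  shows "stbl T (E * A * tp E)"
proof -
  obtain d c where d: "0 < d" and W: "\<And>s. - d < Re s \<Longrightarrow> \<exists>W. isrsv {..<k} A s W \<and> norm W \<le> c"
    using assms(1) unfolding stbl_def by blast
  have EE: "tp E * (E * x) = ix k * x" for x by (simp add: E(2) mult.assoc[symmetric])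
  have T: "dg T * x = E * (tp E * x)" "x * dg T = x * E * tp E" for x by (simp_all add: E(3)[symmetric] mult.assoc)
  have ixE: "ix k * tp E = tp E" "ix k * (tp E * x) = tp E * x" "E * ix k = E" for x
    using ix_left[OF car_tp[OF E(1)]] ix_left'[OF car_tp[OF E(1)]] ix_right[OF E(1)] by auto
  have "\<exists>V. isrsv T (E * A * tp E) s V \<and> norm V \<le> norm E * c * norm E" if s: "- d < Re s" for s
  proof -
    obtain W where W: "isrsv {..<k} A s W" "norm W \<le> c" using W[OF s] by blast
    note r = isrsv_rules[OF W(1)]
    have "isrsv T (E * A * tp E) s (E * W * tp E)"
      unfolding isrsv_def
      by (simp add: T mult.assoc EE E(2) r ixE left_diff_distrib right_diff_distrib csc_left csc_right)
        (simp add: E(3)[symmetric] EE r ixE mult.assoc csc_right right_diff_distrib)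
    moreover have "norm (E * W * tp E) \<le> norm E * c * norm E"
    proof -
      have "norm (E * W * tp E) \<le> norm E * norm W * norm E"
        by (intro order_trans[OF norm_mult_ineq]) (simp add: mult_right_mono norm_mult_ineq)
      also have "\<dots> \<le> norm E * c * norm E" using W(2) by (intro mult_right_mono mult_left_mono) auto
      finally show ?thesis .
    qed
    ultimately show ?thesis by blast
  qed
  then show ?thesis using d E(4) unfolding stbl_def by blast
qed

section \<open>Optimality of the decentralized controller\<close>

text \<open>The graph enters only through index sets. In the application \<open>tn j\<close> and
  \<open>tm j\<close> hold the states and inputs of the descendants of \<open>j\<close>, and
  \<open>tq j\<close> the outputs of \<open>j\<close> alone. \<open>Ft j\<close>, \<open>X j\<close>
  and \<open>Lt j\<close> are gains and Riccati solutions of subsystems, padded with zeros to full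
  size; the commutation rules express that the block-diagonal data respect the index sets.\<close>

locale dsys =
  fixes N n m p nw nz :: nat and A B1 B2 C1 C2 D12 D21 Fd L Y :: fmat
    and tn tm tq :: "nat \<Rightarrow> nat set" and Ft X Lt :: "nat \<Rightarrow> fmat"
  assumes cars: "car n n A" "car n nw B1" "car n m B2" "car nz n C1" "car p n C2" "car nz m D12" "car p nw D21"
      "car m n Fd" "car n p L" "car n n Y"
    and reals: "cj A = A" "cj B1 = B1" "cj B2 = B2" "cj C1 = C1" "cj C2 = C2" "cj D12 = D12" "cj D21 = D21" "cj Fd = Fd"
      "cj L = L" "\<And>j. j < N \<Longrightarrow> cj (Ft j) = Ft j" "\<And>j. j < N \<Longrightarrow> cj (Lt j) = Lt j"
    and tsets: "\<And>j. j < N \<Longrightarrow> tn j \<subseteq> {..<n}" "\<And>j. j < N \<Longrightarrow> tm j \<subseteq> {..<m}" "\<And>j. j < N \<Longrightarrow> tq j \<subseteq> {..<p}"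
    and commA: "\<And>j. j < N \<Longrightarrow> A * dg (tn j) = dg (tn j) * A"
    and commB: "\<And>j. j < N \<Longrightarrow> B2 * dg (tm j) = dg (tn j) * B2"
    and commF: "\<And>j. j < N \<Longrightarrow> Fd * dg (tn j) = dg (tm j) * Fd"
    and commR: "\<And>j. j < N \<Longrightarrow> D21 * tp D21 * dg (tq j) = dg (tq j) * (D21 * tp D21)"
    and sumq: "(\<Sum>j<N. dg (tq j)) = ix p"
    and sumL: "L = (\<Sum>j<N. Lt j)"
    and Lt1: "\<And>j. j < N \<Longrightarrow> dg (tn j) * Lt j = Lt j" "\<And>j. j < N \<Longrightarrow> Lt j * dg (tq j) = Lt j"
    and Lt0: "\<And>j k. j < N \<Longrightarrow> k < N \<Longrightarrow> j \<noteq> k \<Longrightarrow> Lt k * dg (tq j) = 0"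
    and Ft1: "\<And>j. j < N \<Longrightarrow> dg (tm j) * Ft j = Ft j" "\<And>j. j < N \<Longrightarrow> Ft j * dg (tn j) = Ft j"
    and X1: "\<And>j. j < N \<Longrightarrow> dg (tn j) * X j = X j" "\<And>j. j < N \<Longrightarrow> X j * dg (tn j) = X j"
    and ricF: "\<And>j. j < N \<Longrightarrow> tp (D12 * dg (tm j)) * (C1 * dg (tn j) + D12 * Ft j) + tp (B2 * dg (tm j)) * X j = 0"
    and lyapF: "\<And>j. j < N \<Longrightarrow> tp (A * dg (tn j) + B2 * Ft j) * X j + X j * (A * dg (tn j) + B2 * Ft j)
        + tp (C1 * dg (tn j) + D12 * Ft j) * (C1 * dg (tn j) + D12 * Ft j) = 0"
    and stblF: "\<And>j. j < N \<Longrightarrow> stbl (tn j) (A * dg (tn j) + B2 * Ft j)"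
    and tpY: "tp Y = Y"
    and ricL: "(B1 + L * D21) * tp D21 + Y * tp C2 = 0"
    and lyapL: "(A + L * C2) * Y + Y * tp (A + L * C2) + (B1 + L * D21) * tp (B1 + L * D21) = 0"
    and stblL: "stbl {..<n} (A + L * C2)"
    and stblFd: "stbl {..<n} (A + B2 * Fd)"
begin

abbreviation en where "en j \<equiv> dg (tn j)"
abbreviation em where "em j \<equiv> dg (tm j)"
abbreviation ep where "ep j \<equiv> dg (tq j)"

definition AF where "AF j = A * en j + B2 * Ft j"
definition CF where "CF j = C1 * en j + D12 * Ft j"
definition BL where "BL = B1 + L * D21"
definition Ph where "Ph = rsv {..<n} (A + B2 * Fd)"
definition Ps where "Ps = rsv {..<n} (A + L * C2)"
definition Pj where "Pj j = rsv (tn j) (AF j)"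
definition T11 where "T11 s = (C1 + D12 * Fd) * Ph s * (B1 - B2 * Fd * Ps s * BL) - D12 * Fd * Ps s * BL" for s
definition T12 where "T12 s = (C1 + D12 * Fd) * Ph s * B2 + D12" for s
definition T21 where "T21 s = C2 * Ps s * BL + D21" for s
definition Qo where "Qo s = - (\<Sum>j<N. (Ft j - Fd) * Pj j s * Lt j)" for s
text \<open>The optimal closed loop in a form free of \<open>Fd\<close>: estimation error and
  controller states, each with its own stable resolvent. The Riccati cancellations act on this
  form.\<close>

definition G0 where "G0 s = C1 * Ps s * BL - (\<Sum>j<N. CF j * Pj j s * Lt j) * T21 s" for s

lemma fins: "j < N \<Longrightarrow> finite (tn j)" "j < N \<Longrightarrow> finite (tm j)" "j < N \<Longrightarrow> finite (tq j)"
  by (rule finite_subset[OF tsets(1) finite_lessThan] finite_subset[OF tsets(2) finite_lessThan]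
      finite_subset[OF tsets(3) finite_lessThan], assumption)+

lemma stable_margin:
  obtains d where "0 < d" "hold (- d) Ph" "hold (- d) Ps" "\<And>j. j < N \<Longrightarrow> hold (- d) (Pj j)"
    "\<And>s. - d < Re s \<Longrightarrow> isrsv {..<n} (A + B2 * Fd) s (Ph s)"
    "\<And>s. - d < Re s \<Longrightarrow> isrsv {..<n} (A + L * C2) s (Ps s)"
    "\<And>s j. - d < Re s \<Longrightarrow> j < N \<Longrightarrow> isrsv (tn j) (AF j) s (Pj j s)"
proof -
  obtain d1 where d1: "0 < d1" "hold (- d1) Ph" "\<forall>s. - d1 < Re s \<longrightarrow> isrsv {..<n} (A + B2 * Fd) s (Ph s)"
    using stbl_resolvent[OF stblFd] unfolding Ph_def by blast
  obtain d2 where d2: "0 < d2" "hold (- d2) Ps" "\<forall>s. - d2 < Re s \<longrightarrow> isrsv {..<n} (A + L * C2) s (Ps s)"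
    using stbl_resolvent[OF stblL] unfolding Ps_def by blast
  have "\<forall>j\<in>{..<N}. \<exists>d>0. hold (- d) (Pj j) \<and> (\<forall>s. - d < Re s \<longrightarrow> isrsv (tn j) (AF j) s (Pj j s))"
    using stbl_resolvent[OF stblF] unfolding Pj_def AF_def by blast
  from bchoice[OF this] obtain dj where dj: "\<And>j. j < N \<Longrightarrow> 0 < dj j" "\<And>j. j < N \<Longrightarrow> hold (- dj j) (Pj j)"
    "\<And>j s. j < N \<Longrightarrow> - dj j < Re s \<Longrightarrow> isrsv (tn j) (AF j) s (Pj j s)"
    by auto
  define d where "d = Min (insert d1 (insert d2 (dj ` {..<N})))"
  have d: "0 < d" "d \<le> d1" "d \<le> d2" "\<And>j. j < N \<Longrightarrow> d \<le> dj j"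
  proof -
    show "0 < d" unfolding d_def using d1(1) d2(1) dj(1) by (subst Min_gr_iff) auto
    show "d \<le> d1" "d \<le> d2" "\<And>j. j < N \<Longrightarrow> d \<le> dj j" unfolding d_def by (rule Min_le; simp)+
  qed
  show ?thesis
  proof (rule that[OF d(1)])
    show "hold (- d) Ph" "hold (- d) Ps" using hold_mono d1(2) d2(2) d by auto
    show "hold (- d) (Pj j)" if "j < N" for j using hold_mono[OF dj(2)[OF that]] d(4)[OF that] by auto
    fix s assume s: "- d < Re s"
    show "isrsv {..<n} (A + B2 * Fd) s (Ph s)" "isrsv {..<n} (A + L * C2) s (Ps s)" using s d d1 d2 by auto
    show "isrsv (tn j) (AF j) s (Pj j s)" if "j < N" for j using s d(4)[OF that] dj(3)[OF that] by auto
  qed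
qed

lemma cBL: "car n nw BL"
  unfolding BL_def by (intro car_add cars car_mult[OF cars(9) cars(7)])

text \<open>The pointwise form of the closed loop: with the observer error \<open>e\<close> and the controller states \<open>\<xi>\<close>,
  the plant state is \<open>e + \<Sum>\<xi>\<close>.\<close>

lemma closed_loop:
  assumes Phi: "isrsv {..<n} (A + B2 * Fd) s (Ph s)" and Psi: "isrsv {..<n} (A + L * C2) s (Ps s)"
    and Phj: "\<And>j. j < N \<Longrightarrow> isrsv (tn j) (AF j) s (Pj j s)"
  shows "T11 s + T12 s * Qo s * T21 s = G0 s"
proof -
  define e where "e = Ps s * BL"
  define xi where "xi j = - (Pj j s * Lt j * T21 s)" for j
  define v where "v = (\<Sum>j<N. (Ft j - Fd) * xi j)"
  define x where "x = (\<Sum>j<N. xi j)"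
  have v: "v = Qo s * T21 s"
    unfolding v_def Qo_def xi_def by (simp add: sum_distrib_right sum_negf mult.assoc)
  have e: "s *c e = A * e + L * C2 * e + BL"
  proof -
    have "A * e + L * C2 * e = (A + L * C2) * Ps s * BL" by (simp add: e_def algebra_simps)
    also have "\<dots> = s *c e - BL"
      unfolding isrsv_rules(4)[OF Psi] by (simp add: left_diff_distrib csc_left e_def ix_left[OF cBL])
    finally show ?thesis by simp
  qed
  have xi: "s *c xi j = A * xi j + B2 * Ft j * xi j - Lt j * T21 s" if j: "j < N" for j
  proof -
    note r = isrsv_rules[OF Phj[OF j]]
    have en: "en j * xi j = xi j" by (simp add: xi_def r mult.assoc)
    have "A * xi j + B2 * Ft j * xi j = AF j * xi j" by (simp add: AF_def distrib_right mult.assoc en)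
    also have "\<dots> = s *c xi j + Lt j * T21 s"
      by (simp add: xi_def r mult.assoc csc_minus) (simp add: mult.assoc[symmetric] Lt1[OF j])
    finally show ?thesis by simp
  qed
  have sx: "s *c x = A * x + (\<Sum>j<N. B2 * Ft j * xi j) - L * T21 s"
  proof -
    have "s *c x = (\<Sum>j<N. s *c xi j)" unfolding x_def by (rule fmat_eqI) (simp add: sum_distrib_left)
    also have "\<dots> = (\<Sum>j<N. A * xi j + B2 * Ft j * xi j - Lt j * T21 s)" using xi by (intro sum.cong) auto
    finally show ?thesis
      by (simp add: x_def sumL sum.distrib sum_subtractf sum_distrib_left sum_distrib_right)
  qed
  have fx: "(\<Sum>j<N. B2 * Ft j * xi j) = B2 * v + B2 * Fd * x"
    by (simp add: v_def x_def sum_distrib_left left_diff_distrib right_diff_distrib sum_subtractf mult.assoc)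
  \<comment> \<open>In the sum of the error and controller equations all terms with \<open>L\<close>
    cancel. What remains is the plant with feedback \<open>Fd\<close> and external input
    \<open>v\<close>.\<close>
  have "s *c (e + x) - (A + B2 * Fd) * (e + x) = B1 + B2 * v - B2 * Fd * e"
  proof -
    have T: "T21 s = C2 * e + D21" by (simp add: T21_def e_def mult.assoc)
    show ?thesis unfolding csc_add e sx fx BL_def T by (simp add: algebra_simps)
  qed
  moreover have inx: "ix n * (e + x) = e + x"
  proof -
    have "ix n * e = e" by (simp add: e_def isrsv_rules[OF Psi])
    moreover have "ix n * xi j = xi j" if j: "j < N" for j
    proof -
      have en: "xi j = en j * xi j" by (simp add: xi_def isrsv_rules[OF Phj[OF j]] mult.assoc)
      have "ix n * en j = en j" using tsets(1)[OF j] fins(1)[OF j] by (simp add: dg_mult Int_absorb1)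
      then show ?thesis by (subst (1 2) en) (simp add: mult.assoc[symmetric])
    qed
    ultimately show ?thesis by (simp add: x_def distrib_left sum_distrib_left)
  qed
  ultimately have "(s *c ix n - (A + B2 * Fd)) * (e + x) = B1 + B2 * v - B2 * Fd * e"
    by (simp add: left_diff_distrib csc_left)
  then have "Ph s * ((s *c ix n - (A + B2 * Fd)) * (e + x)) = Ph s * (B1 + B2 * v - B2 * Fd * e)" by simp
  then have ex: "e + x = Ph s * (B1 + B2 * v - B2 * Fd * e)"
    using Phi inx unfolding isrsv_def mult.assoc[symmetric] by simp
  have "T11 s + T12 s * Qo s * T21 s = (C1 + D12 * Fd) * (Ph s * (B1 + B2 * v - B2 * Fd * e)) - D12 * Fd * e + D12 * v"
  proof -
    have "T12 s * Qo s * T21 s = T12 s * v" by (simp add: v mult.assoc)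
    then show ?thesis unfolding T11_def T12_def e_def by (simp add: algebra_simps)
  qed
  also have "\<dots> = (C1 + D12 * Fd) * (e + x) - D12 * Fd * e + D12 * v" by (simp only: ex)
  also have "\<dots> = C1 * e + (\<Sum>j<N. C1 * xi j + D12 * Ft j * xi j)"
    unfolding v_def
    by (simp add: x_def algebra_simps sum.distrib sum_subtractf sum_distrib_left)
  also have "(\<Sum>j<N. C1 * xi j + D12 * Ft j * xi j) = (\<Sum>j<N. CF j * xi j)"
  proof (intro sum.cong refl)
    fix j assume "j \<in> {..<N}"
    then have "en j * xi j = xi j" by (simp add: xi_def isrsv_rules[OF Phj] mult.assoc)
    then show "C1 * xi j + D12 * Ft j * xi j = CF j * xi j" by (simp add: CF_def distrib_right mult.assoc)
  qed
  also have "C1 * e + \<dots> = G0 s"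
    by (simp add: G0_def e_def xi_def sum_distrib_right sum_negf mult.assoc)
  finally show ?thesis .
qed

text \<open>What remains of \<open>em j * tp (T12 s) * G0 (- s) * tp (T21 s) * ep j\<close> after
  both Riccati cancellations. No resolvent at \<open>- s\<close> is left, so this is analytic and of
  order 1/s on the right half-plane.\<close>

definition RT where
  "RT j s = em j * tp (T12 s) * C1 * Y * tp (Ps s) * tp C2 * ep j
     - tp (em j + (Fd - Ft j) * Ph s * (B2 * em j)) * tp (B2 * em j) * tp (Pj j s) * X j * Lt j * (D21 * tp D21)" for j s

text \<open>Whitening by the Kalman filter: the innovations have a constant spectrum. The Lyapunov
  equation splits \<open>Ps (- s) * (BL * tp BL) * tp (Ps s)\<close> into a term with the resolvent
  at \<open>s\<close> and a term with the resolvent at \<open>- s\<close>, and the gain equation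
  removes the latter.\<close>

lemma lqe_cancel:
  assumes Pt: "isrsv {..<n} (A + L * C2) (- s) (Ps (- s))" and P: "isrsv {..<n} (A + L * C2) s (Ps s)"
  shows "Ps (- s) * BL * tp (T21 s) = Y * tp (Ps s) * tp C2"
    and "T21 (- s) * tp (T21 s) = D21 * tp D21"
proof -
  let ?P = "Ps s" and ?Q = "Ps (- s)" and ?A = "A + L * C2"
  have bb: "BL * tp BL = - (?A * Y) - Y * tp ?A"
    using lyapL unfolding BL_def[symmetric] by (simp add: eq_neg_iff_add_eq_0 eq_diff_eq add.commute add.left_commute add.assoc)
  have bd: "BL * tp D21 = - (Y * tp C2)"
    using ricL unfolding BL_def[symmetric] by (simp add: eq_neg_iff_add_eq_0)
  have db: "D21 * tp BL = - (C2 * Y)"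
    using arg_cong[OF bd, of tp] by (simp add: tp_mult tpY)
  have tP: "tp ?A * tp ?P = s *c tp ?P - ix n"
    using arg_cong[OF isrsv_rules(3)[OF P], of tp] by (simp add: tp_mult)
  have iY: "ix n * (Y * x) = Y * x" "Y * (ix n * x) = Y * x" "Y * ix n = Y" for x
    using ix_left'[OF cars(10)] ix_right'[OF cars(10)] ix_right[OF cars(10)] by auto
  have "?Q * (BL * tp BL) * tp ?P = - ((?Q * ?A) * Y * tp ?P) - ?Q * Y * (tp ?A * tp ?P)"
    unfolding bb by (simp only: left_diff_distrib right_diff_distrib mult_minus_left mult_minus_right mult.assoc)
  also have "\<dots> = Y * tp ?P + ?Q * Y"
    unfolding tP isrsv_rules(3)[OF Pt]
    by (simp add: left_diff_distrib right_diff_distrib csc_left csc_right csc_minus mult.assoc iY)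
  finally have k: "?Q * (BL * tp BL) * tp ?P = Y * tp ?P + ?Q * Y" .
  have "?Q * BL * tp (T21 s) = ?Q * (BL * tp BL) * tp ?P * tp C2 + ?Q * (BL * tp D21)"
    by (simp add: T21_def tp_mult distrib_left mult.assoc)
  also have "\<dots> = Y * tp ?P * tp C2" unfolding k bd by (simp add: distrib_right mult.assoc)
  finally show 1: "?Q * BL * tp (T21 s) = Y * tp ?P * tp C2" .
  have "T21 (- s) * tp (T21 s) = C2 * (?Q * BL * tp (T21 s)) + D21 * tp BL * tp ?P * tp C2 + D21 * tp D21"
    by (simp add: T21_def[of "- s"] distrib_right mult.assoc) (simp add: T21_def tp_mult distrib_left mult.assoc)
  also have "\<dots> = D21 * tp D21" unfolding 1 db by (simp add: mult.assoc)
  finally show "T21 (- s) * tp (T21 s) = D21 * tp D21" .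
qed

text \<open>Changing the feedback from \<open>Fd\<close> to the optimal \<open>Ft j\<close> factors
  \<open>T12 s * em j\<close> into the loop with gain \<open>Ft j\<close> times a factor
  \<open>W\<close>. For that loop the Lyapunov and gain equations remove the resolvent at
  \<open>- s\<close>, dually to \<open>lqe_cancel\<close>.\<close>

lemma lqr_cancel:
  assumes j: "j < N" and Phi: "isrsv {..<n} (A + B2 * Fd) s (Ph s)"
    and P: "isrsv (tn j) (AF j) s (Pj j s)" and Q: "isrsv (tn j) (AF j) (- s) (Pj j (- s))"
  shows "em j * tp (T12 s) * CF j * Pj j (- s) =
    tp (em j + (Fd - Ft j) * Ph s * (B2 * em j)) * tp (B2 * em j) * tp (Pj j s) * X j"
proof -
  let ?P = "Pj j s" and ?Q = "Pj j (- s)" and ?Bj = "B2 * em j" and ?Dj = "D12 * em j"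
  define th where "th = Ph s * ?Bj"
  define W where "W = em j + (Fd - Ft j) * th"
  have idem: "en j * en j = en j" "em j * em j = em j" using fins[OF j] by (simp_all add: dg_mult)
  note comm = commA[OF j] commB[OF j] commF[OF j]
  have enBj: "en j * ?Bj = ?Bj" using comm(2) idem by (metis mult.assoc)
  \<comment> \<open>\<open>Ph s\<close> commutes with \<open>en j\<close>, so the inputs in
    \<open>tm j\<close> excite only the states in \<open>tn j\<close>.\<close>
  have enth: "en j * th = th"
  proof -
    let ?Ad = "A + B2 * Fd"
    have AdE: "?Ad * en j = en j * ?Ad" using comm by (simp add: distrib_left distrib_right) (metis mult.assoc)
    have iE: "ix n * en j = en j" "en j * ix n = en j"
      using tsets(1)[OF j] fins(1)[OF j] by (simp_all add: dg_mult Int_absorb1 Int_absorb2)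
    have "(s *c ix n - ?Ad) * en j = en j * (s *c ix n - ?Ad)"
      by (simp only: left_diff_distrib right_diff_distrib csc_left csc_right AdE iE)
    then have "Ph s * ((s *c ix n - ?Ad) * en j) * Ph s = Ph s * (en j * (s *c ix n - ?Ad)) * Ph s" by simp
    then have "(Ph s * (s *c ix n - ?Ad)) * en j * Ph s = Ph s * en j * ((s *c ix n - ?Ad) * Ph s)" by (simp only: mult.assoc)
    then have "en j * Ph s = Ph s * en j" using Phi iE unfolding isrsv_def by (simp add: mult.assoc)
    then show ?thesis unfolding th_def by (metis enBj mult.assoc)
  qed
  have Ath: "A * th + B2 * Fd * th = s *c th - ?Bj"
  proof -
    have "A * th + B2 * Fd * th = (A + B2 * Fd) * Ph s * ?Bj" by (simp add: th_def distrib_right mult.assoc)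
    also have "\<dots> = s *c th - ix n * ?Bj" unfolding isrsv_rules(4)[OF Phi] by (simp add: th_def left_diff_distrib csc_left)
    finally show ?thesis using cars(3) by (simp add: ix_left')
  qed
  have emF: "em j * Fd * th = Fd * th" by (metis comm(3) enth mult.assoc)
  have emFt: "em j * Ft j = Ft j" by (rule Ft1[OF j])
  have emW: "em j * W = W"
    unfolding W_def by (simp add: distrib_left left_diff_distrib right_diff_distrib mult.assoc[symmetric] idem emFt emF)
  \<comment> \<open>\<open>W\<close> is the external input under which the loop with gain
    \<open>Ft j\<close> has the same state \<open>th\<close> as the loop with gain
    \<open>Fd\<close>.\<close>
  have BW: "?Bj * W = s *c th - AF j * th"
  proof -
    have "?Bj * W = B2 * W" by (simp add: mult.assoc emW)
    also have "\<dots> = ?Bj + B2 * Fd * th - B2 * Ft j * th"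
      by (simp add: W_def distrib_left left_diff_distrib right_diff_distrib mult.assoc)
    also have "\<dots> = s *c th - A * th - B2 * Ft j * th" using Ath by (simp add: algebra_simps)
    also have "A * th = A * en j * th" by (simp add: mult.assoc enth)
    finally show ?thesis by (simp add: AF_def distrib_right)
  qed
  have PBW: "?P * ?Bj * W = th"
    unfolding mult.assoc BW[unfolded mult.assoc]
    by (simp add: right_diff_distrib csc_right isrsv_rules(8)[OF P] enth)
  have T12W: "T12 s * em j = (?Dj + CF j * ?P * ?Bj) * W"
  proof -
    have "(?Dj + CF j * ?P * ?Bj) * W = D12 * W + CF j * th"
      using PBW by (simp add: distrib_right mult.assoc emW)
    also have "\<dots> = ?Dj + (C1 + D12 * Fd) * th"
      by (simp add: W_def CF_def distrib_left distrib_right left_diff_distrib right_diff_distrib mult.assoc enth)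
    also have "\<dots> = T12 s * em j" by (simp add: T12_def th_def distrib_right mult.assoc add.commute)
    finally show ?thesis by simp
  qed
  have tP: "tp (AF j) * tp ?P = s *c tp ?P - en j" "tp ?P * tp (AF j) = s *c tp ?P - en j"
    using arg_cong[OF isrsv_rules(3)[OF P], of tp] arg_cong[OF isrsv_rules(4)[OF P], of tp] by (simp_all add: tp_mult)
  have lyap: "tp (CF j) * CF j = - (tp (AF j) * X j) - X j * AF j"
    using lyapF[OF j] unfolding AF_def[symmetric] CF_def[symmetric]
    by (simp add: eq_neg_iff_add_eq_0 eq_diff_eq add.commute add.left_commute add.assoc)
  have ric: "tp ?Dj * CF j = - (tp ?Bj * X j)"
    using ricF[OF j] unfolding CF_def[symmetric] by (simp add: eq_neg_iff_add_eq_0)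
  have "tp ?P * (tp (CF j) * CF j) * ?Q = - ((tp ?P * tp (AF j)) * X j * ?Q) - tp ?P * X j * (AF j * ?Q)"
    unfolding lyap by (simp only: left_diff_distrib right_diff_distrib mult_minus_left mult_minus_right mult.assoc)
  also have "\<dots> = X j * ?Q + tp ?P * X j"
    unfolding tP isrsv_rules(4)[OF Q]
    by (simp add: left_diff_distrib right_diff_distrib csc_left csc_right csc_minus mult.assoc X1[OF j])
  finally have key: "tp ?P * (tp (CF j) * CF j) * ?Q = X j * ?Q + tp ?P * X j" .
  have "em j * tp (T12 s) * CF j * ?Q = tp (T12 s * em j) * CF j * ?Q" by (simp add: tp_mult)
  also have "\<dots> = tp W * (tp ?Dj * CF j * ?Q + tp ?Bj * (tp ?P * (tp (CF j) * CF j) * ?Q))"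
  proof -
    have "tp ((?Dj + CF j * ?P * ?Bj) * W) = tp W * (tp ?Dj + tp ?Bj * (tp ?P * tp (CF j)))"
      by (simp only: tp_mult[of "?Dj + CF j * ?P * ?Bj" W] tp_simps(1) tp_mult[of "CF j * ?P" ?Bj] tp_mult[of "CF j" ?P])
    then show ?thesis unfolding T12W by (simp only: distrib_left distrib_right mult.assoc)
  qed
  also have "\<dots> = tp W * (tp ?Bj * (tp ?P * X j))"
    unfolding ric key by (simp add: distrib_left mult.assoc)
  finally show ?thesis by (simp add: W_def th_def mult.assoc)
qed

text \<open>After whitening, \<open>ep j\<close> passes through the block-diagonal
  \<open>D21 * tp D21\<close> and meets the estimator gains, where it leaves only the
  \<open>j\<close>-th summand of \<open>G0\<close>. So just one control Riccati equation is needed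
  for column \<open>j\<close>, and \<open>lqr_cancel\<close> applies.\<close>

lemma RT_eq:
  assumes j: "j < N" and Phi: "isrsv {..<n} (A + B2 * Fd) s (Ph s)"
    and Ps1: "isrsv {..<n} (A + L * C2) s (Ps s)" and Ps2: "isrsv {..<n} (A + L * C2) (- s) (Ps (- s))"
    and P: "isrsv (tn j) (AF j) s (Pj j s)" and Q: "isrsv (tn j) (AF j) (- s) (Pj j (- s))"
  shows "em j * tp (T12 s) * G0 (- s) * tp (T21 s) * ep j = RT j s"
proof -
  have "(\<Sum>k<N. CF k * Pj k (- s) * Lt k) * ep j = (\<Sum>k<N. if k = j then CF k * Pj k (- s) * Lt k else 0)"
    unfolding sum_distrib_right
  proof (intro sum.cong refl)
    fix k assume "k \<in> {..<N}"
    then show "CF k * Pj k (- s) * Lt k * ep j = (if k = j then CF k * Pj k (- s) * Lt k else 0)"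
      using Lt1(2)[OF j] Lt0[OF j, of k] by (auto simp: mult.assoc)
  qed
  also have "\<dots> = CF j * Pj j (- s) * Lt j" using j by simp
  finally have sum: "(\<Sum>k<N. CF k * Pj k (- s) * Lt k) * ep j = CF j * Pj j (- s) * Lt j" .
  have "G0 (- s) * tp (T21 s) * ep j = C1 * (Ps (- s) * BL * tp (T21 s)) * ep j
      - (\<Sum>k<N. CF k * Pj k (- s) * Lt k) * (T21 (- s) * tp (T21 s)) * ep j"
    by (simp add: G0_def left_diff_distrib mult.assoc)
  also have "\<dots> = C1 * Y * tp (Ps s) * tp C2 * ep j - (\<Sum>k<N. CF k * Pj k (- s) * Lt k) * ep j * (D21 * tp D21)"
    unfolding lqe_cancel[OF Ps2 Ps1] mult.assoc[of "\<Sum>k<N. CF k * Pj k (- s) * Lt k"] commR[OF j] by (simp add: mult.assoc)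
  finally have G: "G0 (- s) * tp (T21 s) * ep j = C1 * Y * tp (Ps s) * tp C2 * ep j - CF j * Pj j (- s) * Lt j * (D21 * tp D21)"
    unfolding sum .
  have "em j * tp (T12 s) * G0 (- s) * tp (T21 s) * ep j = em j * tp (T12 s) * (G0 (- s) * tp (T21 s) * ep j)"
    by (simp only: mult.assoc)
  also have "\<dots> = em j * tp (T12 s) * C1 * Y * tp (Ps s) * tp C2 * ep j
      - (em j * tp (T12 s) * CF j * Pj j (- s)) * Lt j * (D21 * tp D21)"
    unfolding G by (simp only: right_diff_distrib mult.assoc)
  finally show ?thesis unfolding RT_def lqr_cancel[OF j Phi P Q] .
qed

text \<open>Column \<open>j\<close> of \<open>Dl\<close> lives in the rows \<open>em j\<close>.
  Hence only these blocks of \<open>tp P * G * tp R\<close> are tested by \<open>Dl\<close>, and the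
  other blocks may be unstable.\<close>

lemma trace_split:
  assumes Dp: "\<And>j. j < N \<Longrightarrow> Dl * ep j = em j * Dl * ep j" and Dc: "Dl * ix p = Dl"
  shows "tr (tp G * (P * Dl * R)) = (\<Sum>j<N. tr (tp (em j * tp P * G * tp R * ep j) * Dl))"
proof -
  have "Dl = (\<Sum>j<N. Dl * ep j)" by (simp add: sum_distrib_left[symmetric] sumq Dc)
  also have "\<dots> = (\<Sum>j<N. em j * Dl * ep j)" using Dp by (intro sum.cong) auto
  finally have "tp G * (P * Dl * R) = tp G * (P * (\<Sum>j<N. em j * Dl * ep j) * R)" by (rule arg_cong)
  then have D: "tp G * (P * Dl * R) = (\<Sum>j<N. (tp G * P * em j * Dl) * (ep j * R))"
    by (simp add: sum_distrib_left sum_distrib_right mult.assoc)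
  show ?thesis
    unfolding D tr_sum by (subst tr_commute) (simp add: tp_mult mult.assoc)
qed

text \<open>The difference to the optimal loop is \<open>T12 * (Q - Qo) * T21\<close>. Its pairing
  with \<open>G0\<close> at the mirrored point is, column by column, the trace of
  \<open>tp (RT j s) * (Q s - Qo s)\<close>, which is analytic and of order 1/s; that is the
  function \<open>f\<close> required by \<open>hardy_optimal\<close>.\<close>

theorem P2_lower_bound:
  assumes Qb: "holb 0 Q" and Qc: "\<And>s. 0 < Re s \<Longrightarrow> car m p (Q s)"
    and Qp: "\<And>s j. 0 < Re s \<Longrightarrow> j < N \<Longrightarrow> Q s * ep j = em j * Q s * ep j"
    and a: "0 < a"
  shows "(\<integral>\<^sup>+\<omega>. ennreal ((norm (G0 (Complex a \<omega>)))\<^sup>2) \<partial>lborel)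
    \<le> (SUP \<xi>\<in>{0::real<..}. \<integral>\<^sup>+\<omega>. ennreal ((norm (T11 (Complex \<xi> \<omega>) + T12 (Complex \<xi> \<omega>) * Q (Complex \<xi> \<omega>) * T21 (Complex \<xi> \<omega>)))\<^sup>2) \<partial>lborel)"
proof -
  obtain d where d: "0 < d" and h: "hold (- d) Ph" "hold (- d) Ps" "\<And>j. j < N \<Longrightarrow> hold (- d) (Pj j)"
    and iPh: "\<And>s. - d < Re s \<Longrightarrow> isrsv {..<n} (A + B2 * Fd) s (Ph s)"
    and iPs: "\<And>s. - d < Re s \<Longrightarrow> isrsv {..<n} (A + L * C2) s (Ps s)"
    and iPj: "\<And>s j. - d < Re s \<Longrightarrow> j < N \<Longrightarrow> isrsv (tn j) (AF j) s (Pj j s)"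
    using stable_margin by blast
  note b = hold_holb[OF h(1)] hold_holb[OF h(2)] hold_holb[OF h(3)]
  have T11h: "hold (- d) T11" and T12h: "holb (- d) T12" and T21h: "holb (- d) T21"
    unfolding T11_def T12_def T21_def
    by (intro hold_diff hold_mult_left hold_mult_right holb_const holb_mult holb_add holb_diff h b)+
  have Qoh: "hold (- d) Qo"
    unfolding Qo_def by (intro hold_minus hold_sum hold_mult_right hold_mult_left holb_const h) auto
  have G0h: "hold (- d) G0"
    unfolding G0_def
    by (intro hold_diff hold_mult_right[OF hold_sum T21h] hold_mult_left hold_mult_right holb_const h T21h) auto
  define H where "H s = T11 s + T12 s * Q s * T21 s" for s
  have Hh: "holb 0 H"
    unfolding H_def using d by (intro holb_add holb_mult Qb holb_mono[OF hold_holb[OF T11h]] holb_mono[OF T12h] holb_mono[OF T21h]) auto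
  have cPs: "car n n (Ps s)" "car n n (Ph s)" if "- d < Re s" for s
    using isrsv_rules(1,2)[OF iPs[OF that]] isrsv_rules(1,2)[OF iPh[OF that]] by (simp_all add: car_iff)
  have cT21: "car p nw (T21 s)" if "- d < Re s" for s
    unfolding T21_def by (intro car_add cars car_mult[OF car_mult[OF cars(5) cPs(1)[OF that]] cBL])
  have cT12: "car nz m (T12 s)" if "- d < Re s" for s
    unfolding T12_def
    by (intro car_add cars car_mult[OF car_mult[OF car_add[OF cars(4) car_mult[OF cars(6) cars(8)]] cPs(2)[OF that]] cars(3)])
  have cT11: "car nz nw (T11 s)" if "- d < Re s" for s
  proof -
    have "car n nw (B1 - B2 * Fd * Ps s * BL)"
      by (rule car_diff[OF cars(2) car_mult[OF car_mult[OF car_mult[OF cars(3) cars(8)] cPs(1)[OF that]] cBL]])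
    then show ?thesis
      unfolding T11_def
      by (rule car_diff[OF car_mult[OF car_mult[OF car_add[OF cars(4) car_mult[OF cars(6) cars(8)]] cPs(2)[OF that]]]
          car_mult[OF car_mult[OF car_mult[OF cars(6) cars(8)] cPs(1)[OF that]] cBL]])
  qed
  have Hc: "car nz nw (H s)" if s: "0 < Re s" for s
  proof -
    have s': "- d < Re s" using s d by simp
    show ?thesis unfolding H_def
      by (intro car_add cT11[OF s'] car_mult[OF car_mult[OF cT12[OF s'] Qc[OF s]] cT21[OF s']])
  qed
  have G0eq: "G0 s = T11 s + T12 s * Qo s * T21 s" if "- d < Re s" for s
    using closed_loop[OF iPh iPs iPj] that by simp
  have QoP: "Qo s * ep j = em j * Qo s * ep j" if s: "- d < Re s" and j: "j < N" for s j
  proof -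
    have "Qo s * ep j = - (\<Sum>k<N. if k = j then (Ft k - Fd) * Pj k s * Lt k else 0)"
      unfolding Qo_def mult_minus_left sum_distrib_right
    proof (intro arg_cong[of _ _ uminus] sum.cong refl)
      fix k assume "k \<in> {..<N}"
      then show "(Ft k - Fd) * Pj k s * Lt k * ep j = (if k = j then (Ft k - Fd) * Pj k s * Lt k else 0)"
        using Lt1(2)[OF j] Lt0[OF j, of k] by (auto simp: mult.assoc)
    qed
    also have "\<dots> = - ((Ft j - Fd) * Pj j s * Lt j)" using j by simp
    finally have 1: "Qo s * ep j = - ((Ft j - Fd) * Pj j s * Lt j)" .
    have "em j * ((Ft j - Fd) * Pj j s) = em j * Ft j * Pj j s - em j * Fd * Pj j s" by (simp add: algebra_simps)
    also have "\<dots> = Ft j * Pj j s - Fd * (en j * Pj j s)"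
      unfolding Ft1(1)[OF j] commF[OF j, symmetric] by (simp add: mult.assoc)
    also have "\<dots> = (Ft j - Fd) * Pj j s" by (simp add: isrsv_rules(1)[OF iPj[OF s j]] left_diff_distrib)
    finally have 2: "em j * ((Ft j - Fd) * Pj j s) = (Ft j - Fd) * Pj j s" .
    have "em j * Qo s * ep j = - (em j * ((Ft j - Fd) * Pj j s) * Lt j)"
      by (simp only: mult.assoc[of "em j" "Qo s"] 1 mult_minus_right mult.assoc)
    then show ?thesis unfolding 1 2 by simp
  qed
  have Qoc: "Qo s * ix p = Qo s" if "- d < Re s" for s
  proof -
    have "Lt k * ix p = Lt k" if "k < N" for k
    proof -
      have "ep k * ix p = ep k" using tsets(3)[OF that] fins(3)[OF that] by (simp add: dg_mult Int_absorb2)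
      then show ?thesis using Lt1(2)[OF that] by (metis mult.assoc)
    qed
    then show ?thesis unfolding Qo_def by (simp add: sum_distrib_right mult.assoc)
  qed
  define f where "f s = tr (\<Sum>j<N. tp (RT j s) * (Q s - Qo s))" for s
  have RTh: "hold 0 (RT j)" if j: "j < N" for j
  proof -
    note k = hold_mono[OF h(2), of 0] holb_mono[OF T12h, of 0] hold_mono[OF h(1), of 0] hold_mono[OF h(3)[OF j], of 0]
    show ?thesis
      unfolding RT_def using d
      by (intro hold_diff hold_mult_right holb_const hold_mult_left[OF holb_mult hold_tp] hold_mult_left holb_mult holb_tp holb_add hold_tp
          k hold_holb[OF k(3)]) auto
  qed
  have fh: "hold 0 (\<lambda>s. \<Sum>j<N. tp (RT j s) * (Q s - Qo s))"
    using d by (intro hold_sum hold_mult_right hold_tp RTh holb_diff Qb holb_mono[OF hold_holb[OF Qoh]]) auto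
  obtain C' where C': "\<And>s. 0 < Re s \<Longrightarrow> cmod (f s) * cmod s \<le> C'" using hold_trace(2)[OF fh] unfolding f_def by blast
  obtain C where C: "\<And>s. - d < Re s \<Longrightarrow> norm (G0 s) * (1 + cmod s) \<le> C" using G0h unfolding hold_def by blast
  have "(\<integral>\<^sup>+\<omega>. ennreal ((norm (G0 (Complex a \<omega>)))\<^sup>2) \<partial>lborel)
    \<le> (SUP \<xi>\<in>{0::real<..}. \<integral>\<^sup>+\<omega>. ennreal ((norm (H (Complex \<xi> \<omega>)))\<^sup>2) \<partial>lborel)"
  proof (rule hardy_optimal[OF d])
    show "car nz nw (G0 s)" if s: "- d < Re s" for s
    proof -
      have "car m p (Qo s)"
      proof -
        have "ix m * Qo s = Qo s"
        proof -
          have "ix m * Ft k = Ft k" if k: "k < N" for k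
          proof -
            have "ix m * em k = em k" using tsets(2)[OF k] fins(2)[OF k] by (simp add: dg_mult Int_absorb1)
            then show ?thesis using Ft1(1)[OF k] by (metis mult.assoc)
          qed
          then show ?thesis
            unfolding Qo_def using ix_left[OF cars(8)]
            by (simp add: sum_distrib_left mult.assoc[symmetric] right_diff_distrib)
        qed
        then show ?thesis using Qoc[OF s] by (simp add: car_iff)
      qed
      then show ?thesis unfolding G0eq[OF s] by (intro car_add cT11[OF s] car_mult[OF car_mult[OF cT12[OF s]] cT21[OF s]])
    qed
    show "(\<lambda>s. ent (G0 s) i j) holomorphic_on {s. - d < Re s}" for i j using G0h unfolding hold_def holb_def by blast
    show "norm (G0 s) * (1 + cmod s) \<le> C" if "- d < Re s" for s by (rule C[OF that])
    show "cj (G0 s) = G0 (cnj s)" if s: "- d < Re s" for s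
    proof -
      have 1: "cj (Ps s) = Ps (cnj s)"
        using rsv_eq[OF isrsv_cnj[OF iPs[OF s]]] by (simp add: Ps_def cj_mult reals)
      have 2: "cj (Pj j s) = Pj j (cnj s)" if j: "j < N" for j
        using rsv_eq[OF isrsv_cnj[OF iPj[OF s j]]] j by (simp add: Pj_def AF_def cj_mult reals)
      have 3: "cj (\<Sum>j<N. CF j * Pj j s * Lt j) = (\<Sum>j<N. CF j * Pj j (cnj s) * Lt j)"
        unfolding cj_sum by (intro sum.cong refl) (simp add: cj_mult CF_def reals 2)
      show ?thesis by (simp add: G0_def T21_def BL_def cj_mult reals 1 3)
    qed
    show "car nz nw (H s)" if "0 < Re s" for s by (rule Hc[OF that])
    show "(\<lambda>s. ent (H s) i j) holomorphic_on {s. 0 < Re s}" for i j using Hh unfolding holb_def by blast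
    show "f holomorphic_on {s. 0 < Re s}" unfolding f_def by (rule hold_trace(1)[OF fh])
    show "cmod (f s) * cmod s \<le> C'" if "0 < Re s" for s by (rule C'[OF that])
    show "tr (tp (G0 (- s)) * (H s - G0 s)) = f s" if s: "0 < Re s" "Re s < d" for s
    proof -
      have sd: "- d < Re s" "- d < Re (- s)" using s by auto
      have "H s - G0 s = T12 s * (Q s - Qo s) * T21 s"
        unfolding H_def G0eq[OF sd(1)] by (simp add: algebra_simps)
      then have "tr (tp (G0 (- s)) * (H s - G0 s)) = (\<Sum>j<N. tr (tp (em j * tp (T12 s) * G0 (- s) * tp (T21 s) * ep j) * (Q s - Qo s)))"
        using Qp[OF s(1)] QoP[OF sd(1)] Qoc[OF sd(1)] ix_right[OF Qc[OF s(1)]]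
        by (simp only:) (rule trace_split, simp_all add: left_diff_distrib right_diff_distrib)
      also have "\<dots> = (\<Sum>j<N. tr (tp (RT j s) * (Q s - Qo s)))"
        by (intro sum.cong refl) (subst RT_eq, use sd in \<open>auto intro: iPh iPs iPj\<close>)
      finally show ?thesis by (simp add: f_def tr_sum)
    qed
  qed (rule a)
  then show ?thesis unfolding H_def .
qed

end

section \<open>Youla parametrization at a point\<close>

text \<open>The second resolvent identity, with \<open>x\<close> left free for a factored form of
  the difference.\<close>

lemma rsv_ident:
  assumes a: "isrsv T a s R" and b: "isrsv T b s R'" and d: "a - b = x"
  shows "R * x * R' = R - R'"
proof -
  have "R * (a - b) * R' = (R * a) * R' - R * (b * R')" by (simp add: algebra_simps)
  also have "\<dots> = R - R'"
    unfolding isrsv_rules(3)[OF a] isrsv_rules(4)[OF b]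
    by (simp add: algebra_simps csc_left csc_right isrsv_rules(1)[OF b] isrsv_rules(2)[OF a])
  finally show ?thesis unfolding d .
qed

locale youla =
  fixes n m p nw nz :: nat and A B1 B2 C1 C2 D12 D21 Fd L :: fmat and s :: complex and Th Ph Ps :: fmat
  assumes cars: "car n n A" "car n nw B1" "car n m B2" "car nz n C1" "car p n C2" "car nz m D12" "car p nw D21"
      "car m n Fd" "car n p L"
    and Th: "isrsv {..<n} A s Th" and Ph: "isrsv {..<n} (A + B2 * Fd) s Ph" and Ps: "isrsv {..<n} (A + L * C2) s Ps"
begin

text \<open>Doubly coprime factors of \<open>P22\<close>: \<open>Mt\<close>, \<open>Nt\<close>,
  \<open>Vt\<close>, \<open>Ut\<close> come from the observer with gain \<open>L\<close>, and
  \<open>U\<close>, \<open>V\<close>, \<open>Nn\<close>, \<open>Mm\<close> from the state feedback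
  \<open>Fd\<close>. They contain only the resolvents \<open>Ps\<close> and \<open>Ph\<close>, hence
  are stable even if \<open>P22\<close> is not.\<close>

definition "Mt = ix p + C2 * Ps * L"
definition "Nt = C2 * Ps * B2"
definition "Vt = ix m - Fd * Ps * B2"
definition "Ut = Fd * Ps * L"
definition "U = - (Fd * Ph * L)"
definition "V = ix p - C2 * Ph * L"
definition "Nn = C2 * Ph * B2"
definition "Mm = ix m + Fd * Ph * B2"
definition "P22 = C2 * Th * B2"
text \<open>The controller \<open>K\<close> has the Youla parameter \<open>Q\<close>.\<close>

definition rel :: "fmat \<Rightarrow> fmat \<Rightarrow> bool" where "rel K Q \<longleftrightarrow> Q * (Mt - Nt * K) = Vt * K + Ut"

lemmas defs = Mt_def Nt_def Vt_def Ut_def U_def V_def Nn_def Mm_def P22_def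

text \<open>Resolvent identities as rewrite rules. The trailing \<open>x\<close> makes them apply
  inside products that are associated to the right.\<close>

lemma ids:
  "Ph * (B2 * (Fd * (Ps * x))) = Ph * x - Ps * x + Ph * (L * (C2 * (Ps * x)))"
  "Ps * (L * (C2 * (Th * x))) = Ps * x - Th * x"
  "Th * (L * (C2 * (Ps * x))) = Ps * x - Th * x"
  "Th * (B2 * (Fd * (Ph * x))) = Ph * x - Th * x"
proof -
  have 1: "Ph * (B2 * Fd - L * C2) * Ps = Ph - Ps" by (rule rsv_ident[OF Ph Ps]) simp
  have 2: "Ps * (L * C2) * Th = Ps - Th" by (rule rsv_ident[OF Ps Th]) simp
  have 3: "Th * (- (L * C2)) * Ps = Th - Ps" by (rule rsv_ident[OF Th Ps]) simp
  have 4: "Th * (- (B2 * Fd)) * Ph = Th - Ph" by (rule rsv_ident[OF Th Ph]) simp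
  show "Ph * (B2 * (Fd * (Ps * x))) = Ph * x - Ps * x + Ph * (L * (C2 * (Ps * x)))"
    using arg_cong[OF 1, of "\<lambda>y. y * x"] by (simp add: algebra_simps)
  show "Ps * (L * (C2 * (Th * x))) = Ps * x - Th * x"
    using arg_cong[OF 2, of "\<lambda>y. y * x"] by (simp add: algebra_simps)
  show "Th * (L * (C2 * (Ps * x))) = Ps * x - Th * x"
    using arg_cong[OF 3, of "\<lambda>y. - (y * x)"] by (simp add: algebra_simps)
  show "Th * (B2 * (Fd * (Ph * x))) = Ph * x - Th * x"
    using arg_cong[OF 4, of "\<lambda>y. - (y * x)"] by (simp add: algebra_simps)
qed

lemma ixs:
  "ix p * (C2 * x) = C2 * x" "ix p * C2 = C2" "L * ix p = L" "L * (ix p * x) = L * x"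
  "ix m * (Fd * x) = Fd * x" "ix m * Fd = Fd" "B2 * ix m = B2" "B2 * (ix m * x) = B2 * x" "Th * (ix n * x) = Th * x"
  using ix_left'[OF cars(5)] ix_left[OF cars(5)] ix_right[OF cars(9)] ix_right'[OF cars(9)]
    ix_left'[OF cars(8)] ix_left[OF cars(8)] ix_right[OF cars(3)] ix_right'[OF cars(3)] isrsv_rules(6)[OF Th]
  by auto

lemma bezout:
  "V * Mt + Nn * Ut = ix p" "Nn * Vt = V * Nt" "U * Mt + Mm * Ut = 0" "Mm * Vt - U * Nt = ix m" "Mt * P22 = Nt"
  "(V - P22 * U) * Mt = ix p"
  unfolding defs by (simp_all add: algebra_simps ids ixs dg_mult)

lemma car_idx: "car m p K \<Longrightarrow> ix m * K = K" "car m p K \<Longrightarrow> K * ix p = K"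
  by (auto simp: car_iff)

text \<open>The Bezout identities solve the relation for \<open>K\<close>: the inverse of
  \<open>Mt - Nt * K\<close> is \<open>V + Nn * Q\<close>, and \<open>K\<close> is
  \<open>U + Mm * Q\<close> times \<open>Mt - Nt * K\<close>.\<close>

lemma rel_inverse:
  assumes K: "car m p K" and r: "rel K Q"
  shows "(V + Nn * Q) * (Mt - Nt * K) = ix p" "(U + Mm * Q) * (Mt - Nt * K) = K"
    "Mt * (ix p - P22 * K) = Mt - Nt * K"
proof -
  have r': "Q * (Mt - Nt * K) = Vt * K + Ut" using r by (simp add: rel_def)
  have "(V + Nn * Q) * (Mt - Nt * K) = V * Mt - V * Nt * K + Nn * (Q * (Mt - Nt * K))" by (simp add: algebra_simps)
  also have "\<dots> = (V * Mt + Nn * Ut) + (Nn * Vt - V * Nt) * K" unfolding r' by (simp add: algebra_simps)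
  finally show "(V + Nn * Q) * (Mt - Nt * K) = ix p" by (simp add: bezout)
  have "(U + Mm * Q) * (Mt - Nt * K) = U * Mt - U * Nt * K + Mm * (Q * (Mt - Nt * K))" by (simp add: algebra_simps)
  also have "\<dots> = (U * Mt + Mm * Ut) + (Mm * Vt - U * Nt) * K" unfolding r' by (simp add: algebra_simps)
  finally show "(U + Mm * Q) * (Mt - Nt * K) = K" by (simp add: bezout car_idx[OF K])
  have "Mt * ix p = Mt" by (simp add: Mt_def distrib_right mult.assoc ixs dg_mult)
  then show "Mt * (ix p - P22 * K) = Mt - Nt * K" by (simp add: right_diff_distrib mult.assoc[symmetric] bezout)
qed

text \<open>These are the four blocks of one matrix equation: \<open>Wv * Mt\<close>,
  \<open>Wv * Nt\<close>, \<open>Wu * Mt\<close> and \<open>ix m + Wu * Nt\<close> form a left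
  inverse of the feedback matrix. They are stable whenever \<open>Q\<close> is.\<close>

lemma rel_stabilizing:
  assumes K: "car m p K" and r: "rel K Q"
  defines "Wv \<equiv> V + Nn * Q" and "Wu \<equiv> U + Mm * Q"
  shows "Wv * Mt - Wv * Nt * K = ix p" "- (Wv * Mt * P22) + Wv * Nt = 0"
    "Wu * Mt - (ix m + Wu * Nt) * K = 0" "- (Wu * Mt * P22) + (ix m + Wu * Nt) = ix m"
proof -
  note i = rel_inverse[OF K r, folded Wv_def Wu_def]
  show "Wv * Mt - Wv * Nt * K = ix p" "Wu * Mt - (ix m + Wu * Nt) * K = 0"
    using i(1,2) by (simp_all add: algebra_simps car_idx[OF K])
  show "- (Wv * Mt * P22) + Wv * Nt = 0" "- (Wu * Mt * P22) + (ix m + Wu * Nt) = ix m"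
    by (simp_all add: mult.assoc bezout)
qed

text \<open>Solving the relation for \<open>Q\<close> gives \<open>Vt * K + Ut\<close> times the
  inverse of \<open>Mt - Nt * K\<close>. That inverse is \<open>H11 * V - H12 * U\<close>, and
  \<open>K\<close> times it is \<open>H21 * V - H22 * U + U\<close>. In this form \<open>K\<close>
  itself disappears, and only blocks of the closed-loop inverse remain.\<close>

lemma rel_from_inverse:
  assumes K: "car m p K" and H: "H11 * (ix p - P22 * K) = ix p" "H12 = H11 * P22" "H21 = K * H11" "H22 = ix m + K * (H11 * P22)"
    and Q: "Q = Vt * (H21 * V - H22 * U + U) + Ut * (H11 * V - H12 * U)"
  shows "rel K Q"
proof -
  have U1: "ix m * U = U" by (simp add: U_def mult.assoc ixs)
  have Mk: "Mt * (ix p - P22 * K) = Mt - Nt * K"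
  proof -
    have "Mt * ix p = Mt" by (simp add: Mt_def distrib_right mult.assoc ixs dg_mult)
    then show ?thesis by (simp add: right_diff_distrib mult.assoc[symmetric] bezout)
  qed
  have g: "(H11 * V - H12 * U) * (Mt - Nt * K) = ix p"
  proof -
    have p22: "ix p * (ix p - P22 * K) = ix p - P22 * K" by (simp add: right_diff_distrib P22_def mult.assoc ixs dg_mult)
    have "(H11 * V - H12 * U) * (Mt - Nt * K) = H11 * ((V - P22 * U) * Mt * (ix p - P22 * K))"
      unfolding Mk[symmetric] H(2) by (simp add: algebra_simps)
    then show ?thesis unfolding bezout p22 H(1) .
  qed
  have e: "H21 * V - H22 * U + U = K * (H11 * V - H12 * U)"
    unfolding H(2-4) by (simp add: algebra_simps U1)
  have "Q * (Mt - Nt * K) = (Vt * K + Ut) * ((H11 * V - H12 * U) * (Mt - Nt * K))"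
    unfolding Q e by (simp only: distrib_right mult.assoc)
  also have "\<dots> = Vt * K + Ut"
    unfolding g by (simp add: distrib_right mult.assoc car_idx[OF K] Ut_def ixs)
  finally show ?thesis by (simp add: rel_def)
qed

text \<open>Both sides describe one loop: once \<open>K\<close> around the plant, once a fixed
  observer with state feedback to which \<open>Q\<close> is attached, fed by the
  innovations.\<close>

lemma rel_cost:
  assumes K: "car m p K" and r: "rel K Q" and G: "(ix p - P22 * K) * G = ix p" and cG: "car p p G"
  shows "C1 * Th * B1 + (C1 * Th * B2 + D12) * K * G * (C2 * Th * B1 + D21) =
     (C1 + D12 * Fd) * Ph * (B1 - B2 * Fd * Ps * (B1 + L * D21)) - D12 * Fd * Ps * (B1 + L * D21)
     + ((C1 + D12 * Fd) * Ph * B2 + D12) * Q * (C2 * Ps * (B1 + L * D21) + D21)"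
proof -
  \<comment> \<open>The signals in response to the disturbance: \<open>ga\<close> is the
    measurement, \<open>mu\<close> the input, \<open>ch\<close> the plant state, \<open>et\<close>
    the observer state and \<open>e\<close> the estimation error.\<close>
  define ga where "ga = G * (C2 * Th * B1 + D21)"
  define mu where "mu = K * ga"
  define ch where "ch = Th * (B1 + B2 * mu)"
  define et where "et = Ps * (B2 * mu - L * ga)"
  define e where "e = Ps * (B1 + L * D21)"
  have y: "C2 * Th * B1 + D21 = ix p * (C2 * Th * B1 + D21)" by (simp add: distrib_left mult.assoc ixs ix_left[OF cars(7)])
  have "ix p * ga - P22 * (K * ga) = ((ix p - P22 * K) * G) * (C2 * Th * B1 + D21)"
    by (simp add: ga_def left_diff_distrib mult.assoc)
  then have "ga = P22 * (K * ga) + (C2 * Th * B1 + D21)"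
    unfolding G y[symmetric] using ix_left'[OF cG] by (simp add: ga_def diff_eq_eq add.commute)
  then have ga: "ga = C2 * ch + D21" by (simp add: ch_def mu_def P22_def algebra_simps)
  have ech: "ch - et = e"
  proof -
    have "Ps * (L * (C2 * ch)) = Ps * (B1 + B2 * mu) - ch"
      unfolding ch_def by (simp only: ids)
    then show ?thesis unfolding et_def e_def ga by (simp add: algebra_simps)
  qed
  have T21: "Mt * ga - Nt * mu = C2 * e + D21"
  proof -
    have "Mt * ga - Nt * mu = ix p * ga - C2 * et" by (simp add: Mt_def Nt_def et_def algebra_simps)
    also have "ix p * ga = ga" using ix_left'[OF cG] by (simp add: ga_def)
    also have "ga - C2 * et = C2 * (ch - et) + D21" by (subst ga) (simp add: right_diff_distrib)
    finally show ?thesis unfolding ech .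
  qed
  have Q: "Q * (C2 * e + D21) = mu - Fd * et"
  proof -
    have "Q * (C2 * e + D21) = Q * (Mt - Nt * K) * ga"
      unfolding T21[symmetric] by (simp add: mu_def algebra_simps)
    also have "\<dots> = Vt * mu + Ut * ga" using r by (simp add: rel_def mu_def distrib_right mult.assoc)
    also have "\<dots> = ix m * mu - Fd * et" by (simp add: Vt_def Ut_def et_def algebra_simps)
    also have "ix m * mu = mu" using ix_left'[OF K] by (simp add: mu_def)
    finally show ?thesis .
  qed
  have inc: "ix n * ch = ch" by (simp add: ch_def isrsv_rules[OF Th])
  have "(A + B2 * Fd) * ch + (B1 + B2 * (mu - Fd * ch)) = s *c ch"
  proof -
    have "A * ch = s *c ch - ix n * (B1 + B2 * mu)" unfolding ch_def by (rule isrsv_rules(7)[OF Th])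
    then show ?thesis by (simp add: algebra_simps ix_left[OF cars(2)] ix_left'[OF cars(3)])
  qed
  then have "(s *c ix n - (A + B2 * Fd)) * ch = B1 + B2 * (mu - Fd * ch)"
    by (simp add: left_diff_distrib csc_left inc diff_eq_eq add.commute)
  then have "Ph * ((s *c ix n - (A + B2 * Fd)) * ch) = Ph * (B1 + B2 * (mu - Fd * ch))" by simp
  then have ch: "ch = Ph * (B1 + B2 * (mu - Fd * ch))"
    using Ph inc unfolding isrsv_def mult.assoc[symmetric] by simp
  have et: "et = ch - e" using ech by (simp add: algebra_simps)
  have "C1 * Th * B1 + (C1 * Th * B2 + D12) * K * G * (C2 * Th * B1 + D21) = C1 * ch + D12 * mu"
    by (simp add: ch_def mu_def ga_def algebra_simps)
  also have "\<dots> = (C1 + D12 * Fd) * ch - D12 * Fd * e + D12 * (mu - Fd * et)"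
    unfolding et by (simp add: algebra_simps)
  also have "(C1 + D12 * Fd) * ch = (C1 + D12 * Fd) * (Ph * (B1 + B2 * (mu - Fd * et) - B2 * Fd * e))"
  proof -
    have "B1 + B2 * (mu - Fd * ch) = B1 + B2 * (mu - Fd * et) - B2 * Fd * e" unfolding et by (simp add: algebra_simps)
    then show ?thesis by (subst ch) (simp only:)
  qed
  finally show ?thesis unfolding Q[symmetric] e_def by (simp add: algebra_simps)
qed

text \<open>The inverse in the fractional transformation exists because it can be written down as
  \<open>y * V\<close>. The formula for \<open>K\<close> is claimed for every left inverse
  \<open>G\<close>, so that it applies to the value of \<open>inv_mat\<close>.\<close>

lemma rel_lft:
  assumes K: "car m p K" and Qc: "car m p Q" and r: "rel K Q" and Ga: "isrsv {..<n} (A + B2 * Fd + L * C2) s Ga"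
  shows "\<exists>G. car p p G \<and> (ix p + C2 * Ga * B2 * Q) * G = ix p \<and>
    (\<forall>G. car p p G \<longrightarrow> G * (ix p + C2 * Ga * B2 * Q) = ix p \<longrightarrow>
      K = - (Fd * Ga * L) + (ix m + Fd * Ga * B2) * Q * G * (ix p + C2 * Ga * L))"
proof -
  \<comment> \<open>For the controller alone, driven by the measurement: \<open>y\<close> is the
    innovation of the observer and \<open>v\<close> the output of \<open>Q\<close>.\<close>
  define y where "y = Mt - Nt * K"
  define v where "v = Vt * K + Ut"
  have v: "v = Q * y" using r by (simp add: rel_def y_def v_def)
  have g1: "Ga * (B2 * (Fd * (Ps * x))) = Ga * x - Ps * x" for x
  proof -
    have "Ga * (B2 * Fd) * Ps = Ga - Ps" by (rule rsv_ident[OF Ga Ps]) simp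
    then have "Ga * (B2 * Fd) * Ps * x = (Ga - Ps) * x" by (simp only:)
    then show ?thesis by (simp add: algebra_simps)
  qed
  have g2: "Ga * (L * (C2 * (Ph * x))) = Ga * x - Ph * x" for x
  proof -
    have "Ga * (L * C2) * Ph = Ga - Ph" by (rule rsv_ident[OF Ga Ph]) (simp add: algebra_simps)
    then have "Ga * (L * C2) * Ph * x = (Ga - Ph) * x" by (simp only:)
    then show ?thesis by (simp add: algebra_simps)
  qed
  have iK: "ix m * K = K" "K * ix p = K" using K by (auto simp: car_iff)
  have GB: "Ga * (B2 * v) = Ga * (B2 * K) - (Ga * (B2 * K) - Ps * (B2 * K)) + (Ga * L - Ps * L)"
    unfolding v_def Vt_def Ut_def by (simp add: algebra_simps g1 ixs)
  have yy: "(ix p + C2 * Ga * B2 * Q) * y = ix p + C2 * Ga * L"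
  proof -
    have "ix p * y = y" by (simp add: y_def Mt_def Nt_def distrib_left right_diff_distrib mult.assoc ixs dg_mult)
    then have "(ix p + C2 * Ga * B2 * Q) * y = y + C2 * (Ga * (B2 * v))" by (simp add: distrib_right v mult.assoc)
    also have "\<dots> = ix p + C2 * Ga * L" unfolding GB y_def Mt_def Nt_def by (simp add: algebra_simps)
    finally show ?thesis .
  qed
  have JV: "(ix p + C2 * Ga * L) * V = ix p"
    unfolding V_def by (simp add: algebra_simps g2 ixs dg_mult)
  have cP: "car n n Ph" "car n n Ps" "car n n Ga"
    using isrsv_rules(1,2)[OF Ph] isrsv_rules(1,2)[OF Ps] isrsv_rules(1,2)[OF Ga] by (simp_all add: car_iff)
  have cV: "car p p V" unfolding V_def by (intro car_diff car_ix car_mult[OF car_mult[OF cars(5) cP(1)] cars(9)])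
  have cy: "car p p y" unfolding y_def Mt_def Nt_def
    by (intro car_diff car_add car_ix car_mult[OF car_mult[OF cars(5) cP(2)] cars(9)] car_mult[OF car_mult[OF car_mult[OF cars(5) cP(2)] cars(3)] K])
  have Kv: "K = Fd * (Ga * (B2 * v) - Ga * L) + v"
  proof -
    have "Fd * (Ga * (B2 * v) - Ga * L) + v = Fd * (Ps * (B2 * K)) - Fd * (Ps * L) + v"
      unfolding GB by (simp add: algebra_simps)
    also have "\<dots> = K" by (simp add: v_def Vt_def Ut_def algebra_simps iK)
    finally show ?thesis by simp
  qed
  show ?thesis
  proof (intro exI[of _ "y * V"] conjI allI impI)
    show "car p p (y * V)" by (rule car_mult[OF cy cV])
    show "(ix p + C2 * Ga * B2 * Q) * (y * V) = ix p" unfolding mult.assoc[symmetric] yy[unfolded mult.assoc[symmetric]] JV[unfolded mult.assoc[symmetric]] ..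
    fix G assume G: "car p p G" "G * (ix p + C2 * Ga * B2 * Q) = ix p"
    have "y = G * ((ix p + C2 * Ga * B2 * Q) * y)" unfolding mult.assoc[symmetric] G(2)[unfolded mult.assoc[symmetric]] by (simp add: ix_left[OF cy])
    then have y: "y = G * (ix p + C2 * Ga * L)" unfolding yy .
    have iv: "ix m * v = v" unfolding v by (rule ix_left'[OF Qc])
    have "- (Fd * Ga * L) + (ix m + Fd * Ga * B2) * Q * G * (ix p + C2 * Ga * L) = - (Fd * Ga * L) + (ix m + Fd * Ga * B2) * v"
    proof -
      have as: "a * b * c * d = a * (b * (c * d))" for a b c d :: fmat by (simp only: mult.assoc)
      show ?thesis by (simp only: as[of _ Q G] y[symmetric] v)
    qed
    also have "\<dots> = K" by (subst Kv) (simp add: algebra_simps iv)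
    finally show "K = - (Fd * Ga * L) + (ix m + Fd * Ga * B2) * Q * G * (ix p + C2 * Ga * L)" by simp
  qed
qed

text \<open>The controller with states \<open>x k\<close> is related to \<open>Q\<close>: the observer state is \<open>\<Sum>x k\<close>.\<close>

lemma rel_from_states:
  fixes N :: nat and Ft Lt x R :: "nat \<Rightarrow> fmat"
  assumes sumL: "L = (\<Sum>k<N. Lt k)"
    and R: "\<And>k. k < N \<Longrightarrow> isrsv {..<n} (A + B2 * Ft k) s (R k)"
    and inx: "\<And>k. k < N \<Longrightarrow> ix n * x k = x k"
    and st: "\<And>k. k < N \<Longrightarrow> s *c x k = (A + B2 * Ft k) * x k + Lt k * (C2 * (\<Sum>l<N. x l)) - Lt k"
    and Ltc: "\<And>k. k < N \<Longrightarrow> car n p (Lt k)"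
    and K: "K = (\<Sum>k<N. Ft k * x k)" and Kc: "car m p K" and Q: "Q = - (\<Sum>k<N. (Ft k - Fd) * R k * Lt k)"
  shows "rel K Q"
proof -
  define et where "et = (\<Sum>l<N. x l)"
  have xk: "x k = - (R k * Lt k * (ix p - C2 * et))" if k: "k < N" for k
  proof -
    have "(s *c ix n - (A + B2 * Ft k)) * x k = - (Lt k * (ix p - C2 * et))"
      using st[OF k] inx[OF k] ix_right[OF Ltc[OF k]]
      by (simp add: left_diff_distrib right_diff_distrib csc_left et_def)
    then have "R k * ((s *c ix n - (A + B2 * Ft k)) * x k) = - (R k * Lt k * (ix p - C2 * et))" by (simp add: mult.assoc)
    then show ?thesis using R[OF k] inx[OF k] unfolding isrsv_def mult.assoc[symmetric] by simp
  qed
  have ine: "ix n * et = et" using inx by (simp add: et_def sum_distrib_left)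
  have "s *c et = (\<Sum>k<N. s *c x k)" unfolding et_def by (rule fmat_eqI) (simp add: sum_distrib_left)
  also have "\<dots> = (\<Sum>k<N. (A + B2 * Ft k) * x k + Lt k * (C2 * et) - Lt k)"
    unfolding et_def using st by (intro sum.cong) auto
  also have "\<dots> = A * et + B2 * K + L * (C2 * et) - L"
  proof -
    have 1: "A * et = (\<Sum>k<N. A * x k)" by (simp add: et_def sum_distrib_left)
    have 2: "B2 * K = (\<Sum>k<N. B2 * (Ft k * x k))" by (simp add: K sum_distrib_left)
    have 3: "L * (C2 * et) = (\<Sum>k<N. Lt k * (C2 * et))" by (simp add: sumL sum_distrib_right)
    show ?thesis
      unfolding 1 2 3 by (simp add: sum.distrib sum_subtractf distrib_right mult.assoc sumL)
  qed
  finally have "(s *c ix n - (A + L * C2)) * et = B2 * K - L"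
    by (simp add: left_diff_distrib csc_left ine distrib_right mult.assoc)
  then have "Ps * ((s *c ix n - (A + L * C2)) * et) = Ps * (B2 * K - L)" by simp
  then have et: "et = Ps * (B2 * K - L)"
    using Ps ine unfolding isrsv_def mult.assoc[symmetric] by simp
  have y: "Mt - Nt * K = ix p - C2 * et" unfolding et Mt_def Nt_def by (simp add: algebra_simps)
  have "Q * (ix p - C2 * et) = (\<Sum>k<N. (Ft k - Fd) * x k)"
    unfolding Q mult_minus_left sum_distrib_right sum_negf[symmetric]
    by (intro sum.cong refl) (simp add: xk mult.assoc)
  also have "\<dots> = K - Fd * et" by (simp add: K et_def left_diff_distrib sum_subtractf sum_distrib_left)
  also have "\<dots> = Vt * K + Ut"
    unfolding et Vt_def Ut_def using ix_left[OF Kc] by (simp add: algebra_simps)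
  finally show ?thesis unfolding rel_def y .
qed

end

section \<open>Block patterns\<close>

text \<open>For coordinate projections \<open>P\<close> and \<open>R\<close>: \<open>M\<close> maps the range of \<open>R\<close> into the range of \<open>P\<close>.\<close>

definition pat :: "fmat \<Rightarrow> fmat \<Rightarrow> fmat \<Rightarrow> bool" where
  "pat P R M \<longleftrightarrow> M * R = P * M * R"

lemma pat_mult: "pat P R M \<Longrightarrow> pat R S M' \<Longrightarrow> pat P S (M * M')"
  unfolding pat_def by (metis mult.assoc)

lemma pat_add: "pat P R M \<Longrightarrow> pat P R M' \<Longrightarrow> pat P R (M + M')"
  and pat_diff: "pat P R M \<Longrightarrow> pat P R M' \<Longrightarrow> pat P R (M - M')"
  and pat_minus: "pat P R M \<Longrightarrow> pat P R (- M)"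
  unfolding pat_def by (simp_all add: distrib_left distrib_right left_diff_distrib right_diff_distrib)

lemma pat_comm: "M * R = P * M \<Longrightarrow> R * R = R \<Longrightarrow> pat P R M"
  unfolding pat_def by (metis mult.assoc)

text \<open>Block triangular elimination: \<open>M\<close> factors through \<open>X = P M P + (1 - P)\<close>, whose inverse leaves the range of \<open>P\<close> invariant.\<close>

lemma pat_inverse:
  assumes T: "T \<subseteq> {..<k}" and M: "car k k M" and pat: "pat (dg T) (dg T) M"
    and W: "car k k W" "W * M = ix k" "M * W = ix k"
  shows "pat (dg T) (dg T) W"
proof -
  let ?P = "dg T"
  have fT: "finite T" using T finite_subset by blast
  have P: "?P * ?P = ?P" "ix k * ?P = ?P" "?P * ix k = ?P" "car k k ?P"
    using T fT by (simp_all add: dg_mult Int_absorb1 Int_absorb2 car_dg)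
  have MP: "M * ?P = ?P * M * ?P" using pat by (simp add: pat_def)
  define X where "X = ?P * M * ?P + (ix k - ?P)"
  have cX: "car k k X" unfolding X_def by (intro car_add car_diff car_ix P(4) car_mult[OF car_mult[OF P(4) M] P(4)])
  have PX: "?P * X = ?P * M * ?P" "(ix k - ?P) * X = ix k - ?P"
    unfolding X_def by (simp_all add: algebra_simps P dg_mult) (simp_all add: P mult.assoc[symmetric])
  have "inj_mul k X" unfolding inj_mul_def
  proof (intro allI impI)
    fix x assume x: "ix k * x = x" "X * x = 0"
    have "M * (?P * x) = ?P * X * x" unfolding PX MP[symmetric] by (simp add: mult.assoc)
    also have "\<dots> = 0" using x by (simp add: mult.assoc)
    finally have "W * (M * (?P * x)) = 0" by simp
    then have "?P * x = 0" unfolding mult.assoc[symmetric] W P by simp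
    moreover have "(ix k - ?P) * X * x = 0" using x by (simp add: mult.assoc)
    then have "x - ?P * x = 0" unfolding PX by (simp add: left_diff_distrib x)
    ultimately show "x = 0" by simp
  qed
  then obtain V where V: "car k k V" "X * V = ix k" using inverse_exists[OF cX] by blast
  have "(ix k - ?P) * (X * V) = (ix k - ?P) * V" unfolding mult.assoc[symmetric] PX ..
  then have "ix k - ?P = V - ?P * V" unfolding V(2) by (simp add: left_diff_distrib ix_left[OF V(1)] dg_mult P)
  then have "(ix k - ?P) * ?P = (V - ?P * V) * ?P" by simp
  then have VP: "V * ?P = ?P * V * ?P" by (simp add: left_diff_distrib P)
  have "M * (V * ?P) = (M * ?P) * (V * ?P)" by (subst VP) (simp add: mult.assoc)
  also have "\<dots> = ?P * X * (V * ?P)" unfolding PX MP ..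
  also have "\<dots> = ?P * (X * V) * ?P" by (simp add: mult.assoc)
  also have "\<dots> = ?P" unfolding V(2) by (simp add: P mult.assoc)
  finally have "W * (M * (V * ?P)) = W * ?P" by simp
  then have WP: "W * ?P = V * ?P" unfolding mult.assoc[symmetric] W by (simp add: ix_left[OF V(1)] mult.assoc)
  have "?P * (V * ?P) = V * ?P" using VP by (simp only: mult.assoc)
  then show ?thesis unfolding pat_def by (simp only: mult.assoc WP)
qed

section \<open>Block structure of the data\<close>

definition off :: "(nat \<Rightarrow> nat) \<Rightarrow> nat \<Rightarrow> nat" where "off d i = (\<Sum>k<i. d k)"

definition blk :: "(nat \<Rightarrow> nat) \<Rightarrow> nat set \<Rightarrow> nat set" where
  "blk d S = (\<Union>i\<in>S. {off d i..<off d (Suc i)})"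

lemma off_Suc: "off d (Suc i) = off d i + d i" by (simp add: off_def)

lemma off_mono: "i \<le> j \<Longrightarrow> off d i \<le> off d j"
  unfolding off_def by (intro sum_mono2) auto

lemma off_disjoint: "x \<in> {off d i..<off d (Suc i)} \<Longrightarrow> x \<in> {off d j..<off d (Suc j)} \<Longrightarrow> i = j"
  using off_mono[of "Suc i" j d] off_mono[of "Suc j" i d] by (cases i j rule: linorder_cases) auto

lemma set_block_idx: "set (block_idx d S) = blk d (set S)"
  by (auto simp: block_idx_def blk_def off_def)

lemma distinct_block_idx: "distinct S \<Longrightarrow> distinct (block_idx d S)"
proof (induction S)
  case (Cons i S)
  have "set [off d i..<off d (Suc i)] \<inter> blk d (set S) = {}"
    using Cons.prems off_disjoint[of _ d i] by (auto simp: blk_def) (metis atLeastLessThan_iff)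
  then show ?case
    using Cons set_block_idx[of d S] by (simp add: block_idx_def off_def)
qed (simp add: block_idx_def)

lemma blk_bound: "S \<subseteq> {..<N} \<Longrightarrow> blk d S \<subseteq> {..<off d N}"
proof
  fix x assume S: "S \<subseteq> {..<N}" and "x \<in> blk d S"
  then obtain i where i: "i \<in> S" "x < off d (Suc i)" by (auto simp: blk_def)
  then have "off d (Suc i) \<le> off d N" using S by (intro off_mono) auto
  then show "x \<in> {..<off d N}" using i by simp
qed

lemma blk_single: "blk d {k} = {off d k..<off d (Suc k)}" by (simp add: blk_def)

lemma finite_blk: "finite S \<Longrightarrow> finite (blk d S)" by (simp add: blk_def)

lemma ex_block: "x < off d N \<Longrightarrow> \<exists>i<N. x \<in> {off d i..<off d (Suc i)}"
proof (induction N)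
  case (Suc N)
  then show ?case by (cases "x < off d N") (auto simp: less_Suc_eq)
qed (simp add: off_def)

lemma dg_blk: "finite S \<Longrightarrow> dg (blk d S) = (\<Sum>i\<in>S. dg (blk d {i}))"
proof (rule fmat_eqI)
  fix a b assume S: "finite S"
  show "ent (dg (blk d S)) a b = ent (\<Sum>i\<in>S. dg (blk d {i})) a b"
  proof (cases "a = b \<and> a \<in> blk d S")
    case True
    then obtain i where i: "i \<in> S" "a \<in> blk d {i}" by (auto simp: blk_def)
    have "a \<in> blk d {k} \<longleftrightarrow> k = i" for k
      unfolding blk_single using i(2)[unfolded blk_single] off_disjoint by blast
    then have "(\<Sum>k\<in>S. ent (dg (blk d {k})) a b) = (\<Sum>k\<in>S. if k = i then 1 else 0)"
      using True by (intro sum.cong) (simp_all add: finite_blk)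
    then show ?thesis using True i(1) S by (auto simp: finite_blk)
  next
    case False
    then show ?thesis using S by (auto simp: finite_blk blk_def intro!: sum.neutral[symmetric])
  qed
qed

lemma sum_dg_blk: "(\<Sum>i<N. dg (blk d {i})) = ix (off d N)"
proof -
  have "blk d {..<N} = {..<off d N}"
  proof (intro equalityI blk_bound subset_refl subsetI)
    fix x assume "x \<in> {..<off d N}"
    then obtain i where "i < N" "x \<in> {off d i..<off d (Suc i)}" using ex_block[of x d N] by auto
    then show "x \<in> blk d {..<N}" unfolding blk_def by blast
  qed
  then show ?thesis using dg_blk[of "{..<N}" d] by simp
qed

lemma block_idx_less: "set S \<subseteq> {..<N} \<Longrightarrow> j < length (block_idx d S) \<Longrightarrow> block_idx d S ! j < off d N"
  using nth_mem[of j "block_idx d S"] blk_bound[of "set S" N d] set_block_idx[of d S] by auto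

lemma embed_carrier: "embed N d S \<in> carrier_mat (off d N) (length (block_idx d S))"
  by (simp add: embed_def sub_cols_def select_mat_def off_def)

lemma ent_embed:
  assumes "set S \<subseteq> {..<N}"
  shows "ent (rm (embed N d S)) i j = (if j < length (block_idx d S) \<and> i = block_idx d S ! j then 1 else 0)"
  using block_idx_less[OF assms, of _ d] by (auto simp: embed_def sub_cols_def select_mat_def off_def)

lemma ent_embed_right:
  assumes S: "set S \<subseteq> {..<N}"
  shows "ent (M * rm (embed N d S)) i j = (if j < length (block_idx d S) then ent M i (block_idx d S ! j) else 0)"
proof -
  note lt = block_idx_less[OF S, of _ d]
  have "ent (M * rm (embed N d S)) i j = (\<Sum>k<off d N. if k = block_idx d S ! j then (if j < length (block_idx d S) then ent M i k else 0) else 0)"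
    unfolding ent_mult_right[OF car_rm[OF embed_carrier]] ent_embed[OF S] by (intro sum.cong) auto
  then show ?thesis using lt[of j] by auto
qed

lemma ent_embed_left:
  assumes S: "set S \<subseteq> {..<N}"
  shows "ent (tp (rm (embed N d S)) * M) i j = (if i < length (block_idx d S) then ent M (block_idx d S ! i) j else 0)"
proof -
  have "tp (rm (embed N d S)) * M = tp (tp M * rm (embed N d S))" by (simp add: tp_mult)
  then show ?thesis by (simp only: ent_tp ent_embed_right[OF S])
qed

lemma embed_iso:
  assumes S: "set S \<subseteq> {..<N}" "distinct S"
  shows "tp (rm (embed N d S)) * rm (embed N d S) = ix (length (block_idx d S))"
    "rm (embed N d S) * tp (rm (embed N d S)) = dg (blk d (set S))"
proof -
  let ?l = "block_idx d S" and ?E = "rm (embed N d S)"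
  have dist: "distinct ?l" by (rule distinct_block_idx[OF S(2)])
  show "tp ?E * ?E = ix (length ?l)"
  proof (rule fmat_eqI)
    fix i j
    show "ent (tp ?E * ?E) i j = ent (ix (length ?l)) i j"
      using dist by (auto simp: ent_embed_left[OF S(1)] ent_embed[OF S(1)] nth_eq_iff_index_eq simp del: ent_fm)
  qed
  have cE: "car (off d N) (length ?l) ?E" by (rule car_rm[OF embed_carrier])
  show "?E * tp ?E = dg (blk d (set S))"
  proof (rule fmat_eqI)
    fix i j
    have "ent (?E * tp ?E) i j = (\<Sum>a<length ?l. if i = ?l ! a \<and> j = ?l ! a then 1 else 0)"
      unfolding ent_mult_left[OF cE] ent_tp ent_embed[OF S(1)] by (intro sum.cong) auto
    also have "\<dots> = (if i = j \<and> i \<in> set ?l then 1 else 0)"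
    proof (cases "i = j \<and> i \<in> set ?l")
      case True
      then obtain b where b: "b < length ?l" "?l ! b = i" by (auto simp: in_set_conv_nth)
      have "(\<Sum>a<length ?l. if i = ?l ! a \<and> j = ?l ! a then 1 else 0) = (\<Sum>a<length ?l. if a = b then 1 else (0::complex))"
        using True b dist by (intro sum.cong) (auto simp: nth_eq_iff_index_eq)
      then show ?thesis using True b(1) by auto
    next
      case False
      then show ?thesis by (auto intro!: sum.neutral simp: in_set_conv_nth)
    qed
    also have "\<dots> = ent (dg (blk d (set S))) i j" by (simp add: set_block_idx finite_blk)
    finally show "ent (?E * tp ?E) i j = ent (dg (blk d (set S))) i j" .
  qed
qed

lemma embed_single: "i < N \<Longrightarrow> rm (embed N d [i]) = sh (off d i) (d i)"
  by (rule fmat_eqI) (auto simp: ent_embed simp del: ent_fm, auto simp: block_idx_def off_def)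

lemma fm_sub_block:
  assumes M: "M \<in> carrier_mat (off dr N) (off dc N)" and S: "set S \<subseteq> {..<N}" "set T \<subseteq> {..<N}"
  shows "sub_block dr dc M S T \<in> carrier_mat (length (block_idx dr S)) (length (block_idx dc T))"
    "fm (sub_block dr dc M S T) = tp (rm (embed N dr S)) * fm M * rm (embed N dc T)"
proof -
  note lr = block_idx_less[OF S(1), of _ dr]
  note lc = block_idx_less[OF S(2), of _ dc]
  show "sub_block dr dc M S T \<in> carrier_mat (length (block_idx dr S)) (length (block_idx dc T))"
    by (simp add: sub_block_def select_mat_def)
  show "fm (sub_block dr dc M S T) = tp (rm (embed N dr S)) * fm M * rm (embed N dc T)"
  proof (rule fmat_eqI)
    fix i j
    have "ent (tp (rm (embed N dr S)) * fm M * rm (embed N dc T)) i j =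
      (if j < length (block_idx dc T) then if i < length (block_idx dr S) then ent (fm M) (block_idx dr S ! i) (block_idx dc T ! j) else 0 else 0)"
      unfolding ent_embed_right[OF S(2)] ent_embed_left[OF S(1)] ..
    then show "ent (fm (sub_block dr dc M S T)) i j = ent (tp (rm (embed N dr S)) * fm M * rm (embed N dc T)) i j"
      using M lr[of i] lc[of j] by (auto simp: sub_block_def select_mat_def)
  qed
qed

lemma cmat_sub_block:
  assumes M: "M \<in> carrier_mat (off dr N) (off dc N)" and S: "set S \<subseteq> {..<N}" "set T \<subseteq> {..<N}"
  shows "cmat (sub_block dr dc M S T) = sub_block dr dc (cmat M) S T"
proof -
  note lr = block_idx_less[OF S(1), of _ dr]
  note lc = block_idx_less[OF S(2), of _ dc]
  show ?thesis using M lr lc by (intro eq_matI) (auto simp: sub_block_def select_mat_def)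
qed

lemma rm_sub_block:
  assumes M: "M \<in> carrier_mat (off dr N) (off dc N)" and S: "set S \<subseteq> {..<N}" "set T \<subseteq> {..<N}"
  shows "sub_block dr dc M S T \<in> carrier_mat (length (block_idx dr S)) (length (block_idx dc T))"
    "rm (sub_block dr dc M S T) = tp (rm (embed N dr S)) * rm M * rm (embed N dc T)"
proof -
  show "sub_block dr dc M S T \<in> carrier_mat (length (block_idx dr S)) (length (block_idx dc T))"
    by (simp add: sub_block_def select_mat_def)
  show "rm (sub_block dr dc M S T) = tp (rm (embed N dr S)) * rm M * rm (embed N dc T)"
    unfolding cmat_sub_block[OF assms] using fm_sub_block(2)[of "cmat M" dr N dc S T] M S by simp
qed

lemma rm_sub_cols:
  assumes M: "M \<in> carrier_mat r (off dc N)" and T: "set T \<subseteq> {..<N}"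
  shows "sub_cols dc M T \<in> carrier_mat r (length (block_idx dc T))" "rm (sub_cols dc M T) = rm M * rm (embed N dc T)"
proof -
  note lc = block_idx_less[OF T, of _ dc]
  show "sub_cols dc M T \<in> carrier_mat r (length (block_idx dc T))" using M by (simp add: sub_cols_def select_mat_def)
  show "rm (sub_cols dc M T) = rm M * rm (embed N dc T)"
  proof (rule fmat_eqI)
    fix i j
    show "ent (rm (sub_cols dc M T)) i j = ent (rm M * rm (embed N dc T)) i j"
      unfolding ent_embed_right[OF T] using M lc[of j] by (auto simp: sub_cols_def select_mat_def)
  qed
qed

text \<open>Vanishing off-diagonal blocks mean commuting with the projection onto each block, and
  then onto any union of blocks. The latter is the form required by \<open>dsys\<close>.\<close>

lemma block_comm:
  assumes M: "car (off dr N) (off dc N) M"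
    and z: "\<And>i j. i < N \<Longrightarrow> j < N \<Longrightarrow> i \<noteq> j \<Longrightarrow> dg (blk dr {i}) * M * dg (blk dc {j}) = 0"
    and S: "S \<subseteq> {..<N}"
  shows "M * dg (blk dc S) = dg (blk dr S) * M"
proof -
  have one: "M * dg (blk dc {k}) = dg (blk dr {k}) * M" if k: "k < N" for k
  proof -
    have "M * dg (blk dc {k}) = (\<Sum>i<N. dg (blk dr {i})) * M * dg (blk dc {k})"
      unfolding sum_dg_blk by (simp add: ix_left[OF M])
    also have "\<dots> = (\<Sum>i<N. if i = k then dg (blk dr {k}) * M * dg (blk dc {k}) else 0)"
      unfolding sum_distrib_right using z[OF _ k] by (intro sum.cong) auto
    finally have 1: "M * dg (blk dc {k}) = dg (blk dr {k}) * M * dg (blk dc {k})" using k by simp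
    have "dg (blk dr {k}) * M = dg (blk dr {k}) * M * (\<Sum>i<N. dg (blk dc {i}))"
      unfolding sum_dg_blk by (simp add: mult.assoc ix_right[OF M])
    also have "\<dots> = (\<Sum>i<N. if i = k then dg (blk dr {k}) * M * dg (blk dc {k}) else 0)"
      unfolding sum_distrib_left using z[OF k] by (intro sum.cong) auto
    finally show ?thesis using 1 k by simp
  qed
  have fS: "finite S" using S finite_subset by blast
  show ?thesis
    unfolding dg_blk[OF fS] sum_distrib_left sum_distrib_right using one S by (intro sum.cong) auto
qed

lemma block_diagonal_comm:
  assumes M: "block_diagonal N dr dc (M :: real mat)" and S: "S \<subseteq> {..<N}"
  shows "rm M * dg (blk dc S) = dg (blk dr S) * rm M"
proof (rule block_comm[OF _ _ S])
  have cM: "M \<in> carrier_mat (off dr N) (off dc N)" using M by (simp add: block_diagonal_def off_def)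
  then show "car (off dr N) (off dc N) (rm M)" by (rule car_rm)
  fix i j assume ij: "i < N" "j < N" "i \<noteq> j"
  have "sub_block dr dc M [i] [j] = 0\<^sub>m (dr i) (dc j)" using M ij by (simp add: block_diagonal_def)
  then have "tp (rm (embed N dr [i])) * rm M * rm (embed N dc [j]) = 0"
    using rm_sub_block(2)[OF cM, of "[i]" "[j]"] ij by (simp add: rm_zero)
  then have "rm (embed N dr [i]) * (tp (rm (embed N dr [i])) * rm M * rm (embed N dc [j])) * tp (rm (embed N dc [j])) = 0" by simp
  then have "(rm (embed N dr [i]) * tp (rm (embed N dr [i]))) * rm M * (rm (embed N dc [j]) * tp (rm (embed N dc [j]))) = 0"
    by (simp only: mult.assoc)
  then show "dg (blk dr {i}) * rm M * dg (blk dc {j}) = 0"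
    using embed_iso(2)[of "[i]" N dr] embed_iso(2)[of "[j]" N dc] ij by simp
qed

section \<open>Block-diagonal lists, Kronecker products and stacked identities\<close>

lemma sh_sh: "b + n \<le> n' \<Longrightarrow> sh a n' * sh b n = sh (a + b) n"
  by (rule fmat_eqI) (auto simp: ent_sh_left)

lemma tpsh_sh_ne: "a + n \<le> b \<or> b + n' \<le> a \<Longrightarrow> tp (sh a n) * sh b n' = 0"
  by (rule fmat_eqI) (auto simp: ent_tpsh_left)

text \<open>\<open>diag_block_mat\<close> recurses on the head of the list, so the induction peels
  off block 0. This shifts the families \<open>M\<close>, \<open>r\<close> and \<open>c\<close> by
  one index, hence the generalization over them.\<close>

lemma diag_block_mat_upt:
  assumes "\<And>k. k < N \<Longrightarrow> M k \<in> carrier_mat (r k) (c k)"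
  shows "diag_block_mat (map M [0..<N]) \<in> carrier_mat (off r N) (off c N) \<and>
    rm (diag_block_mat (map M [0..<N])) = (\<Sum>k<N. sh (off r k) (r k) * rm (M k) * tp (sh (off c k) (c k)))"
  using assms
proof (induction N arbitrary: M r c)
  case 0
  show ?case by (auto simp: off_def rm_zero)
next
  case (Suc N)
  let ?M = "\<lambda>k. M (Suc k)" and ?r = "\<lambda>k. r (Suc k)" and ?c = "\<lambda>k. c (Suc k)"
  let ?D = "diag_block_mat (map ?M [0..<N])"
  have IH: "?D \<in> carrier_mat (off ?r N) (off ?c N)"
    "rm ?D = (\<Sum>k<N. sh (off ?r k) (?r k) * rm (?M k) * tp (sh (off ?c k) (?c k)))"
    using Suc.IH[of ?M ?r ?c] Suc.prems by auto
  have M0: "M 0 \<in> carrier_mat (r 0) (c 0)" using Suc.prems by simp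
  have o: "off r (Suc k) = r 0 + off ?r k" "off c (Suc k) = c 0 + off ?c k" for k
    unfolding off_def by (simp_all add: sum.lessThan_Suc_shift del: sum.lessThan_Suc)
  have "map M [0..<Suc N] = M 0 # map ?M [0..<N]"
    by (simp add: upt_conv_Cons map_Suc_upt[symmetric] del: upt_Suc)
  then have eq: "diag_block_mat (map M [0..<Suc N]) = four_block_mat (M 0) (0\<^sub>m (r 0) (off ?c N)) (0\<^sub>m (off ?r N) (c 0)) ?D"
    using M0 IH(1) by (simp add: Let_def)
  have shs: "sh (r 0) (off ?r N) * sh (off ?r k) (?r k) = sh (off r (Suc k)) (?r k)"
    "sh (c 0) (off ?c N) * sh (off ?c k) (?c k) = sh (off c (Suc k)) (?c k)" if "k < N" for k
  proof -
    have c: "off ?r k + ?r k \<le> off ?r N" "off ?c k + ?c k \<le> off ?c N"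
      using off_mono[of "Suc k" N ?r] off_mono[of "Suc k" N ?c] that by (simp_all add: off_Suc)
    show "sh (r 0) (off ?r N) * sh (off ?r k) (?r k) = sh (off r (Suc k)) (?r k)"
      "sh (c 0) (off ?c N) * sh (off ?c k) (?c k) = sh (off c (Suc k)) (?c k)"
      by (simp_all only: sh_sh[OF c(1)] sh_sh[OF c(2)] o)
  qed
  have "rm (diag_block_mat (map M [0..<Suc N])) = rm (M 0) + sh (r 0) (off ?r N) * rm ?D * tp (sh (c 0) (off ?c N))"
    unfolding eq using M0 IH(1) by (subst rm_four_block) (auto simp: rm_zero)
  also have "sh (r 0) (off ?r N) * rm ?D * tp (sh (c 0) (off ?c N)) =
    (\<Sum>k<N. sh (off r (Suc k)) (?r k) * rm (?M k) * tp (sh (off c (Suc k)) (?c k)))"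
    unfolding IH(2) sum_distrib_left sum_distrib_right
  proof (intro sum.cong refl)
    fix k assume k: "k \<in> {..<N}"
    have "sh (r 0) (off ?r N) * (sh (off ?r k) (?r k) * rm (?M k) * tp (sh (off ?c k) (?c k))) * tp (sh (c 0) (off ?c N))
      = (sh (r 0) (off ?r N) * sh (off ?r k) (?r k)) * rm (?M k) * tp (sh (c 0) (off ?c N) * sh (off ?c k) (?c k))"
      by (simp only: tp_mult mult.assoc)
    then show "sh (r 0) (off ?r N) * (sh (off ?r k) (?r k) * rm (?M k) * tp (sh (off ?c k) (?c k))) * tp (sh (c 0) (off ?c N))
      = sh (off r (Suc k)) (?r k) * rm (?M k) * tp (sh (off c (Suc k)) (?c k))"
      using shs k by simp
  qed
  also have "rm (M 0) = sh (off r 0) (r 0) * rm (M 0) * tp (sh (off c 0) (c 0))"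
  proof -
    have "sh 0 x = ix x" for x by (rule fmat_eqI) auto
    then show ?thesis using ix_left[OF car_rm[OF M0]] ix_right[OF car_rm[OF M0]] by (simp add: off_def)
  qed
  finally have "rm (diag_block_mat (map M [0..<Suc N])) = (\<Sum>k<Suc N. sh (off r k) (r k) * rm (M k) * tp (sh (off c k) (c k)))"
    by (subst sum.lessThan_Suc_shift) simp
  moreover have "diag_block_mat (map M [0..<Suc N]) \<in> carrier_mat (off r (Suc N)) (off c (Suc N))"
    unfolding eq o using M0 IH(1) by (intro four_block_carrier_mat) auto
  ultimately show ?case by simp
qed

lemma off_const: "off (\<lambda>_. r) k = k * r" by (simp add: off_def)

lemma div_block: "(k * r \<le> i \<and> i < k * r + r) \<longleftrightarrow> (0 < r \<and> i div r = (k::nat))"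
proof
  assume a: "k * r \<le> i \<and> i < k * r + r"
  then show "0 < r \<and> i div r = k" by (auto intro!: div_nat_eqI simp: mult.commute)
next
  assume a: "0 < r \<and> i div r = k"
  then have "k * r + i mod r = i" "i mod r < r" using div_mult_mod_eq[of i r] by auto
  then show "k * r \<le> i \<and> i < k * r + r" by linarith
qed

lemma rm_kron_one:
  assumes M: "M \<in> carrier_mat r c"
  shows "kron (1\<^sub>m N) M \<in> carrier_mat (N * r) (N * c)"
    "rm (kron (1\<^sub>m N) M) = (\<Sum>k<N. sh (k * r) r * rm M * tp (sh (k * c) c))"
proof -
  show "kron (1\<^sub>m N) M \<in> carrier_mat (N * r) (N * c)" using M by (simp add: kron_def)
  show "rm (kron (1\<^sub>m N) M) = (\<Sum>k<N. sh (k * r) r * rm M * tp (sh (k * c) c))"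
  proof (rule fmat_eqI)
    fix i j
    have "ent (\<Sum>k<N. sh (k * r) r * rm M * tp (sh (k * c) c)) i j =
      (\<Sum>k<N. if i div r = k then if 0 < r \<and> 0 < c \<and> j div c = k then ent (rm M) (i - k * r) (j - k * c) else 0 else 0)"
      unfolding ent_sum ent_sh_right ent_sh_left div_block by (intro sum.cong) auto
    also have "\<dots> = (if i div r < N then if 0 < r \<and> 0 < c \<and> j div c = i div r then ent (rm M) (i - i div r * r) (j - i div r * c) else 0 else 0)"
      by simp
    also have "\<dots> = ent (rm (kron (1\<^sub>m N) M)) i j"
    proof (cases "0 < r \<and> 0 < c")
      case True
      then have "i div r < N \<longleftrightarrow> i < N * r" "j div c < N \<longleftrightarrow> j < N * c" by (simp_all add: div_less_iff_less_mult)
      moreover have "i - i div r * r = i mod r" "j - j div c * c = j mod c" by (simp_all add: minus_div_mult_eq_mod)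
      ultimately show ?thesis using True M by (auto simp: kron_def)
    qed (use M in \<open>auto simp: kron_def\<close>)
    finally show "ent (rm (kron (1\<^sub>m N) M)) i j = ent (\<Sum>k<N. sh (k * r) r * rm M * tp (sh (k * c) c)) i j" by simp
  qed
qed

lemma rm_kron_ones:
  shows "kron (ones_col N) (1\<^sub>m r) \<in> carrier_mat (N * r) r" "rm (kron (ones_col N) (1\<^sub>m r)) = (\<Sum>k<N. sh (k * r) r)"
proof -
  show "kron (ones_col N) (1\<^sub>m r) \<in> carrier_mat (N * r) r" by (simp add: kron_def ones_col_def)
  show "rm (kron (ones_col N) (1\<^sub>m r)) = (\<Sum>k<N. sh (k * r) r)"
  proof (rule fmat_eqI)
    fix i j
    have "ent (\<Sum>k<N. sh (k * r) r) i j = (\<Sum>k<N. if i div r = k then if 0 < r \<and> j < r \<and> i mod r = j then 1 else 0 else 0)"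
      unfolding ent_sum
    proof (intro sum.cong refl)
      fix k
      have "i = k * r + j \<and> j < r \<longleftrightarrow> i div r = k \<and> 0 < r \<and> j < r \<and> i mod r = j"
        by (cases "r = 0") (auto simp: div_mult_mod_eq)
      then show "ent (sh (k * r) r) i j = (if i div r = k then if 0 < r \<and> j < r \<and> i mod r = j then 1 else 0 else 0)" by auto
    qed
    also have "\<dots> = ent (rm (kron (ones_col N) (1\<^sub>m r))) i j"
      by (cases "r = 0") (auto simp: kron_def ones_col_def div_less_iff_less_mult)
    finally show "ent (rm (kron (ones_col N) (1\<^sub>m r))) i j = ent (\<Sum>k<N. sh (k * r) r) i j" by simp
  qed
qed

section \<open>Evaluating the transfer matrices\<close>

text \<open>The inverse in \<open>realization\<close> is unspecified at singular points, so the
  evaluation asks for a resolvent \<open>W\<close> at \<open>s\<close>.\<close>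

lemma realization_fm:
  assumes "A \<in> carrier_mat n n" "B \<in> carrier_mat n c" "C \<in> carrier_mat r n" "D \<in> carrier_mat r c"
    and W: "isrsv {..<n} (rm A) s W"
  shows "realization A B C D s \<in> carrier_mat r c" "fm (realization A B C D s) = rm D + rm C * W * rm B"
proof -
  let ?M = "s \<cdot>\<^sub>m 1\<^sub>m (dim_row A) - cmat A"
  have M: "?M \<in> carrier_mat n n" using assms(1) by (intro minus_carrier_mat) simp
  have fM: "fm ?M = s *c ix n - rm A"
    using assms by (subst fm_diff[of _ n n]) (auto simp: fm_smult fm_one)
  have cW: "car n n W" using isrsv_rules(1,2)[OF W] by (simp add: car_iff)
  have W': "W * fm ?M = ix n" using W unfolding fM isrsv_def by simp
  note i = fm_inv_mat[OF M W']
  have c: "cmat C * inv_mat ?M \<in> carrier_mat r n" "cmat C * inv_mat ?M * cmat B \<in> carrier_mat r c"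
    using assms i(1) by auto
  show "realization A B C D s \<in> carrier_mat r c" unfolding realization_def using assms c by simp
  have "fm (cmat C * inv_mat ?M * cmat B) = rm C * W * rm B"
    using fm_mult[of "cmat C * inv_mat ?M" "cmat B"] fm_mult[of "cmat C" "inv_mat ?M"] carrier_matD[OF c(1)] carrier_matD[OF i(1)] assms i(4)[OF cW]
    by simp
  then show "fm (realization A B C D s) = rm D + rm C * W * rm B"
    unfolding realization_def using fm_add[of "cmat D" r c] c assms by simp
qed

text \<open>By their sizes the four terms occupy disjoint index ranges, so any decomposition of this
  shape determines the blocks.\<close>

lemma tf_fm:
  assumes G: "G s \<in> carrier_mat (r + r') (c + c')"
    and eq: "fm (G s) = a + b * tp (sh c c') + sh r r' * e + sh r r' * f * tp (sh c c')"
    and car: "car r c a" "car r c' b" "car r' c e" "car r' c' f"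
  shows "tf11 r c G s \<in> carrier_mat r c" "fm (tf11 r c G s) = a"
    "tf12 r c G s \<in> carrier_mat r c'" "fm (tf12 r c G s) = b"
    "tf21 r c G s \<in> carrier_mat r' c" "fm (tf21 r c G s) = e"
    "tf22 r c G s \<in> carrier_mat r' c'" "fm (tf22 r c G s) = f"
proof -
  note d = tf11_def tf12_def tf21_def tf22_def split_block_def Let_def
  show "tf11 r c G s \<in> carrier_mat r c" "tf12 r c G s \<in> carrier_mat r c'" "tf21 r c G s \<in> carrier_mat r' c" "tf22 r c G s \<in> carrier_mat r' c'"
    using G by (auto simp: d)
  have E: "ent (fm (G s)) i j = ent a i j + (if c \<le> j \<and> j < c + c' then ent b i (j - c) else 0)
     + (if r \<le> i \<and> i < r + r' then ent e (i - r) j else 0)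
     + (if c \<le> j \<and> j < c + c' then if r \<le> i \<and> i < r + r' then ent f (i - r) (j - c) else 0 else 0)" for i j
    unfolding eq by (simp add: ent_sh_right ent_sh_left)
  have E': "(if i < r + r' \<and> j < c + c' then G s $$ (i, j) else 0) = ent (fm (G s)) i j" for i j using G by simp
  show "fm (tf11 r c G s) = a"
  proof (rule fmat_eqI)
    fix i j show "ent (fm (tf11 r c G s)) i j = ent a i j"
    proof (cases "i < r \<and> j < c")
      case True
      then show ?thesis using G E[of i j] E'[of i j]  by (simp add: d add.commute)
    next
      case False
      then show ?thesis using G carD[OF car(1) False] by (auto simp: d)
    qed
  qed
  show "fm (tf12 r c G s) = b"
  proof (rule fmat_eqI)
    fix i j show "ent (fm (tf12 r c G s)) i j = ent b i j"
    proof (cases "i < r \<and> j < c'")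
      case True
      then show ?thesis using G E[of i "c + j"] E'[of i "c + j"] carD[OF car(1), of i "c + j"] by (simp add: d add.commute)
    next
      case False
      then show ?thesis using G carD[OF car(2) False] by (auto simp: d)
    qed
  qed
  show "fm (tf21 r c G s) = e"
  proof (rule fmat_eqI)
    fix i j show "ent (fm (tf21 r c G s)) i j = ent e i j"
    proof (cases "i < r' \<and> j < c")
      case True
      then show ?thesis using G E[of "r + i" j] E'[of "r + i" j] carD[OF car(1), of "r + i" j] by (simp add: d add.commute)
    next
      case False
      then show ?thesis using G carD[OF car(3) False] by (auto simp: d)
    qed
  qed
  show "fm (tf22 r c G s) = f"
  proof (rule fmat_eqI)
    fix i j show "ent (fm (tf22 r c G s)) i j = ent f i j"
    proof (cases "i < r' \<and> j < c'")
      case True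
      then show ?thesis using G E[of "r + i" "c + j"] E'[of "r + i" "c + j"] carD[OF car(1), of "r + i" "c + j"] carD[OF car(2), of "r + i" j] carD[OF car(3), of i "c + j"] by (simp add: d add.commute)
    next
      case False
      then show ?thesis using G carD[OF car(4) False] by (auto simp: d)
    qed
  qed
qed

lemma rm_append_cols:
  assumes "M \<in> carrier_mat r c" "M' \<in> carrier_mat r c'"
  shows "append_cols M M' \<in> carrier_mat r (c + c')" "rm (append_cols M M') = rm M + rm M' * tp (sh c c')"
proof -
  show "append_cols M M' \<in> carrier_mat r (c + c')"
    unfolding append_cols_def using assms four_block_carrier_mat[of M r c "0\<^sub>m 0 c'" 0 c'] by simp
  show "rm (append_cols M M') = rm M + rm M' * tp (sh c c')"
    unfolding append_cols_def using assms by (subst rm_four_block[of _ r c _ c' _ 0]) (auto simp: rm_zero)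
qed

lemma rm_append_rows:
  assumes "M \<in> carrier_mat r c" "M' \<in> carrier_mat r' c"
  shows "M @\<^sub>r M' \<in> carrier_mat (r + r') c" "rm (M @\<^sub>r M') = rm M + sh r r' * rm M'"
proof -
  show "M @\<^sub>r M' \<in> carrier_mat (r + r') c" using assms by (rule carrier_append_rows)
  show "rm (M @\<^sub>r M') = rm M + sh r r' * rm M'"
    unfolding append_rows_def using assms by (subst rm_four_block[of _ r c _ 0 _ r']) (auto simp: rm_zero)
qed

lemma plant_fm:
  assumes c: "A \<in> carrier_mat n n" "B1 \<in> carrier_mat n nw" "B2 \<in> carrier_mat n m" "C1 \<in> carrier_mat nz n"
      "C2 \<in> carrier_mat p n" "D12 \<in> carrier_mat nz m" "D21 \<in> carrier_mat p nw"
    and Th: "isrsv {..<n} (rm A) s Th"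
  defines "P \<equiv> plant_tf A B1 B2 C1 C2 D12 D21"
  shows "tf11 nz nw P s \<in> carrier_mat nz nw" "fm (tf11 nz nw P s) = rm C1 * Th * rm B1"
    "tf12 nz nw P s \<in> carrier_mat nz m" "fm (tf12 nz nw P s) = rm C1 * Th * rm B2 + rm D12"
    "tf21 nz nw P s \<in> carrier_mat p nw" "fm (tf21 nz nw P s) = rm C2 * Th * rm B1 + rm D21"
    "tf22 nz nw P s \<in> carrier_mat p m" "fm (tf22 nz nw P s) = rm C2 * Th * rm B2"
proof -
  have cT: "car n n Th" using isrsv_rules(1,2)[OF Th] by (simp add: car_iff)
  have D: "four_block_mat (0\<^sub>m (dim_row C1) (dim_col B1)) D12 D21 (0\<^sub>m (dim_row C2) (dim_col B2)) \<in> carrier_mat (nz + p) (nw + m)"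
    "rm (four_block_mat (0\<^sub>m (dim_row C1) (dim_col B1)) D12 D21 (0\<^sub>m (dim_row C2) (dim_col B2))) = rm D12 * tp (sh nw m) + sh nz p * rm D21"
    using c by (intro four_block_carrier_mat, simp_all) (subst rm_four_block[of _ nz nw _ m _ p], simp_all add: rm_zero)
  note r = realization_fm[OF c(1) rm_append_cols(1)[OF c(2,3)] rm_append_rows(1)[OF c(4,5)] D(1) Th]
  have G: "P s \<in> carrier_mat (nz + p) (nw + m)" unfolding P_def plant_tf_def by (rule r(1))
  have e: "fm (P s) = rm C1 * Th * rm B1 + (rm C1 * Th * rm B2 + rm D12) * tp (sh nw m) + sh nz p * (rm C2 * Th * rm B1 + rm D21)
     + sh nz p * (rm C2 * Th * rm B2) * tp (sh nw m)"
    unfolding P_def plant_tf_def r(2) D(2) rm_append_cols(2)[OF c(2,3)] rm_append_rows(2)[OF c(4,5)] by (simp add: algebra_simps)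
  have cc: "car nz nw (rm C1 * Th * rm B1)" "car nz m (rm C1 * Th * rm B2 + rm D12)" "car p nw (rm C2 * Th * rm B1 + rm D21)" "car p m (rm C2 * Th * rm B2)"
    by (rule car_add car_rm[OF c(6)] car_rm[OF c(7)] car_mult[OF car_mult[OF car_rm[OF c(4)] cT] car_rm[OF c(2)]]
      car_mult[OF car_mult[OF car_rm[OF c(4)] cT] car_rm[OF c(3)]] car_mult[OF car_mult[OF car_rm[OF c(5)] cT] car_rm[OF c(2)]]
      car_mult[OF car_mult[OF car_rm[OF c(5)] cT] car_rm[OF c(3)]])+
  show "tf11 nz nw P s \<in> carrier_mat nz nw" "fm (tf11 nz nw P s) = rm C1 * Th * rm B1"
    "tf12 nz nw P s \<in> carrier_mat nz m" "fm (tf12 nz nw P s) = rm C1 * Th * rm B2 + rm D12"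
    "tf21 nz nw P s \<in> carrier_mat p nw" "fm (tf21 nz nw P s) = rm C2 * Th * rm B1 + rm D21"
    "tf22 nz nw P s \<in> carrier_mat p m" "fm (tf22 nz nw P s) = rm C2 * Th * rm B2"
    by (rule tf_fm[where G=P, OF G e cc])+
qed

lemma J_fm:
  assumes c: "A \<in> carrier_mat n n" "B2 \<in> carrier_mat n m" "C2 \<in> carrier_mat p n" "Fd \<in> carrier_mat m n" "L \<in> carrier_mat n p"
    and Ga: "isrsv {..<n} (rm A + rm B2 * rm Fd + rm L * rm C2) s Ga"
  defines "J \<equiv> J_tf A B2 C2 Fd L"
  shows "tf11 m p J s \<in> carrier_mat m p" "fm (tf11 m p J s) = - (rm Fd * Ga * rm L)"
    "tf12 m p J s \<in> carrier_mat m m" "fm (tf12 m p J s) = ix m + rm Fd * Ga * rm B2"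
    "tf21 m p J s \<in> carrier_mat p p" "fm (tf21 m p J s) = ix p + rm C2 * Ga * rm L"
    "tf22 m p J s \<in> carrier_mat p m" "fm (tf22 m p J s) = - (rm C2 * Ga * rm B2)"
proof -
  have cT: "car n n Ga" using isrsv_rules(1,2)[OF Ga] by (simp add: car_iff)
  have D: "four_block_mat (0\<^sub>m (dim_col B2) (dim_row C2)) (1\<^sub>m (dim_col B2)) (1\<^sub>m (dim_row C2)) (0\<^sub>m (dim_row C2) (dim_col B2)) \<in> carrier_mat (m + p) (p + m)"
    "rm (four_block_mat (0\<^sub>m (dim_col B2) (dim_row C2)) (1\<^sub>m (dim_col B2)) (1\<^sub>m (dim_row C2)) (0\<^sub>m (dim_row C2) (dim_col B2))) = ix m * tp (sh p m) + sh m p * ix p"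
    using c by (intro four_block_carrier_mat, simp_all) (subst rm_four_block[of _ m p _ m _ p], simp_all add: rm_zero rm_one)
  have cA: "A + B2 * Fd + L * C2 \<in> carrier_mat n n" using c by simp
  have "rm (A + B2 * Fd + L * C2) = rm A + rm B2 * rm Fd + rm L * rm C2"
    using c rm_add[of "A + B2 * Fd" n n "L * C2"] rm_add[of A n n "B2 * Fd"] rm_mult[of B2 Fd] rm_mult[of L C2] by simp
  then have Ga': "isrsv {..<n} (rm (A + B2 * Fd + L * C2)) s Ga" using Ga by simp
  have mL: "- L \<in> carrier_mat n p" and mC: "- C2 \<in> carrier_mat p n" using c by auto
  note r = realization_fm[OF cA rm_append_cols(1)[OF mL c(2)] rm_append_rows(1)[OF c(4) mC] D(1) Ga']
  have G: "J s \<in> carrier_mat (m + p) (p + m)" unfolding J_def J_tf_def by (rule r(1))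
  have e: "fm (J s) = - (rm Fd * Ga * rm L) + (ix m + rm Fd * Ga * rm B2) * tp (sh p m) + sh m p * (ix p + rm C2 * Ga * rm L)
     + sh m p * (- (rm C2 * Ga * rm B2)) * tp (sh p m)"
    unfolding J_def J_tf_def r(2) D(2) rm_append_cols(2)[OF mL c(2)] rm_append_rows(2)[OF c(4) mC] rm_uminus by (simp add: algebra_simps)
  have cc: "car m p (- (rm Fd * Ga * rm L))" "car m m (ix m + rm Fd * Ga * rm B2)" "car p p (ix p + rm C2 * Ga * rm L)" "car p m (- (rm C2 * Ga * rm B2))"
    by (rule car_add car_minus car_ix car_mult[OF car_mult[OF car_rm[OF c(4)] cT] car_rm[OF c(5)]]
      car_mult[OF car_mult[OF car_rm[OF c(4)] cT] car_rm[OF c(2)]] car_mult[OF car_mult[OF car_rm[OF c(3)] cT] car_rm[OF c(5)]]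
      car_mult[OF car_mult[OF car_rm[OF c(3)] cT] car_rm[OF c(2)]])+
  show "tf11 m p J s \<in> carrier_mat m p" "fm (tf11 m p J s) = - (rm Fd * Ga * rm L)"
    "tf12 m p J s \<in> carrier_mat m m" "fm (tf12 m p J s) = ix m + rm Fd * Ga * rm B2"
    "tf21 m p J s \<in> carrier_mat p p" "fm (tf21 m p J s) = ix p + rm C2 * Ga * rm L"
    "tf22 m p J s \<in> carrier_mat p m" "fm (tf22 m p J s) = - (rm C2 * Ga * rm B2)"
    by (rule tf_fm[where G=J, OF G e cc])+
qed

lemma ix_split: "ix (a + b) = ix a + sh a b * tp (sh a b)"
  by (rule fmat_eqI) (auto simp: ent_sh_left ent_sh_right)

lemma T_fm:
  assumes c: "A \<in> carrier_mat n n" "B1 \<in> carrier_mat n nw" "B2 \<in> carrier_mat n m" "C1 \<in> carrier_mat nz n"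
      "C2 \<in> carrier_mat p n" "D12 \<in> carrier_mat nz m" "D21 \<in> carrier_mat p nw" "Fd \<in> carrier_mat m n" "L \<in> carrier_mat n p"
    and Ph: "isrsv {..<n} (rm A + rm B2 * rm Fd) s Ph" and Ps: "isrsv {..<n} (rm A + rm L * rm C2) s Ps"
  defines "T \<equiv> T_tf A B1 B2 C1 C2 D12 D21 Fd L" and "BL \<equiv> rm B1 + rm L * rm D21"
  shows "tf11 nz nw T s \<in> carrier_mat nz nw"
    "fm (tf11 nz nw T s) = (rm C1 + rm D12 * rm Fd) * Ph * (rm B1 - rm B2 * rm Fd * Ps * BL) - rm D12 * rm Fd * Ps * BL"
    "tf12 nz nw T s \<in> carrier_mat nz m" "fm (tf12 nz nw T s) = (rm C1 + rm D12 * rm Fd) * Ph * rm B2 + rm D12"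
    "tf21 nz nw T s \<in> carrier_mat p nw" "fm (tf21 nz nw T s) = rm C2 * Ps * BL + rm D21"
proof -
  let ?S = "sh n n"
  have cPh: "car n n Ph" "car n n Ps" using isrsv_rules(1,2)[OF Ph] isrsv_rules(1,2)[OF Ps] by (simp_all add: car_iff)
  have BF: "B2 * Fd \<in> carrier_mat n n" "rm (B2 * Fd) = rm B2 * rm Fd" using c rm_mult[of B2 Fd] by auto
  have LC: "L * C2 \<in> carrier_mat n n" "rm (L * C2) = rm L * rm C2" using c rm_mult[of L C2] by auto
  have LD: "L * D21 \<in> carrier_mat n nw" "rm (L * D21) = rm L * rm D21" using c rm_mult[of L D21] by auto
  have DF: "D12 * Fd \<in> carrier_mat nz n" "rm (D12 * Fd) = rm D12 * rm Fd" using c rm_mult[of D12 Fd] by auto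
  define AA where "AA = four_block_mat (A + B2 * Fd) (- (B2 * Fd)) (0\<^sub>m (dim_row A) (dim_row A)) (A + L * C2)"
  define BB where "BB = four_block_mat B1 B2 (B1 + L * D21) (0\<^sub>m (dim_row A) (dim_col B2))"
  define CC where "CC = four_block_mat (C1 + D12 * Fd) (- (D12 * Fd)) (0\<^sub>m (dim_row C2) (dim_row A)) C2"
  define DD where "DD = four_block_mat (0\<^sub>m (dim_row C1) (dim_col B1)) D12 D21 (0\<^sub>m (dim_row C2) (dim_col B2))"
  let ?Ad = "rm A + rm B2 * rm Fd" and ?Al = "rm A + rm L * rm C2" and ?BF = "rm B2 * rm Fd"
  have cs: "AA \<in> carrier_mat (n + n) (n + n)" "BB \<in> carrier_mat (n + n) (nw + m)" "CC \<in> carrier_mat (nz + p) (n + n)" "DD \<in> carrier_mat (nz + p) (nw + m)"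
    unfolding AA_def BB_def CC_def DD_def using c BF LC LD DF by (auto intro!: four_block_carrier_mat)
  have rAA: "rm AA = ?Ad - ?BF * tp ?S + ?S * ?Al * tp ?S"
    unfolding AA_def using c BF LC
    by (subst rm_four_block[of _ n n _ n _ n]) (auto simp: rm_zero rm_uminus rm_add[OF c(1) BF(1)] rm_add[OF c(1) LC(1)])
  have rBB: "rm BB = rm B1 + rm B2 * tp (sh nw m) + ?S * BL"
    unfolding BB_def BL_def using c LD
    by (subst rm_four_block[of _ n nw _ m _ n]) (auto simp: rm_zero rm_add[OF c(2) LD(1)])
  have rCC: "rm CC = (rm C1 + rm D12 * rm Fd) - rm D12 * rm Fd * tp ?S + sh nz p * rm C2 * tp ?S"
    unfolding CC_def using c DF
    by (subst rm_four_block[of _ nz n _ n _ p]) (auto simp: rm_zero rm_uminus rm_add[OF c(4) DF(1)])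
  have rDD: "rm DD = rm D12 * tp (sh nw m) + sh nz p * rm D21"
    unfolding DD_def using c by (subst rm_four_block[of _ nz nw _ m _ p]) (auto simp: rm_zero)
  note k1 = ix_left[OF cPh(1)] ix_left[OF cPh(2)] ix_right[OF cPh(1)] ix_right[OF cPh(2)]
    ix_left'[OF cPh(1)] ix_left'[OF cPh(2)] ix_right'[OF cPh(1)] ix_right'[OF cPh(2)]
  have tS: "tp ?S * (?S * x) = ix n * x" for x by (simp add: mult.assoc[symmetric] tpsh_sh)
  have zero: "tp ?S * M = 0" "M' * ?S = 0" if "ix n * M = M" "M' * ix n = M'" for M M'
  proof -
    have "tp ?S * M = tp ?S * ix n * M" using that by (simp add: mult.assoc)
    then show "tp ?S * M = 0" by (simp add: tpsh_ix)
    have "M' * ?S = M' * (ix n * ?S)" using that by (simp add: mult.assoc[symmetric])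
    then show "M' * ?S = 0" by (simp add: ix_sh)
  qed
  have zero': "tp ?S * (M * x) = 0" "M' * (?S * x) = 0" if "ix n * M = M" "M' * ix n = M'" for M M' x
    using zero[OF that] by (simp_all add: mult.assoc[symmetric])
  have il: "ix n * rm B1 = rm B1" "ix n * rm B2 = rm B2" "ix n * rm A = rm A" "rm A * ix n = rm A" "rm Fd * ix n = rm Fd" "rm C1 * ix n = rm C1"
      "ix n * rm L = rm L" "rm C2 * ix n = rm C2"
    using ix_left[OF car_rm[OF c(2)]] ix_left[OF car_rm[OF c(3)]] ix_left[OF car_rm[OF c(1)]] ix_right[OF car_rm[OF c(1)]]
      ix_right[OF car_rm[OF c(8)]] ix_right[OF car_rm[OF c(4)]] ix_left[OF car_rm[OF c(9)]] ix_right[OF car_rm[OF c(5)]] by auto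
  have il': "ix n * (rm B1 * x) = rm B1 * x" "ix n * (rm B2 * x) = rm B2 * x" "ix n * (rm L * x) = rm L * x" for x
    using il by (simp_all add: mult.assoc[symmetric])
  \<comment> \<open>The state matrix is block upper triangular. Its resolvent has \<open>Ph\<close>
    and \<open>Ps\<close> on the diagonal and \<open>- Ph * (B2 * Fd) * Ps\<close> in the
    corner.\<close>
  define W where "W = Ph - Ph * ?BF * Ps * tp ?S + ?S * Ps * tp ?S"
  have idm: "ix n * ix n = ix n" by (simp add: dg_mult)
  have iS: "ix n * (?S * x) = 0" "tp ?S * ix n = 0" "ix n * ?S = 0" for x by (simp_all add: tpsh_ix ix_sh mult.assoc[symmetric])
  have tt: "tp ?S * ?S = ix n" "?S * ix n = ?S" "ix n * tp ?S = tp ?S" "?S * (ix n * x) = ?S * x" "ix n * (tp ?S * x) = tp ?S * x" for x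
    using ix_right[OF car_sh[of n n]] ix_left[OF car_tp[OF car_sh[of n n]]] ix_right'[OF car_sh[of n n]] ix_left'[OF car_tp[OF car_sh[of n n]]]
    by (simp_all add: tpsh_sh)
  have W1: "ix (n + n) * W = W" "W * ix (n + n) = W"
    unfolding W_def ix_split by (simp_all add: algebra_simps k1 tS tt iS zero[OF k1(1) k1(3)] zero'[OF k1(1) k1(3)])
  have W2: "W * (s *c ix (n + n) - rm AA) = ix (n + n)"
  proof -
    have p: "Ph * (s *c ix n - ?Ad) = ix n" "Ps * (s *c ix n - ?Al) = ix n" using Ph Ps by (auto simp: isrsv_def)
    have s2: "s *c ix (n + n) - rm AA = (s *c ix n - ?Ad) + ?BF * tp ?S + ?S * (s *c ix n - ?Al) * tp ?S"
      unfolding rAA ix_split by (simp add: algebra_simps csc_add csc_left csc_right tt)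
    have z: "tp ?S * (s *c ix n - ?Ad) = 0" "tp ?S * (rm B2 * x) = 0" "Ph * (?S * x) = 0" for x
      using zero[of "s *c ix n - ?Ad" Ph] zero'(1)[of "rm B2" Ph x] zero'[of Ph Ph x]
      by (simp_all add: k1 algebra_simps csc_right idm il il')
    have "W * (s *c ix (n + n) - rm AA) = Ph * (s *c ix n - ?Ad) + Ph * (?BF * tp ?S) - Ph * (?BF * (Ps * (tp ?S * (?S * ((s *c ix n - ?Al) * tp ?S)))))
       + ?S * (Ps * (tp ?S * (?S * ((s *c ix n - ?Al) * tp ?S))))"
      unfolding s2 W_def by (simp only: distrib_left distrib_right left_diff_distrib mult.assoc z mult_zero_right add_0_right diff_0_right add_0_left diff_0)
        simp
    also have "\<dots> = ix n + ?S * tp ?S"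
    proof -
      have "Ps * (ix n * ((s *c ix n - ?Al) * tp ?S)) = tp ?S" by (simp only: k1 mult.assoc[symmetric] p tt)
      then show ?thesis by (simp only: tS p) simp
    qed
    finally show ?thesis by (simp only: ix_split)
  qed
  have cW: "car (n + n) (n + n) W" using W1 by (simp add: car_iff)
  have W3: "isrsv {..<n + n} (rm AA) s W"
    unfolding isrsv_def
    using W1 W2 left_inverse_imp_right[OF car_diff[OF car_csc[OF car_ix] car_rm[OF cs(1)]] cW] by simp
  note r = realization_fm[OF cs W3]
  have G: "T s \<in> carrier_mat (nz + p) (nw + m)" unfolding T_def T_tf_def AA_def[symmetric] BB_def[symmetric] CC_def[symmetric] DD_def[symmetric] by (rule r(1))
  have e: "fm (T s) = ((rm C1 + rm D12 * rm Fd) * Ph * (rm B1 - rm B2 * rm Fd * Ps * BL) - rm D12 * rm Fd * Ps * BL)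
     + ((rm C1 + rm D12 * rm Fd) * Ph * rm B2 + rm D12) * tp (sh nw m) + sh nz p * (rm C2 * Ps * BL + rm D21) + sh nz p * 0 * tp (sh nw m)"
  proof -
    have iBL: "ix n * BL = BL" unfolding BL_def by (simp add: distrib_left il il')
    have tSB: "tp ?S * rm B1 = 0" "tp ?S * (rm B2 * x) = 0" "rm C1 * (?S * x) = 0" "rm Fd * (?S * x) = 0" "Ph * (?S * x) = 0" "tp ?S * (Ph * x) = 0" for x
      using zero[OF il(1) il(4)] zero'[OF il(2) il(4)] zero'[OF il(1) il(6)] zero'[OF il(1) il(5)] zero'[OF k1(1) k1(3)] by auto
    have WB: "W * rm BB = Ph * rm B1 + Ph * (rm B2 * tp (sh nw m)) - Ph * (?BF * (Ps * BL)) + ?S * (Ps * BL)"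
      unfolding W_def rBB by (simp add: algebra_simps tS tSB iBL)
    show ?thesis
      unfolding T_def T_tf_def AA_def[symmetric] BB_def[symmetric] CC_def[symmetric] DD_def[symmetric] r(2) mult.assoc[of "rm CC"] WB
      unfolding rCC rDD by (simp add: algebra_simps tS tSB k1)
  qed
  have cBL: "car n nw BL" unfolding BL_def by (intro car_add car_rm[OF c(2)] car_mult[OF car_rm[OF c(9)] car_rm[OF c(7)]])
  have cCd: "car nz n (rm C1 + rm D12 * rm Fd)" by (intro car_add car_rm[OF c(4)] car_mult[OF car_rm[OF c(6)] car_rm[OF c(8)]])
  have cc: "car nz nw ((rm C1 + rm D12 * rm Fd) * Ph * (rm B1 - rm B2 * rm Fd * Ps * BL) - rm D12 * rm Fd * Ps * BL)"
    by (rule car_diff[OF car_mult[OF car_mult[OF cCd cPh(1)] car_diff[OF car_rm[OF c(2)] car_mult[OF car_mult[OF car_mult[OF car_rm[OF c(3)] car_rm[OF c(8)]] cPh(2)] cBL]]]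
        car_mult[OF car_mult[OF car_mult[OF car_rm[OF c(6)] car_rm[OF c(8)]] cPh(2)] cBL]])
  have cc2: "car nz m ((rm C1 + rm D12 * rm Fd) * Ph * rm B2 + rm D12)"
    by (rule car_add[OF car_mult[OF car_mult[OF cCd cPh(1)] car_rm[OF c(3)]] car_rm[OF c(6)]])
  have cc3: "car p nw (rm C2 * Ps * BL + rm D21)"
    by (rule car_add[OF car_mult[OF car_mult[OF car_rm[OF c(5)] cPh(2)] cBL] car_rm[OF c(7)]])
  show "tf11 nz nw T s \<in> carrier_mat nz nw"
    "fm (tf11 nz nw T s) = (rm C1 + rm D12 * rm Fd) * Ph * (rm B1 - rm B2 * rm Fd * Ps * BL) - rm D12 * rm Fd * Ps * BL"
    "tf12 nz nw T s \<in> carrier_mat nz m" "fm (tf12 nz nw T s) = (rm C1 + rm D12 * rm Fd) * Ph * rm B2 + rm D12"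
    "tf21 nz nw T s \<in> carrier_mat p nw" "fm (tf21 nz nw T s) = rm C2 * Ps * BL + rm D21"
    by (rule tf_fm[where G=T, OF G e cc cc2 cc3 car_0])+
qed

section \<open>Riccati data of the subsystems\<close>

text \<open>Padding with zeros embeds the small system into the large one, and so R1 and R3
  restrict. An arbitrary stabilizing gain need not restrict to a subsystem; the block-diagonal
  \<open>Fd\<close> does, and it enters as the commuting gain \<open>F\<close>.\<close>

lemma ric_hyp_sub:
  assumes H: "ric_hyp n m z A B C D" and F: "car m n F" "cj F = F" "hurw n (A + B * F)"
    and En: "car n n' En" "cj En = En" "tp En * En = ix n'" "En * tp En = dg S"
    and Em: "car m m' Em" "cj Em = Em" "tp Em * Em = ix m'" "Em * tp Em = dg T"
    and comm: "A * dg S = dg S * A" "B * dg T = dg S * B" "F * dg S = dg T * F"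
  shows "ric_hyp n' m' z (tp En * A * En) (tp En * B * Em) (C * En) (D * Em)"
proof -
  note h = H[unfolded ric_hyp_def]
  have car: "car n n A" "car n m B" "car z n C" "car z m D" and re: "cj A = A" "cj B = B" "cj C = C" "cj D = D"
    and inj: "inj_mul m D" using h by auto
  have r3: "\<And>w x u. ix n * x = x \<Longrightarrow> ix m * u = u \<Longrightarrow> A * x + B * u = (\<i> * complex_of_real w) *c x \<Longrightarrow> C * x + D * u = 0 \<Longrightarrow> x = 0"
    using h by blast
  have EE: "tp En * (En * x) = ix n' * x" "tp Em * (Em * x) = ix m' * x" for x
    by (simp_all add: mult.assoc[symmetric] En Em)
  have dgE: "dg S * En = En" "dg T * Em = Em"
    by (simp_all add: En(4)[symmetric] Em(4)[symmetric] mult.assoc En(3) Em(3) ix_right[OF En(1)] ix_right[OF Em(1)])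
  have push: "En * (tp En * (A * (En * x))) = A * (En * x)" "En * (tp En * (B * (Em * x))) = B * (Em * x)" for x
  proof -
    have "En * (tp En * (A * (En * x))) = (dg S * A) * En * x" by (simp add: En(4)[symmetric] mult.assoc)
    also have "\<dots> = A * (dg S * En) * x" by (simp only: comm(1)[symmetric] mult.assoc)
    finally show "En * (tp En * (A * (En * x))) = A * (En * x)" by (simp only: dgE mult.assoc)
    have "En * (tp En * (B * (Em * x))) = (dg S * B) * Em * x" by (simp add: En(4)[symmetric] mult.assoc)
    also have "\<dots> = B * (dg T * Em) * x" by (simp only: comm(2)[symmetric] mult.assoc)
    finally show "En * (tp En * (B * (Em * x))) = B * (Em * x)" by (simp only: dgE mult.assoc)
  qed
  have "inj_mul m' (D * Em)" unfolding inj_mul_def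
  proof (intro allI impI)
    fix u assume u: "ix m' * u = u" "D * Em * u = 0"
    then have "Em * u = 0" using inj ix_left'[OF Em(1), of u] by (simp add: inj_mul_def mult.assoc)
    then have "tp Em * (Em * u) = 0" by simp
    then show "u = 0" using u by (simp add: EE)
  qed
  moreover have "hurw n' (tp En * A * En + tp En * B * Em * (tp Em * F * En))"
  proof -
    have "tp En * B * Em * (tp Em * F * En) = tp En * (B * dg T) * F * En" by (simp add: Em(4)[symmetric] mult.assoc)
    also have "\<dots> = (tp En * dg S) * B * F * En" unfolding comm(2) by (simp add: mult.assoc)
    also have "tp En * dg S = tp En"
      by (simp add: En(4)[symmetric] mult.assoc[symmetric] En(3) ix_left[OF car_tp[OF En(1)]])
    finally have eq: "tp En * A * En + tp En * B * Em * (tp Em * F * En) = tp En * (A + B * F) * En" by (simp add: algebra_simps)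
    show ?thesis unfolding eq hurw_def
    proof (intro conjI allI impI)
      have "car n n (A + B * F)" using F by (simp add: hurw_def)
      then show "car n' n' (tp En * (A + B * F) * En)" by (rule car_mult[OF car_mult[OF car_tp[OF En(1)]] En(1)])
      fix l x assume x: "ix n' * x = x" "x \<noteq> 0" "tp En * (A + B * F) * En * x = l *c x"
      have Ad: "(A + B * F) * dg S = dg S * (A + B * F)"
      proof -
        have "B * F * dg S = B * dg T * F" by (simp add: mult.assoc comm(3))
        then show ?thesis using comm by (simp add: distrib_left distrib_right mult.assoc)
      qed
      have "(A + B * F) * (En * x) = (A + B * F) * dg S * (En * x)" by (simp add: mult.assoc) (simp add: mult.assoc[symmetric] dgE)
      also have "\<dots> = En * (tp En * (A + B * F) * En * x)" unfolding Ad by (simp add: En(4)[symmetric] mult.assoc)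
      also have "\<dots> = l *c (En * x)" unfolding x(3) by (simp add: csc_right)
      finally have ev: "(A + B * F) * (En * x) = l *c (En * x)" .
      have "En * x \<noteq> 0"
      proof
        assume "En * x = 0"
        then have "tp En * (En * x) = 0" by simp
        then show False using x by (simp add: EE)
      qed
      then show "Re l < 0" using F(3) ev ix_left'[OF En(1), of x] unfolding hurw_def by blast
    qed
  qed
  moreover have "x = 0" if x: "ix n' * x = x" "ix m' * u = u"
      "tp En * A * En * x + tp En * B * Em * u = (\<i> * complex_of_real w) *c x" "C * En * x + D * Em * u = 0" for w x u
  proof -
    have "A * (En * x) + B * (Em * u) = En * (tp En * A * En * x + tp En * B * Em * u)"
      by (simp add: distrib_left mult.assoc push)
    also have "\<dots> = (\<i> * complex_of_real w) *c (En * x)" unfolding x(3) by (simp add: csc_right)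
    finally have "En * x = 0"
      using r3[of "En * x" "Em * u" w] ix_left'[OF En(1)] ix_left'[OF Em(1)] x(4) by (simp add: mult.assoc)
    then have "tp En * (En * x) = 0" by simp
    then show "x = 0" using x by (simp add: EE)
  qed
  moreover have "car n' n' (tp En * A * En)" "car n' m' (tp En * B * Em)" "car z n' (C * En)" "car z m' (D * Em)" "car m' n' (tp Em * F * En)"
    by (rule car_mult[OF car_mult[OF car_tp[OF En(1)] car(1)] En(1)] car_mult[OF car_mult[OF car_tp[OF En(1)] car(2)] Em(1)]
      car_mult[OF car(3) En(1)] car_mult[OF car(4) Em(1)] car_mult[OF car_mult[OF car_tp[OF Em(1)] F(1)] En(1)])+
  moreover have "cj (tp Em * F * En) = tp Em * F * En" by (simp add: cj_mult F En Em)
  moreover have "cj (tp En * A * En) = tp En * A * En" "cj (tp En * B * Em) = tp En * B * Em" "cj (C * En) = C * En" "cj (D * Em) = D * Em"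
    by (simp_all add: cj_mult re En(2) Em(2))
  ultimately show ?thesis
    unfolding ric_hyp_def by blast
qed

text \<open>The coordinates in \<open>S\<close> and \<open>T\<close> are invariant under the data,
  and \<open>En\<close>, \<open>Em\<close> are isometries onto them. So the equations of the small
  problem, conjugated by these isometries, hold at full size.\<close>

lemma ric_sol_lift:
  assumes sol: "ric_sol n' m' (tp En * A * En) (tp En * B * Em) (C * En) (D * Em) X F"
    and car: "car n n A" "car n m B"
    and En: "car n n' En" "cj En = En" "tp En * En = ix n'" "En * tp En = dg S" "finite S"
    and Em: "car m m' Em" "cj Em = Em" "tp Em * Em = ix m'" "Em * tp Em = dg T"
    and comm: "A * dg S = dg S * A" "B * dg T = dg S * B"
  defines "Ft \<equiv> Em * F * tp En" and "Xt \<equiv> En * X * tp En"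
  shows "dg T * Ft = Ft" "Ft * dg S = Ft" "dg S * Xt = Xt" "Xt * dg S = Xt" "cj Ft = Ft"
    "tp (D * dg T) * (C * dg S + D * Ft) + tp (B * dg T) * Xt = 0"
    "tp (A * dg S + B * Ft) * Xt + Xt * (A * dg S + B * Ft) + tp (C * dg S + D * Ft) * (C * dg S + D * Ft) = 0"
    "stbl S (A * dg S + B * Ft)"
proof -
  have X: "car n' n' X" "car m' n' F" "cj F = F"
    and e1: "tp (D * Em) * (C * En + D * Em * F) + tp (tp En * B * Em) * X = 0"
    and e2: "tp (tp En * A * En + tp En * B * Em * F) * X + X * (tp En * A * En + tp En * B * Em * F) + tp (C * En + D * Em * F) * (C * En + D * Em * F) = 0"
    and hw: "hurw n' (tp En * A * En + tp En * B * Em * F)"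
    using sol unfolding ric_sol_def by blast+
  have EE: "tp En * (En * x) = ix n' * x" "tp Em * (Em * x) = ix m' * x" for x
    by (simp_all add: mult.assoc[symmetric] En Em)
  note k = ix_left[OF X(1)] ix_left'[OF X(1)] ix_right[OF X(1)] ix_right'[OF X(1)] ix_left[OF X(2)] ix_left'[OF X(2)]
    ix_left[OF car_tp[OF En(1)]] ix_left'[OF car_tp[OF En(1)]] ix_left[OF car_tp[OF Em(1)]] ix_left'[OF car_tp[OF Em(1)]]
    ix_right[OF En(1)] ix_right[OF Em(1)] ix_right'[OF En(1)] ix_right'[OF Em(1)]
  show "dg T * Ft = Ft" "Ft * dg S = Ft" "dg S * Xt = Xt" "Xt * dg S = Xt"
    by (simp_all add: Ft_def Xt_def En(4)[symmetric] Em(4)[symmetric] mult.assoc EE k)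
  show "cj Ft = Ft" by (simp add: Ft_def cj_mult En Em X)
  have dgE: "dg S * En = En" "dg T * Em = Em"
    by (simp_all add: En(4)[symmetric] Em(4)[symmetric] mult.assoc En(3) Em(3) k)
  have AE: "A * En = En * (tp En * A * En)" "B * Em = En * (tp En * B * Em)"
  proof -
    have "A * En = (A * dg S) * En" by (simp add: mult.assoc dgE)
    then show "A * En = En * (tp En * A * En)" unfolding comm by (simp add: En(4)[symmetric] mult.assoc)
    have "B * Em = (B * dg T) * Em" by (simp add: mult.assoc dgE)
    then show "B * Em = En * (tp En * B * Em)" unfolding comm by (simp add: En(4)[symmetric] mult.assoc)
  qed
  define A' where "A' = tp En * A * En + tp En * B * Em * F"
  define C' where "C' = C * En + D * Em * F"
  have AF: "A * dg S + B * Ft = En * A' * tp En"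
  proof -
    have "A * dg S + B * Ft = (A * En) * tp En + (B * Em) * F * tp En" by (simp add: En(4)[symmetric] Ft_def mult.assoc)
    also have "\<dots> = En * A' * tp En" unfolding AE by (simp add: A'_def algebra_simps)
    finally show ?thesis .
  qed
  have CF: "C * dg S + D * Ft = C' * tp En" by (simp add: En(4)[symmetric] Ft_def C'_def algebra_simps)
  have "tp (D * dg T) * (C' * tp En) + tp (B * dg T) * Xt = Em * (tp (D * Em) * C' + tp (B * Em) * En * X) * tp En"
    by (simp add: Em(4)[symmetric] tp_mult Xt_def algebra_simps)
  also have "tp (B * Em) * En = tp (tp En * B * Em)" by (simp add: tp_mult mult.assoc)
  finally show "tp (D * dg T) * (C * dg S + D * Ft) + tp (B * dg T) * Xt = 0" unfolding CF e1[folded C'_def] by simp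
  have "tp (En * A' * tp En) * Xt + Xt * (En * A' * tp En) + tp (C' * tp En) * (C' * tp En)
     = En * (tp A' * X + X * A' + tp C' * C') * tp En"
    by (simp add: Xt_def tp_mult algebra_simps EE k)
  then show "tp (A * dg S + B * Ft) * Xt + Xt * (A * dg S + B * Ft) + tp (C * dg S + D * Ft) * (C * dg S + D * Ft) = 0"
    unfolding AF CF e2[folded A'_def C'_def] by simp
  show "stbl S (A * dg S + B * Ft)"
    unfolding AF by (rule stbl_lift[OF hurw_stbl[OF hw[folded A'_def]] En(1,3,4,5)])
qed

text \<open>The estimators are obtained from transposed data; this brings their stability
  back.\<close>

lemma stbl_tp: "stbl T (tp A) \<Longrightarrow> stbl T A"
proof -
  assume s: "stbl T (tp A)"
  have "isrsv T A s (tp W)" if W: "isrsv T (tp A) s W" for s W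
  proof -
    have "tp (dg T * W) = tp W" "tp (W * dg T) = tp W" "tp (W * (s *c dg T - tp A)) = tp (dg T)" "tp ((s *c dg T - tp A) * W) = tp (dg T)"
      using W unfolding isrsv_def by (simp_all only:)
    then show ?thesis unfolding isrsv_def by (simp add: tp_mult)
  qed
  then have "\<exists>V. isrsv T A s V \<and> norm V \<le> c" if "\<exists>W. isrsv T (tp A) s W \<and> norm W \<le> c" for s c
    using that by (metis norm_tp)
  then show ?thesis using s unfolding stbl_def by meson
qed

lemma stbl_no_eigenvector:
  assumes "stbl T A" and "dg T * x = x" and "A * x = z *c x" and "0 \<le> Re z"
  shows "x = 0"
proof -
  obtain W where W: "isrsv T A z W" using assms(1,4) unfolding stbl_def by (smt (verit))
  have "(z *c dg T - A) * x = 0" using assms(2,3) by (simp add: left_diff_distrib csc_left)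
  then have "W * ((z *c dg T - A) * x) = 0" by simp
  then show ?thesis using W assms(2) unfolding isrsv_def mult.assoc[symmetric] by simp
qed

text \<open>The local filters do not interact. Multiplying a global equation by one block projection
  leaves the equation of that agent, and the projections add up to the identity.\<close>

lemma est_assemble:
  fixes A C B D :: fmat and dn dw dq :: "nat \<Rightarrow> nat set" and Lt Yt :: "nat \<Rightarrow> fmat"
  assumes car: "car n n A" "car q n C" "car n w B" "car q w D"
    and sums: "(\<Sum>i<N. dg (dn i)) = ix n" "(\<Sum>i<N. dg (dq i)) = ix q"
    and disj: "\<And>i j. i < N \<Longrightarrow> j < N \<Longrightarrow> i \<noteq> j \<Longrightarrow> dg (dn i) * dg (dn j) = 0"
      "\<And>i j. i < N \<Longrightarrow> j < N \<Longrightarrow> i \<noteq> j \<Longrightarrow> dg (dq i) * dg (dq j) = 0"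
    and idem: "\<And>i. i < N \<Longrightarrow> dg (dn i) * dg (dn i) = dg (dn i)" "\<And>i. i < N \<Longrightarrow> dg (dw i) * dg (dw i) = dg (dw i)"
    and Ac: "\<And>i. i < N \<Longrightarrow> A * dg (dn i) = dg (dn i) * A"
    and Cc: "\<And>i. i < N \<Longrightarrow> C * dg (dn i) = dg (dq i) * C"
    and Bc: "\<And>i. i < N \<Longrightarrow> B * dg (dw i) = dg (dn i) * B"
    and Dc: "\<And>i. i < N \<Longrightarrow> D * dg (dw i) = dg (dq i) * D"
    and Lt: "\<And>i. i < N \<Longrightarrow> dg (dn i) * Lt i = Lt i" "\<And>i. i < N \<Longrightarrow> Lt i * dg (dq i) = Lt i"
    and Yt: "\<And>i. i < N \<Longrightarrow> dg (dn i) * Yt i = Yt i" "\<And>i. i < N \<Longrightarrow> Yt i * dg (dn i) = Yt i"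
    and r: "\<And>i. i < N \<Longrightarrow> (dg (dn i) * B + Lt i * D) * tp D * dg (dq i) + Yt i * tp C * dg (dq i) = 0"
    and l: "\<And>i. i < N \<Longrightarrow> (dg (dn i) * A + Lt i * C) * Yt i + Yt i * tp (dg (dn i) * A + Lt i * C)
        + (dg (dn i) * B + Lt i * D) * tp (dg (dn i) * B + Lt i * D) = 0"
    and s: "\<And>i. i < N \<Longrightarrow> stbl (dn i) (dg (dn i) * A + Lt i * C)"
  defines "L \<equiv> \<Sum>i<N. Lt i" and "Y \<equiv> \<Sum>i<N. Yt i"
  shows "(B + L * D) * tp D + Y * tp C = 0"
    "(A + L * C) * Y + Y * tp (A + L * C) + (B + L * D) * tp (B + L * D) = 0"
    "stbl {..<n} (A + L * C)"
    "\<And>j k. j < N \<Longrightarrow> k < N \<Longrightarrow> j \<noteq> k \<Longrightarrow> Lt k * dg (dq j) = 0"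
proof -
  have Lz: "Lt k * dg (dq j) = 0" "dg (dn j) * Lt k = 0" "dg (dn j) * Yt k = 0" "Yt k * dg (dn j) = 0"
    if "j < N" "k < N" "j \<noteq> k" for j k
  proof -
    have "Lt k * dg (dq j) = Lt k * (dg (dq k) * dg (dq j))" by (simp only: mult.assoc[symmetric] Lt(2)[OF that(2)])
    then show "Lt k * dg (dq j) = 0" using disj(2)[of k j] that by simp
    have "dg (dn j) * Lt k = dg (dn j) * dg (dn k) * Lt k" by (simp only: mult.assoc Lt(1)[OF that(2)])
    then show "dg (dn j) * Lt k = 0" using disj(1)[of j k] that by simp
    have "dg (dn j) * Yt k = dg (dn j) * dg (dn k) * Yt k" by (simp only: mult.assoc Yt(1)[OF that(2)])
    then show "dg (dn j) * Yt k = 0" using disj(1)[of j k] that by simp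
    have "Yt k * dg (dn j) = Yt k * (dg (dn k) * dg (dn j))" by (simp only: mult.assoc[symmetric] Yt(2)[OF that(2)])
    then show "Yt k * dg (dn j) = 0" using disj(1)[of k j] that by simp
  qed
  show "\<And>j k. j < N \<Longrightarrow> k < N \<Longrightarrow> j \<noteq> k \<Longrightarrow> Lt k * dg (dq j) = 0" by (rule Lz)
  have pick: "(\<Sum>k<N. f k) = f i" if "i < N" "\<And>k. k < N \<Longrightarrow> k \<noteq> i \<Longrightarrow> f k = 0" for f :: "nat \<Rightarrow> fmat" and i
  proof -
    have "(\<Sum>k<N. f k) = (\<Sum>k<N. if k = i then f i else 0)" using that(2) by (intro sum.cong) auto
    then show ?thesis using that(1) by simp
  qed
  have Lp: "L * dg (dq i) = Lt i" "dg (dn i) * L = Lt i" "dg (dn i) * Y = Yt i" "Y * dg (dn i) = Yt i" if i: "i < N" for i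
    unfolding L_def Y_def sum_distrib_left sum_distrib_right
    using pick[OF i, of "\<lambda>k. Lt k * dg (dq i)"] pick[OF i, of "\<lambda>k. dg (dn i) * Lt k"]
      pick[OF i, of "\<lambda>k. dg (dn i) * Yt k"] pick[OF i, of "\<lambda>k. Yt k * dg (dn i)"] Lz[OF i] Lt[OF i] Yt[OF i]
    by metis+
  have ixi: "ix n * Lt i = Lt i" "Lt i * ix q = Lt i" "ix n * Yt i = Yt i" "Yt i * ix n = Yt i" if i: "i < N" for i
  proof -
    have e: "ix n * dg (dn i) = dg (dn i)" "dg (dn i) * ix n = dg (dn i)"
      unfolding sums(1)[symmetric] sum_distrib_right sum_distrib_left
      using pick[OF i, of "\<lambda>k. dg (dn k) * dg (dn i)"] pick[OF i, of "\<lambda>k. dg (dn i) * dg (dn k)"] disj(1)[OF _ i] disj(1)[OF i] idem(1)[OF i] by auto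
    show "ix n * Lt i = Lt i" using Lt[OF i] e by (metis mult.assoc)
    show "ix n * Yt i = Yt i" "Yt i * ix n = Yt i" using Yt[OF i] e by (metis mult.assoc)+
    show "Lt i * ix q = Lt i" unfolding sums(2)[symmetric] sum_distrib_left
      using pick[OF i, of "\<lambda>k. Lt i * dg (dq k)"] Lz(1)[OF _ i] Lt(2)[OF i] by simp
  qed
  have cL: "car n q L" and cY: "car n n Y" unfolding L_def Y_def car_iff by (simp_all add: sum_distrib_left sum_distrib_right ixi)
  let ?Al = "A + L * C" and ?BL = "B + L * D"
  have cAl: "car n n ?Al" by (rule car_add[OF car(1) car_mult[OF cL car(2)]])
  have cBl: "car n w ?BL" by (rule car_add[OF car(3) car_mult[OF cL car(4)]])
  have Ai: "?Al * dg (dn i) = dg (dn i) * A + Lt i * C" "dg (dn i) * ?Al = dg (dn i) * A + Lt i * C" if i: "i < N" for i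
  proof -
    show "?Al * dg (dn i) = dg (dn i) * A + Lt i * C"
      by (simp only: distrib_right mult.assoc Cc[OF i] Ac[OF i]) (simp only: mult.assoc[symmetric] Lp[OF i])
    show "dg (dn i) * ?Al = dg (dn i) * A + Lt i * C"
      by (simp only: distrib_left) (simp only: mult.assoc[symmetric] Lp[OF i])
  qed
  have Bi: "?BL * dg (dw i) = dg (dn i) * B + Lt i * D" "dg (dn i) * ?BL = dg (dn i) * B + Lt i * D" if i: "i < N" for i
  proof -
    show "?BL * dg (dw i) = dg (dn i) * B + Lt i * D"
      by (simp only: distrib_right mult.assoc Dc[OF i] Bc[OF i]) (simp only: mult.assoc[symmetric] Lp[OF i])
    show "dg (dn i) * ?BL = dg (dn i) * B + Lt i * D"
      by (simp only: distrib_left) (simp only: mult.assoc[symmetric] Lp[OF i])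
  qed
  have t: "dg (dn i) * tp C = tp C * dg (dq i)" if i: "i < N" for i
    using arg_cong[OF Cc[OF i], of tp] by (simp_all add: tp_mult)
  have tD: "dg (dw i) * tp D = tp D * dg (dq i)" if i: "i < N" for i
    using arg_cong[OF Dc[OF i], of tp] by (simp add: tp_mult)
  show "?BL * tp D + Y * tp C = 0"
  proof -
    have z: "(?BL * tp D + Y * tp C) * dg (dq i) = 0" if i: "i < N" for i
    proof -
      have d2: "dg (dw i) * (dg (dw i) * tp D) = dg (dw i) * tp D" by (simp only: mult.assoc[symmetric] idem[OF i])
      have "(?BL * tp D + Y * tp C) * dg (dq i) = (?BL * dg (dw i)) * (dg (dw i) * tp D) + (Y * dg (dn i)) * tp C"
        by (simp only: distrib_right mult.assoc t[OF i] tD[OF i, symmetric] d2)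
      also have "\<dots> = (dg (dn i) * B + Lt i * D) * tp D * dg (dq i) + Yt i * tp C"
        by (simp only: Bi[OF i] Lp[OF i] tD[OF i] mult.assoc)
      also have "Yt i * tp C = (Yt i * dg (dn i)) * tp C" by (simp only: Yt[OF i])
      also have "\<dots> = Yt i * tp C * dg (dq i)" by (simp only: mult.assoc t[OF i])
      finally show ?thesis by (simp only: r[OF i])
    qed
    have c: "car n q (?BL * tp D + Y * tp C)"
      by (rule car_add[OF car_mult[OF cBl car_tp[OF car(4)]] car_mult[OF cY car_tp[OF car(2)]]])
    have "(?BL * tp D + Y * tp C) * ix q = 0"
      unfolding sums(2)[symmetric] sum_distrib_left using z by (intro sum.neutral) auto
    then show ?thesis using ix_right[OF c] by simp
  qed
  show "?Al * Y + Y * tp ?Al + ?BL * tp ?BL = 0" (is "?M = 0")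
  proof -
    have z: "?M * dg (dn i) = 0" if i: "i < N" for i
    proof -
      have Yd: "Y * dg (dn i) = dg (dn i) * Yt i" by (simp only: Lp[OF i] Yt[OF i])
      have ta: "tp ?Al * dg (dn i) = tp (dg (dn i) * ?Al)" "tp ?BL * dg (dn i) = tp (dg (dn i) * ?BL)" by (simp_all only: tp_mult tp_dg)
      have ta': "dg (dn i) * tp ?Al = tp (?Al * dg (dn i))" "dg (dw i) * tp ?BL = tp (?BL * dg (dw i))" by (simp_all only: tp_mult tp_dg)
      have 1: "?Al * Y * dg (dn i) = (dg (dn i) * A + Lt i * C) * Yt i"
        by (simp only: mult.assoc Yd) (simp only: mult.assoc[symmetric] Ai[OF i])
      have "tp ?Al * dg (dn i) = dg (dn i) * tp ?Al" by (simp only: ta ta' Ai[OF i])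
      then have 2: "Y * tp ?Al * dg (dn i) = Yt i * tp (dg (dn i) * A + Lt i * C)"
      proof -
        assume h: "tp ?Al * dg (dn i) = dg (dn i) * tp ?Al"
        have "Y * tp ?Al * dg (dn i) = (Y * dg (dn i)) * (dg (dn i) * tp ?Al)"
        proof -
          have "dg (dn i) * (dg (dn i) * tp ?Al) = dg (dn i) * tp ?Al" by (simp only: mult.assoc[symmetric] idem[OF i])
          then show ?thesis by (simp only: mult.assoc h)
        qed
        then show ?thesis by (simp only: Lp[OF i] ta' Ai[OF i])
      qed
      have "tp ?BL * dg (dn i) = dg (dw i) * tp ?BL" by (simp only: ta ta' Bi[OF i])
      then have 3: "?BL * tp ?BL * dg (dn i) = (dg (dn i) * B + Lt i * D) * tp (dg (dn i) * B + Lt i * D)"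
      proof -
        assume h: "tp ?BL * dg (dn i) = dg (dw i) * tp ?BL"
        have "?BL * tp ?BL * dg (dn i) = (?BL * dg (dw i)) * (dg (dw i) * tp ?BL)"
        proof -
          have "dg (dw i) * (dg (dw i) * tp ?BL) = dg (dw i) * tp ?BL" by (simp only: mult.assoc[symmetric] idem[OF i])
          then show ?thesis by (simp only: mult.assoc h)
        qed
        then show ?thesis by (simp only: ta' Bi[OF i])
      qed
      show ?thesis unfolding distrib_right[of _ _ "dg (dn i)"] 1 2 3 l[OF i] ..
    qed
    have "?M * ix n = 0"
      unfolding sums(1)[symmetric] sum_distrib_left using z by (intro sum.neutral) auto
    moreover have "car n n ?M"
      by (rule car_add[OF car_add[OF car_mult[OF cAl cY] car_mult[OF cY car_tp[OF cAl]]] car_mult[OF cBl car_tp[OF cBl]]])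
    ultimately show ?thesis using ix_right by metis
  qed
  show "stbl {..<n} ?Al"
  proof (rule hurw_stbl)
    show "hurw n ?Al" unfolding hurw_def
    proof (intro conjI allI impI)
      show "car n n ?Al" by (rule cAl)
    next
      fix z x assume x: "ix n * x = x" "x \<noteq> 0" "?Al * x = z *c x"
      show "Re z < 0"
      proof (rule ccontr)
        assume "\<not> Re z < 0"
        then have z: "0 \<le> Re z" by simp
        \<comment> \<open>The block of an unstable eigenvector that belongs to agent
          \<open>i\<close> satisfies the eigenvalue equation of the local filter, which is stable,
          so the block is zero.\<close>
        have "dg (dn i) * x = 0" if i: "i < N" for i
        proof (rule stbl_no_eigenvector[OF s[OF i] _ _ z])
          show "dg (dn i) * (dg (dn i) * x) = dg (dn i) * x" by (simp only: mult.assoc[symmetric] idem[OF i])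
          have "(dg (dn i) * A + Lt i * C) * (dg (dn i) * x) = (?Al * dg (dn i)) * (dg (dn i) * x)" by (simp only: Ai[OF i])
          also have "\<dots> = (?Al * dg (dn i)) * x" by (simp only: mult.assoc) (simp only: mult.assoc[symmetric] idem[OF i])
          also have "\<dots> = dg (dn i) * (?Al * x)" by (simp only: Ai[OF i] mult.assoc[symmetric])
          finally show "(dg (dn i) * A + Lt i * C) * (dg (dn i) * x) = z *c (dg (dn i) * x)" by (simp only: x(3) csc_right)
        qed
        then have "ix n * x = 0" unfolding sums(1)[symmetric] sum_distrib_right by (intro sum.neutral) auto
        then show False using x by simp
      qed
    qed
  qed
qed

section \<open>The networked plant\<close>

locale network =
  fixes N :: nat and E :: "(nat \<times> nat) set"
    and nd md pd wd :: "nat \<Rightarrow> nat" and n m p nw nz :: nat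
    and A B1 B2 C1 C2 D12 D21 Fd L :: "real mat"
    and F Lg :: "nat \<Rightarrow> real mat"
  assumes graph: "E \<subseteq> {..<N} \<times> {..<N}"
    and dims: "n = (\<Sum>k<N. nd k)" "m = (\<Sum>k<N. md k)" "p = (\<Sum>k<N. pd k)" "nw = (\<Sum>k<N. wd k)"
    and plant: "block_diagonal N nd nd A" "block_diagonal N nd wd B1" "block_diagonal N nd md B2"
      "block_diagonal N pd nd C2" "block_diagonal N pd wd D21"
      "C1 \<in> carrier_mat nz n" "D12 \<in> carrier_mat nz m"
    and sys: "system_assumptions N nd md pd wd A B1 B2 C1 C2 D12 D21"
    and Fd: "block_diagonal N md nd Fd" "hurwitz (A + B2 * Fd)"
    and F: "\<And>i. i < N \<Longrightarrow> F i = ctrl_gain N E nd md A B2 C1 D12 i"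
    and Lg: "\<And>i. i < N \<Longrightarrow> Lg i = est_gain nd pd wd A B1 C2 D21 i"
    and L: "L = diag_block_mat (map Lg [0..<N])"
begin

definition "De j = descendants N E j"
definition "tn j = blk nd (set (De j))"
definition "tm j = blk md (set (De j))"
definition "tq j = blk pd {j}"
definition "Ft j = rm (embed N md (De j)) * rm (F j) * tp (rm (embed N nd (De j)))"
definition "Lt j = rm (embed N nd [j]) * rm (Lg j) * tp (rm (embed N pd [j]))"

lemma noff: "off nd N = n" "off md N = m" "off pd N = p" "off wd N = nw"
  by (simp_all add: off_def dims)

lemma carr: "A \<in> carrier_mat n n" "B1 \<in> carrier_mat n nw" "B2 \<in> carrier_mat n m" "C1 \<in> carrier_mat nz n"
    "C2 \<in> carrier_mat p n" "D12 \<in> carrier_mat nz m" "D21 \<in> carrier_mat p nw" "Fd \<in> carrier_mat m n"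
  using plant Fd by (simp_all add: block_diagonal_def dims)

lemma carF: "car n n (rm A)" "car n nw (rm B1)" "car n m (rm B2)" "car nz n (rm C1)"
    "car p n (rm C2)" "car nz m (rm D12)" "car p nw (rm D21)" "car m n (rm Fd)"
  using carr car_rm by blast+

lemma De_mem: "j \<in> set (De j)" by (simp add: De_def descendants_def)

lemma De_sub: "j < N \<Longrightarrow> set (De j) \<subseteq> {..<N}" by (auto simp: De_def descendants_def)

lemma De_distinct: "distinct (De j)" by (auto simp: De_def descendants_def reaches_def)

lemma De_iff: "j < N \<Longrightarrow> k < N \<Longrightarrow> k \<in> set (De j) \<longleftrightarrow> k = j \<or> reaches E j k"
  by (auto simp: De_def descendants_def)

lemma De_trans: "j < N \<Longrightarrow> k \<in> set (De j) \<Longrightarrow> set (De k) \<subseteq> set (De j)"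
  by (auto simp: De_def descendants_def reaches_def dest: trancl_trans)

lemma hurwFd: "hurw n (rm A + rm B2 * rm Fd)"
proof -
  have "A + B2 * Fd \<in> carrier_mat n n" using carr by auto
  moreover have "rm (A + B2 * Fd) = rm A + rm B2 * rm Fd"
    using carr rm_add[of A n n "B2 * Fd"] rm_mult[of B2 Fd] by simp
  ultimately show ?thesis using Fd(2) hurwitz_iff by metis
qed

lemma comm:
  assumes "S \<subseteq> {..<N}"
  shows "rm A * dg (blk nd S) = dg (blk nd S) * rm A" "rm B1 * dg (blk wd S) = dg (blk nd S) * rm B1"
    "rm B2 * dg (blk md S) = dg (blk nd S) * rm B2" "rm C2 * dg (blk nd S) = dg (blk pd S) * rm C2"
    "rm D21 * dg (blk wd S) = dg (blk pd S) * rm D21" "rm Fd * dg (blk nd S) = dg (blk md S) * rm Fd"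
  using plant Fd block_diagonal_comm[OF _ assms] by blast+

text \<open>One predicate for a padded Riccati solution with everything \<open>dsys\<close> asks of
  it, so that \<open>SOME\<close> can fix the solution and all its properties at once.\<close>

definition "ctrl_sol j X \<longleftrightarrow> dg (tm j) * Ft j = Ft j \<and> Ft j * dg (tn j) = Ft j \<and> dg (tn j) * X = X \<and> X * dg (tn j) = X \<and> cj (Ft j) = Ft j \<and>
    tp (rm D12 * dg (tm j)) * (rm C1 * dg (tn j) + rm D12 * Ft j) + tp (rm B2 * dg (tm j)) * X = 0 \<and>
    tp (rm A * dg (tn j) + rm B2 * Ft j) * X + X * (rm A * dg (tn j) + rm B2 * Ft j)
      + tp (rm C1 * dg (tn j) + rm D12 * Ft j) * (rm C1 * dg (tn j) + rm D12 * Ft j) = 0 \<and>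
    stbl (tn j) (rm A * dg (tn j) + rm B2 * Ft j) \<and> F j \<in> carrier_mat (length (block_idx md (De j))) (length (block_idx nd (De j)))"

lemma ctrl_data:
  assumes j: "j < N"
  shows "\<exists>X. ctrl_sol j X"
proof -
  let ?S = "De j"
  let ?n = "length (block_idx nd ?S)" and ?m = "length (block_idx md ?S)"
  let ?En = "rm (embed N nd ?S)" and ?Em = "rm (embed N md ?S)"
  note S = De_sub[OF j] and dS = De_distinct[of j]
  have H: "ric_hyp n m nz (rm A) (rm B2) (rm C1) (rm D12)"
    by (rule riccati_assumptions_hyp[OF carr(1,3,4,6)]) (use sys in \<open>simp add: system_assumptions_def\<close>)
  have cE: "car n ?n ?En" "car m ?m ?Em" using car_rm[OF embed_carrier] noff by metis+
  note En = cE(1) cj_rm embed_iso[OF S dS] and Em = cE(2) cj_rm embed_iso[OF S dS]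
  note cm = comm[OF S]
  have H': "ric_hyp ?n ?m nz (tp ?En * rm A * ?En) (tp ?En * rm B2 * ?Em) (rm C1 * ?En) (rm D12 * ?Em)"
    by (rule ric_hyp_sub[OF H carF(8) cj_rm hurwFd En Em cm(1,3,6)])
  have cA: "A \<in> carrier_mat (off nd N) (off nd N)" and cB: "B2 \<in> carrier_mat (off nd N) (off md N)"
    and cC: "C1 \<in> carrier_mat nz (off nd N)" and cD: "D12 \<in> carrier_mat nz (off md N)" using carr noff by auto
  note sA = rm_sub_block[OF cA S S] and sB = rm_sub_block[OF cB S S] and sC = rm_sub_cols[OF cC S] and sD = rm_sub_cols[OF cD S]
  obtain X G where XG: "ric (sub_block nd nd A ?S ?S) (sub_block nd md B2 ?S ?S) (sub_cols nd C1 ?S) (sub_cols md D12 ?S) = (X, G)"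
      "G \<in> carrier_mat ?m ?n"
      "ric_sol ?n ?m (tp ?En * rm A * ?En) (tp ?En * rm B2 * ?Em) (rm C1 * ?En) (rm D12 * ?Em) (rm X) (rm G)"
    using ric_correct[OF sA(1) sB(1) sC(1) sD(1)] H' unfolding sA(2) sB(2) sC(2) sD(2) by blast
  have G: "G = F j" using XG(1) F[OF j] by (simp add: ctrl_gain_def De_def Let_def)
  have fin: "finite (blk nd (set ?S))" by (rule finite_blk) simp
  note l = ric_sol_lift[OF XG(3) carF(1,3) En fin Em cm(1,3), unfolded G, folded Ft_def tn_def tm_def]
  show ?thesis unfolding ctrl_sol_def using l XG(2)[unfolded G] by blast
qed

definition "est_sol i Y \<longleftrightarrow> dg (blk nd {i}) * Lt i = Lt i \<and> Lt i * dg (blk pd {i}) = Lt i \<and> dg (blk nd {i}) * Y = Y \<and> Y * dg (blk nd {i}) = Y \<and>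
    tp Y = Y \<and> cj (Lt i) = Lt i \<and>
    (dg (blk nd {i}) * rm B1 + Lt i * rm D21) * tp (rm D21) * dg (blk pd {i}) + Y * tp (rm C2) * dg (blk pd {i}) = 0 \<and>
    (dg (blk nd {i}) * rm A + Lt i * rm C2) * Y + Y * tp (dg (blk nd {i}) * rm A + Lt i * rm C2)
      + (dg (blk nd {i}) * rm B1 + Lt i * rm D21) * tp (dg (blk nd {i}) * rm B1 + Lt i * rm D21) = 0 \<and>
    stbl (blk nd {i}) (dg (blk nd {i}) * rm A + Lt i * rm C2) \<and> Lg i \<in> carrier_mat (nd i) (pd i)"

text \<open>By duality each estimator is a control problem for transposed data. Its solution is
  padded as for the control gains and transposed back.\<close>

lemma est_data:
  assumes i: "i < N"
  shows "\<exists>Y. est_sol i Y"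
proof -
  have S: "set [i] \<subseteq> {..<N}" and dS: "distinct [i]" using i by auto
  let ?n = "nd i" and ?q = "pd i" and ?w = "wd i"
  let ?En = "rm (embed N nd [i])" and ?Ep = "rm (embed N pd [i])" and ?Ew = "rm (embed N wd [i])"
  have len: "length (block_idx d [i]) = d i" for d by (simp add: block_idx_def)
  have cE: "car n ?n ?En" "car p ?q ?Ep" "car nw ?w ?Ew" using car_rm[OF embed_carrier] noff len by metis+
  note iso = embed_iso[OF S dS, unfolded len, simplified list.set]
  note cm = comm[OF S, simplified list.set]
  have cA: "A \<in> carrier_mat (off nd N) (off nd N)" and cB: "B1 \<in> carrier_mat (off nd N) (off wd N)"
    and cC: "C2 \<in> carrier_mat (off pd N) (off nd N)" and cD: "D21 \<in> carrier_mat (off pd N) (off wd N)" using carr noff by auto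
  note sA = rm_sub_block[OF cA S S, unfolded len] and sB = rm_sub_block[OF cB S S, unfolded len]
    and sC = rm_sub_block[OF cC S S, unfolded len] and sD = rm_sub_block[OF cD S S, unfolded len]
  let ?A = "transpose_mat (sub_block nd nd A [i] [i])" and ?B = "transpose_mat (sub_block pd nd C2 [i] [i])"
    and ?C = "transpose_mat (sub_block nd wd B1 [i] [i])" and ?D = "transpose_mat (sub_block pd wd D21 [i] [i])"
  have c: "?A \<in> carrier_mat ?n ?n" "?B \<in> carrier_mat ?n ?q" "?C \<in> carrier_mat ?w ?n" "?D \<in> carrier_mat ?w ?q"
    using sA(1) sB(1) sC(1) sD(1) by simp_all
  have r: "rm ?A = tp ?En * tp (rm A) * ?En" "rm ?B = tp ?En * tp (rm C2) * ?Ep" "rm ?C = tp ?Ew * (tp (rm B1) * ?En)" "rm ?D = tp ?Ew * (tp (rm D21) * ?Ep)"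
    by (simp_all add: rm_transpose sA(2) sB(2) sC(2) sD(2) tp_mult mult.assoc)
  have "riccati_assumptions ?A ?B ?C ?D" using sys i by (simp add: system_assumptions_def)
  from riccati_assumptions_hyp[OF c this]
  obtain Y G where YG: "ric ?A ?B ?C ?D = (Y, G)" "G \<in> carrier_mat ?q ?n"
      "ric_sol ?n ?q (rm ?A) (rm ?B) (rm ?C) (rm ?D) (rm Y) (rm G)"
    using ric_correct[OF c] by blast
  have LG: "Lg i = transpose_mat G" using YG(1) Lg[OF i] by (simp add: est_gain_def)
  have push: "?Ew * (tp ?Ew * (tp (rm B1) * ?En)) = tp (rm B1) * ?En" "?Ew * (tp ?Ew * (tp (rm D21) * ?Ep)) = tp (rm D21) * ?Ep"
  proof -
    have t: "dg (blk wd {i}) * tp (rm B1) = tp (rm B1) * dg (blk nd {i})" "dg (blk wd {i}) * tp (rm D21) = tp (rm D21) * dg (blk pd {i})"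
      using arg_cong[OF cm(2), of tp] arg_cong[OF cm(5), of tp] by (simp_all add: tp_mult)
    have d: "dg (blk nd {i}) * ?En = ?En" "dg (blk pd {i}) * ?Ep = ?Ep"
      by (simp_all add: iso(2)[symmetric] mult.assoc iso(1) ix_right[OF cE(1)] ix_right[OF cE(2)])
    have "?Ew * (tp ?Ew * (tp (rm B1) * ?En)) = (?Ew * tp ?Ew) * tp (rm B1) * ?En" by (simp only: mult.assoc)
    also have "\<dots> = tp (rm B1) * (dg (blk nd {i}) * ?En)" by (simp only: iso(2) t mult.assoc)
    finally show "?Ew * (tp ?Ew * (tp (rm B1) * ?En)) = tp (rm B1) * ?En" by (simp only: d)
    have "?Ew * (tp ?Ew * (tp (rm D21) * ?Ep)) = (?Ew * tp ?Ew) * tp (rm D21) * ?Ep" by (simp only: mult.assoc)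
    also have "\<dots> = tp (rm D21) * (dg (blk pd {i}) * ?Ep)" by (simp only: iso(2) t mult.assoc)
    finally show "?Ew * (tp ?Ew * (tp (rm D21) * ?Ep)) = tp (rm D21) * ?Ep" by (simp only: d)
  qed
  have sol: "ric_sol ?n ?q (tp ?En * tp (rm A) * ?En) (tp ?En * tp (rm C2) * ?Ep) (tp (rm B1) * ?En) (tp (rm D21) * ?Ep) (rm Y) (rm G)"
  proof -
    let ?c = "tp (rm B1) * ?En" and ?d = "tp (rm D21) * ?Ep"
    have e: "rm ?C + rm ?D * rm G = tp ?Ew * (?c + ?d * rm G)" unfolding r by (simp add: distrib_left mult.assoc)
    have e1: "?Ew * (tp ?Ew * (?c + ?d * rm G)) = ?c + ?d * rm G"
      using push(1) arg_cong[OF push(2), of "\<lambda>x. x * rm G"] by (simp add: distrib_left mult.assoc)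
    have "tp (rm ?D) * (rm ?C + rm ?D * rm G) = tp ?d * (?Ew * (tp ?Ew * (?c + ?d * rm G)))"
      unfolding e unfolding r(4) by (simp only: tp_mult tp_simps mult.assoc)
    then have 1: "tp (rm ?D) * (rm ?C + rm ?D * rm G) = tp ?d * (?c + ?d * rm G)" unfolding e1 .
    have "tp (rm ?C + rm ?D * rm G) * (rm ?C + rm ?D * rm G) = tp (?c + ?d * rm G) * (?Ew * (tp ?Ew * (?c + ?d * rm G)))"
      unfolding e by (simp only: tp_mult tp_simps mult.assoc)
    then have 2: "tp (rm ?C + rm ?D * rm G) * (rm ?C + rm ?D * rm G) = tp (?c + ?d * rm G) * (?c + ?d * rm G)" unfolding e1 .
    show ?thesis using YG(3) unfolding ric_sol_def 1 2 r(1,2) .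
  qed
  have tY: "tp (rm Y) = rm Y" using YG(3) by (simp add: ric_sol_def)
  have tc: "tp (rm A) * dg (blk nd {i}) = dg (blk nd {i}) * tp (rm A)" "tp (rm C2) * dg (blk pd {i}) = dg (blk nd {i}) * tp (rm C2)"
    using arg_cong[OF cm(1), of tp] arg_cong[OF cm(4), of tp] by (simp_all add: tp_mult)
  have fin: "finite (blk nd {i})" by (rule finite_blk) simp
  define Yt where "Yt = ?En * rm Y * tp ?En"
  define Gt where "Gt = ?Ep * rm G * tp ?En"
  note l = ric_sol_lift[OF sol car_tp[OF carF(1)] car_tp[OF carF(5)] cE(1) cj_rm iso fin cE(2) cj_rm iso tc, folded Yt_def Gt_def]
  have LtG: "Lt i = tp Gt" by (simp add: Lt_def LG Gt_def rm_transpose tp_mult mult.assoc)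
  have a: "tp (tp (rm A) * dg (blk nd {i}) + tp (rm C2) * Gt) = dg (blk nd {i}) * rm A + Lt i * rm C2"
    "tp (tp (rm B1) * dg (blk nd {i}) + tp (rm D21) * Gt) = dg (blk nd {i}) * rm B1 + Lt i * rm D21"
    by (simp_all add: LtG tp_mult)
  have b: "tp (dg (blk nd {i}) * rm A + Lt i * rm C2) = tp (rm A) * dg (blk nd {i}) + tp (rm C2) * Gt"
    "tp (dg (blk nd {i}) * rm B1 + Lt i * rm D21) = tp (rm B1) * dg (blk nd {i}) + tp (rm D21) * Gt"
    by (simp_all add: LtG tp_mult)
  have tYt: "tp Yt = Yt" by (simp add: Yt_def tp_mult tY mult.assoc)
  have "dg (blk nd {i}) * Lt i = Lt i" "Lt i * dg (blk pd {i}) = Lt i"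
    using arg_cong[OF l(2), of tp] arg_cong[OF l(1), of tp] by (simp_all add: LtG tp_mult)
  moreover have "cj (Lt i) = Lt i" by (simp add: LtG l(5))
  moreover have "(dg (blk nd {i}) * rm B1 + Lt i * rm D21) * tp (rm D21) * dg (blk pd {i}) + Yt * tp (rm C2) * dg (blk pd {i}) = 0"
  proof -
    have "tp (tp (tp (rm D21) * dg (blk pd {i})) * (tp (rm B1) * dg (blk nd {i}) + tp (rm D21) * Gt) + tp (tp (rm C2) * dg (blk pd {i})) * Yt) = tp 0"
      by (simp only: l(6))
    then show ?thesis unfolding b(2)[symmetric] by (simp only: tp_mult tp_simps tp_dg tYt mult.assoc)
  qed
  moreover have "(dg (blk nd {i}) * rm A + Lt i * rm C2) * Yt + Yt * tp (dg (blk nd {i}) * rm A + Lt i * rm C2)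
      + (dg (blk nd {i}) * rm B1 + Lt i * rm D21) * tp (dg (blk nd {i}) * rm B1 + Lt i * rm D21) = 0"
    using l(7) unfolding a b .
  moreover have "stbl (blk nd {i}) (dg (blk nd {i}) * rm A + Lt i * rm C2)"
    by (rule stbl_tp) (use l(8) in \<open>simp only: b\<close>)
  moreover have "Lg i \<in> carrier_mat (nd i) (pd i)" using YG(2) LG by simp
  ultimately show ?thesis unfolding est_sol_def using l(3,4) tYt by blast
qed

definition "Xs j = (SOME X. ctrl_sol j X)"

definition "Ys i = (SOME Y. est_sol i Y)"

lemmas ctrl = someI_ex[OF ctrl_data, folded Xs_def, unfolded ctrl_sol_def]
lemmas est = someI_ex[OF est_data, folded Ys_def, unfolded est_sol_def]

definition "Yt = (\<Sum>i<N. Ys i)"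

lemma L_facts: "L \<in> carrier_mat n p" "rm L = (\<Sum>j<N. Lt j)"
proof -
  have c: "\<And>k. k < N \<Longrightarrow> Lg k \<in> carrier_mat (nd k) (pd k)" using est by blast
  have "L \<in> carrier_mat n p \<and> rm L = (\<Sum>k<N. sh (off nd k) (nd k) * rm (Lg k) * tp (sh (off pd k) (pd k)))"
    using diag_block_mat_upt[of N Lg nd pd, OF c, folded L, unfolded noff] .
  moreover have "(\<Sum>k<N. sh (off nd k) (nd k) * rm (Lg k) * tp (sh (off pd k) (pd k))) = (\<Sum>j<N. Lt j)"
    unfolding Lt_def by (intro sum.cong refl) (simp only: embed_single lessThan_iff)
  ultimately show "L \<in> carrier_mat n p" "rm L = (\<Sum>j<N. Lt j)" by simp_all
qed

lemma blk_disjoint: "i \<noteq> j \<Longrightarrow> dg (blk d {i}) * dg (blk d {j}) = 0"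
proof -
  assume "i \<noteq> j"
  then have "blk d {i} \<inter> blk d {j} = {}" unfolding blk_single using off_disjoint[of _ d i j] by blast
  moreover have "dg {} = 0" by (rule fmat_eqI) simp
  ultimately show ?thesis by (simp add: dg_mult finite_blk)
qed

lemma blk_idem: "dg (blk d {i}) * dg (blk d {i}) = dg (blk d {i})"
  by (simp add: dg_mult finite_blk)

text \<open>Here the graph turns into index sets. The gain \<open>Lt j\<close> fits into
  \<open>tn j\<close> because the list of descendants of \<open>j\<close> contains \<open>j\<close>
  itself.\<close>

sublocale dsys N n m p nw nz "rm A" "rm B1" "rm B2" "rm C1" "rm C2" "rm D12" "rm D21" "rm Fd" "rm L" Yt tn tm tq Ft Xs Lt
proof -
  have sub: "{i} \<subseteq> {..<N}" if "i < N" for i using that by simp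
  note cm = comm[OF sub]
  have e: "dg (blk nd {i}) * Lt i = Lt i" "Lt i * dg (blk pd {i}) = Lt i" "dg (blk nd {i}) * Ys i = Ys i" "Ys i * dg (blk nd {i}) = Ys i"
    "(dg (blk nd {i}) * rm B1 + Lt i * rm D21) * tp (rm D21) * dg (blk pd {i}) + Ys i * tp (rm C2) * dg (blk pd {i}) = 0"
    "(dg (blk nd {i}) * rm A + Lt i * rm C2) * Ys i + Ys i * tp (dg (blk nd {i}) * rm A + Lt i * rm C2)
      + (dg (blk nd {i}) * rm B1 + Lt i * rm D21) * tp (dg (blk nd {i}) * rm B1 + Lt i * rm D21) = 0"
    "stbl (blk nd {i}) (dg (blk nd {i}) * rm A + Lt i * rm C2)" if "i < N" for i
    using est[OF that] by blast+
  note es = est_assemble[where dn = "\<lambda>i. blk nd {i}" and dw = "\<lambda>i. blk wd {i}" and dq = "\<lambda>i. blk pd {i}" and Lt = Lt and Yt = Ys,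
      OF carF(1,5,2,7) sum_dg_blk[of nd N, unfolded noff] sum_dg_blk[of pd N, unfolded noff] blk_disjoint blk_disjoint blk_idem blk_idem
        cm(1,4,2,5) e, folded L_facts(2) Yt_def]
  have es': "(rm B1 + rm L * rm D21) * tp (rm D21) + Yt * tp (rm C2) = 0"
    "(rm A + rm L * rm C2) * Yt + Yt * tp (rm A + rm L * rm C2) + (rm B1 + rm L * rm D21) * tp (rm B1 + rm L * rm D21) = 0"
    "stbl {..<n} (rm A + rm L * rm C2)"
    by (rule es(1) es(2) es(3); assumption)+
  have es4: "Lt k * dg (blk pd {j}) = 0" if "j < N" "k < N" "j \<noteq> k" for j k
    by (rule es(4)) (rule that | assumption)+
  have bN: "blk d (set (De j)) \<subseteq> {..<off d N}" if "j < N" for d j by (rule blk_bound[OF De_sub[OF that]])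
  have sing: "dg (blk nd (set (De j))) * Lt j = Lt j" if j: "j < N" for j
  proof -
    have "blk nd (set (De j)) \<inter> blk nd {j} = blk nd {j}" using De_mem[of j] by (auto simp: blk_def)
    then have "dg (blk nd (set (De j))) * dg (blk nd {j}) = dg (blk nd {j})" by (simp add: dg_mult finite_blk)
    then show ?thesis using e(1)[OF j] by (metis mult.assoc)
  qed
  have cYs: "ix n * Ys i = Ys i" "Ys i * ix n = Ys i" if i: "i < N" for i
  proof -
    have "blk nd {i} \<subseteq> {..<n}" using blk_bound[OF sub[OF i], of nd] noff by simp
    then have "ix n * dg (blk nd {i}) = dg (blk nd {i})" "dg (blk nd {i}) * ix n = dg (blk nd {i})"
      using ix_left[OF car_dg] ix_right[OF car_dg] by blast+
    then show "ix n * Ys i = Ys i" "Ys i * ix n = Ys i" using e(3,4)[OF i] by (metis mult.assoc)+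
  qed
  have cY: "car n n Yt" unfolding Yt_def car_iff by (simp add: sum_distrib_left sum_distrib_right cYs)
  have tY: "tp Yt = Yt" unfolding Yt_def tp_sum using est by (intro sum.cong) auto
  show "dsys N n m p nw nz (rm A) (rm B1) (rm B2) (rm C1) (rm C2) (rm D12) (rm D21) (rm Fd) (rm L) Yt tn tm tq Ft Xs Lt"
  proof (unfold_locales)
    show "tn j \<subseteq> {..<n}" "tm j \<subseteq> {..<m}" "tq j \<subseteq> {..<p}" if "j < N" for j
      using bN[OF that, of nd] bN[OF that, of md] blk_bound[OF sub[OF that], of pd] by (simp_all add: tn_def tm_def tq_def noff)
    show "rm D21 * tp (rm D21) * dg (tq j) = dg (tq j) * (rm D21 * tp (rm D21))" if j: "j < N" for j
    proof -
      have "tp (rm D21) * dg (blk pd {j}) = dg (blk wd {j}) * tp (rm D21)"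
        using arg_cong[OF cm(5)[OF j], of tp] by (simp add: tp_mult)
      then have "rm D21 * tp (rm D21) * dg (tq j) = (rm D21 * dg (blk wd {j})) * tp (rm D21)" by (simp add: tq_def mult.assoc)
      then show ?thesis unfolding cm(5)[OF j] tq_def by (simp add: mult.assoc)
    qed
    show "(\<Sum>j<N. dg (tq j)) = ix p" unfolding tq_def by (rule sum_dg_blk[of pd N, unfolded noff])
    show "rm A * dg (tn j) = dg (tn j) * rm A" "rm B2 * dg (tm j) = dg (tn j) * rm B2" "rm Fd * dg (tn j) = dg (tm j) * rm Fd" if "j < N" for j
      unfolding tn_def tm_def using comm[OF De_sub[OF that]] by blast+
    show "stbl {..<n} (rm A + rm B2 * rm Fd)" by (rule hurw_stbl[OF hurwFd])
    show "rm L = (\<Sum>j<N. Lt j)" by (rule L_facts)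
    show "car n p (rm L)" by (rule car_rm[OF L_facts(1)])
    show "dg (tn j) * Lt j = Lt j" if "j < N" for j unfolding tn_def by (rule sing[OF that])
    show "Lt j * dg (tq j) = Lt j" if "j < N" for j unfolding tq_def by (rule e[OF that])
    show "Lt k * dg (tq j) = 0" if "j < N" "k < N" "j \<noteq> k" for j k unfolding tq_def by (rule es4[OF that])
    show "cj (Lt j) = Lt j" if "j < N" for j using est[OF that] by blast
  qed (use ctrl in \<open>blast intro: cj_rm carF cY tY es'\<close>)+
qed

end

section \<open>The realizations of the optimal controllers\<close>

text \<open>Block-diagonal matrices with \<open>N\<close> blocks of equal size, the common form of
  \<open>Abar\<close>, \<open>Bbar\<close>, \<open>Cbar\<close>, \<open>Fdbar\<close>,
  \<open>Fbar\<close> and \<open>Lbar\<close>. With the block columns \<open>bc\<close> they reduce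
  computations with \<open>N * n\<close> states to one copy at a time.\<close>

definition bdg :: "nat \<Rightarrow> nat \<Rightarrow> nat \<Rightarrow> (nat \<Rightarrow> fmat) \<Rightarrow> fmat" where
  "bdg N r c M = (\<Sum>k<N. sh (k * r) r * M k * tp (sh (k * c) c))"

definition bc :: "nat \<Rightarrow> nat \<Rightarrow> (nat \<Rightarrow> fmat) \<Rightarrow> fmat" where
  "bc N r x = (\<Sum>k<N. sh (k * r) r * x k)"

lemma tpsh_block: "tp (sh (k * r) r) * sh (l * r) r = (if k = l then ix r else 0)"
proof (cases "k = l")
  case False
  then have "k * r + r \<le> l * r \<or> l * r + r \<le> k * r"
    by (metis add.commute linorder_neqE_nat mult_Suc mult_le_mono1 Suc_leI)
  then show ?thesis using False by (simp add: tpsh_sh_ne)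
qed (simp add: tpsh_sh)

lemma tpsh_bc: "k < N \<Longrightarrow> tp (sh (k * r) r) * bc N r x = ix r * x k"
proof -
  assume k: "k < N"
  have "tp (sh (k * r) r) * bc N r x = (\<Sum>l<N. if k = l then ix r * x l else 0)"
    unfolding bc_def sum_distrib_left by (intro sum.cong refl) (simp only: mult.assoc[symmetric] tpsh_block, simp)
  then show ?thesis by (simp add: k)
qed

lemma bdg_bc: "(\<And>k. k < N \<Longrightarrow> car r c (M k)) \<Longrightarrow> bdg N r c M * bc N c x = bc N r (\<lambda>k. M k * x k)"
proof -
  assume M: "\<And>k. k < N \<Longrightarrow> car r c (M k)"
  have "sh (k * r) r * M k * tp (sh (k * c) c) * bc N c x = sh (k * r) r * (M k * x k)" if "k < N" for k
  proof -
    have "sh (k * r) r * M k * tp (sh (k * c) c) * bc N c x = sh (k * r) r * (M k * (tp (sh (k * c) c) * bc N c x))"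
      by (simp only: mult.assoc)
    then show ?thesis by (simp only: tpsh_bc[OF that] ix_right'[OF M[OF that]])
  qed
  then show ?thesis unfolding bdg_def by (subst sum_distrib_right) (simp add: bc_def)
qed

lemma bdg_mult:
  assumes "\<And>k. k < N \<Longrightarrow> car r c (M k)"
  shows "bdg N r c M * bdg N c d M' = bdg N r d (\<lambda>k. M k * M' k)"
proof -
  have "sh (k * r) r * M k * tp (sh (k * c) c) * bdg N c d M' = sh (k * r) r * (M k * M' k) * tp (sh (k * d) d)" if k: "k < N" for k
  proof -
    have "tp (sh (k * c) c) * bdg N c d M' = (\<Sum>l<N. if k = l then ix c * M' l * tp (sh (l * d) d) else 0)"
      unfolding bdg_def sum_distrib_left by (intro sum.cong refl) (simp only: mult.assoc[symmetric] tpsh_block, simp)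
    then have "tp (sh (k * c) c) * bdg N c d M' = ix c * M' k * tp (sh (k * d) d)" by (simp add: k)
    then have "sh (k * r) r * M k * tp (sh (k * c) c) * bdg N c d M' = sh (k * r) r * (M k * (ix c * (M' k * tp (sh (k * d) d))))"
      by (simp only: mult.assoc)
    then show ?thesis by (simp only: ix_right'[OF assms[OF k]] mult.assoc)
  qed
  then show ?thesis unfolding bdg_def[of N r c M] by (subst sum_distrib_right) (simp add: bdg_def)
qed

lemma bdg_add: "bdg N r c M + bdg N r c M' = bdg N r c (\<lambda>k. M k + M' k)"
  and bdg_diff: "bdg N r c M - bdg N r c M' = bdg N r c (\<lambda>k. M k - M' k)"
  unfolding bdg_def by (simp_all add: sum.distrib sum_subtractf algebra_simps)

lemma bdg_csc: "s *c bdg N r c M = bdg N r c (\<lambda>k. s *c M k)"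
  by (rule fmat_eqI) (simp add: bdg_def sum_distrib_left csc_left csc_right del: ent_sum, simp add: sum_distrib_left)

lemma bdg_cong: "(\<And>k. k < N \<Longrightarrow> M k = M' k) \<Longrightarrow> bdg N r c M = bdg N r c M'"
  unfolding bdg_def by (intro sum.cong) auto

lemma bc_cong: "(\<And>k. k < N \<Longrightarrow> x k = x' k) \<Longrightarrow> bc N r x = bc N r x'"
  unfolding bc_def by (intro sum.cong) auto

lemma bdg_ix: "bdg N r r (\<lambda>_. ix r) = ix (N * r)"
proof -
  have "rm (kron (1\<^sub>m N) (1\<^sub>m r)) = bdg N r r (\<lambda>_. ix r)"
    using rm_kron_one(2)[of "1\<^sub>m r" r r N] by (simp add: bdg_def rm_one)
  moreover have "kron (1\<^sub>m N) (1\<^sub>m r :: real mat) = 1\<^sub>m (N * r)"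
  proof (rule eq_matI)
    fix i j assume "i < dim_row (1\<^sub>m (N * r) :: real mat)" "j < dim_col (1\<^sub>m (N * r) :: real mat)"
    then have ij: "i < N * r" "j < N * r" by auto
    then have "0 < r" by (cases r) auto
    moreover have "i div r < N" "j div r < N" using ij \<open>0 < r\<close> by (simp_all add: div_less_iff_less_mult)
    moreover have "i = j \<longleftrightarrow> i div r = j div r \<and> i mod r = j mod r" by (metis div_mult_mod_eq)
    ultimately show "kron (1\<^sub>m N) (1\<^sub>m r) $$ (i, j) = (1\<^sub>m (N * r) :: real mat) $$ (i, j)"
      using ij by (auto simp: kron_def)
  qed (simp_all add: kron_def)
  ultimately show ?thesis by (simp add: rm_one)
qed

lemma car_bc: "(\<And>k. k < N \<Longrightarrow> car r c (x k)) \<Longrightarrow> car (N * r) c (bc N r x)"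
proof -
  assume x: "\<And>k. k < N \<Longrightarrow> car r c (x k)"
  have "ix (N * r) * bc N r x = bc N r x"
    unfolding bdg_ix[symmetric] by (subst bdg_bc) (auto intro!: bc_cong ix_left[OF x])
  moreover have "bc N r x * ix c = bc N r x"
    unfolding bc_def sum_distrib_right by (intro sum.cong refl) (simp add: mult.assoc ix_right[OF x])
  ultimately show ?thesis by (simp add: car_iff)
qed

lemma isrsv_bdg:
  assumes "\<And>k. k < N \<Longrightarrow> car r r (M k)" "\<And>k. k < N \<Longrightarrow> isrsv {..<r} (M k) s (R k)"
  shows "isrsv {..<N * r} (bdg N r r M) s (bdg N r r R)"
proof -
  have cR: "\<And>k. k < N \<Longrightarrow> car r r (R k)" using isrsv_rules(1,2)[OF assms(2)] by (simp add: car_iff)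
  have e: "s *c ix (N * r) - bdg N r r M = bdg N r r (\<lambda>k. s *c ix r - M k)"
    unfolding bdg_ix[symmetric] bdg_csc bdg_diff ..
  have c: "\<And>k. k < N \<Longrightarrow> car r r (s *c ix r - M k)" using assms(1) by (intro car_diff car_csc car_ix) auto
  show ?thesis
    unfolding isrsv_def e unfolding bdg_ix[symmetric]
    by (subst bdg_mult, simp add: cR car_ix c)+ (intro conjI bdg_cong; use assms(2) in \<open>simp add: isrsv_def\<close>)
qed

section \<open>The realizations far to the right\<close>

lemma eventually_rhp: "eventually P at_rhp \<longleftrightarrow> (\<exists>a. \<forall>s. a < Re s \<longrightarrow> P s)"
  by (simp add: eventually_filtercomap_at_top_dense)

lemma eventually_Re: "\<forall>\<^sub>F s in at_rhp. a < Re s"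
  unfolding eventually_rhp by blast

lemma eventually_isrsv:
  assumes "car k k M"
  shows "\<forall>\<^sub>F s in at_rhp. isrsv {..<k} M s (rsv {..<k} M s) \<and> norm (rsv {..<k} M s) \<le> norm (ix k)"
proof -
  have "isrsv {..<k} M s (rsv {..<k} M s) \<and> norm (rsv {..<k} M s) \<le> norm (ix k)" if s: "norm M + 1 < Re s" for s
  proof -
    obtain W where W: "isrsv {..<k} M s W" "norm W * (Re s - norm M) \<le> norm (ix k)"
      using isrsv_large[OF assms, of s] s by auto
    have "norm W * 1 \<le> norm W * (Re s - norm M)" using s by (intro mult_left_mono) auto
    then show ?thesis using W rsv_eq[OF W(1)] by simp
  qed
  then show ?thesis unfolding eventually_rhp by blast
qed

context dsys
begin

lemma car_Ft: "j < N \<Longrightarrow> car m n (Ft j)"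
proof -
  assume j: "j < N"
  obtain k where "car k k (Ft j)" using car_ex by blast
  then have "car m n (dg (tm j) * Ft j * dg (tn j))"
    by (rule car_mult[OF car_mult[OF car_dg[OF tsets(2)[OF j]]] car_dg[OF tsets(1)[OF j]]])
  then show ?thesis by (simp add: Ft1[OF j])
qed

lemma car_Lt: "j < N \<Longrightarrow> car n p (Lt j)"
proof -
  assume j: "j < N"
  obtain k where "car k k (Lt j)" using car_ex by blast
  then have "car n p (dg (tn j) * Lt j * dg (tq j))"
    by (rule car_mult[OF car_mult[OF car_dg[OF tsets(1)[OF j]]] car_dg[OF tsets(3)[OF j]]])
  then show ?thesis by (simp add: Lt1[OF j])
qed

text \<open>The realizations keep a full state copy for each agent, although
  \<open>A + B2 * Ft j\<close> may be unstable outside \<open>tn j\<close>. The coordinates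
  \<open>tn j\<close> are invariant and contain the range of \<open>Lt j\<close>, so only the stable
  part is excited.\<close>

lemma restrict_resolvent:
  assumes j: "j < N" and R: "isrsv {..<n} (A + B2 * Ft j) s R" and P: "isrsv (tn j) (AF j) s (Pj j s)"
  shows "R * Lt j = Pj j s * Lt j"
proof -
  have 1: "(A + B2 * Ft j) * en j = AF j" by (simp add: AF_def distrib_right mult.assoc Ft1[OF j])
  have ee: "ix n * en j = en j" by (rule ix_left[OF car_dg[OF tsets(1)[OF j]]])
  have 2: "(s *c ix n - (A + B2 * Ft j)) * en j = s *c en j - AF j"
    by (simp only: left_diff_distrib csc_left ee 1)
  have "R * (s *c en j - AF j) = en j"
    unfolding 2[symmetric] using R ee unfolding isrsv_def by (simp add: mult.assoc[symmetric])
  then have "R * ((s *c en j - AF j) * Pj j s) = en j * Pj j s" by (simp only: mult.assoc[symmetric])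
  then have "R * en j = Pj j s" using P unfolding isrsv_def by simp
  then have "R * (en j * Lt j) = Pj j s * Lt j" by (simp only: mult.assoc[symmetric])
  then show ?thesis by (simp only: Lt1[OF j])
qed

end

context network
begin

definition "Th = rsv {..<n} (rm A)"

abbreviation rel :: "complex \<Rightarrow> fmat \<Rightarrow> fmat \<Rightarrow> bool" where
  "rel s \<equiv> youla.rel m p (rm B2) (rm C2) (rm Fd) (rm L) (Ps s)"

lemma eventually_youla:
  "\<forall>\<^sub>F s in at_rhp. youla n m p nw nz (rm A) (rm B1) (rm B2) (rm C1) (rm C2) (rm D12) (rm D21) (rm Fd) (rm L) s (Th s) (Ph s) (Ps s)"
proof -
  obtain d where "0 < d" "\<And>s. - d < Re s \<Longrightarrow> isrsv {..<n} (rm A + rm B2 * rm Fd) s (Ph s)"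
    "\<And>s. - d < Re s \<Longrightarrow> isrsv {..<n} (rm A + rm L * rm C2) s (Ps s)"
    using stable_margin by metis
  then have "\<forall>\<^sub>F s in at_rhp. isrsv {..<n} (rm A + rm B2 * rm Fd) s (Ph s) \<and> isrsv {..<n} (rm A + rm L * rm C2) s (Ps s)"
    unfolding eventually_rhp by blast
  with eventually_isrsv[OF carF(1)] show ?thesis
    by eventually_elim (simp add: youla_def carF cars(9) Th_def)
qed

end

locale optimal_realizations = network +
  fixes Abar Bbar Cbar Fbar Fdbar Lbar one_n one_m one_p :: "real mat"
  assumes bars: "Abar = kron (1\<^sub>m N) A" "Bbar = kron (1\<^sub>m N) B2" "Cbar = kron (1\<^sub>m N) C2"
      "Fdbar = kron (1\<^sub>m N) Fd"
      "one_n = kron (ones_col N) (1\<^sub>m n)"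
      "one_m = kron (ones_col N) (1\<^sub>m m)"
      "one_p = kron (ones_col N) (1\<^sub>m p)"
    and Fbar: "Fbar = diag_block_mat (map (\<lambda>i.
        embed N md (descendants N E i) * F i * transpose_mat (embed N nd (descendants N E i))) [0..<N])"
    and Lbar: "Lbar = diag_block_mat (map (\<lambda>i.
        embed N nd [i] * Lg i * transpose_mat (embed N pd [i])) [0..<N])"
begin

definition "Q_opt = realization (Abar + Bbar * Fbar) (- (Lbar * one_p))
        (transpose_mat one_m * (Fbar - Fdbar)) (0\<^sub>m m p)"

definition "K_opt = realization (Abar + Bbar * Fbar + Lbar * Cbar * one_n * transpose_mat one_n)
        (- (Lbar * one_p)) (transpose_mat one_m * Fbar) (0\<^sub>m m p)"

lemma bar_carr: "Abar \<in> carrier_mat (N * n) (N * n)" "Bbar \<in> carrier_mat (N * n) (N * m)" "Cbar \<in> carrier_mat (N * p) (N * n)"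
    "Fdbar \<in> carrier_mat (N * m) (N * n)" "one_n \<in> carrier_mat (N * n) n" "one_m \<in> carrier_mat (N * m) m" "one_p \<in> carrier_mat (N * p) p"
  unfolding bars using rm_kron_one(1) rm_kron_ones(1) carr by blast+

lemma bar_rm: "rm Abar = bdg N n n (\<lambda>_. rm A)" "rm Bbar = bdg N n m (\<lambda>_. rm B2)" "rm Cbar = bdg N p n (\<lambda>_. rm C2)"
    "rm Fdbar = bdg N m n (\<lambda>_. rm Fd)" "rm one_n = bc N n (\<lambda>_. ix n)" "rm one_m = bc N m (\<lambda>_. ix m)" "rm one_p = bc N p (\<lambda>_. ix p)"
  unfolding bars rm_kron_ones(2) rm_kron_one(2)[OF carr(1)] rm_kron_one(2)[OF carr(3)] rm_kron_one(2)[OF carr(5)] rm_kron_one(2)[OF carr(8)]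
  by (simp_all add: bdg_def bc_def ix_right[OF car_sh])

lemma Fbar_rm: "Fbar \<in> carrier_mat (N * m) (N * n)" "rm Fbar = bdg N m n Ft"
proof -
  let ?M = "\<lambda>i. embed N md (descendants N E i) * F i * transpose_mat (embed N nd (descendants N E i))"
  have Fc: "F k \<in> carrier_mat (length (block_idx md (De k))) (length (block_idx nd (De k)))" if "k < N" for k
    using ctrl[OF that] by blast
  have e: "embed N d S \<in> carrier_mat (off d N) (length (block_idx d S))" for d S by (rule embed_carrier)
  have c: "?M k \<in> carrier_mat m n" and r: "rm (?M k) = Ft k" if k: "k < N" for k
  proof -
    have "embed N md (De k) * F k \<in> carrier_mat m (length (block_idx nd (De k)))"
      using mult_carrier_mat[OF e[of md "De k"] Fc[OF k]] by (simp add: noff)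
    then show "?M k \<in> carrier_mat m n"
      using e[of nd "De k"] by (auto simp: De_def noff)
    show "rm (?M k) = Ft k"
      using carrier_matD[OF e[of nd "De k"]] carrier_matD[OF e[of md "De k"]] carrier_matD[OF Fc[OF k]]
      by (simp add: De_def[symmetric] rm_mult Ft_def rm_transpose)
  qed
  have "Fbar \<in> carrier_mat (N * m) (N * n) \<and> rm Fbar = (\<Sum>k<N. sh (k * m) m * rm (?M k) * tp (sh (k * n) n))"
    using diag_block_mat_upt[of N ?M "\<lambda>_. m" "\<lambda>_. n", OF c, folded Fbar, unfolded off_const] .
  then show "Fbar \<in> carrier_mat (N * m) (N * n)" "rm Fbar = bdg N m n Ft" using r by (auto simp: bdg_def)
qed

lemma Lbar_rm: "Lbar \<in> carrier_mat (N * n) (N * p)" "rm Lbar = bdg N n p Lt"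
proof -
  let ?M = "\<lambda>i. embed N nd [i] * Lg i * transpose_mat (embed N pd [i])"
  have Lc: "Lg k \<in> carrier_mat (nd k) (pd k)" if "k < N" for k using est[OF that] by blast
  have e: "embed N d [i] \<in> carrier_mat (off d N) (d i)" for d i using embed_carrier[of N d "[i]"] by (simp add: block_idx_def)
  have c: "?M k \<in> carrier_mat n p" and r: "rm (?M k) = Lt k" if k: "k < N" for k
  proof -
    have "embed N nd [k] * Lg k \<in> carrier_mat n (pd k)"
      using mult_carrier_mat[OF e[of nd k] Lc[OF k]] by (simp add: noff)
    then show "?M k \<in> carrier_mat n p"
      using e[of pd k] by (auto simp: noff)
    show "rm (?M k) = Lt k"
      using carrier_matD[OF e[of nd k]] carrier_matD[OF e[of pd k]] carrier_matD[OF Lc[OF k]]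
      by (simp add: rm_mult Lt_def rm_transpose)
  qed
  have "Lbar \<in> carrier_mat (N * n) (N * p) \<and> rm Lbar = (\<Sum>k<N. sh (k * n) n * rm (?M k) * tp (sh (k * p) p))"
    using diag_block_mat_upt[of N ?M "\<lambda>_. n" "\<lambda>_. p", OF c, folded Lbar, unfolded off_const] .
  then show "Lbar \<in> carrier_mat (N * n) (N * p)" "rm Lbar = bdg N n p Lt" using r by (auto simp: bdg_def)
qed

lemma AFbar: "Abar + Bbar * Fbar \<in> carrier_mat (N * n) (N * n)" "rm (Abar + Bbar * Fbar) = bdg N n n (\<lambda>k. rm A + rm B2 * Ft k)"
proof -
  have c: "Bbar * Fbar \<in> carrier_mat (N * n) (N * n)" using bar_carr Fbar_rm by auto
  show "Abar + Bbar * Fbar \<in> carrier_mat (N * n) (N * n)" using bar_carr c by auto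
  have "rm (Bbar * Fbar) = bdg N n n (\<lambda>k. rm B2 * Ft k)"
    using carrier_matD[OF bar_carr(2)] carrier_matD[OF Fbar_rm(1)] by (simp add: rm_mult bar_rm Fbar_rm(2) bdg_mult carF)
  then show "rm (Abar + Bbar * Fbar) = bdg N n n (\<lambda>k. rm A + rm B2 * Ft k)"
    by (simp add: rm_add[OF bar_carr(1) c] bar_rm bdg_add)
qed

lemma Bbar_rm: "- (Lbar * one_p) \<in> carrier_mat (N * n) p" "rm (- (Lbar * one_p)) = - bc N n Lt"
proof -
  show "- (Lbar * one_p) \<in> carrier_mat (N * n) p" using Lbar_rm bar_carr by auto
  have "bdg N n p Lt * bc N p (\<lambda>_. ix p) = bc N n (\<lambda>k. Lt k * ix p)" by (rule bdg_bc[OF car_Lt])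
  also have "\<dots> = bc N n Lt" by (intro bc_cong ix_right[OF car_Lt])
  finally show "rm (- (Lbar * one_p)) = - bc N n Lt"
    using carrier_matD[OF Lbar_rm(1)] carrier_matD[OF bar_carr(7)] by (simp add: rm_uminus rm_mult Lbar_rm(2) bar_rm)
qed

lemma tp_one_bc: "tp (bc N r (\<lambda>_. ix r)) * bc N r x = (\<Sum>k<N. ix r * x k)"
proof -
  have "tp (bc N r (\<lambda>_. ix r)) * bc N r x = (\<Sum>k<N. tp (sh (k * r) r) * bc N r x)"
    unfolding bc_def[of N r "\<lambda>_. ix r"] tp_sum sum_distrib_right by (simp add: ix_right[OF car_sh])
  also have "\<dots> = (\<Sum>k<N. ix r * x k)" by (intro sum.cong refl tpsh_bc) simp
  finally show ?thesis .
qed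

text \<open>The equality is claimed only far to the right, since the state matrix of the realization
  may be unstable. There \<open>restrict_resolvent\<close> replaces the resolvent of each full copy
  by the stable \<open>Pj\<close>.\<close>

lemma Q_opt_eq: "\<forall>\<^sub>F s in at_rhp. Q_opt s \<in> carrier_mat m p \<and> fm (Q_opt s) = Qo s"
proof -
  have cM: "car n n (rm A + rm B2 * Ft k)" if "k < N" for k
    by (intro car_add carF(1) car_mult[OF carF(3) car_Ft[OF that]])
  have "\<forall>\<^sub>F s in at_rhp. \<forall>k\<in>{..<N}. isrsv {..<n} (rm A + rm B2 * Ft k) s (rsv {..<n} (rm A + rm B2 * Ft k) s)"
    by (rule eventually_ball_finite) (auto intro: eventually_mono[OF eventually_isrsv[OF cM]])
  moreover obtain d where d: "0 < d" "\<And>s j. - d < Re s \<Longrightarrow> j < N \<Longrightarrow> isrsv (tn j) (AF j) s (Pj j s)"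
    using stable_margin by metis
  then have "\<forall>\<^sub>F s in at_rhp. \<forall>j<N. isrsv (tn j) (AF j) s (Pj j s)" unfolding eventually_rhp by blast
  ultimately show ?thesis
  proof eventually_elim
    case (elim s)
    define R where "R k = rsv {..<n} (rm A + rm B2 * Ft k) s" for k
    have R: "isrsv {..<n} (rm A + rm B2 * Ft k) s (R k)" if "k < N" for k using elim(1) that by (simp add: R_def)
    have cR: "car n n (R k)" if "k < N" for k using isrsv_rules(1,2)[OF R[OF that]] by (simp add: car_iff)
    have W: "isrsv {..<N * n} (rm (Abar + Bbar * Fbar)) s (bdg N n n R)"
      unfolding AFbar(2) by (rule isrsv_bdg[OF cM R])
    have cC: "transpose_mat one_m * (Fbar - Fdbar) \<in> carrier_mat m (N * n)" using bar_carr Fbar_rm by auto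
    note r = realization_fm[OF AFbar(1) Bbar_rm(1) cC zero_carrier_mat W]
    have "rm (transpose_mat one_m * (Fbar - Fdbar)) = tp (bc N m (\<lambda>_. ix m)) * (bdg N m n (\<lambda>k. Ft k - rm Fd))"
      using bar_carr Fbar_rm
      by (simp add: rm_mult rm_transpose bar_rm rm_diff[of Fbar "N * m" "N * n"] bdg_diff)
    then have "rm (transpose_mat one_m * (Fbar - Fdbar)) * bdg N n n R * bc N n Lt
      = tp (bc N m (\<lambda>_. ix m)) * (bdg N m n (\<lambda>k. Ft k - rm Fd) * (bdg N n n R * bc N n Lt))" by (simp only: mult.assoc)
    also have "bdg N n n R * bc N n Lt = bc N n (\<lambda>k. R k * Lt k)" by (rule bdg_bc[OF cR])
    also have "bdg N m n (\<lambda>k. Ft k - rm Fd) * \<dots> = bc N m (\<lambda>k. (Ft k - rm Fd) * (R k * Lt k))"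
      by (rule bdg_bc) (intro car_diff car_Ft carF)
    also have "tp (bc N m (\<lambda>_. ix m)) * \<dots> = (\<Sum>k<N. ix m * ((Ft k - rm Fd) * (R k * Lt k)))" by (rule tp_one_bc)
    also have "\<dots> = (\<Sum>k<N. (Ft k - rm Fd) * Pj k s * Lt k)"
    proof (intro sum.cong refl)
      fix k assume "k \<in> {..<N}"
      then have k: "k < N" by simp
      have RL: "R k * Lt k = Pj k s * Lt k" using restrict_resolvent[OF k R[OF k]] elim(2) k by blast
      show "ix m * ((Ft k - rm Fd) * (R k * Lt k)) = (Ft k - rm Fd) * Pj k s * Lt k"
        by (simp only: ix_left'[OF car_diff[OF car_Ft[OF k] carF(8)]] RL mult.assoc)
    qed
    finally have "fm (Q_opt s) = Qo s"
      unfolding Q_opt_def r(2) Bbar_rm(2) Qo_def by (simp add: rm_zero)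
    then show ?case using r(1) by (simp add: Q_opt_def)
  qed
qed

text \<open>The product of \<open>one_n\<close> and its transpose feeds the sum of all state copies
  back into each of them, and this sum is the observer state required by
  \<open>rel_from_states\<close>. The bound \<open>b\<close> provides properness.\<close>

lemma K_opt_eq:
  "\<exists>b. \<forall>\<^sub>F s in at_rhp. K_opt s \<in> carrier_mat m p \<and> rel s (fm (K_opt s)) (Qo s) \<and> norm (fm (K_opt s)) \<le> b"
proof -
  define AK where "AK = Abar + Bbar * Fbar + Lbar * Cbar * one_n * transpose_mat one_n"
  have cA: "AK \<in> carrier_mat (N * n) (N * n)" unfolding AK_def using bar_carr AFbar Lbar_rm by auto
  have c0: "Lbar * Cbar \<in> carrier_mat (N * n) (N * n)" "Lbar * Cbar * one_n * transpose_mat one_n \<in> carrier_mat (N * n) (N * n)"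
    using bar_carr Lbar_rm by auto
  have rA: "rm AK = bdg N n n (\<lambda>k. rm A + rm B2 * Ft k) + bc N n (\<lambda>k. Lt k * rm C2) * tp (bc N n (\<lambda>_. ix n))"
  proof -
    have h: "bdg N n p Lt * (bdg N p n (\<lambda>_. rm C2) * bc N n (\<lambda>_. ix n)) = bc N n (\<lambda>k. Lt k * rm C2)"
    proof -
      have "bdg N p n (\<lambda>_. rm C2) * bc N n (\<lambda>_. ix n) = bc N p (\<lambda>_. rm C2)"
        by (subst bdg_bc[OF carF(5)]) (simp add: ix_right[OF carF(5)])
      then show ?thesis by (simp only: mult.assoc bdg_bc[OF car_Lt])
    qed
    have "rm (Lbar * Cbar * one_n * transpose_mat one_n) = bc N n (\<lambda>k. Lt k * rm C2) * tp (bc N n (\<lambda>_. ix n))"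
      using bar_carr Lbar_rm by (simp add: rm_mult rm_transpose bar_rm h)
    then show ?thesis unfolding AK_def using rm_add[OF AFbar(1) c0(2)] by (simp add: AFbar(2))
  qed
  define CK where "CK = transpose_mat one_m * Fbar"
  have cC: "CK \<in> carrier_mat m (N * n)" unfolding CK_def using bar_carr Fbar_rm by auto
  have rC: "rm CK = tp (bc N m (\<lambda>_. ix m)) * bdg N m n Ft"
    unfolding CK_def using bar_carr Fbar_rm by (simp add: rm_mult rm_transpose bar_rm)
  have cM: "car n n (rm A + rm B2 * Ft k)" if "k < N" for k
    by (intro car_add carF(1) car_mult[OF carF(3) car_Ft[OF that]])
  have 1: "\<forall>\<^sub>F s in at_rhp. \<forall>k\<in>{..<N}. isrsv {..<n} (rm A + rm B2 * Ft k) s (rsv {..<n} (rm A + rm B2 * Ft k) s)"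
    by (rule eventually_ball_finite) (auto intro: eventually_mono[OF eventually_isrsv[OF cM]])
  obtain d where d: "0 < d" "\<And>s j. - d < Re s \<Longrightarrow> j < N \<Longrightarrow> isrsv (tn j) (AF j) s (Pj j s)"
    using stable_margin by metis
  then have 2: "\<forall>\<^sub>F s in at_rhp. \<forall>j<N. isrsv (tn j) (AF j) s (Pj j s)" unfolding eventually_rhp by blast
  define b where "b = norm (rm CK) * norm (ix (N * n)) * norm (bc N n Lt)"
  have "\<forall>\<^sub>F s in at_rhp. K_opt s \<in> carrier_mat m p \<and> rel s (fm (K_opt s)) (Qo s) \<and> norm (fm (K_opt s)) \<le> b"
    using 1 2 eventually_youla eventually_isrsv[OF car_rm[OF cA]]
  proof eventually_elim
    case (elim s)
    interpret y: youla n m p nw nz "rm A" "rm B1" "rm B2" "rm C1" "rm C2" "rm D12" "rm D21" "rm Fd" "rm L" s "Th s" "Ph s" "Ps s"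
      by (rule elim(3))
    define R where "R k = rsv {..<n} (rm A + rm B2 * Ft k) s" for k
    have R: "isrsv {..<n} (rm A + rm B2 * Ft k) s (R k)" if "k < N" for k using elim(1) that by (simp add: R_def)
    define W where "W = rsv {..<N * n} (rm AK) s"
    have W: "isrsv {..<N * n} (rm AK) s W" "norm W \<le> norm (ix (N * n))" using elim(4) by (simp_all add: W_def)
    note r = realization_fm[OF cA Bbar_rm(1) cC zero_carrier_mat W(1), unfolded Bbar_rm(2)]
    \<comment> \<open>The response of the controller state to the measurement; \<open>x k\<close> is
      its \<open>k\<close>-th copy.\<close>
    define X where "X = W * (- bc N n Lt)"
    define x where "x k = tp (sh (k * n) n) * X" for k
    have cW: "ix (N * n) * X = X" unfolding X_def by (simp only: mult.assoc[symmetric] isrsv_rules(1)[OF W(1)])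
    have Xx: "X = bc N n x"
    proof -
      have "X = (\<Sum>k<N. sh (k * n) n * ix n * tp (sh (k * n) n)) * X" using cW by (simp only: bdg_ix[symmetric] bdg_def)
      then show ?thesis unfolding sum_distrib_right bc_def x_def by (simp add: ix_right[OF car_sh] mult.assoc)
    qed
    have xin: "ix n * x k = x k" for k unfolding x_def by (rule ix_left'[OF car_tp[OF car_sh]])
    have tX: "tp (bc N n (\<lambda>_. ix n)) * X = (\<Sum>k<N. x k)" unfolding Xx tp_one_bc by (simp only: xin)
    have st: "s *c X - rm AK * X = - bc N n Lt"
    proof -
      have "(s *c ix (N * n) - rm AK) * X = ix (N * n) * (- bc N n Lt)"
        unfolding X_def using W(1) unfolding isrsv_def by (simp only: mult.assoc[symmetric])
      also have "\<dots> = - bc N n Lt" using ix_left[OF car_bc[OF car_Lt]] by simp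
      finally show ?thesis by (simp add: left_diff_distrib csc_left cW)
    qed
    have AKX: "rm AK * X = bc N n (\<lambda>k. (rm A + rm B2 * Ft k) * x k) + bc N n (\<lambda>k. Lt k * (rm C2 * (\<Sum>l<N. x l)))"
    proof -
      have "bdg N n n (\<lambda>k. rm A + rm B2 * Ft k) * X = bc N n (\<lambda>k. (rm A + rm B2 * Ft k) * x k)"
        unfolding Xx by (rule bdg_bc[OF cM])
      moreover have "bc N n (\<lambda>k. Lt k * rm C2) * (\<Sum>l<N. x l) = bc N n (\<lambda>k. Lt k * (rm C2 * (\<Sum>l<N. x l)))"
        unfolding bc_def sum_distrib_right by (simp only: mult.assoc)
      ultimately show ?thesis unfolding rA by (simp only: distrib_right mult.assoc tX)
    qed
    have K: "fm (K_opt s) = rm CK * X"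
      unfolding K_opt_def AK_def[symmetric] CK_def[symmetric] r(2) X_def by (simp add: rm_zero mult.assoc)
    have Kc: "K_opt s \<in> carrier_mat m p" unfolding K_opt_def AK_def[symmetric] CK_def[symmetric] by (rule r(1))
    have "rel s (fm (K_opt s)) (Qo s)"
    proof (rule y.rel_from_states[OF L_facts(2) R xin])
      fix k assume k: "k < N"
      have c: "ix n * ((rm A + rm B2 * Ft k) * x k) = (rm A + rm B2 * Ft k) * x k" by (rule ix_left'[OF cM[OF k]])
      have c': "ix n * (Lt k * y) = Lt k * y" "ix n * Lt k = Lt k" for y by (rule ix_left'[OF car_Lt[OF k]] ix_left[OF car_Lt[OF k]])+
      have "tp (sh (k * n) n) * (s *c X - rm AK * X) = - (tp (sh (k * n) n) * bc N n Lt)" by (simp only: st mult_minus_right)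
      then have "s *c x k - ((rm A + rm B2 * Ft k) * x k + Lt k * (rm C2 * (\<Sum>l<N. x l))) = - Lt k"
        unfolding AKX by (simp only: right_diff_distrib distrib_left csc_right tpsh_bc[OF k] c c' x_def[symmetric])
      then show "s *c x k = (rm A + rm B2 * Ft k) * x k + Lt k * (rm C2 * (\<Sum>l<N. x l)) - Lt k"
        by (simp add: algebra_simps)
      show "car n p (Lt k)" by (rule car_Lt[OF k])
    next
      have "rm CK * X = tp (bc N m (\<lambda>_. ix m)) * (bdg N m n Ft * X)" by (simp only: rC mult.assoc)
      also have "bdg N m n Ft * X = bc N m (\<lambda>k. Ft k * x k)" unfolding Xx by (rule bdg_bc[OF car_Ft])
      also have "tp (bc N m (\<lambda>_. ix m)) * \<dots> = (\<Sum>k<N. ix m * (Ft k * x k))" by (rule tp_one_bc)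
      also have "\<dots> = (\<Sum>k<N. Ft k * x k)" by (intro sum.cong refl) (simp add: ix_left'[OF car_Ft])
      finally show "fm (K_opt s) = (\<Sum>k<N. Ft k * x k)" unfolding K .
      show "car m p (fm (K_opt s))" by (rule car_fm[OF Kc])
      have "(Ft k - rm Fd) * Pj k s * Lt k = (Ft k - rm Fd) * R k * Lt k" if k: "k < N" for k
      proof -
        have "R k * Lt k = Pj k s * Lt k" using restrict_resolvent[OF k R[OF k]] elim(2) k by blast
        then show ?thesis by (simp only: mult.assoc)
      qed
      then show "Qo s = - (\<Sum>k<N. (Ft k - rm Fd) * R k * Lt k)" unfolding Qo_def by simp
    qed
    moreover have "norm (fm (K_opt s)) \<le> b"
    proof -
      have "norm (fm (K_opt s)) \<le> norm (rm CK) * norm X" unfolding K by (rule norm_mult_ineq)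
      also have "norm X \<le> norm W * norm (bc N n Lt)" unfolding X_def using norm_mult_ineq[of W "- bc N n Lt"] by simp
      also have "norm W \<le> norm (ix (N * n))" by (rule W(2))
      finally show ?thesis unfolding b_def by (simp add: mult_left_mono mult_right_mono mult.assoc)
    qed
    ultimately show ?case using Kc by blast
  qed
  then show ?thesis by blast
qed

end

section \<open>Transfer matrices as analytic functions\<close>

lemma open_rhp: "open {s. 0 < Re s}" and connected_rhp: "connected {s. (a::real) < Re s}"
proof -
  show "open {s. 0 < Re s}" by (rule open_halfspace_Re_gt)
  show "connected {s. a < Re s}" by (intro convex_connected convex_halfspace_Re_gt)
qed

text \<open>Relations between transfer matrices are known far to the right only; the identity
  theorem on the connected half-plane carries them to all of it.\<close>

lemma rhp_identity:
  assumes f: "f holomorphic_on {s. 0 < Re s}" and g: "g holomorphic_on {s. 0 < Re s}"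
    and e: "\<forall>\<^sub>F s in at_rhp. f s = g s" and z: "0 < Re z"
  shows "f z = g z"
proof -
  obtain a where a: "\<And>s. a < Re s \<Longrightarrow> f s = g s" using e unfolding eventually_rhp by blast
  let ?S = "{s. max a 0 < Re s}"
  show ?thesis
  proof (rule analytic_continuation_open[OF _ open_rhp _ connected_rhp _ f g])
    show "open ?S" by (rule open_halfspace_Re_gt)
    show "?S \<noteq> {}" using complex.sel(1)[of "max a 0 + 1" 0] by (metis empty_iff less_add_one mem_Collect_eq)
    show "?S \<subseteq> {s. 0 < Re s}" by auto
    show "z \<in> {s. 0 < Re s}" using z by simp
    show "\<And>z. z \<in> ?S \<Longrightarrow> f z = g z" using a by simp
  qed
qed

lemma fm_rhp_identity:
  assumes "holb 0 f" "holb 0 g" "\<forall>\<^sub>F s in at_rhp. f s = g s" "0 < Re z"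
  shows "f z = g z"
proof (rule fmat_eqI)
  fix i j
  show "ent (f z) i j = ent (g z) i j"
    by (rule rhp_identity[OF _ _ _ assms(4)]) (use assms(1-3) in \<open>auto simp: holb_def elim: eventually_mono\<close>)
qed

lemma holb_fm:
  assumes H: "analytic_rhp r c H" and b: "\<And>s. 0 < Re s \<Longrightarrow> sqrt (frob_sq (H s)) \<le> b"
  shows "holb 0 (\<lambda>s. fm (H s))"
  unfolding holb_def
proof (intro conjI allI exI impI)
  have d: "dim_row (H s) = r" "dim_col (H s) = c" if "0 < Re s" for s
    using H that unfolding analytic_rhp_def by auto
  fix i j
  have "(\<lambda>s. if i < r \<and> j < c then H s $$ (i, j) else 0) holomorphic_on {s. 0 < Re s}"
    using H unfolding analytic_rhp_def by (cases "i < r \<and> j < c") auto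
  then show "(\<lambda>s. ent (fm (H s)) i j) holomorphic_on {s. 0 < Re s}"
    by (rule holomorphic_transform) (simp add: d)
next
  fix s :: complex assume s: "0 < Re s"
  have "H s \<in> carrier_mat r c" using H s unfolding analytic_rhp_def by blast
  then show "car (max r c) (max r c) (fm (H s))" using car_mono[OF car_fm] by (meson max.cobounded1 max.cobounded2)
  show "norm (fm (H s)) \<le> b" using b[OF s] by (simp add: frob_sq_fm)
qed

lemma H_infD:
  assumes "G \<in> H_inf r c"
  shows "\<exists>H. holb 0 H \<and> (\<forall>s. 0 < Re s \<longrightarrow> car r c (H s)) \<and> (\<forall>\<^sub>F s in at_rhp. G s \<in> carrier_mat r c \<and> fm (G s) = H s)"
proof -
  obtain H b where H: "analytic_rhp r c H" "\<And>s. 0 < Re s \<Longrightarrow> sqrt (frob_sq (H s)) \<le> b" "\<forall>\<^sub>F s in at_rhp. G s = H s"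
    using assms unfolding H_inf_def by blast
  have c: "H s \<in> carrier_mat r c" if "0 < Re s" for s using H(1) that unfolding analytic_rhp_def by blast
  have "\<forall>\<^sub>F s in at_rhp. G s \<in> carrier_mat r c \<and> fm (G s) = fm (H s)"
    using H(3) eventually_Re[of 0] by eventually_elim (simp add: c)
  then show ?thesis using holb_fm[OF H(1,2)] car_fm[OF c] by blast
qed

lemma analytic_rhp_mtx:
  assumes "\<And>i j. (\<lambda>s. ent (H s) i j) holomorphic_on {s. 0 < Re s}"
  shows "analytic_rhp r c (\<lambda>s. mtx r c (H s))"
  unfolding analytic_rhp_def using assms by (simp add: mtx_def)

lemma eventually_mtx:
  assumes "\<forall>\<^sub>F s in at_rhp. G s \<in> carrier_mat r c \<and> fm (G s) = H s" "\<And>s. 0 < Re s \<Longrightarrow> car r c (H s)"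
  shows "\<forall>\<^sub>F s in at_rhp. G s = mtx r c (H s)"
  using assms(1) eventually_Re[of 0]
proof eventually_elim
  case (elim s)
  then show ?case using fm_inject[of "G s" r c "mtx r c (H s)"] fm_mtx[OF assms(2)] by simp
qed

lemma H_infI:
  assumes H: "holb 0 H" "\<And>s. 0 < Re s \<Longrightarrow> car r c (H s)"
    and e: "\<forall>\<^sub>F s in at_rhp. G s \<in> carrier_mat r c \<and> fm (G s) = H s"
  shows "G \<in> H_inf r c"
proof -
  obtain b where b: "\<And>s. 0 < Re s \<Longrightarrow> norm (H s) \<le> b" using H(1) unfolding holb_def by blast
  have "sqrt (frob_sq (mtx r c (H s))) \<le> b" if "0 < Re s" for s
    using b[OF that] by (simp add: frob_sq_fm fm_mtx[OF H(2)[OF that]])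
  moreover have "analytic_rhp r c (\<lambda>s. mtx r c (H s))" by (rule analytic_rhp_mtx) (use H(1) in \<open>simp add: holb_def\<close>)
  ultimately show ?thesis unfolding H_inf_def using eventually_mtx[OF e H(2)] by blast
qed

definition cost :: "(complex \<Rightarrow> fmat) \<Rightarrow> ennreal" where
  "cost H = (SUP \<xi>\<in>{0::real<..}. (\<integral>\<^sup>+\<omega>. ennreal ((norm (H (Complex \<xi> \<omega>)))\<^sup>2) \<partial>lborel) / ennreal (2 * pi))"

lemma cost_cong: "(\<And>s. 0 < Re s \<Longrightarrow> H s = H' s) \<Longrightarrow> cost H = cost H'"
  unfolding cost_def by (intro SUP_cong refl) simp

text \<open>The infimum ranges over analytic continuations of \<open>G\<close>. On the half-plane
  they all agree with \<open>H\<close>, and the integrals see nothing else, so the infimum is over a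
  single value.\<close>

lemma H2_norm_sq_fm:
  assumes H: "holb 0 H" "\<And>s. 0 < Re s \<Longrightarrow> car r c (H s)"
    and e: "\<forall>\<^sub>F s in at_rhp. G s \<in> carrier_mat r c \<and> fm (G s) = H s"
  shows "H2_norm_sq r c G = cost H"
proof -
  let ?S = "{H. analytic_rhp r c H \<and> (\<forall>\<^sub>F s in at_rhp. G s = H s)}"
  let ?c = "\<lambda>H. SUP \<xi>\<in>{0::real<..}. (\<integral>\<^sup>+\<omega>. ennreal (frob_sq (H (Complex \<xi> \<omega>))) \<partial>lborel) / ennreal (2 * pi)"
  have hol: "(\<lambda>s. ent (H s) i j) holomorphic_on {s. 0 < Re s}" for i j using H(1) by (simp add: holb_def)
  have "?c H' = cost H" if H': "H' \<in> ?S" for H'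
  proof -
    have "fm (H' z) = H z" if z: "0 < Re z" for z
    proof (rule fmat_eqI)
      fix i j
      have d: "H' s \<in> carrier_mat r c" if "0 < Re s" for s using H' that by (auto simp: analytic_rhp_def)
      show "ent (fm (H' z)) i j = ent (H z) i j"
      proof (cases "i < r \<and> j < c")
        case True
        have "H' z $$ (i, j) = ent (H z) i j"
        proof (rule rhp_identity[OF _ hol _ z])
          show "(\<lambda>s. H' s $$ (i, j)) holomorphic_on {s. 0 < Re s}" using H' True by (auto simp: analytic_rhp_def)
          have "\<forall>\<^sub>F s in at_rhp. G s = H' s" using H' by blast
          with e show "\<forall>\<^sub>F s in at_rhp. H' s $$ (i, j) = ent (H s) i j"
          proof eventually_elim
            case (elim s)
            then have "ent (H s) i j = ent (fm (H' s)) i j" "H' s \<in> carrier_mat r c" by auto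
            then show ?case using True by auto
          qed
        qed
        then show ?thesis using True d[OF z] by auto
      next
        case False
        then show ?thesis using d[OF z] carD[OF H(2)[OF z] False] by auto
      qed
    qed
    then show ?thesis unfolding cost_def by (intro SUP_cong refl) (simp add: frob_sq_fm)
  qed
  moreover have "(\<lambda>s. mtx r c (H s)) \<in> ?S" using analytic_rhp_mtx[OF hol] eventually_mtx[OF e H(2)] by simp
  ultimately show ?thesis unfolding H2_norm_sq_def by (intro INF_eq_const) blast+
qed

lemma rsv_commute:
  assumes R: "isrsv {..<n} A s R" and c: "A * dg T = dg T * A" and T: "T \<subseteq> {..<n}"
  shows "R * dg T = dg T * R"
proof -
  have i: "ix n * dg T = dg T" "dg T * ix n = dg T" using ix_left[OF car_dg[OF T]] ix_right[OF car_dg[OF T]] by auto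
  have com: "(s *c ix n - A) * dg T = dg T * (s *c ix n - A)"
    by (simp add: left_diff_distrib right_diff_distrib csc_left csc_right c i)
  have "R * ((s *c ix n - A) * dg T) * R = dg T * R"
    using R unfolding isrsv_def mult.assoc[symmetric] by (simp add: i)
  moreover have "R * (dg T * (s *c ix n - A)) * R = R * dg T"
  proof -
    have "R * (dg T * (s *c ix n - A)) * R = R * dg T * ((s *c ix n - A) * R)" by (simp only: mult.assoc)
    also have "\<dots> = R * dg T" using R unfolding isrsv_def by (simp add: mult.assoc i)
    finally show ?thesis .
  qed
  ultimately show ?thesis unfolding com by simp
qed

lemma pat_ep:
  assumes "pat P E X" and "E * e = e"
  shows "X * e = P * X * e"
proof -
  have "X * e = (X * E) * e" using assms(2) by (simp only: mult.assoc)
  also have "X * E = P * X * E" using assms(1) unfolding pat_def .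
  also have "P * X * E * e = P * X * (E * e)" by (simp only: mult.assoc)
  finally show ?thesis by (simp only: assms(2))
qed

lemma invertible_fm:
  assumes M: "M \<in> carrier_mat n n" and W: "W * fm M = ix n"
  shows "invertible_mat M"
proof -
  note i = fm_inv_mat[OF M W]
  have 1: "inv_mat M * M = 1\<^sub>m n"
    using fm_inject[of "inv_mat M * M" n n "1\<^sub>m n"] i M fm_mult[of "inv_mat M" M] by (simp add: fm_one)
  have 2: "M * inv_mat M = 1\<^sub>m n"
    using fm_inject[of "M * inv_mat M" n n "1\<^sub>m n"] i M fm_mult[of M "inv_mat M"] by (simp add: fm_one)
  show ?thesis unfolding invertible_mat_def inverts_mat_def
    using 1 2 M i(1) by (auto intro!: exI[of _ "inv_mat M"])
qed

lemma invertible_fm_inverse: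
  assumes M: "M \<in> carrier_mat n n" and i: "invertible_mat M"
  shows "fm (inv_mat M) * fm M = ix n" "fm M * fm (inv_mat M) = ix n" "inv_mat M \<in> carrier_mat n n"
proof -
  obtain B where B: "M * B = 1\<^sub>m (dim_row M)" "B * M = 1\<^sub>m (dim_row B)"
    using i unfolding invertible_mat_def inverts_mat_def by blast
  have "dim_col B = n" using arg_cong[OF B(1), of dim_col] M by simp
  moreover have "dim_row B = n" using arg_cong[OF B(2), of dim_col] M by simp
  ultimately have "fm B * fm M = ix n" using B(2) M fm_mult[of B M] by (simp add: fm_one)
  then show "fm (inv_mat M) * fm M = ix n" "fm M * fm (inv_mat M) = ix n" "inv_mat M \<in> carrier_mat n n"
    using fm_inv_mat[OF M] by blast+
qed

section \<open>Optimality among the structured controllers\<close>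

context network
begin

text \<open>The outputs of all descendants of \<open>j\<close>, in contrast to \<open>ep j\<close>.
  Patterns stated with \<open>eP\<close> can be multiplied with each other.\<close>

abbreviation "eP j \<equiv> dg (blk pd (set (De j)))"

lemma eP_facts:
  assumes j: "j < N"
  shows "blk pd (set (De j)) \<subseteq> {..<p}" "eP j * ep j = ep j" "rm C2 * en j = eP j * rm C2" "rm L * eP j = en j * rm L"
proof -
  show "blk pd (set (De j)) \<subseteq> {..<p}" using blk_bound[OF De_sub[OF j], of pd] by (simp add: noff)
  have "blk pd (set (De j)) \<inter> blk pd {j} = blk pd {j}" using De_mem[of j] by (auto simp: blk_def)
  then show "eP j * ep j = ep j" by (simp add: tq_def dg_mult finite_blk)
  show "rm C2 * en j = eP j * rm C2" unfolding tn_def by (rule comm(4)[OF De_sub[OF j]])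
  show "rm L * eP j = en j * rm L" unfolding tn_def
  proof (rule block_comm[OF _ _ De_sub[OF j]])
    show "car (off nd N) (off pd N) (rm L)" by (simp add: noff cars)
    fix i k assume ik: "i < N" "k < N" "i \<noteq> k"
    have "rm L * dg (blk pd {k}) = (\<Sum>l<N. Lt l * ep k)" unfolding L_facts(2) sum_distrib_right tq_def ..
    also have "\<dots> = (\<Sum>l<N. if l = k then Lt k else 0)"
      using Lt0[OF ik(2)] Lt1(2)[OF ik(2)] by (intro sum.cong) auto
    finally have "rm L * dg (blk pd {k}) = Lt k" using ik by simp
    moreover have "dg (blk nd {k}) * Lt k = Lt k" using est[OF ik(2)] by blast
    ultimately have "dg (blk nd {i}) * rm L * dg (blk pd {k}) = dg (blk nd {i}) * (dg (blk nd {k}) * Lt k)"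
      by (simp only: mult.assoc)
    then show "dg (blk nd {i}) * rm L * dg (blk pd {k}) = 0"
      by (simp add: mult.assoc[symmetric] blk_disjoint[OF ik(3)])
  qed
qed

text \<open>By transitivity the descendants of a descendant \<open>k\<close> of \<open>j\<close> are
  descendants of \<open>j\<close>, so column \<open>k\<close> stays within \<open>em j\<close> as
  well. This is what makes the information structure closed under products.\<close>

lemma pat_eP:
  assumes X: "\<And>j. j < N \<Longrightarrow> X * ep j = em j * X * ep j" and j: "j < N"
  shows "pat (em j) (eP j) X"
proof -
  have "X * eP j = (\<Sum>k\<in>set (De j). X * ep k)"
    unfolding dg_blk[OF finite_set] sum_distrib_left tq_def ..
  also have "\<dots> = (\<Sum>k\<in>set (De j). em j * (X * ep k))"
  proof (intro sum.cong refl)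
    fix k assume k: "k \<in> set (De j)"
    then have kN: "k < N" using De_sub[OF j] by auto
    have "tm j \<inter> tm k = tm k" using De_trans[OF j k] by (auto simp: tm_def blk_def)
    then have "em j * em k = em k" using fins[OF j] fins[OF kN] by (simp add: dg_mult)
    moreover have "em j * (em k * X * ep k) = (em j * em k) * X * ep k" by (simp only: mult.assoc)
    ultimately show "X * ep k = em j * (X * ep k)" by (simp only: X[OF kN, symmetric])
  qed
  also have "\<dots> = em j * (X * eP j)"
    unfolding dg_blk[OF finite_set] sum_distrib_left tq_def ..
  finally show ?thesis unfolding pat_def by (simp only: mult.assoc)
qed

lemma sub_block_single:
  assumes M: "M \<in> carrier_mat m p" and ij: "i < N" "j < N"
  shows "sub_block md pd M [i] [j] \<in> carrier_mat (md i) (pd j)"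
    "fm (sub_block md pd M [i] [j]) = tp (rm (embed N md [i])) * fm M * rm (embed N pd [j])"
    "rm (embed N md [i]) * fm (sub_block md pd M [i] [j]) * tp (rm (embed N pd [j])) = dg (blk md {i}) * fm M * dg (blk pd {j})"
proof -
  have s: "set [i] \<subseteq> {..<N}" "set [j] \<subseteq> {..<N}" using ij by auto
  note b = fm_sub_block[OF M[folded noff(2,3)] s]
  show "sub_block md pd M [i] [j] \<in> carrier_mat (md i) (pd j)" using b(1) by (simp add: block_idx_def)
  show 1: "fm (sub_block md pd M [i] [j]) = tp (rm (embed N md [i])) * fm M * rm (embed N pd [j])" by (rule b(2))
  have "rm (embed N md [i]) * (tp (rm (embed N md [i])) * fm M * rm (embed N pd [j])) * tp (rm (embed N pd [j]))
    = (rm (embed N md [i]) * tp (rm (embed N md [i]))) * fm M * (rm (embed N pd [j]) * tp (rm (embed N pd [j])))"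
    by (simp only: mult.assoc)
  then show "rm (embed N md [i]) * fm (sub_block md pd M [i] [j]) * tp (rm (embed N pd [j])) = dg (blk md {i}) * fm M * dg (blk pd {j})"
    using embed_iso(2)[OF s(1)] embed_iso(2)[OF s(2)] by (simp add: 1)
qed

lemma info_setD:
  assumes "K \<in> info_set N E md pd 0"
  shows "\<forall>\<^sub>F s in at_rhp. K s \<in> carrier_mat m p \<and> (\<forall>j<N. fm (K s) * ep j = em j * fm (K s) * ep j)"
proof -
  obtain Kb where e: "\<forall>\<^sub>F s in at_rhp. K s \<in> carrier_mat (\<Sum>k<N. md k) (\<Sum>k<N. pd k) \<and>
          (\<forall>i<N. \<forall>j<N. sub_block md pd (K s) [i] [j] =
             (if i = j then Kb i i s
              else if reaches E j i then exp (- s * of_real 0) \<cdot>\<^sub>m Kb i j s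
              else 0\<^sub>m (md i) (pd j)))"
    using assms unfolding info_set_def by blast
  then show ?thesis
  proof eventually_elim
    case (elim s)
    have M: "K s \<in> carrier_mat m p" using elim by (simp add: dims)
    let ?K = "fm (K s)"
    have "?K * ep j = em j * ?K * ep j" if j: "j < N" for j
    proof -
      have z: "dg (blk md {i}) * ?K * ep j = 0" if i: "i < N" "i \<notin> set (De j)" for i
      proof -
        have "sub_block md pd (K s) [i] [j] = 0\<^sub>m (md i) (pd j)" using elim i j De_iff[OF j i(1)] by auto
        then show ?thesis using sub_block_single(3)[OF M i(1) j] by (simp add: tq_def fm_zero)
      qed
      have "?K * ep j = (\<Sum>i<N. dg (blk md {i})) * ?K * ep j"
        unfolding sum_dg_blk noff by (simp add: ix_left[OF car_fm[OF M]])
      also have "\<dots> = (\<Sum>i<N. em j * (dg (blk md {i}) * ?K * ep j))" unfolding sum_distrib_right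
      proof (intro sum.cong refl)
        fix i assume i: "i \<in> {..<N}"
        show "dg (blk md {i}) * ?K * ep j = em j * (dg (blk md {i}) * ?K * ep j)"
        proof (cases "i \<in> set (De j)")
          case True
          then have "tm j \<inter> blk md {i} = blk md {i}" by (auto simp: tm_def blk_def)
          then have "em j * dg (blk md {i}) = dg (blk md {i})" using fins[OF j] by (simp add: dg_mult finite_blk)
          then show ?thesis by (simp only: mult.assoc[symmetric])
        qed (use z i in simp)
      qed
      also have "\<dots> = em j * ((\<Sum>i<N. dg (blk md {i})) * ?K * ep j)" unfolding sum_distrib_right sum_distrib_left ..
      also have "\<dots> = em j * ?K * ep j" unfolding sum_dg_blk noff by (simp add: ix_left[OF car_fm[OF M]] mult.assoc)
      finally show ?thesis .
    qed
    then show ?case using M by blast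
  qed
qed

lemma info_setI:
  assumes e: "\<forall>\<^sub>F s in at_rhp. K s \<in> carrier_mat m p \<and> norm (fm (K s)) \<le> b \<and> (\<forall>j<N. fm (K s) * ep j = em j * fm (K s) * ep j)"
  shows "K \<in> info_set N E md pd 0"
proof -
  define Kb where "Kb i j s = sub_block md pd (K s) [i] [j]" for i j s
  obtain a where a: "\<And>s. a < Re s \<Longrightarrow> K s \<in> carrier_mat m p \<and> norm (fm (K s)) \<le> b \<and> (\<forall>j<N. fm (K s) * ep j = em j * fm (K s) * ep j)"
    using e unfolding eventually_rhp by blast
  have "Kb i j \<in> L_prop (md i) (pd j)" if ij: "i < N" "j < N" for i j
  proof -
    let ?b = "norm (rm (embed N md [i])) * b * norm (rm (embed N pd [j]))"
    \<comment> \<open>The abscissa in \<open>L_prop\<close> has to be positive, hence the maximum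
      with 1.\<close>
    have "Kb i j s \<in> carrier_mat (md i) (pd j) \<and> sqrt (frob_sq (Kb i j s)) \<le> ?b" if s: "max a 1 < Re s" for s
    proof -
      have s: "K s \<in> carrier_mat m p" "norm (fm (K s)) \<le> b" using a[of s] s by auto
      note sb = sub_block_single[OF s(1) ij]
      have "norm (tp (rm (embed N md [i])) * fm (K s) * rm (embed N pd [j])) \<le> norm (tp (rm (embed N md [i])) * fm (K s)) * norm (rm (embed N pd [j]))"
        by (rule norm_mult_ineq)
      also have "\<dots> \<le> norm (tp (rm (embed N md [i]))) * norm (fm (K s)) * norm (rm (embed N pd [j]))"
        by (intro mult_right_mono norm_mult_ineq) simp
      also have "\<dots> \<le> ?b"
        using s(2) by (simp add: mult_left_mono mult_right_mono)
      finally show ?thesis using sb(1) by (simp add: frob_sq_fm Kb_def sb(2))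
    qed
    moreover have "0 < max a 1" by simp
    ultimately show ?thesis unfolding L_prop_def by blast
  qed
  moreover have "\<forall>\<^sub>F s in at_rhp. K s \<in> carrier_mat (\<Sum>k<N. md k) (\<Sum>k<N. pd k) \<and>
          (\<forall>i<N. \<forall>j<N. sub_block md pd (K s) [i] [j] =
             (if i = j then Kb i i s
              else if reaches E j i then exp (- s * of_real 0) \<cdot>\<^sub>m Kb i j s
              else 0\<^sub>m (md i) (pd j)))"
    using e
  proof eventually_elim
    case (elim s)
    then have M: "K s \<in> carrier_mat m p" by blast
    have "sub_block md pd (K s) [i] [j] = 0\<^sub>m (md i) (pd j)" if ij: "i < N" "j < N" "i \<noteq> j" "\<not> reaches E j i" for i j
    proof -
      let ?Ei = "rm (embed N md [i])" and ?Ej = "rm (embed N pd [j])"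
      have s: "set [i] \<subseteq> {..<N}" "set [j] \<subseteq> {..<N}" "distinct [i]" "distinct [j]" using ij by auto
      note iso1 = embed_iso[OF s(1,3), simplified list.set] and iso2 = embed_iso[OF s(2,4), simplified list.set]
      have d: "tq j = blk pd {j}" "i \<notin> set (De j)" using De_iff[OF ij(2,1)] ij by (auto simp: tq_def)
      have Ej: "ep j * ?Ej = ?Ej"
        unfolding d iso2(2)[symmetric] by (simp only: mult.assoc iso2(1) ix_right[OF car_rm[OF embed_carrier]])
      have Ei: "tp ?Ei * em j = 0"
      proof -
        have "tp ?Ei = tp ?Ei * dg (blk md {i})"
          unfolding iso1(2)[symmetric] by (simp only: mult.assoc[symmetric] iso1(1) ix_left[OF car_tp[OF car_rm[OF embed_carrier]]])
        then have "tp ?Ei * em j = tp ?Ei * (dg (blk md {i}) * em j)" by (metis mult.assoc)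
        also have "blk md {i} \<inter> tm j = {}" using d(2) off_disjoint[of _ md i] by (auto simp: tm_def blk_def) (metis atLeastLessThan_iff)
        then have "dg (blk md {i}) * em j = dg {}" using fins[OF ij(2)] by (simp add: dg_mult finite_blk)
        also have "dg {} = 0" by (rule fmat_eqI) simp
        finally show ?thesis by simp
      qed
      have "fm (sub_block md pd (K s) [i] [j]) = tp ?Ei * (fm (K s) * ep j) * ?Ej"
        unfolding sub_block_single(2)[OF M ij(1,2)] by (simp only: mult.assoc Ej)
      also have "fm (K s) * ep j = em j * (fm (K s) * ep j)" using elim ij by (metis mult.assoc)
      also have "tp ?Ei * (em j * (fm (K s) * ep j)) * ?Ej = (tp ?Ei * em j) * (fm (K s) * ep j) * ?Ej" by (simp only: mult.assoc)
      finally have "fm (sub_block md pd (K s) [i] [j]) = fm (0\<^sub>m (md i) (pd j))" by (simp add: Ei fm_zero)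
      then show ?thesis using fm_inject[OF sub_block_single(1)[OF M ij(1,2)] zero_carrier_mat] by blast
    qed
    then show ?case using M by (auto simp: dims Kb_def)
  qed
  ultimately show ?thesis unfolding info_set_def by blast
qed

lemma Ph_holb: "holb 0 Ph" "holb 0 Ps" "holb 0 Qo" "holb 0 T11" "holb 0 T12" "holb 0 T21"
proof -
  obtain d where d: "0 < d" and h: "hold (- d) Ph" "hold (- d) Ps" "\<And>j. j < N \<Longrightarrow> hold (- d) (Pj j)"
    using stable_margin by metis
  have h0: "holb 0 Ph" "holb 0 Ps" "\<And>j. j < N \<Longrightarrow> holb 0 (Pj j)"
    using holb_mono[OF hold_holb[OF h(1)]] holb_mono[OF hold_holb[OF h(2)]] holb_mono[OF hold_holb[OF h(3)]] d by auto
  then show "holb 0 Ph" "holb 0 Ps" by auto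
  show "holb 0 Qo" unfolding Qo_def[abs_def]
    by (intro holb_minus holb_sum holb_mult holb_const h0) simp
  show "holb 0 T11" "holb 0 T12" "holb 0 T21" unfolding T11_def[abs_def] T12_def[abs_def] T21_def[abs_def]
    by (intro holb_add holb_diff holb_mult holb_const h0)+
qed

lemma resolvents:
  assumes "0 < Re s"
  shows "isrsv {..<n} (rm A + rm B2 * rm Fd) s (Ph s)" "isrsv {..<n} (rm A + rm L * rm C2) s (Ps s)"
    "\<And>j. j < N \<Longrightarrow> isrsv (tn j) (AF j) s (Pj j s)"
  using stable_margin assms by (metis less_trans neg_less_0_iff_less)+

lemma Qo_facts:
  assumes s: "0 < Re s"
  shows "car m p (Qo s)" "\<And>j. j < N \<Longrightarrow> Qo s * ep j = em j * Qo s * ep j"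
proof -
  have cP: "car n n (Pj j s)" if j: "j < N" for j
  proof -
    have "dg (tn j) * Pj j s = Pj j s" "Pj j s * dg (tn j) = Pj j s" using resolvents(3)[OF s j] by (auto simp: isrsv_def)
    moreover obtain k where "car k k (Pj j s)" using car_ex by blast
    then have "car n n (dg (tn j) * Pj j s * dg (tn j))"
      by (rule car_mult[OF car_mult[OF car_dg[OF tsets(1)[OF j]]] car_dg[OF tsets(1)[OF j]]])
    ultimately show ?thesis by simp
  qed
  show "car m p (Qo s)" unfolding Qo_def
    by (intro car_minus car_sum) (auto intro: car_mult[OF car_mult[OF car_diff[OF car_Ft carF(8)] cP] car_Lt])
  fix j assume j: "j < N"
  have z: "Lt k * ep j = (if k = j then Lt j else 0)" if "k < N" for k using Lt0[OF j that] Lt1(2)[OF j] by auto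
  have "(\<Sum>k<N. (Ft k - rm Fd) * Pj k s * Lt k) * ep j = (\<Sum>k<N. if k = j then (Ft j - rm Fd) * Pj j s * Lt j else 0)"
    unfolding sum_distrib_right by (intro sum.cong refl) (use z in \<open>simp add: mult.assoc\<close>)
  then have q: "Qo s * ep j = - ((Ft j - rm Fd) * Pj j s * Lt j)" unfolding Qo_def using j by simp
  have "em j * ((Ft j - rm Fd) * Pj j s * Lt j) = (em j * Ft j - em j * rm Fd) * Pj j s * Lt j"
    by (simp only: mult.assoc[symmetric] right_diff_distrib)
  also have "em j * rm Fd = rm Fd * en j" by (rule commF[OF j, symmetric])
  also have "(em j * Ft j - rm Fd * en j) * Pj j s * Lt j = (Ft j - rm Fd) * Pj j s * Lt j"
  proof -
    have "en j * Pj j s = Pj j s" using resolvents(3)[OF s j] by (simp add: isrsv_def)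
    then have "(Ft j - rm Fd * en j) * Pj j s = (Ft j - rm Fd) * Pj j s" by (simp only: left_diff_distrib mult.assoc)
    then show ?thesis by (simp only: Ft1[OF j])
  qed
  finally show "Qo s * ep j = em j * Qo s * ep j" using q by (simp add: mult.assoc)
qed

definition "Tc Q s = T11 s + T12 s * Q s * T21 s"

lemma Tc_holb: "holb 0 Q \<Longrightarrow> holb 0 (Tc Q)"
  unfolding Tc_def[abs_def] by (intro holb_add holb_mult Ph_holb)

lemma T_car:
  assumes s: "0 < Re s"
  shows "car nz nw (T11 s)" "car nz m (T12 s)" "car p nw (T21 s)"
proof -
  have c: "car n n (Ph s)" "car n n (Ps s)" using isrsv_rules(1,2)[OF resolvents(1)[OF s]] isrsv_rules(1,2)[OF resolvents(2)[OF s]]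
    by (simp_all add: car_iff)
  have cd: "car nz n (rm C1 + rm D12 * rm Fd)" by (rule car_add[OF carF(4) car_mult[OF carF(6,8)]])
  have df: "car nz n (rm D12 * rm Fd)" "car n n (rm B2 * rm Fd)" by (rule car_mult[OF carF(6,8)] car_mult[OF carF(3,8)])+
  show "car nz nw (T11 s)" unfolding T11_def
    by (rule car_diff[OF car_mult[OF car_mult[OF cd c(1)] car_diff[OF carF(2) car_mult[OF car_mult[OF df(2) c(2)] cBL]]] car_mult[OF car_mult[OF df(1) c(2)] cBL]])
  show "car nz m (T12 s)" unfolding T12_def by (rule car_add[OF car_mult[OF car_mult[OF cd c(1)] carF(3)] carF(6)])
  show "car p nw (T21 s)" unfolding T21_def by (rule car_add[OF car_mult[OF car_mult[OF carF(5) c(2)] cBL] carF(7)])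
qed

lemma Tc_car: "0 < Re s \<Longrightarrow> car nz nw (Tc Q s)"
proof -
  assume s: "0 < Re s"
  obtain k where "car k k (Q s)" using car_ex by blast
  then show ?thesis unfolding Tc_def
    by (rule car_add[OF T_car(1)[OF s] car_mult[OF car_mult[OF T_car(2)[OF s]] T_car(3)[OF s]]])
qed

lemma cost_optimal:
  assumes Q: "holb 0 Q" "\<And>s. 0 < Re s \<Longrightarrow> car m p (Q s)"
    "\<And>s j. 0 < Re s \<Longrightarrow> j < N \<Longrightarrow> Q s * ep j = em j * Q s * ep j"
  shows "cost (Tc Qo) \<le> cost (Tc Q)"
proof -
  have "Tc Qo s = G0 s" if "0 < Re s" for s unfolding Tc_def by (rule closed_loop[OF resolvents[OF that]])
  then have "cost (Tc Qo) = cost G0" by (rule cost_cong)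
  also have "\<dots> \<le> cost (Tc Q)"
    unfolding cost_def SUP_divide_ennreal[symmetric] Tc_def
    by (intro divide_right_mono_ennreal SUP_least P2_lower_bound Q) auto
  finally show ?thesis .
qed

lemma T_cost:
  assumes Q: "holb 0 Qh" and e: "\<forall>\<^sub>F s in at_rhp. Q s \<in> carrier_mat m p \<and> fm (Q s) = Qh s"
  defines "T \<equiv> T_tf A B1 B2 C1 C2 D12 D21 Fd L"
  shows "H2_norm_sq nz nw (\<lambda>s. tf11 nz nw T s + tf12 nz nw T s * Q s * tf21 nz nw T s) = cost (Tc Qh)"
proof (rule H2_norm_sq_fm[OF Tc_holb[OF Q] Tc_car])
  show "\<forall>\<^sub>F s in at_rhp. tf11 nz nw T s + tf12 nz nw T s * Q s * tf21 nz nw T s \<in> carrier_mat nz nw \<and>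
      fm (tf11 nz nw T s + tf12 nz nw T s * Q s * tf21 nz nw T s) = Tc Qh s"
    using e eventually_Re[of 0]
  proof eventually_elim
    case (elim s)
    note r = resolvents[OF elim(2)]
    note T = T_fm[OF carr L_facts(1) r(1,2), folded T_def BL_def, folded T11_def T12_def T21_def]
    have c: "tf12 nz nw T s * Q s \<in> carrier_mat nz p" "tf12 nz nw T s * Q s * tf21 nz nw T s \<in> carrier_mat nz nw" using T elim by auto
    have "fm (tf12 nz nw T s * Q s * tf21 nz nw T s) = T12 s * Qh s * T21 s"
      using T elim carrier_matD[OF c(1)] carrier_matD[OF T(3)] carrier_matD[OF T(5)] carrier_matD[of "Q s" m p] by (simp add: fm_mult)
    then show ?case using c(2) T(1,2) fm_add[OF T(1) c(2)] by (simp add: Tc_def)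
  qed
qed simp

text \<open>The inverse inside \<open>lower_lft\<close> is justified by the relation, which supplies
  the left inverse \<open>(V + Nn * Q) * Mt\<close> of \<open>ix p - P22 * K\<close>. The rest is
  \<open>rel_cost\<close> at each point.\<close>

lemma lft_cost:
  assumes Q: "holb 0 Q" and e: "\<forall>\<^sub>F s in at_rhp. K s \<in> carrier_mat m p \<and> rel s (fm (K s)) (Q s)"
  defines "P \<equiv> plant_tf A B1 B2 C1 C2 D12 D21"
  shows "H2_norm_sq nz nw (lower_lft nz nw P K) = cost (Tc Q)"
proof (rule H2_norm_sq_fm[OF Tc_holb[OF Q] Tc_car])
  show "\<forall>\<^sub>F s in at_rhp. lower_lft nz nw P K s \<in> carrier_mat nz nw \<and> fm (lower_lft nz nw P K s) = Tc Q s"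
    using e eventually_youla
  proof eventually_elim
    case (elim s)
    interpret y: youla n m p nw nz "rm A" "rm B1" "rm B2" "rm C1" "rm C2" "rm D12" "rm D21" "rm Fd" "rm L" s "Th s" "Ph s" "Ps s"
      by (rule elim(2))
    have K: "K s \<in> carrier_mat m p" and r: "rel s (fm (K s)) (Q s)" using elim by auto
    note cK = car_fm[OF K]
    note T = plant_fm[OF carr(1-7) y.Th, folded P_def]
    let ?M = "1\<^sub>m (dim_row (tf22 nz nw P s)) - tf22 nz nw P s * K s"
    have PK: "tf22 nz nw P s * K s \<in> carrier_mat p p" using T(7) K by auto
    have M: "?M \<in> carrier_mat p p" using T(7) K by auto
    have fM: "fm ?M = ix p - y.P22 * fm (K s)"
      using carrier_matD[OF T(7)] carrier_matD[OF K] fm_diff[OF one_carrier_mat PK] by (simp add: fm_mult T(8) y.P22_def fm_one)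
    have W: "((y.V + y.Nn * Q s) * y.Mt) * fm ?M = ix p"
      unfolding fM using y.rel_inverse(1,3)[OF cK r] by (simp only: mult.assoc)
    note i = fm_inv_mat[OF M W]
    have G: "(ix p - y.P22 * fm (K s)) * fm (inv_mat ?M) = ix p" using i(3) unfolding fM .
    have c1: "tf12 nz nw P s * K s \<in> carrier_mat nz p" using T K by auto
    have c2: "tf12 nz nw P s * K s * inv_mat ?M \<in> carrier_mat nz p" using c1 i(1) by auto
    have c3: "tf12 nz nw P s * K s * inv_mat ?M * tf21 nz nw P s \<in> carrier_mat nz nw" using c2 T by auto
    have "fm (tf12 nz nw P s * K s * inv_mat ?M * tf21 nz nw P s) = fm (tf12 nz nw P s) * fm (K s) * fm (inv_mat ?M) * fm (tf21 nz nw P s)"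
      using carrier_matD[OF c1] carrier_matD[OF c2] carrier_matD[OF T(3)] carrier_matD[OF T(5)] carrier_matD[OF K] carrier_matD[OF i(1)]
      by (simp only: fm_mult)
    then have f: "fm (lower_lft nz nw P K s) = rm C1 * Th s * rm B1 + (rm C1 * Th s * rm B2 + rm D12) * fm (K s) * fm (inv_mat ?M) * (rm C2 * Th s * rm B1 + rm D21)"
      unfolding lower_lft_def using fm_add[OF T(1) c3] by (simp only: T(2,4,6))
    have "fm (lower_lft nz nw P K s) = Tc Q s"
      unfolding f y.rel_cost[OF cK r G car_fm[OF i(1)]] Tc_def T11_def T12_def T21_def BL_def ..
    then show ?case unfolding lower_lft_def using T(1) c3 by auto
  qed
qed simp

end

text \<open>The block matrix with identities on the diagonal, \<open>- P\<close> in the upper right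
  and \<open>- K\<close> in the lower left corner; its inverse defines internal stability.\<close>

definition feedback :: "nat \<Rightarrow> nat \<Rightarrow> fmat \<Rightarrow> fmat \<Rightarrow> fmat" where
  "feedback p m P K = ix p - P * tp (sh p m) - sh p m * K + sh p m * tp (sh p m)"

lemma feedback_parts:
  assumes K: "car m p K" and P: "car p m P"
  shows "feedback p m P K * ix p = ix p - sh p m * K" "feedback p m P K * sh p m = sh p m - P"
    "ix p * feedback p m P K = ix p - P * tp (sh p m)" "tp (sh p m) * feedback p m P K = tp (sh p m) - K"
proof -
  let ?S = "sh p m"
  have z: "tp ?S * (P * x) = 0" "K * ?S = 0" for x
  proof -
    have "tp ?S * (P * x) = (tp ?S * ix p) * (P * x)" by (simp only: mult.assoc ix_left'[OF P])
    then show "tp ?S * (P * x) = 0" by (simp add: tpsh_ix)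
    have "K * ?S = K * (ix p * ?S)" by (simp only: ix_right'[OF K])
    then show "K * ?S = 0" by (simp add: ix_sh)
  qed
  have s: "tp ?S * (?S * x) = ix m * x" "ix p * (?S * x) = 0" for x
    by (simp_all add: mult.assoc[symmetric] tpsh_sh ix_sh)
  have t: "?S * ix m = ?S" "ix m * tp ?S = tp ?S" by (rule ix_right[OF car_sh] ix_left[OF car_tp[OF car_sh]])+
  note r = z s t tpsh_ix ix_sh tpsh_sh ix_right[OF K] ix_left[OF K] ix_right[OF P] ix_left[OF P] ix_left'[OF P]
  show "feedback p m P K * ix p = ix p - ?S * K" "feedback p m P K * ?S = ?S - P"
    "ix p * feedback p m P K = ix p - P * tp ?S" "tp ?S * feedback p m P K = tp ?S - K"
    unfolding feedback_def by (simp_all add: distrib_left distrib_right left_diff_distrib right_diff_distrib mult.assoc r dg_mult)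
qed

lemma ix_sum_parts: "ix (p + m) * ix p = ix p" "ix (p + m) * sh p m = sh p m"
  unfolding ix_split by (simp_all add: distrib_right mult.assoc tpsh_ix ix_sh tpsh_sh dg_mult ix_right[OF car_sh])

text \<open>The first block row of \<open>H * feedback p m P K\<close> and the second block row of
  \<open>feedback p m P K * H\<close> express every block of \<open>H\<close> through
  \<open>h11\<close>, \<open>P\<close> and \<open>K\<close>.\<close>

lemma feedback_inverse_blocks:
  assumes K: "car m p K" and P: "car p m P"
    and H: "H * feedback p m P K = ix (p + m)" "feedback p m P K * H = ix (p + m)"
  defines "h11 \<equiv> ix p * H * ix p" and "h12 \<equiv> ix p * H * sh p m" and "h21 \<equiv> tp (sh p m) * H * ix p" and "h22 \<equiv> tp (sh p m) * H * sh p m"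
  shows "h11 * (ix p - P * K) = ix p" "h12 = h11 * P" "h21 = K * h11" "h22 = ix m + K * (h11 * P)"
proof -
  let ?S = "sh p m"
  note f = feedback_parts[OF K P]
  have ii: "ix p * ix p = ix p" by (simp add: dg_mult)
  have t: "tp ?S * ix p = 0" "ix p * ?S = 0" "tp ?S * ?S = ix m" by (rule tpsh_ix ix_sh tpsh_sh)+
  have iP: "ix p * P = P" "K * ix p = K" by (rule ix_left[OF P] ix_right[OF K])+
  have "ix p * (H * (feedback p m P K * ix p)) = ix p"
    unfolding mult.assoc[symmetric, of H] H by (simp only: ix_sum_parts ii)
  then have 1: "h11 - h12 * K = ix p" unfolding f h11_def h12_def by (simp only: right_diff_distrib mult.assoc)
  have "ix p * (H * (feedback p m P K * ?S)) = 0"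
    unfolding mult.assoc[symmetric, of H] H by (simp only: ix_sum_parts t)
  then have "ix p * (H * ?S) - ix p * (H * P) = 0" unfolding f by (simp only: right_diff_distrib)
  then show 2: "h12 = h11 * P" unfolding h11_def h12_def by (simp add: mult.assoc iP)
  show "h11 * (ix p - P * K) = ix p"
  proof -
    have "h11 * ix p = h11" unfolding h11_def by (simp only: mult.assoc ii)
    then show ?thesis using 1 unfolding 2 by (simp only: right_diff_distrib mult.assoc)
  qed
  have "((tp ?S * feedback p m P K) * H) * ix p = 0"
    unfolding mult.assoc[of _ _ H] H mult.assoc ix_sum_parts by (simp only: t)
  then have "tp ?S * (H * ix p) - K * (H * ix p) = 0" unfolding f by (simp only: left_diff_distrib mult.assoc)
  then show 3: "h21 = K * h11" unfolding h11_def h21_def by (simp add: mult.assoc[symmetric] iP)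
  have "((tp ?S * feedback p m P K) * H) * ?S = ix m"
    unfolding mult.assoc[of _ _ H] H mult.assoc ix_sum_parts by (simp only: t)
  then have "tp ?S * (H * ?S) - K * (H * ?S) = ix m" unfolding f by (simp only: left_diff_distrib mult.assoc)
  then have "h22 = ix m + K * h12" unfolding h22_def h12_def by (simp add: mult.assoc[symmetric] iP diff_eq_eq)
  then show "h22 = ix m + K * (h11 * P)" unfolding 2 .
qed

lemma feedback_inverseI:
  assumes K: "car m p K" and P: "car p m P" and c: "h11 * ix p = h11" "h12 * ix m = h12" "h21 * ix p = h21" "h22 * ix m = h22"
    and h: "h11 - h12 * K = ix p" "- (h11 * P) + h12 = 0" "h21 - h22 * K = 0" "- (h21 * P) + h22 = ix m"
  shows "(h11 + h12 * tp (sh p m) + sh p m * h21 + sh p m * h22 * tp (sh p m)) * feedback p m P K = ix (p + m)"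
proof -
  let ?S = "sh p m"
  note f = feedback_parts[OF K P]
  let ?F = "feedback p m P K"
  have 1: "h11 * ?F = h11 - h11 * P * tp ?S" "h21 * ?F = h21 - h21 * P * tp ?S"
    using arg_cong[OF f(3), of "\<lambda>x. h11 * x"] arg_cong[OF f(3), of "\<lambda>x. h21 * x"]
    by (simp_all add: mult.assoc[symmetric] c right_diff_distrib)
  have 2: "h12 * (tp ?S * ?F) = h12 * tp ?S - h12 * K" "h22 * (tp ?S * ?F) = h22 * tp ?S - h22 * K"
    unfolding f by (simp_all only: right_diff_distrib)
  have a: "h11 * ?F + h12 * (tp ?S * ?F) = (h11 - h12 * K) + (- (h11 * P) + h12) * tp ?S"
    unfolding 1 2 by (simp add: algebra_simps)
  have b: "h21 * ?F + h22 * (tp ?S * ?F) = (h21 - h22 * K) + (- (h21 * P) + h22) * tp ?S"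
    unfolding 1 2 by (simp add: algebra_simps)
  have "(h11 + h12 * tp ?S + ?S * h21 + ?S * h22 * tp ?S) * ?F
     = (h11 * ?F + h12 * (tp ?S * ?F)) + ?S * (h21 * ?F + h22 * (tp ?S * ?F))"
    by (simp only: distrib_left distrib_right mult.assoc add.assoc)
  also have "\<dots> = ix p + ?S * (ix m * tp ?S)" unfolding a b h by simp
  finally show ?thesis by (simp add: ix_split ix_left[OF car_tp[OF car_sh]])
qed

section \<open>The Youla correspondence for structured controllers\<close>

context network
begin

definition "Pl = plant_tf A B1 B2 C1 C2 D12 D21"

text \<open>The coprime factors of \<open>youla\<close> as functions of \<open>s\<close>, so that
  they can be treated as analytic functions.\<close>

definition "yV s = ix p - rm C2 * Ph s * rm L"
definition "yU s = - (rm Fd * Ph s * rm L)"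
definition "yNn s = rm C2 * Ph s * rm B2"
definition "yMm s = ix m + rm Fd * Ph s * rm B2"
definition "yMt s = ix p + rm C2 * Ps s * rm L"
definition "yNt s = rm C2 * Ps s * rm B2"
definition "yVt s = ix m - rm Fd * Ps s * rm B2"
definition "yUt s = rm Fd * Ps s * rm L"
definition "yP s = rm C2 * Th s * rm B2"

lemmas ydefs = yV_def yU_def yNn_def yMm_def yMt_def yNt_def yVt_def yUt_def yP_def

lemma y_holb: "holb 0 yV" "holb 0 yU" "holb 0 yNn" "holb 0 yMm" "holb 0 yMt" "holb 0 yNt" "holb 0 yVt" "holb 0 yUt"
  unfolding ydefs[abs_def] by (intro holb_add holb_diff holb_minus holb_mult holb_const Ph_holb)+

lemma res_car:
  assumes "0 < Re s"
  shows "car n n (Ph s)" "car n n (Ps s)"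
  using isrsv_rules(1,2)[OF resolvents(1)[OF assms]] isrsv_rules(1,2)[OF resolvents(2)[OF assms]] by (simp_all add: car_iff)

lemma y_car:
  assumes s: "0 < Re s"
  shows "car p p (yV s)" "car m p (yU s)" "car p m (yNn s)" "car m m (yMm s)" "car p p (yMt s)" "car p m (yNt s)" "car m m (yVt s)" "car m p (yUt s)"
  unfolding ydefs
  by (rule car_diff[OF car_ix car_mult[OF car_mult[OF carF(5) res_car(1)[OF s]] cars(9)]]
      car_minus[OF car_mult[OF car_mult[OF carF(8) res_car(1)[OF s]] cars(9)]]
      car_mult[OF car_mult[OF carF(5) res_car(1)[OF s]] carF(3)]
      car_add[OF car_ix car_mult[OF car_mult[OF carF(8) res_car(1)[OF s]] carF(3)]]
      car_add[OF car_ix car_mult[OF car_mult[OF carF(5) res_car(2)[OF s]] cars(9)]]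
      car_mult[OF car_mult[OF carF(5) res_car(2)[OF s]] carF(3)]
      car_diff[OF car_ix car_mult[OF car_mult[OF carF(8) res_car(2)[OF s]] carF(3)]]
      car_mult[OF car_mult[OF carF(8) res_car(2)[OF s]] cars(9)])+

lemma pat_data:
  assumes j: "j < N"
  shows "pat (en j) (em j) (rm B2)" "pat (eP j) (en j) (rm C2)" "pat (em j) (en j) (rm Fd)" "pat (en j) (eP j) (rm L)"
    "pat (eP j) (eP j) (ix p)" "pat (em j) (em j) (ix m)"
proof -
  have i: "en j * en j = en j" "em j * em j = em j" "eP j * eP j = eP j"
    using fins[OF j] by (simp_all add: dg_mult finite_blk)
  show "pat (en j) (em j) (rm B2)" by (rule pat_comm[OF commB[OF j] i(2)])
  show "pat (eP j) (en j) (rm C2)" by (rule pat_comm[OF eP_facts(3)[OF j] i(1)])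
  show "pat (em j) (en j) (rm Fd)" by (rule pat_comm[OF commF[OF j] i(1)])
  show "pat (en j) (eP j) (rm L)" by (rule pat_comm[OF eP_facts(4)[OF j] i(3)])
  have c: "car p p (eP j)" "car m m (em j)" by (rule car_dg[OF eP_facts(1)[OF j]] car_dg[OF tsets(2)[OF j]])+
  show "pat (eP j) (eP j) (ix p)" by (rule pat_comm[OF _ i(3)]) (simp add: ix_left[OF c(1)] ix_right[OF c(1)])
  show "pat (em j) (em j) (ix m)" by (rule pat_comm[OF _ i(2)]) (simp add: ix_left[OF c(2)] ix_right[OF c(2)])
qed

lemma pat_resolvents:
  assumes j: "j < N"
  shows "isrsv {..<n} (rm A) s R \<Longrightarrow> pat (en j) (en j) R"
    "isrsv {..<n} (rm A + rm B2 * rm Fd) s R \<Longrightarrow> pat (en j) (en j) R"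
    "isrsv {..<n} (rm A + rm L * rm C2) s R \<Longrightarrow> pat (en j) (en j) R"
proof -
  have i: "en j * en j = en j" using fins[OF j] by (simp add: dg_mult)
  have 1: "(rm A + rm B2 * rm Fd) * en j = en j * (rm A + rm B2 * rm Fd)"
  proof -
    have "rm B2 * rm Fd * en j = (rm B2 * em j) * rm Fd" by (simp only: mult.assoc commF[OF j])
    then show ?thesis by (simp only: distrib_left distrib_right commA[OF j] commB[OF j] mult.assoc)
  qed
  have 2: "(rm A + rm L * rm C2) * en j = en j * (rm A + rm L * rm C2)"
  proof -
    have "rm L * rm C2 * en j = (rm L * eP j) * rm C2" by (simp only: mult.assoc eP_facts(3)[OF j])
    then show ?thesis by (simp only: distrib_left distrib_right commA[OF j] eP_facts(4)[OF j] mult.assoc)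
  qed
  show "isrsv {..<n} (rm A) s R \<Longrightarrow> pat (en j) (en j) R"
    "isrsv {..<n} (rm A + rm B2 * rm Fd) s R \<Longrightarrow> pat (en j) (en j) R"
    "isrsv {..<n} (rm A + rm L * rm C2) s R \<Longrightarrow> pat (en j) (en j) R"
    by (rule pat_comm[OF rsv_commute[OF _ commA[OF j] tsets(1)[OF j]] i] pat_comm[OF rsv_commute[OF _ 1 tsets(1)[OF j]] i]
        pat_comm[OF rsv_commute[OF _ 2 tsets(1)[OF j]] i]; assumption)+
qed

lemma y_pat:
  assumes j: "j < N" and s: "0 < Re s"
  shows "pat (eP j) (eP j) (yV s)" "pat (em j) (eP j) (yU s)" "pat (eP j) (em j) (yNn s)" "pat (em j) (em j) (yMm s)"
    "pat (eP j) (eP j) (yMt s)" "pat (eP j) (em j) (yNt s)" "pat (em j) (em j) (yVt s)" "pat (em j) (eP j) (yUt s)"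
    "isrsv {..<n} (rm A) s (Th s) \<Longrightarrow> pat (eP j) (em j) (yP s)"
proof -
  note d = pat_data[OF j] and r = pat_resolvents(2)[OF j resolvents(1)[OF s]] pat_resolvents(3)[OF j resolvents(2)[OF s]]
  show "pat (eP j) (eP j) (yV s)" "pat (em j) (eP j) (yU s)" "pat (eP j) (em j) (yNn s)" "pat (em j) (em j) (yMm s)"
    "pat (eP j) (eP j) (yMt s)" "pat (eP j) (em j) (yNt s)" "pat (em j) (em j) (yVt s)" "pat (em j) (eP j) (yUt s)"
    unfolding ydefs
    by (rule pat_diff[OF d(5) pat_mult[OF pat_mult[OF d(2) r(1)] d(4)]] pat_minus[OF pat_mult[OF pat_mult[OF d(3) r(1)] d(4)]]
      pat_mult[OF pat_mult[OF d(2) r(1)] d(1)] pat_add[OF d(6) pat_mult[OF pat_mult[OF d(3) r(1)] d(1)]]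
      pat_add[OF d(5) pat_mult[OF pat_mult[OF d(2) r(2)] d(4)]] pat_mult[OF pat_mult[OF d(2) r(2)] d(1)]
      pat_diff[OF d(6) pat_mult[OF pat_mult[OF d(3) r(2)] d(1)]] pat_mult[OF pat_mult[OF d(3) r(2)] d(4)])+
  assume t: "isrsv {..<n} (rm A) s (Th s)"
  show "pat (eP j) (em j) (yP s)" unfolding yP_def
    by (rule pat_mult[OF pat_mult[OF d(2) pat_resolvents(1)[OF j t]] d(1)])
qed

lemma feedback_fm:
  assumes K: "K s \<in> carrier_mat m p" and T: "isrsv {..<n} (rm A) s (Th s)"
  defines "M \<equiv> four_block_mat (1\<^sub>m p) (- tf22 nz nw Pl s) (- K s) (1\<^sub>m m)"
  shows "M \<in> carrier_mat (p + m) (p + m)" "fm M = feedback p m (yP s) (fm (K s))" "car p m (yP s)"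
proof -
  note P = plant_fm(7,8)[OF carr(1-7) T, folded Pl_def yP_def]
  show "M \<in> carrier_mat (p + m) (p + m)" unfolding M_def using P K by (intro four_block_carrier_mat) auto
  have "fm M = fm (1\<^sub>m p) + fm (- tf22 nz nw Pl s) * tp (sh p m) + sh p m * fm (- K s) + sh p m * fm (1\<^sub>m m) * tp (sh p m)"
    unfolding M_def using P K by (intro fm_four_block) auto
  then show "fm M = feedback p m (yP s) (fm (K s))"
    by (simp add: feedback_def fm_one fm_uminus P(2) ix_right[OF car_sh])
  show "car p m (yP s)" using car_fm[OF P(1)] P(2) by simp
qed

text \<open>\<open>K\<close> is given only far to the right, but the closed-loop inverse has a
  bounded analytic continuation. Building \<open>Q\<close> from its blocks defines \<open>Q\<close>
  on the whole half-plane, and the relation to \<open>K\<close> is needed far to the right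
  only.\<close>

lemma youla_parameter_exists:
  assumes K: "K \<in> info_set N E md pd 0" and st: "stabilizes m p K (tf22 nz nw Pl)"
  shows "\<exists>Q. holb 0 Q \<and> (\<forall>s. 0 < Re s \<longrightarrow> car m p (Q s)) \<and> (\<forall>s j. 0 < Re s \<longrightarrow> j < N \<longrightarrow> Q s * ep j = em j * Q s * ep j) \<and>
     (\<forall>\<^sub>F s in at_rhp. K s \<in> carrier_mat m p \<and> rel s (fm (K s)) (Q s))"
proof -
  let ?M = "\<lambda>s. four_block_mat (1\<^sub>m p) (- tf22 nz nw Pl s) (- K s) (1\<^sub>m m)"
  have inv: "\<forall>\<^sub>F s in at_rhp. invertible_mat (?M s)" and Hi: "(\<lambda>s. inv_mat (?M s)) \<in> H_inf (p + m) (p + m)"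
    using st unfolding stabilizes_def Let_def by auto
  obtain H where H: "holb 0 H" "\<forall>\<^sub>F s in at_rhp. inv_mat (?M s) \<in> carrier_mat (p + m) (p + m) \<and> fm (inv_mat (?M s)) = H s"
    using H_infD[OF Hi] by blast
  let ?S = "sh p m"
  define h11 where "h11 s = ix p * H s * ix p" for s
  define h12 where "h12 s = ix p * H s * ?S" for s
  define h21 where "h21 s = tp ?S * H s * ix p" for s
  define h22 where "h22 s = tp ?S * H s * ?S" for s
  have hh: "holb 0 h11" "holb 0 h12" "holb 0 h21" "holb 0 h22"
    unfolding h11_def[abs_def] h12_def[abs_def] h21_def[abs_def] h22_def[abs_def] by (intro holb_mult holb_const H)+
  \<comment> \<open>The formula of \<open>rel_from_inverse\<close>, in which \<open>K\<close> does
    not occur.\<close>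
  define Q where "Q s = yVt s * (h21 s * yV s - h22 s * yU s + yU s) + yUt s * (h11 s * yV s - h12 s * yU s)" for s
  have Qh: "holb 0 Q" unfolding Q_def[abs_def] by (intro holb_add holb_diff holb_mult hh y_holb)
  have Qc: "car m p (Q s)" if s: "0 < Re s" for s
  proof -
    note y = y_car[OF s]
    have "Q s * ix p = Q s"
      unfolding Q_def by (simp add: distrib_right left_diff_distrib mult.assoc ix_right[OF y(1)] ix_right[OF y(2)])
    moreover have "ix m * Q s = Q s"
      unfolding Q_def by (simp only: distrib_left ix_left'[OF y(7)] ix_left'[OF y(8)])
    ultimately show ?thesis by (simp add: car_iff)
  qed
  have ev: "\<forall>\<^sub>F s in at_rhp. K s \<in> carrier_mat m p \<and> rel s (fm (K s)) (Q s) \<and> (\<forall>j<N. Q s * ep j = em j * Q s * ep j)"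
    using info_setD[OF K] inv H(2) eventually_youla eventually_Re[of 0]
  proof eventually_elim
    case (elim s)
    interpret y: youla n m p nw nz "rm A" "rm B1" "rm B2" "rm C1" "rm C2" "rm D12" "rm D21" "rm Fd" "rm L" s "Th s" "Ph s" "Ps s"
      by (rule elim(4))
    note ye = y.defs[folded ydefs]
    have K: "K s \<in> carrier_mat m p" and Kp: "\<And>j. j < N \<Longrightarrow> fm (K s) * ep j = em j * fm (K s) * ep j" using elim by auto
    note cK = car_fm[OF K]
    note M = feedback_fm[where K = K, OF K y.Th]
    have HM: "H s * feedback p m (yP s) (fm (K s)) = ix (p + m)" "feedback p m (yP s) (fm (K s)) * H s = ix (p + m)"
      using invertible_fm_inverse[OF M(1) elim(2)] elim(3) unfolding M(2) by simp_all
    note hb = feedback_inverse_blocks[OF cK M(3) HM, folded h11_def h12_def h21_def h22_def]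
    have r: "rel s (fm (K s)) (Q s)"
      by (rule y.rel_from_inverse[OF cK, of "h11 s" "h12 s" "h21 s" "h22 s"]) (simp_all only: ye hb(1), rule hb(2), rule hb(3), rule hb(4), rule Q_def)
    have "Q s * ep j = em j * Q s * ep j" if j: "j < N" for j
    proof -
      note p = y_pat[OF j elim(5)] and pd = pat_data[OF j]
      have pK: "pat (em j) (eP j) (fm (K s))" by (rule pat_eP[OF Kp j])
      have pP: "pat (eP j) (em j) (yP s)" by (rule p(9)[OF y.Th])
      have ch: "car p p (h11 s)" unfolding h11_def car_iff by (simp add: mult.assoc dg_mult) (simp add: mult.assoc[symmetric] dg_mult)
      have cM: "car p p (ix p - yP s * fm (K s))" by (rule car_diff[OF car_ix car_mult[OF M(3) cK]])
      \<comment> \<open>Only this block needs the pattern of an inverse; the remaining blocks are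
        built from it by products and sums.\<close>
      have p11: "pat (eP j) (eP j) (h11 s)"
        by (rule pat_inverse[OF eP_facts(1)[OF j] cM pat_diff[OF pd(5) pat_mult[OF pP pK]] ch hb(1) left_inverse_imp_right[OF cM ch hb(1)]])
      have p12: "pat (eP j) (em j) (h12 s)" unfolding hb(2) by (rule pat_mult[OF p11 pP])
      have p21: "pat (em j) (eP j) (h21 s)" unfolding hb(3) by (rule pat_mult[OF pK p11])
      have p22: "pat (em j) (em j) (h22 s)" unfolding hb(4) by (rule pat_add[OF pd(6) pat_mult[OF pK pat_mult[OF p11 pP]]])
      have "pat (em j) (eP j) (Q s)" unfolding Q_def
        by (rule pat_add[OF pat_mult[OF p(7) pat_add[OF pat_diff[OF pat_mult[OF p21 p(1)] pat_mult[OF p22 p(2)]] p(2)]]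
              pat_mult[OF p(8) pat_diff[OF pat_mult[OF p11 p(1)] pat_mult[OF p12 p(2)]]]])
      then show ?thesis by (rule pat_ep[OF _ eP_facts(2)[OF j]])
    qed
    then show ?case using K r by blast
  qed
  \<comment> \<open>Far to the right the pattern of \<open>Q\<close> comes from that of
    \<open>K\<close>; both sides are analytic, so it holds on the half-plane.\<close>
  have "Q s * ep j = em j * Q s * ep j" if s: "0 < Re s" and j: "j < N" for s j
    by (rule fm_rhp_identity[OF _ _ _ s]) (use ev j Qh in \<open>auto intro!: holb_mult elim: eventually_mono\<close>)
  then show ?thesis using Qh Qc ev by (intro exI[of _ Q]) (auto elim: eventually_mono)
qed

text \<open>The inverse of the feedback matrix is written down from \<open>Q\<close> and the stable
  coprime factors. So it is bounded and analytic, although \<open>K\<close> itself may be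
  unstable.\<close>

lemma rel_stabilizes:
  assumes Q: "holb 0 Q" "\<And>s. 0 < Re s \<Longrightarrow> car m p (Q s)" and e: "\<forall>\<^sub>F s in at_rhp. K s \<in> carrier_mat m p \<and> rel s (fm (K s)) (Q s)"
  shows "stabilizes m p K (tf22 nz nw Pl)"
proof -
  let ?M = "\<lambda>s. four_block_mat (1\<^sub>m p) (- tf22 nz nw Pl s) (- K s) (1\<^sub>m m)"
  let ?S = "sh p m"
  define Wv where "Wv s = yV s + yNn s * Q s" for s
  define Wu where "Wu s = yU s + yMm s * Q s" for s
  define H where "H s = Wv s * yMt s + Wv s * yNt s * tp ?S + ?S * (Wu s * yMt s) + ?S * (ix m + Wu s * yNt s) * tp ?S" for s
  have Hh: "holb 0 H" unfolding H_def[abs_def] Wv_def[abs_def] Wu_def[abs_def]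
    by (intro holb_add holb_mult holb_const y_holb Q)
  have cW: "car p p (Wv s)" "car m p (Wu s)" if s: "0 < Re s" for s
    unfolding Wv_def Wu_def
    by (rule car_add[OF y_car(1)[OF s] car_mult[OF y_car(3)[OF s] Q(2)[OF s]]] car_add[OF y_car(2)[OF s] car_mult[OF y_car(4)[OF s] Q(2)[OF s]]])+
  have Hc: "car (p + m) (p + m) (H s)" if s: "0 < Re s" for s
  proof -
    have S: "car (p + m) m ?S" by (rule car_sh)
    have mono: "car (p + m) (p + m) M" if "car p p M" for M by (rule car_mono[OF that]) auto
    have mono2: "car (p + m) (p + m) M" if "car (p + m) p M" for M by (rule car_mono[OF that]) auto
    have mono3: "car (p + m) (p + m) M" if "car p (p + m) M" for M by (rule car_mono[OF that]) auto
    show ?thesis unfolding H_def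
      by (rule car_add[OF car_add[OF car_add[OF mono[OF car_mult[OF cW(1)[OF s] y_car(5)[OF s]]]
              mono3[OF car_mult[OF car_mult[OF cW(1)[OF s] y_car(6)[OF s]] car_tp[OF S]]]]
              mono2[OF car_mult[OF S car_mult[OF cW(2)[OF s] y_car(5)[OF s]]]]]
              car_mult[OF car_mult[OF S car_add[OF car_ix car_mult[OF cW(2)[OF s] y_car(6)[OF s]]]] car_tp[OF S]]])
  qed
  have "\<forall>\<^sub>F s in at_rhp. invertible_mat (?M s) \<and> inv_mat (?M s) \<in> carrier_mat (p + m) (p + m) \<and> fm (inv_mat (?M s)) = H s"
    using e eventually_youla eventually_Re[of 0]
  proof eventually_elim
    case (elim s)
    interpret y: youla n m p nw nz "rm A" "rm B1" "rm B2" "rm C1" "rm C2" "rm D12" "rm D21" "rm Fd" "rm L" s "Th s" "Ph s" "Ps s"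
      by (rule elim(2))
    note ye = y.defs[folded ydefs]
    have K: "K s \<in> carrier_mat m p" and r: "rel s (fm (K s)) (Q s)" using elim by auto
    note cK = car_fm[OF K]
    note M = feedback_fm[where K = K, OF K y.Th]
    note st = y.rel_stabilizing[OF cK r, unfolded ye, folded Wv_def Wu_def]
    note yc = y_car[OF elim(3)]
    have "H s * feedback p m (yP s) (fm (K s)) = ix (p + m)" unfolding H_def
      by (rule feedback_inverseI[OF cK M(3) _ _ _ _ st])
        (simp_all add: distrib_right mult.assoc ix_right[OF yc(5)] ix_right[OF yc(6)] dg_mult)
    then have W: "H s * fm (?M s) = ix (p + m)" unfolding M(2) .
    show ?case using invertible_fm[OF M(1) W] fm_inv_mat(1,4)[OF M(1) W] Hc[OF elim(3)] by blast
  qed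
  then have "\<forall>\<^sub>F s in at_rhp. invertible_mat (?M s)" "\<forall>\<^sub>F s in at_rhp. inv_mat (?M s) \<in> carrier_mat (p + m) (p + m) \<and> fm (inv_mat (?M s)) = H s"
    by (auto elim: eventually_mono)
  then show ?thesis unfolding stabilizes_def Let_def using H_infI[OF Hh Hc, of "\<lambda>s. inv_mat (?M s)"] by blast
qed

text \<open>\<open>K\<close> is \<open>U + Mm * Q\<close> times the inverse of
  \<open>V + Nn * Q\<close>. The factors have the pattern, inversion keeps it by
  \<open>pat_inverse\<close>, and the bound \<open>b\<close> is the properness of
  \<open>K\<close>.\<close>

lemma rel_pattern:
  assumes Q: "\<And>s. 0 < Re s \<Longrightarrow> car m p (Q s)" "\<And>s j. 0 < Re s \<Longrightarrow> j < N \<Longrightarrow> Q s * ep j = em j * Q s * ep j"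
    and e: "\<forall>\<^sub>F s in at_rhp. K s \<in> carrier_mat m p \<and> rel s (fm (K s)) (Q s) \<and> norm (fm (K s)) \<le> b"
  shows "K \<in> info_set N E md pd 0"
proof (rule info_setI)
  show "\<forall>\<^sub>F s in at_rhp. K s \<in> carrier_mat m p \<and> norm (fm (K s)) \<le> b \<and> (\<forall>j<N. fm (K s) * ep j = em j * fm (K s) * ep j)"
    using e eventually_youla eventually_Re[of 0]
  proof eventually_elim
    case (elim s)
    interpret y: youla n m p nw nz "rm A" "rm B1" "rm B2" "rm C1" "rm C2" "rm D12" "rm D21" "rm Fd" "rm L" s "Th s" "Ph s" "Ps s"
      by (rule elim(2))
    note ye = y.defs[folded ydefs]
    have K: "K s \<in> carrier_mat m p" and r: "rel s (fm (K s)) (Q s)" using elim by auto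
    note cK = car_fm[OF K]
    note ri = y.rel_inverse(1,2)[OF cK r, unfolded ye]
    note yc = y_car[OF elim(3)]
    have cG: "car p p (yV s + yNn s * Q s)" by (rule car_add[OF yc(1) car_mult[OF yc(3) Q(1)[OF elim(3)]]])
    have cY: "car p p (yMt s - yNt s * fm (K s))" by (rule car_diff[OF yc(5) car_mult[OF yc(6) cK]])
    have "fm (K s) * ep j = em j * fm (K s) * ep j" if j: "j < N" for j
    proof -
      note p = y_pat[OF j elim(3)]
      have pQ: "pat (em j) (eP j) (Q s)" by (rule pat_eP[OF Q(2)[OF elim(3)] j])
      have pY: "pat (eP j) (eP j) (yMt s - yNt s * fm (K s))"
        by (rule pat_inverse[OF eP_facts(1)[OF j] cG pat_add[OF p(1) pat_mult[OF p(3) pQ]] cY left_inverse_imp_right[OF cY cG ri(1)] ri(1)])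
      have "pat (em j) (eP j) (fm (K s))"
        by (subst ri(2)[symmetric]) (rule pat_mult[OF pat_add[OF p(2) pat_mult[OF p(4) pQ]] pY])
      then show ?thesis by (rule pat_ep[OF _ eP_facts(2)[OF j]])
    qed
    then show ?case using elim by blast
  qed
qed

lemma rel_lower_lft:
  assumes Q: "\<forall>\<^sub>F s in at_rhp. Q s \<in> carrier_mat m p \<and> fm (Q s) = Qh s"
    and K: "\<forall>\<^sub>F s in at_rhp. K s \<in> carrier_mat m p \<and> rel s (fm (K s)) (Qh s)"
  shows "\<forall>\<^sub>F s in at_rhp. K s = lower_lft m p (J_tf A B2 C2 Fd L) Q s"
proof -
  have cA: "car n n (rm A + rm B2 * rm Fd + rm L * rm C2)"
    by (rule car_add[OF car_add[OF carF(1) car_mult[OF carF(3,8)]] car_mult[OF cars(9) carF(5)]])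
  show ?thesis using Q K eventually_youla eventually_isrsv[OF cA]
  proof eventually_elim
    case (elim s)
    interpret y: youla n m p nw nz "rm A" "rm B1" "rm B2" "rm C1" "rm C2" "rm D12" "rm D21" "rm Fd" "rm L" s "Th s" "Ph s" "Ps s"
      by (rule elim(3))
    have K: "K s \<in> carrier_mat m p" and r: "rel s (fm (K s)) (Qh s)" and Qc: "Q s \<in> carrier_mat m p" and Qf: "fm (Q s) = Qh s"
      using elim by auto
    define Ga where "Ga = rsv {..<n} (rm A + rm B2 * rm Fd + rm L * rm C2) s"
    have Ga: "isrsv {..<n} (rm A + rm B2 * rm Fd + rm L * rm C2) s Ga" using elim by (simp add: Ga_def)
    let ?J = "J_tf A B2 C2 Fd L"
    note J = J_fm[OF carr(1,3,5,8) L_facts(1) Ga]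
    let ?M = "1\<^sub>m (dim_row (tf22 m p ?J s)) - tf22 m p ?J s * Q s"
    have PQ: "tf22 m p ?J s * Q s \<in> carrier_mat p p" and M: "?M \<in> carrier_mat p p" using J(7) Qc by auto
    have fM: "fm ?M = ix p + rm C2 * Ga * rm B2 * Qh s"
      using carrier_matD[OF J(7)] carrier_matD[OF Qc] fm_diff[OF one_carrier_mat PQ] by (simp add: fm_mult J(8) Qf fm_one)
    have cQ: "car m p (Qh s)" using car_fm[OF Qc] Qf by simp
    obtain G where G: "car p p G" "(ix p + rm C2 * Ga * rm B2 * Qh s) * G = ix p"
      and all: "\<And>G. car p p G \<Longrightarrow> G * (ix p + rm C2 * Ga * rm B2 * Qh s) = ix p \<Longrightarrow>
        fm (K s) = - (rm Fd * Ga * rm L) + (ix m + rm Fd * Ga * rm B2) * Qh s * G * (ix p + rm C2 * Ga * rm L)"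
      using y.rel_lft[OF car_fm[OF K] cQ r Ga] by blast
    have cM: "car p p (ix p + rm C2 * Ga * rm B2 * Qh s)" using car_fm[OF M] fM by simp
    have "G * fm ?M = ix p" unfolding fM by (rule left_inverse_imp_right[OF G(1) cM G(2)])
    note i = fm_inv_mat[OF M this]
    have c1: "tf12 m p ?J s * Q s \<in> carrier_mat m p" using J Qc by auto
    have c2: "tf12 m p ?J s * Q s * inv_mat ?M \<in> carrier_mat m p" using c1 i(1) by auto
    have c3: "tf12 m p ?J s * Q s * inv_mat ?M * tf21 m p ?J s \<in> carrier_mat m p" using c2 J by auto
    have "fm (tf12 m p ?J s * Q s * inv_mat ?M * tf21 m p ?J s) = fm (tf12 m p ?J s) * fm (Q s) * fm (inv_mat ?M) * fm (tf21 m p ?J s)"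
      using carrier_matD[OF c1] carrier_matD[OF c2] carrier_matD[OF J(3)] carrier_matD[OF J(5)] carrier_matD[OF Qc] carrier_matD[OF i(1)]
      by (simp only: fm_mult)
    then have "fm (lower_lft m p ?J Q s) = fm (K s)"
      unfolding lower_lft_def using fm_add[OF J(1) c3] all[OF car_fm[OF i(1)] i(2)[unfolded fM]] by (simp only: J(2,4,6) Qf)
    moreover have "lower_lft m p ?J Q s \<in> carrier_mat m p" unfolding lower_lft_def using J(1) c3 by auto
    ultimately show ?case using fm_inject[OF K] by metis
  qed
qed

end

section \<open>Optimality of the two realizations\<close>

context optimal_realizations
begin

lemma Q_opt_solves: "solves_P2 N E md pd nz nw 0 (T_tf A B1 B2 C1 C2 D12 D21 Fd L) Q_opt"
proof -
  let ?T = "T_tf A B1 B2 C1 C2 D12 D21 Fd L"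
  let ?c = "\<lambda>Q. H2_norm_sq nz nw (\<lambda>s. tf11 nz nw ?T s + tf12 nz nw ?T s * Q s * tf21 nz nw ?T s)"
  obtain b where b: "\<And>s. 0 < Re s \<Longrightarrow> norm (Qo s) \<le> b" using Ph_holb(3) unfolding holb_def by blast
  have "Q_opt \<in> H_inf m p" by (rule H_infI[OF Ph_holb(3) Qo_facts(1) Q_opt_eq])
  moreover have "Q_opt \<in> info_set N E md pd 0"
  proof (rule info_setI)
    show "\<forall>\<^sub>F s in at_rhp. Q_opt s \<in> carrier_mat m p \<and> norm (fm (Q_opt s)) \<le> b \<and> (\<forall>j<N. fm (Q_opt s) * ep j = em j * fm (Q_opt s) * ep j)"
      using Q_opt_eq eventually_Re[of 0]
    proof eventually_elim
      case (elim s)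
      then have q: "fm (Q_opt s) = Qo s" by blast
      show ?case unfolding q using elim b Qo_facts(2) by blast
    qed
  qed
  moreover have "\<not> ?c Q < ?c Q_opt" if Q: "Q \<in> H_inf m p" "Q \<in> info_set N E md pd 0" for Q
  proof -
    obtain H where H: "holb 0 H" "\<And>s. 0 < Re s \<Longrightarrow> car m p (H s)" "\<forall>\<^sub>F s in at_rhp. Q s \<in> carrier_mat m p \<and> fm (Q s) = H s"
      using H_infD[OF Q(1)] by blast
    have "H s * ep j = em j * H s * ep j" if s: "0 < Re s" and j: "j < N" for s j
    proof (rule fm_rhp_identity[OF _ _ _ s])
      show "\<forall>\<^sub>F s in at_rhp. H s * ep j = em j * H s * ep j"
        using H(3) info_setD[OF Q(2)]
      proof eventually_elim
        case (elim s)
        then have "fm (Q s) = H s" "fm (Q s) * ep j = em j * fm (Q s) * ep j" using j by blast+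
        then show ?case by simp
      qed
    qed (intro holb_mult holb_const H)+
    from cost_optimal[OF H(1,2) this] have "cost (Tc Qo) \<le> cost (Tc H)" .
    then show ?thesis unfolding T_cost[OF H(1,3)] T_cost[OF Ph_holb(3) Q_opt_eq] by simp
  qed
  ultimately show ?thesis unfolding solves_P2_def is_arg_min_def dims[symmetric] by blast
qed

lemma K_opt_solves: "solves_P1 N E md pd nz nw 0 (plant_tf A B1 B2 C1 C2 D12 D21) K_opt"
proof -
  obtain b where b: "\<forall>\<^sub>F s in at_rhp. K_opt s \<in> carrier_mat m p \<and> rel s (fm (K_opt s)) (Qo s) \<and> norm (fm (K_opt s)) \<le> b"
    using K_opt_eq by blast
  then have e: "\<forall>\<^sub>F s in at_rhp. K_opt s \<in> carrier_mat m p \<and> rel s (fm (K_opt s)) (Qo s)" by (auto elim: eventually_mono)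
  have "K_opt \<in> info_set N E md pd 0" by (rule rel_pattern[OF Qo_facts b])
  moreover have "stabilizes m p K_opt (tf22 nz nw Pl)" by (rule rel_stabilizes[OF Ph_holb(3) Qo_facts(1) e])
  moreover have "\<not> H2_norm_sq nz nw (lower_lft nz nw Pl K) < H2_norm_sq nz nw (lower_lft nz nw Pl K_opt)"
    if K: "K \<in> info_set N E md pd 0" "stabilizes m p K (tf22 nz nw Pl)" for K
  proof -
    obtain Q where Q: "holb 0 Q" "\<And>s. 0 < Re s \<Longrightarrow> car m p (Q s)" "\<And>s j. 0 < Re s \<Longrightarrow> j < N \<Longrightarrow> Q s * ep j = em j * Q s * ep j"
        "\<forall>\<^sub>F s in at_rhp. K s \<in> carrier_mat m p \<and> rel s (fm (K s)) (Q s)"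
      using youla_parameter_exists[OF K] by blast
    show ?thesis
      unfolding Pl_def lft_cost[OF Q(1,4)] lft_cost[OF Ph_holb(3) e] using cost_optimal[OF Q(1-3)] by simp
  qed
  ultimately show ?thesis unfolding solves_P1_def is_arg_min_def dims[symmetric] Pl_def[symmetric] by blast
qed

lemma K_opt_lft: "\<forall>\<^sub>F s in at_rhp. K_opt s = lower_lft m p (J_tf A B2 C2 Fd L) Q_opt s"
  by (rule rel_lower_lft[OF Q_opt_eq]) (use K_opt_eq in \<open>auto elim: eventually_mono\<close>)

end

theorem theorem8:
  fixes N :: nat and E :: "(nat \<times> nat) set"
    and nd md pd wd :: "nat \<Rightarrow> nat" and n m p nw nz :: nat
    and A B1 B2 C1 C2 D12 D21 Fd L :: "real mat"
    and F Lg :: "nat \<Rightarrow> real mat"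
    and Abar Bbar Cbar Fbar Fdbar Lbar one_n one_m one_p :: "real mat"
    and Q_opt K_opt :: tmat
  assumes graph: "E \<subseteq> {..<N} \<times> {..<N}"
    and dims: "n = (\<Sum>k<N. nd k)" "m = (\<Sum>k<N. md k)" "p = (\<Sum>k<N. pd k)" "nw = (\<Sum>k<N. wd k)"
    and plant: "block_diagonal N nd nd A" "block_diagonal N nd wd B1" "block_diagonal N nd md B2"
      "block_diagonal N pd nd C2" "block_diagonal N pd wd D21"
      "C1 \<in> carrier_mat nz n" "D12 \<in> carrier_mat nz m"
    and sys: "system_assumptions N nd md pd wd A B1 B2 C1 C2 D12 D21"
    and Fd: "block_diagonal N md nd Fd" "hurwitz (A + B2 * Fd)"
    and F: "\<And>i. i < N \<Longrightarrow> F i = ctrl_gain N E nd md A B2 C1 D12 i"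
    and Lg: "\<And>i. i < N \<Longrightarrow> Lg i = est_gain nd pd wd A B1 C2 D21 i"
    and L: "L = diag_block_mat (map Lg [0..<N])"
    and bars: "Abar = kron (1\<^sub>m N) A" "Bbar = kron (1\<^sub>m N) B2" "Cbar = kron (1\<^sub>m N) C2"
      "Fdbar = kron (1\<^sub>m N) Fd"
      "one_n = kron (ones_col N) (1\<^sub>m n)"
      "one_m = kron (ones_col N) (1\<^sub>m m)"
      "one_p = kron (ones_col N) (1\<^sub>m p)"
    and Fbar: "Fbar = diag_block_mat (map (\<lambda>i.
        embed N md (descendants N E i) * F i * transpose_mat (embed N nd (descendants N E i))) [0..<N])"
    and Lbar: "Lbar = diag_block_mat (map (\<lambda>i.
        embed N nd [i] * Lg i * transpose_mat (embed N pd [i])) [0..<N])"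
    and Q_opt: "Q_opt = realization (Abar + Bbar * Fbar) (- (Lbar * one_p))
        (transpose_mat one_m * (Fbar - Fdbar)) (0\<^sub>m m p)"
    and K_opt: "K_opt = realization (Abar + Bbar * Fbar + Lbar * Cbar * one_n * transpose_mat one_n)
        (- (Lbar * one_p)) (transpose_mat one_m * Fbar) (0\<^sub>m m p)"
  shows "solves_P2 N E md pd nz nw 0 (T_tf A B1 B2 C1 C2 D12 D21 Fd L) Q_opt
    \<and> solves_P1 N E md pd nz nw 0 (plant_tf A B1 B2 C1 C2 D12 D21) K_opt
    \<and> (\<forall>\<^sub>F s in at_rhp. K_opt s = lower_lft m p (J_tf A B2 C2 Fd L) Q_opt s)"
proof -
  interpret o: optimal_realizations N E nd md pd wd n m p nw nz A B1 B2 C1 C2 D12 D21 Fd L F Lg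
      Abar Bbar Cbar Fbar Fdbar Lbar one_n one_m one_p
    by unfold_locales (fact assms)+
  have "Q_opt = o.Q_opt" "K_opt = o.K_opt"
    unfolding Q_opt K_opt o.Q_opt_def o.K_opt_def by (rule refl)+
  then show ?thesis using o.Q_opt_solves o.K_opt_solves o.K_opt_lft by simp
qed

end
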